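(* Let $A$ be a $C^*$-algebra, let $X$ be an $A$-$A$-Hilbert bimodule, and let $\widehat{h}$ be the partial homeomorphism of the spectrum $\widehat{A}$ dual to $X$. If $\widehat{h}$ is topologically free, then for every faithful covariant representation $(\pi_A,\pi_X)$ of $(A,X)$ the integrated representation $\pi_A\rtimes\pi_X$ of the crossed product $A\rtimes_X\mathbb{Z}$ is faithful.
   Context: For bilinear or sesquilinear maps $\gamma$ (inner products, multiplications, representations), $\gamma(S,T)$ denotes the closed linear span of $\{\gamma(s,t): s\in S, t\in T\}$. Ideals in $C^*$-algebras are closed and two-sided. Hilbert bimodule: An $A$-$A$-Hilbert bimodule $X$ is an $A$-$A$-bimodule which is both a left and a right Hilbert module over $A$, with $A$-valued inner products $\langle\cdot,\cdot\rangle_L$ (linear in the first variable) and $\langle\cdot,\cdot\rangle_R$ (linear in the second variable), such that $x\cdot\langle y,z\rangle_R=\langle x,y\rangle_L\cdot z$ for all $x,y,z\in X$. (The inner products are not assumed full.) Put $I_L=\langle X,X\rangle_L$ and $I_R=\langle X,X\rangle_R$; these are ideals in $A$ and $X$ is an imprimitivity $I_L$-$I_R$-bimodule. Dual partial homeomorphism: $\widehat{A}$ is the spectrum of $A$ (unitary equivalence classes $[\pi]$ of irreducible representations, with the usual topology). For an ideal $I$ of $A$, $\widehat{I}$ is identified with the open subset $\{[\pi]\in\widehat{A}:\pi(I)\neq 0\}$. The partial homeomorphism dual to $X$ is the homeomorphism $\widehat{h}:\widehat{I_R}\to\widehat{I_L}$ between open subsets of $\widehat{A}$ given by Rieffel induction: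 $\widehat{h}([\pi])=[X\text{-}\mathrm{Ind}(\pi)]$, where, for $\pi:A\to\mathcal{B}(H_\pi)$, $X\text{-}\mathrm{Ind}(\pi)$ acts on the Hilbert space $X\otimes_\pi H_\pi$ (with $\langle x_1\otimes_\pi h_1,x_2\otimes_\pi h_2\rangle=\langle h_1,\pi(\langle x_1,x_2\rangle_R)h_2\rangle$) by $X\text{-}\mathrm{Ind}(\pi)(a)(x\otimes_\pi h)=(ax)\otimes_\pi h$. Topological freeness: a partial homeomorphism $\varphi$ of a topological space (a homeomorphism between open subsets) is topologically free if for every $n>0$ the set $F_n=\{x:\varphi^n(x)=x\}$ (a subset of the natural domain of the $n$-fold composition $\varphi^n$) has empty interior. Covariant representations: A covariant representation of $(A,X)$ on a Hilbert space $H$ is a pair $(\pi_A,\pi_X)$, where $\pi_A:A\to\mathcal{B}(H)$ is a representation and $\pi_X:X\to\mathcal{B}(H)$ is linear, such that for all $a\in A$, $x,y\in X$: $\pi_X(ax)=\pi_A(a)\pi_X(x)$, $\pi_X(xa)=\pi_X(x)\pi_A(a)$, $\pi_A(\langle x,y\rangle_R)=\pi_X(x)^*\pi_X(y)$, $\pi_A(\langle x,y\rangle_L)=\pi_X(x)\pi_X(y)^*$. It is called faithful if $\pi_A$ is faithful. The crossed product $A\rtimes_X\mathbb{Z}$ is the $C^*$-algebra universal for covariant representations of $(A,X)$; it is generated by the images of $A$ and $X$ under the universal covariant representation. The integrated form $\pi_A\rtimes\pi_X$ of $(\pi_A,\pi_X)$ is the representation of $A\rtimes_X\mathbb{Z}$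 that it corresponds to under the universal property. *)

theory Defs
  imports "HOL-Analysis.Analysis"
begin

section \<open>Complex vector spaces, C*-algebras and Hilbert spaces\<close>

class complex_vector = real_vector +
  fixes scaleC :: "complex \<Rightarrow> 'a \<Rightarrow> 'a" (infixr \<open>*\<^sub>C\<close> 75)
  assumes scaleC_add_right: "c *\<^sub>C (x + y) = c *\<^sub>C x + c *\<^sub>C y"
    and scaleC_add_left: "(c + d) *\<^sub>C x = c *\<^sub>C x + d *\<^sub>C x"
    and scaleC_scaleC: "c *\<^sub>C d *\<^sub>C x = (c * d) *\<^sub>C x"
    and scaleC_one: "1 *\<^sub>C x = x"
    and scaleR_scaleC: "r *\<^sub>R x = complex_of_real r *\<^sub>C x"

global_interpretation complex_vector: vector_space "scaleC :: complex \<Rightarrow> 'a \<Rightarrow> 'a :: complex_vector"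
  by unfold_locales (fact scaleC_add_right scaleC_add_left scaleC_scaleC scaleC_one)+

abbreviation csubspace :: "'a::complex_vector set \<Rightarrow> bool"
  where "csubspace \<equiv> module.subspace scaleC"

abbreviation cspan :: "'a::complex_vector set \<Rightarrow> 'a set"
  where "cspan \<equiv> module.span scaleC"

abbreviation clinear :: "('a::complex_vector \<Rightarrow> 'b::complex_vector) \<Rightarrow> bool"
  where "clinear \<equiv> Vector_Spaces.linear scaleC scaleC"

lemma clinearI:
  assumes "\<And>x y. f (x + y) = f x + f y" and "\<And>c x. f (c *\<^sub>C x) = c *\<^sub>C f x"
  shows "clinear f"
  using assms by (auto intro!: Vector_Spaces.linear.intro complex_vector.vector_space_axioms
      simp: module_hom_axioms_def module_hom_def complex_vector.module_axioms)

class complex_normed_vector = complex_vector + real_normed_vector +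
  assumes norm_scaleC: "norm (c *\<^sub>C x) = cmod c * norm x"

text \<open>C*-algebras are not assumed to be unital (nor nonzero).\<close>

class cstar_algebra = complex_normed_vector + real_normed_algebra + banach +
  fixes star :: "'a \<Rightarrow> 'a"
  assumes mult_scaleC_left: "(c *\<^sub>C a) * b = c *\<^sub>C (a * b)"
    and mult_scaleC_right: "a * (c *\<^sub>C b) = c *\<^sub>C (a * b)"
    and star_add: "star (a + b) = star a + star b"
    and star_scaleC: "star (c *\<^sub>C a) = cnj c *\<^sub>C star a"
    and star_mult: "star (a * b) = star b * star a"
    and star_star: "star (star a) = a"
    and cstar_identity: "norm (star a * a) = (norm a)\<^sup>2"

text \<open>Inner products on Hilbert spaces are linear in the second variable.\<close>

class chilbert_space = complex_normed_vector + banach +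
  fixes cinner :: "'a \<Rightarrow> 'a \<Rightarrow> complex"
  assumes cinner_commute: "cinner x y = cnj (cinner y x)"
    and cinner_add_right: "cinner x (y + z) = cinner x y + cinner x z"
    and cinner_scaleC_right: "cinner x (c *\<^sub>C y) = c * cinner x y"
    and norm_eq_sqrt_cinner: "norm x = sqrt (Re (cinner x x))"


section \<open>The Hilbert space of square-summable families\<close>

definition square_summable :: "('i \<Rightarrow> complex) \<Rightarrow> bool"
  where "square_summable f \<longleftrightarrow> (\<lambda>i. (cmod (f i))\<^sup>2) summable_on UNIV"

definition sq_norm :: "('i \<Rightarrow> complex) \<Rightarrow> real"
  where "sq_norm f = sqrt (\<Sum>\<^sub>\<infinity>i. (cmod (f i))\<^sup>2)"

lemma sq_norm_nonneg: "0 \<le> sq_norm f"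
  by (simp add: sq_norm_def infsum_nonneg)

lemma L2_set_le_sq_norm:
  assumes "square_summable f" "finite F"
  shows "L2_set (\<lambda>i. cmod (f i)) F \<le> sq_norm f"
  unfolding L2_set_def sq_norm_def
  using assms by (intro real_sqrt_le_mono finite_sum_le_infsum) (auto simp: square_summable_def)

lemma square_summable_bound:
  assumes "\<And>F. finite F \<Longrightarrow> L2_set (\<lambda>i. cmod (f i)) F \<le> B"
  shows "square_summable f" "sq_norm f \<le> B"
proof -
  have B: "0 \<le> B" using assms[of "{}"] by simp
  have le: "(\<Sum>i\<in>F. (cmod (f i))\<^sup>2) \<le> B\<^sup>2" if "finite F" for F
    using assms[OF that] B unfolding L2_set_def by (metis real_sqrt_le_iff real_sqrt_unique)
  show s: "square_summable f"
    unfolding square_summable_def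
    by (rule nonneg_bdd_above_summable_on) (auto intro!: bdd_aboveI2 le)
  have "(\<Sum>\<^sub>\<infinity>i. (cmod (f i))\<^sup>2) \<le> B\<^sup>2"
    using s by (intro infsum_le_finite_sums) (auto simp: square_summable_def le)
  then show "sq_norm f \<le> B"
    unfolding sq_norm_def using B by (metis real_sqrt_le_iff real_sqrt_unique)
qed

lemma square_summable_0: "square_summable (\<lambda>_. 0)"
  by (simp add: square_summable_def)

lemma square_summable_add:
  assumes "square_summable f" "square_summable g"
  shows "square_summable (\<lambda>i. f i + g i)" "sq_norm (\<lambda>i. f i + g i) \<le> sq_norm f + sq_norm g"
proof -
  have "L2_set (\<lambda>i. cmod (f i + g i)) F \<le> sq_norm f + sq_norm g" if "finite F" for F
  proof -
    have "L2_set (\<lambda>i. cmod (f i + g i)) F \<le> L2_set (\<lambda>i. cmod (f i) + cmod (g i)) F"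
      by (intro L2_set_mono norm_triangle_ineq) auto
    also have "\<dots> \<le> L2_set (\<lambda>i. cmod (f i)) F + L2_set (\<lambda>i. cmod (g i)) F"
      by (rule L2_set_triangle_ineq)
    also have "\<dots> \<le> sq_norm f + sq_norm g"
      using assms that by (intro add_mono L2_set_le_sq_norm)
    finally show ?thesis .
  qed
  then show "square_summable (\<lambda>i. f i + g i)" "sq_norm (\<lambda>i. f i + g i) \<le> sq_norm f + sq_norm g"
    by (auto intro: square_summable_bound)
qed

lemma square_summable_scale:
  "square_summable f \<Longrightarrow> square_summable (\<lambda>i. c * f i)"
  by (auto simp: square_summable_def norm_mult power_mult_distrib intro: summable_on_cmult_right)

lemma sq_norm_scale: "sq_norm (\<lambda>i. c * f i) = cmod c * sq_norm f"
  by (simp add: sq_norm_def norm_mult power_mult_distrib infsum_cmult_right' real_sqrt_mult)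

lemma square_summable_product:
  assumes "square_summable f" "square_summable g"
  shows "(\<lambda>i. cnj (f i) * g i) summable_on UNIV"
proof (rule abs_summable_summable, rule abs_summable_product)
  show "(\<lambda>i. norm (cnj (f i) * cnj (f i))) summable_on UNIV" "(\<lambda>i. norm (g i * g i)) summable_on UNIV"
    using assms by (simp_all add: square_summable_def norm_mult power2_eq_square)
qed

lemma sq_norm_eq_0:
  assumes "square_summable f"
  shows "sq_norm f = 0 \<longleftrightarrow> f = (\<lambda>_. 0)"
proof
  assume 0: "sq_norm f = 0"
  show "f = (\<lambda>_. 0)"
  proof
    show "f i = 0" for i
      using L2_set_le_sq_norm[OF assms, of "{i}"] 0 by simp
  qed
next
  assume "f = (\<lambda>_. 0)"
  then show "sq_norm f = 0"
    by (simp add: sq_norm_def)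
qed

typedef 'i ell2 = "{f :: 'i \<Rightarrow> complex. square_summable f}"
  by (auto intro: square_summable_0)

setup_lifting type_definition_ell2

instantiation ell2 :: (type) complex_vector
begin

lift_definition zero_ell2 :: "'a ell2" is "\<lambda>_. 0"
  by (rule square_summable_0)
lift_definition plus_ell2 :: "'a ell2 \<Rightarrow> 'a ell2 \<Rightarrow> 'a ell2" is "\<lambda>f g i. f i + g i"
  by (rule square_summable_add)
lift_definition scaleC_ell2 :: "complex \<Rightarrow> 'a ell2 \<Rightarrow> 'a ell2" is "\<lambda>c f i. c * f i"
  by (rule square_summable_scale)
lift_definition scaleR_ell2 :: "real \<Rightarrow> 'a ell2 \<Rightarrow> 'a ell2" is "\<lambda>r f i. complex_of_real r * f i"
  by (rule square_summable_scale)
lift_definition uminus_ell2 :: "'a ell2 \<Rightarrow> 'a ell2" is "\<lambda>f i. - f i"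
  by (simp add: square_summable_def)
definition minus_ell2 :: "'a ell2 \<Rightarrow> 'a ell2 \<Rightarrow> 'a ell2" where "minus_ell2 f g = f + - g"

instance
proof
  fix f g h :: "'a ell2" and c d :: complex and r s :: real
  show "f - g = f + - g" by (rule minus_ell2_def)
  show "f + g + h = f + (g + h)" "f + g = g + f" "0 + f = f" "- f + f = 0"
    by (transfer; simp add: add_ac)+
  show "c *\<^sub>C (f + g) = c *\<^sub>C f + c *\<^sub>C g" "(c + d) *\<^sub>C f = c *\<^sub>C f + d *\<^sub>C f"
    "c *\<^sub>C d *\<^sub>C f = (c * d) *\<^sub>C f" "1 *\<^sub>C f = f"
    by (transfer; simp add: algebra_simps)+
  show "r *\<^sub>R (f + g) = r *\<^sub>R f + r *\<^sub>R g" "(r + s) *\<^sub>R f = r *\<^sub>R f + s *\<^sub>R f"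
    "r *\<^sub>R s *\<^sub>R f = (r * s) *\<^sub>R f" "1 *\<^sub>R f = f" "r *\<^sub>R f = complex_of_real r *\<^sub>C f"
    by (transfer; simp add: algebra_simps)+
qed

end

lemma Rep_ell2_minus: "Rep_ell2 (f - g) i = Rep_ell2 f i - Rep_ell2 g i"
  by (simp only: minus_ell2_def plus_ell2.rep_eq uminus_ell2.rep_eq) simp

instantiation ell2 :: (type) complex_normed_vector
begin

lift_definition norm_ell2 :: "'a ell2 \<Rightarrow> real" is sq_norm .
definition dist_ell2 :: "'a ell2 \<Rightarrow> 'a ell2 \<Rightarrow> real" where "dist_ell2 f g = norm (f - g)"
definition sgn_ell2 :: "'a ell2 \<Rightarrow> 'a ell2" where "sgn_ell2 f = f /\<^sub>R norm f"
definition "(uniformity :: ('a ell2 \<times> 'a ell2) filter)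
  = (INF e\<in>{0 <..}. principal {(f, g). dist f g < e})"
definition "open (U :: 'a ell2 set)
  = (\<forall>f\<in>U. \<forall>\<^sub>F (f', g) in uniformity. f' = f \<longrightarrow> g \<in> U)"

instance
proof
  fix f g :: "'a ell2" and r :: real and c :: complex and U :: "'a ell2 set"
  show "dist f g = norm (f - g)" "sgn f = f /\<^sub>R norm f"
    by (fact dist_ell2_def, fact sgn_ell2_def)
  show "uniformity = (INF e\<in>{0 <..}. principal {(f :: 'a ell2, g). dist f g < e})"
    "open U = (\<forall>f\<in>U. \<forall>\<^sub>F (f', g) in uniformity. f' = f \<longrightarrow> g \<in> U)"
    by (fact uniformity_ell2_def, fact open_ell2_def)
  show "norm f = 0 \<longleftrightarrow> f = 0"
    by transfer (rule sq_norm_eq_0)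
  show "norm (f + g) \<le> norm f + norm g"
    by transfer (rule square_summable_add)
  show "norm (r *\<^sub>R f) = \<bar>r\<bar> * norm f"
    by transfer (simp add: sq_norm_scale)
  show "norm (c *\<^sub>C f) = cmod c * norm f"
    by transfer (simp add: sq_norm_scale)
qed

end

instantiation ell2 :: (type) chilbert_space
begin

lift_definition cinner_ell2 :: "'a ell2 \<Rightarrow> 'a ell2 \<Rightarrow> complex"
  is "\<lambda>f g. \<Sum>\<^sub>\<infinity>i. cnj (f i) * g i" .

instance
proof
  fix F :: "nat \<Rightarrow> 'a ell2"
  assume "Cauchy F"
  have coord: "L2_set (\<lambda>i. cmod (Rep_ell2 f i)) S \<le> norm f" if "finite S" for f :: "'a ell2" and S
    using L2_set_le_sq_norm[OF _ that, of "Rep_ell2 f"] Rep_ell2[of f] by (simp add: norm_ell2.rep_eq)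
  have coord1: "cmod (Rep_ell2 f i) \<le> norm f" for f :: "'a ell2" and i
    using coord[of "{i}" f] by simp
  have "Cauchy (\<lambda>n. Rep_ell2 (F n) i)" for i
  proof (rule CauchyI)
    fix e :: real assume "0 < e"
    then obtain M where M: "\<forall>m\<ge>M. \<forall>n\<ge>M. norm (F m - F n) < e"
      using \<open>Cauchy F\<close> by (meson CauchyD)
    have "norm (Rep_ell2 (F m) i - Rep_ell2 (F n) i) < e" if "m \<ge> M" "n \<ge> M" for m n
      using coord1[of "F m - F n" i] M that by (force simp: Rep_ell2_minus)
    then show "\<exists>M. \<forall>m\<ge>M. \<forall>n\<ge>M. norm (Rep_ell2 (F m) i - Rep_ell2 (F n) i) < e"
      by blast
  qed
  then have "\<forall>i. \<exists>x. (\<lambda>n. Rep_ell2 (F n) i) \<longlonglongrightarrow> x"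
    by (simp add: Cauchy_convergent_iff convergent_def)
  from choice[OF this] obtain l where l: "\<And>i. (\<lambda>n. Rep_ell2 (F n) i) \<longlonglongrightarrow> l i"
    by blast
  have ev: "\<exists>M. \<forall>n\<ge>M. \<forall>S. finite S \<longrightarrow> L2_set (\<lambda>i. cmod (Rep_ell2 (F n) i - l i)) S \<le> e"
    if "0 < e" for e :: real
  proof -
    obtain M where M: "\<And>m n. m \<ge> M \<Longrightarrow> n \<ge> M \<Longrightarrow> norm (F m - F n) < e"
      using \<open>Cauchy F\<close> \<open>0 < e\<close> by (meson CauchyD)
    have "L2_set (\<lambda>i. cmod (Rep_ell2 (F n) i - l i)) S \<le> e" if "n \<ge> M" "finite S" for n S
    proof (rule LIMSEQ_le_const2)
      show "(\<lambda>m. L2_set (\<lambda>i. cmod (Rep_ell2 (F n) i - Rep_ell2 (F m) i)) S)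
        \<longlonglongrightarrow> L2_set (\<lambda>i. cmod (Rep_ell2 (F n) i - l i)) S"
        unfolding L2_set_def by (intro tendsto_intros l)
      show "\<exists>N. \<forall>m\<ge>N. L2_set (\<lambda>i. cmod (Rep_ell2 (F n) i - Rep_ell2 (F m) i)) S \<le> e"
      proof (intro exI allI impI)
        fix m assume "m \<ge> M"
        have "L2_set (\<lambda>i. cmod (Rep_ell2 (F n - F m) i)) S \<le> norm (F n - F m)"
          using \<open>finite S\<close> by (rule coord)
        also have "\<dots> \<le> e" using M[OF \<open>n \<ge> M\<close> \<open>m \<ge> M\<close>] by simp
        finally show "L2_set (\<lambda>i. cmod (Rep_ell2 (F n) i - Rep_ell2 (F m) i)) S \<le> e"
          by (simp add: Rep_ell2_minus)
      qed
    qed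
    then show ?thesis by blast
  qed
  have "square_summable l"
  proof -
    obtain M where M: "\<And>S. finite S \<Longrightarrow> L2_set (\<lambda>i. cmod (Rep_ell2 (F M) i - l i)) S \<le> 1"
      using ev[of 1] by auto
    have "square_summable (\<lambda>i. Rep_ell2 (F M) i - l i)"
      using M by (rule square_summable_bound(1))
    then have "square_summable (\<lambda>i. Rep_ell2 (F M) i + (-1) * (Rep_ell2 (F M) i - l i))"
      using Rep_ell2[of "F M"] by (intro square_summable_add square_summable_scale) auto
    then show ?thesis by simp
  qed
  then have L: "Rep_ell2 (Abs_ell2 l) = l" by (simp add: Abs_ell2_inverse)
  have "F \<longlonglongrightarrow> Abs_ell2 l"
  proof (rule LIMSEQ_I)
    fix e :: real assume "0 < e"
    then obtain M where M: "\<And>n S. n \<ge> M \<Longrightarrow> finite S \<Longrightarrow>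
        L2_set (\<lambda>i. cmod (Rep_ell2 (F n) i - l i)) S \<le> e / 2"
      using ev[of "e / 2"] by auto
    have "norm (F n - Abs_ell2 l) \<le> e / 2" if "n \<ge> M" for n
    proof -
      have "Rep_ell2 (F n - Abs_ell2 l) = (\<lambda>i. Rep_ell2 (F n) i - l i)"
        by (simp add: fun_eq_iff Rep_ell2_minus L)
      then show ?thesis
        using square_summable_bound(2)[OF M[OF that]] by (simp add: norm_ell2.rep_eq)
    qed
    moreover have "e / 2 < e" using \<open>0 < e\<close> by simp
    ultimately show "\<exists>M. \<forall>n\<ge>M. norm (F n - Abs_ell2 l) < e"
      by (meson le_less_trans)
  qed
  then show "convergent F" by (auto simp: convergent_def)
next
  fix f g h :: "'a ell2" and c :: complex
  show "cinner f g = cnj (cinner g f)"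
    by transfer (simp flip: infsum_cnj add: mult.commute)
  show "cinner f (g + h) = cinner f g + cinner f h"
    by transfer (simp add: distrib_left infsum_add square_summable_product)
  show "cinner f (c *\<^sub>C g) = c * cinner f g"
    by transfer (simp add: infsum_cmult_right' mult.left_commute)
  show "norm f = sqrt (Re (cinner f f))"
  proof transfer
    fix f :: "'a \<Rightarrow> complex" assume f: "square_summable f"
    have "Re (\<Sum>\<^sub>\<infinity>i. cnj (f i) * f i) = (\<Sum>\<^sub>\<infinity>i. Re (cnj (f i) * f i))"
      using square_summable_product[OF f f] by (rule infsum_Re[symmetric])
    moreover have "Re (cnj (f i) * f i) = (cmod (f i))\<^sup>2" for i
      by (simp only: cmod_power2) (simp add: power2_eq_square)
    ultimately show "sq_norm f = sqrt (Re (\<Sum>\<^sub>\<infinity>i. cnj (f i) * f i))"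
      by (simp only: sq_norm_def)
  qed
qed

end


section \<open>The C*-algebra of bounded operators on a Hilbert space\<close>

lemma cinner_add_left: "cinner (x + y) z = cinner x z + cinner y z"
  using cinner_add_right[of z x y] by (metis cinner_commute complex_cnj_add)

lemma cinner_scaleC_left: "cinner (c *\<^sub>C x) y = cnj c * cinner x y"
  using cinner_scaleC_right[of y c x] by (metis cinner_commute complex_cnj_mult)

lemma cinner_zero_right [simp]: "cinner x 0 = 0"
  using cinner_scaleC_right[of x 0 0] by simp

lemma cinner_zero_left [simp]: "cinner 0 x = 0"
  using cinner_scaleC_left[of 0 0 x] by simp

lemma cinner_minus_right: "cinner x (- y) = - cinner x y"
  using cinner_scaleC_right[of x "-1" y] by (simp add: complex_vector.scale_minus_left)

lemma cinner_diff_right: "cinner x (y - z) = cinner x y - cinner x z"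
  using cinner_add_right[of x y "- z"] by (simp add: cinner_minus_right)

lemma cinner_diff_left: "cinner (x - y) z = cinner x z - cinner y z"
  using cinner_diff_right[of z x y] by (metis cinner_commute complex_cnj_diff)

lemma cinner_scaleR_right: "cinner x (r *\<^sub>R y) = complex_of_real r * cinner x y"
  by (simp add: scaleR_scaleC cinner_scaleC_right)

lemma cinner_scaleR_left: "cinner (r *\<^sub>R x) y = complex_of_real r * cinner x y"
  by (simp add: scaleR_scaleC cinner_scaleC_left)

lemma norm_power2_cinner: "(norm x)\<^sup>2 = Re (cinner x x)"
proof -
  have "0 \<le> Re (cinner x x)"
    using norm_ge_zero[of x] unfolding norm_eq_sqrt_cinner by simp
  then show ?thesis by (simp add: norm_eq_sqrt_cinner)
qed

lemma cinner_self: "cinner x x = complex_of_real ((norm x)\<^sup>2)"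
proof (rule complex_eqI)
  show "Im (cinner x x) = Im (complex_of_real ((norm x)\<^sup>2))"
    using arg_cong[OF cinner_commute[of x x], of Im] by simp
qed (simp add: norm_power2_cinner)

lemma norm_add_power2: "(norm (x + y))\<^sup>2 = (norm x)\<^sup>2 + 2 * Re (cinner x y) + (norm y)\<^sup>2"
proof -
  have "Re (cinner y x) = Re (cinner x y)" by (subst cinner_commute) simp
  then show ?thesis by (simp add: norm_power2_cinner cinner_add_left cinner_add_right)
qed

lemma norm_diff_power2: "(norm (x - y))\<^sup>2 = (norm x)\<^sup>2 - 2 * Re (cinner x y) + (norm y)\<^sup>2"
  using norm_add_power2[of x "- y"] by (simp add: cinner_minus_right)

lemma Re_cinner_le: "Re (cinner x y) \<le> norm x * norm y"
proof -
  have "(norm (x + y))\<^sup>2 \<le> (norm x + norm y)\<^sup>2"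
    by (intro power_mono norm_triangle_ineq) simp
  then show ?thesis by (simp add: norm_add_power2 power2_sum)
qed

lemma cmod_cinner_le: "cmod (cinner x y) \<le> norm x * norm y"
proof (cases "cinner x y = 0")
  case False
  define c where "c = cnj (sgn (cinner x y))"
  have c: "cmod c = 1" using False by (simp add: c_def norm_sgn)
  have "c * cinner x y = complex_of_real (cmod (cinner x y))"
    unfolding c_def sgn_eq using False
    by (simp add: complex_norm_square[symmetric] field_simps power2_eq_square mult.commute)
  then have "cmod (cinner x y) = Re (cinner x (c *\<^sub>C y))"
    by (simp add: cinner_scaleC_right)
  also have "\<dots> \<le> norm x * norm (c *\<^sub>C y)" by (rule Re_cinner_le)
  also have "\<dots> = norm x * norm y" by (simp add: norm_scaleC c)
  finally show ?thesis .
qed simp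

lemma cinner_eq_all:
  assumes "\<And>z. cinner x z = cinner y z"
  shows "x = y"
proof -
  have "cinner (x - y) (x - y) = 0" using assms by (simp add: cinner_diff_left)
  then show ?thesis by (simp add: cinner_self)
qed

lemma riesz_representation:
  fixes f :: "'h::chilbert_space \<Rightarrow> complex"
  assumes add: "\<And>x y. f (x + y) = f x + f y"
    and scale: "\<And>c x. f (c *\<^sub>C x) = c * f x"
    and bound: "\<And>x. cmod (f x) \<le> K * norm x"
  shows "\<exists>z. \<forall>x. f x = cinner z x"
proof -
  define g where "g x = (norm x)\<^sup>2 - 2 * Re (f x)" for x
  have scaleR: "f (r *\<^sub>R x) = complex_of_real r * f x" for r x
    by (simp add: scaleR_scaleC scale)
  have "- (K\<^sup>2) \<le> g x" for x
  proof -
    have "Re (f x) \<le> K * norm x"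
      using bound[of x] complex_Re_le_cmod[of "f x"] by linarith
    moreover have "0 \<le> (norm x - K)\<^sup>2" by simp
    ultimately show ?thesis by (simp add: g_def power2_diff mult.commute)
  qed
  then have bdd: "bdd_below (range g)" by (rule bdd_belowI2)
  define m where "m = Inf (range g)"
  have m: "m \<le> g x" for x unfolding m_def using bdd by (rule cInf_lower[rotated]) simp
  have "\<exists>x. g x < m + 1 / Suc n" for n
    using cInf_lessD[of "range g" "m + 1 / Suc n"] by (auto simp: m_def)
  then obtain X where X: "\<And>n. g (X n) < m + 1 / Suc n" by metis
  have half: "(norm (x - y))\<^sup>2 = 2 * g x + 2 * g y - 4 * g ((1/2) *\<^sub>R (x + y))" for x y
  proof -
    have n: "(norm ((1/2) *\<^sub>R (x + y)))\<^sup>2 = (norm (x + y))\<^sup>2 / 4"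
      by (simp add: power_mult_distrib power2_eq_square)
    have r: "Re (f ((1/2) *\<^sub>R (x + y))) = (Re (f x) + Re (f y)) / 2"
      by (simp only: scaleR add) simp
    show ?thesis
      unfolding g_def norm_diff_power2 n r norm_add_power2 by (simp add: field_simps)
  qed
  have "Cauchy X"
  proof (rule CauchyI)
    fix e :: real assume "0 < e"
    then obtain M where M: "4 / e\<^sup>2 < real M" using reals_Archimedean2 by blast
    have "norm (X i - X j) < e" if "i \<ge> M" "j \<ge> M" for i j
    proof -
      have Mi: "1 / Suc n < e\<^sup>2 / 4" if "n \<ge> M" for n
      proof -
        have "4 / e\<^sup>2 < real (Suc n)" using M that by simp
        then show ?thesis using \<open>0 < e\<close> by (simp add: field_simps)
      qed
      have "(norm (X i - X j))\<^sup>2 < 2 * (1 / Suc i) + 2 * (1 / Suc j)"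
        using half[of "X i" "X j"] X[of i] X[of j] m[of "(1/2) *\<^sub>R (X i + X j)"] by linarith
      also have "\<dots> < e\<^sup>2" using Mi[OF that(1)] Mi[OF that(2)] by linarith
      finally show ?thesis using \<open>0 < e\<close> by (simp add: power2_less_imp_less)
    qed
    then show "\<exists>M. \<forall>i\<ge>M. \<forall>j\<ge>M. norm (X i - X j) < e" by blast
  qed
  then obtain z where z: "X \<longlonglongrightarrow> z" by (auto simp: Cauchy_convergent_iff convergent_def)
  have "bounded_linear f"
    by (rule bounded_linear_intro[where K = K]) (simp_all add: add scaleR bound mult.commute scaleR_conv_of_real)
  then have "(\<lambda>n. f (X n)) \<longlonglongrightarrow> f z" using z by (rule bounded_linear.tendsto)
  then have "(\<lambda>n. g (X n)) \<longlonglongrightarrow> g z"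
    unfolding g_def by (intro tendsto_intros z)
  moreover have "(\<lambda>n. m + 1 / Suc n) \<longlonglongrightarrow> m + 0"
    by (intro tendsto_intros LIMSEQ_Suc lim_1_over_n)
  ultimately have "g z \<le> m + 0"
    by (rule LIMSEQ_le) (use X in \<open>auto intro: less_imp_le\<close>)
  then have gz: "g z \<le> g v" for v using m[of v] by simp
  have Re_eq: "Re (f v) = Re (cinner z v)" for v
  proof -
    define d where "d = Re (cinner z v) - Re (f v)"
    have t: "0 \<le> t\<^sup>2 * (norm v)\<^sup>2 + 2 * t * d" for t
      using gz[of "z + t *\<^sub>R v"]
      by (simp add: g_def norm_add_power2 add scaleR cinner_scaleR_right d_def power_mult_distrib algebra_simps)
    have "d = 0"
    proof (rule ccontr)
      assume "d \<noteq> 0"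
      define q where "q = (norm v)\<^sup>2 + 1"
      have q: "0 < q" by (simp add: q_def add_nonneg_pos)
      have "0 \<le> (- d / q)\<^sup>2 * (norm v)\<^sup>2 + 2 * (- d / q) * d" by (rule t)
      also have "\<dots> = d\<^sup>2 / q\<^sup>2 * ((norm v)\<^sup>2 - 2 * q)"
        using q by (simp add: field_simps power2_eq_square)
      also have "\<dots> < 0"
        using \<open>d \<noteq> 0\<close> q by (intro mult_pos_neg) (simp_all add: q_def add_pos_nonneg)
      finally show False by simp
    qed
    then show ?thesis by (simp add: d_def)
  qed
  have "f v = cinner z v" for v
  proof (rule complex_eqI)
    show "Re (f v) = Re (cinner z v)" by (rule Re_eq)
    show "Im (f v) = Im (cinner z v)"
      using Re_eq[of "\<i> *\<^sub>C v"] by (simp add: scale cinner_scaleC_right)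
  qed
  then show ?thesis by blast
qed

typedef (overloaded) 'h bop = "{T :: 'h::chilbert_space \<Rightarrow>\<^sub>L 'h. \<forall>c x. T (c *\<^sub>C x) = c *\<^sub>C T x}"
  morphisms blinfun_of_bop Abs_bop
  by (rule exI[of _ 0]) simp

setup_lifting type_definition_bop

lift_definition bop_apply :: "'h::chilbert_space bop \<Rightarrow> 'h \<Rightarrow> 'h" is blinfun_apply .

lemma bop_eqI: "(\<And>x. bop_apply S x = bop_apply T x) \<Longrightarrow> S = T"
  by transfer (rule blinfun_eqI)

lemma bop_apply_add: "bop_apply T (x + y) = bop_apply T x + bop_apply T y"
  by transfer (rule blinfun.add_right)

lemma bop_apply_scaleC: "bop_apply T (c *\<^sub>C x) = c *\<^sub>C bop_apply T x"
  by transfer blast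

lemma bop_of_function:
  fixes f :: "'h::chilbert_space \<Rightarrow> 'h"
  assumes "\<And>x y. f (x + y) = f x + f y" "\<And>c x. f (c *\<^sub>C x) = c *\<^sub>C f x"
    and "\<And>x. norm (f x) \<le> K * norm x"
  shows "\<exists>T. bop_apply T = f"
proof -
  have "bounded_linear f"
    using assms by (intro bounded_linear_intro[where K = K]) (simp_all add: scaleR_scaleC mult.commute)
  then have B: "blinfun_apply (Blinfun f) = f" by (rule bounded_linear_Blinfun_apply)
  then have "bop_apply (Abs_bop (Blinfun f)) = f"
    using assms(2) by (simp add: bop_apply.rep_eq Abs_bop_inverse)
  then show ?thesis by blast
qed

instantiation bop :: (chilbert_space) complex_vector
begin

lift_definition zero_bop :: "'a bop" is 0 by simp
lift_definition plus_bop :: "'a bop \<Rightarrow> 'a bop \<Rightarrow> 'a bop" is "(+)"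
  by (simp add: blinfun.add_left scaleC_add_right)
lift_definition uminus_bop :: "'a bop \<Rightarrow> 'a bop" is uminus
  by (simp add: blinfun.minus_left)
lift_definition minus_bop :: "'a bop \<Rightarrow> 'a bop \<Rightarrow> 'a bop" is "(-)"
  by (simp add: blinfun.diff_left complex_vector.scale_right_diff_distrib)
lift_definition scaleR_bop :: "real \<Rightarrow> 'a bop \<Rightarrow> 'a bop" is "(*\<^sub>R)"
  by (simp add: blinfun.scaleR_left scaleR_scaleC scaleC_scaleC mult.commute)
definition scaleC_bop :: "complex \<Rightarrow> 'a bop \<Rightarrow> 'a bop"
  where "scaleC_bop c T = (SOME S. bop_apply S = (\<lambda>x. c *\<^sub>C bop_apply T x))"

lemma bop_norm_apply: "norm (bop_apply T x) \<le> norm (blinfun_of_bop T) * norm x"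
  by (simp add: bop_apply.rep_eq norm_blinfun)

lemma bop_apply_scaleC_left: "bop_apply (c *\<^sub>C T) x = c *\<^sub>C bop_apply (T :: 'a bop) x"
proof -
  have "\<exists>S. bop_apply S = (\<lambda>x. c *\<^sub>C bop_apply T x)"
  proof (rule bop_of_function)
    show "norm (c *\<^sub>C bop_apply T x) \<le> (cmod c * norm (blinfun_of_bop T)) * norm x" for x
      using mult_left_mono[OF bop_norm_apply, of "cmod c" T x] by (simp add: norm_scaleC mult.assoc)
  qed (simp_all add: bop_apply_add bop_apply_scaleC scaleC_add_right scaleC_scaleC mult.commute)
  from someI_ex[OF this] show ?thesis unfolding scaleC_bop_def by simp
qed

lemma bop_apply_linear_left:
  "bop_apply (S + T) x = bop_apply S x + bop_apply (T :: 'a bop) x"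
  "bop_apply (S - T) x = bop_apply S x - bop_apply (T :: 'a bop) x"
  "bop_apply (- T) x = - bop_apply (T :: 'a bop) x"
  "bop_apply 0 x = (0 :: 'a)"
  "bop_apply (r *\<^sub>R T) x = r *\<^sub>R bop_apply T x"
  by (transfer; simp add: blinfun.bilinear_simps)+

instance
  by standard (rule bop_eqI;
    simp add: bop_apply_linear_left bop_apply_scaleC_left algebra_simps scaleC_add_right scaleC_add_left
      scaleC_scaleC scaleC_one scaleR_scaleC)+

end

instantiation bop :: (chilbert_space) complex_normed_vector
begin

lift_definition norm_bop :: "'a bop \<Rightarrow> real" is norm .
definition dist_bop :: "'a bop \<Rightarrow> 'a bop \<Rightarrow> real" where "dist_bop S T = norm (S - T)"
definition sgn_bop :: "'a bop \<Rightarrow> 'a bop" where "sgn_bop T = T /\<^sub>R norm T"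
definition [code del]: "(uniformity :: ('a bop \<times> 'a bop) filter)
  = (INF e\<in>{0 <..}. principal {(S, T). dist S T < e})"
definition [code del]: "open (U :: 'a bop set)
  = (\<forall>S\<in>U. \<forall>\<^sub>F (S', T) in uniformity. S' = S \<longrightarrow> T \<in> U)"

lemma norm_bop_bound: "0 \<le> b \<Longrightarrow> (\<And>x. norm (bop_apply T x) \<le> b * norm x) \<Longrightarrow> norm (T :: 'a bop) \<le> b"
  by transfer (rule norm_blinfun_bound)

lemma norm_bop_apply: "norm (bop_apply T x) \<le> norm (T :: 'a bop) * norm x"
  by transfer (rule norm_blinfun)

lemma norm_bop_ge_zero: "0 \<le> norm (T :: 'a bop)"
  by transfer simp

instance
proof
  fix S T :: "'a bop" and r :: real and c :: complex and U :: "'a bop set"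
  show "dist S T = norm (S - T)" "sgn T = T /\<^sub>R norm T"
    by (fact dist_bop_def, fact sgn_bop_def)
  show "uniformity = (INF e\<in>{0 <..}. principal {(S :: 'a bop, T). dist S T < e})"
    "open U = (\<forall>S\<in>U. \<forall>\<^sub>F (S', T) in uniformity. S' = S \<longrightarrow> T \<in> U)"
    by (fact uniformity_bop_def, fact open_bop_def)
  show "norm T = 0 \<longleftrightarrow> T = 0" by transfer simp
  show "norm (S + T) \<le> norm S + norm T" by transfer (rule norm_triangle_ineq)
  show "norm (r *\<^sub>R T) = \<bar>r\<bar> * norm T" by transfer simp
  have le: "norm (c *\<^sub>C T) \<le> cmod c * norm T" for c and T :: "'a bop"
  proof (rule norm_bop_bound)
    show "norm (bop_apply (c *\<^sub>C T) x) \<le> cmod c * norm T * norm x" for x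
      using mult_left_mono[OF norm_bop_apply, of "cmod c" T x]
      by (simp add: bop_apply_scaleC_left norm_scaleC mult.assoc)
  qed (simp add: norm_bop_ge_zero)
  show "norm (c *\<^sub>C T) = cmod c * norm T"
  proof (cases "c = 0")
    case False
    have "norm T = norm (inverse c *\<^sub>C c *\<^sub>C T)"
      using False by (simp only: scaleC_scaleC) (simp add: scaleC_one)
    also have "\<dots> \<le> cmod (inverse c) * norm (c *\<^sub>C T)" by (rule le)
    finally have "cmod c * norm T \<le> norm (c *\<^sub>C T)"
      using False by (simp add: norm_inverse norm_divide field_simps)
    with le[of c T] show ?thesis by simp
  next
    case True
    moreover have "norm (0 :: 'a bop) = 0" by transfer simp
    ultimately show ?thesis by simp
  qed
qed

end

lemma adjoint_exists: "\<exists>S. \<forall>x y. cinner (bop_apply S x) y = cinner x (bop_apply T y)"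
proof -
  have "\<exists>z. \<forall>y. cinner x (bop_apply T y) = cinner z y" for x
  proof (rule riesz_representation)
    show "cmod (cinner x (bop_apply T y)) \<le> (norm x * norm T) * norm y" for y
      using cmod_cinner_le[of x "bop_apply T y"] mult_left_mono[OF norm_bop_apply[of T y], of "norm x"]
      by (simp add: mult.assoc)
  qed (simp_all add: bop_apply_add bop_apply_scaleC cinner_add_right cinner_scaleC_right)
  then obtain s where s: "\<And>x y. cinner x (bop_apply T y) = cinner (s x) y" by metis
  have "\<exists>S. bop_apply S = s"
  proof (rule bop_of_function)
    show "s (x + y) = s x + s y" for x y
      by (rule cinner_eq_all) (simp add: cinner_add_left flip: s)
    show "s (c *\<^sub>C x) = c *\<^sub>C s x" for c x
      by (rule cinner_eq_all) (simp add: cinner_scaleC_left flip: s)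
    show "norm (s x) \<le> norm T * norm x" for x
    proof (cases "s x = 0")
      case False
      have "(norm (s x))\<^sup>2 = Re (cinner x (bop_apply T (s x)))" by (simp add: norm_power2_cinner s)
      also have "\<dots> \<le> norm x * norm (bop_apply T (s x))" by (rule Re_cinner_le)
      also have "\<dots> \<le> norm x * (norm T * norm (s x))" by (intro mult_left_mono norm_bop_apply) simp
      finally show ?thesis using False by (simp add: power2_eq_square mult_ac)
    qed (simp add: norm_bop_ge_zero)
  qed
  with s show ?thesis by metis
qed

instantiation bop :: (chilbert_space) cstar_algebra
begin

lift_definition times_bop :: "'a bop \<Rightarrow> 'a bop \<Rightarrow> 'a bop" is "(o\<^sub>L)" by simp

definition star_bop :: "'a bop \<Rightarrow> 'a bop"
  where "star_bop T = (THE S. \<forall>x y. cinner (bop_apply S x) y = cinner x (bop_apply T y))"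

lemma bop_apply_times: "bop_apply (S * T) x = bop_apply S (bop_apply (T :: 'a bop) x)"
  by transfer simp

lemma cinner_star_left: "cinner (bop_apply (star T) x) y = cinner x (bop_apply (T :: 'a bop) y)"
proof -
  have "\<exists>!S. \<forall>x y. cinner (bop_apply S x) y = cinner x (bop_apply T y)"
    using adjoint_exists[of T] by (metis bop_eqI cinner_eq_all)
  from theI'[OF this] show ?thesis by (simp add: star_bop_def)
qed

lemma cinner_star_right: "cinner x (bop_apply (star T) y) = cinner (bop_apply (T :: 'a bop) x) y"
  by (metis cinner_commute cinner_star_left)

instance
proof
  fix S T V :: "'a bop" and r :: real and c :: complex
  show "S * T * V = S * (T * V)" "(S + T) * V = S * V + T * V" "S * (T + V) = S * T + S * V"
    "(r *\<^sub>R S) * T = r *\<^sub>R (S * T)" "S * (r *\<^sub>R T) = r *\<^sub>R (S * T)"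
    "(c *\<^sub>C S) * T = c *\<^sub>C (S * T)" "S * (c *\<^sub>C T) = c *\<^sub>C (S * T)"
    by (rule bop_eqI; simp add: bop_apply_times bop_apply_linear_left bop_apply_scaleC_left
        bop_apply_add bop_apply_scaleC scaleR_scaleC)+
  show le: "norm (S * T) \<le> norm S * norm T" for S T :: "'a bop" by transfer (rule norm_blinfun_compose)
  show "star (S + T) = star S + star T" "star (c *\<^sub>C S) = cnj c *\<^sub>C star S"
    "star (S * T) = star T * star S" "star (star S) = S"
    by (rule bop_eqI, rule cinner_eq_all, simp add: cinner_star_left cinner_star_right bop_apply_times
        bop_apply_linear_left bop_apply_scaleC_left cinner_add_left cinner_add_right
        cinner_scaleC_left cinner_scaleC_right)+
  have sq: "(norm T)\<^sup>2 \<le> norm (star T * T)" for T :: "'a bop"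
  proof -
    have "norm T \<le> sqrt (norm (star T * T))"
    proof (rule norm_bop_bound)
      fix x
      have "(norm (bop_apply T x))\<^sup>2 = Re (cinner x (bop_apply (star T * T) x))"
        by (simp add: norm_power2_cinner bop_apply_times cinner_star_right)
      also have "\<dots> \<le> norm x * norm (bop_apply (star T * T) x)" by (rule Re_cinner_le)
      also have "\<dots> \<le> norm x * (norm (star T * T) * norm x)" by (intro mult_left_mono norm_bop_apply) simp
      also have "\<dots> = (sqrt (norm (star T * T)) * norm x)\<^sup>2"
        by (simp add: power_mult_distrib power2_eq_square mult_ac)
      finally show "norm (bop_apply T x) \<le> sqrt (norm (star T * T)) * norm x"
        by (rule power2_le_imp_le) simp
    qed simp
    then have "(norm T)\<^sup>2 \<le> (sqrt (norm (star T * T)))\<^sup>2"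
      by (rule power_mono) simp
    then show ?thesis by simp
  qed
  have star_le: "norm (star T) \<le> norm T" if "\<And>S. star (star S) = (S :: 'a bop)" for T :: "'a bop"
  proof -
    have "(norm (star T))\<^sup>2 \<le> norm T * norm (star T)"
      using sq[of "star T"] le[of T "star T"] that by simp
    then show ?thesis
      by (cases "norm (star T) = 0") (auto simp: power2_eq_square)
  qed
  have "star (star S) = S" for S :: "'a bop"
    by (rule bop_eqI, rule cinner_eq_all) (simp add: cinner_star_left cinner_star_right)
  note star_le = star_le[OF this]
  have "norm (star T * T) \<le> norm T * norm T"
    using le[of "star T" T] mult_right_mono[OF star_le[of T], of "norm T"] by simp
  then show "norm (star T * T) = (norm T)\<^sup>2"
    using sq[of T] by (simp add: power2_eq_square)
next
  fix F :: "nat \<Rightarrow> 'a bop"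
  assume F: "Cauchy F"
  have dist: "dist (blinfun_of_bop S) (blinfun_of_bop T) = dist S T" for S T :: "'a bop"
    by (simp add: dist_norm norm_bop.rep_eq minus_bop.rep_eq)
  have "Cauchy (\<lambda>n. blinfun_of_bop (F n))"
    using F by (simp add: Cauchy_def dist)
  then obtain L where L: "(\<lambda>n. blinfun_of_bop (F n)) \<longlonglongrightarrow> L"
    by (auto simp: Cauchy_convergent_iff convergent_def)
  have lim: "(\<lambda>n. bop_apply (F n) x) \<longlonglongrightarrow> L x" for x
    unfolding bop_apply.rep_eq by (intro tendsto_intros L)
  have "L (c *\<^sub>C x) = c *\<^sub>C L x" for c x
  proof (rule LIMSEQ_unique[OF lim])
    have "bounded_linear (\<lambda>y :: 'a. c *\<^sub>C y)"
      by (rule bounded_linear_intro[where K = "cmod c"])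
        (simp_all add: scaleC_add_right scaleR_scaleC scaleC_scaleC norm_scaleC mult.commute)
    from bounded_linear.tendsto[OF this lim[of x]]
    show "(\<lambda>n. bop_apply (F n) (c *\<^sub>C x)) \<longlonglongrightarrow> c *\<^sub>C L x"
      by (simp add: bop_apply_scaleC)
  qed
  then have "blinfun_of_bop (Abs_bop L) = L" by (simp add: Abs_bop_inverse)
  then have "F \<longlonglongrightarrow> Abs_bop L"
    using L by (simp add: tendsto_iff flip: dist)
  then show "convergent F" by (auto simp: convergent_def)
qed

end


section \<open>*-homomorphisms and Hilbert bimodules\<close>

definition star_hom :: "('a::cstar_algebra \<Rightarrow> 'b::cstar_algebra) \<Rightarrow> bool"
  where "star_hom \<phi> \<longleftrightarrow> clinear \<phi> \<and> (\<forall>a b. \<phi> (a * b) = \<phi> a * \<phi> b) \<and> (\<forall>a. \<phi> (star a) = star (\<phi> a))"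

definition closed_ideal :: "'a::cstar_algebra set \<Rightarrow> bool"
  where "closed_ideal I \<longleftrightarrow> csubspace I \<and> closed I \<and> (\<forall>a\<in>I. \<forall>b. a * b \<in> I \<and> b * a \<in> I)"

definition positive :: "'a::cstar_algebra \<Rightarrow> bool"
  where "positive a \<longleftrightarrow> (\<exists>b. a = star b * b)"

definition complete_norm :: "('x::ab_group_add \<Rightarrow> real) \<Rightarrow> bool"
  where "complete_norm N \<longleftrightarrow> (\<forall>u :: nat \<Rightarrow> 'x.
    (\<forall>e>0. \<exists>M. \<forall>m\<ge>M. \<forall>n\<ge>M. N (u m - u n) < e) \<longrightarrow> (\<exists>l. (\<lambda>n. N (u n - l)) \<longlonglongrightarrow> 0))"

locale left_hilbert_module =
  fixes lact :: "'a::cstar_algebra \<Rightarrow> 'x::complex_vector \<Rightarrow> 'x"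
    and ipL :: "'x \<Rightarrow> 'x \<Rightarrow> 'a"
  assumes lact_linear_left: "clinear (\<lambda>a. lact a x)"
    and lact_linear_right: "clinear (lact a)"
    and lact_mult: "lact (a * b) x = lact a (lact b x)"
    and ipL_linear: "clinear (\<lambda>x. ipL x y)"
    and ipL_lact: "ipL (lact a x) y = a * ipL x y"
    and ipL_star: "star (ipL x y) = ipL y x"
    and ipL_positive: "positive (ipL x x)"
    and ipL_definite: "ipL x x = 0 \<Longrightarrow> x = 0"
    and ipL_complete: "complete_norm (\<lambda>x. sqrt (norm (ipL x x)))"

locale right_hilbert_module =
  fixes ract :: "'x::complex_vector \<Rightarrow> 'a::cstar_algebra \<Rightarrow> 'x"
    and ipR :: "'x \<Rightarrow> 'x \<Rightarrow> 'a"
  assumes ract_linear_left: "clinear (\<lambda>x. ract x a)"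
    and ract_linear_right: "clinear (ract x)"
    and ract_mult: "ract x (a * b) = ract (ract x a) b"
    and ipR_linear: "clinear (ipR x)"
    and ipR_ract: "ipR x (ract y a) = ipR x y * a"
    and ipR_star: "star (ipR x y) = ipR y x"
    and ipR_positive: "positive (ipR x x)"
    and ipR_definite: "ipR x x = 0 \<Longrightarrow> x = 0"
    and ipR_complete: "complete_norm (\<lambda>x. sqrt (norm (ipR x x)))"

locale hilbert_bimodule =
  left_hilbert_module lact ipL + right_hilbert_module ract ipR
  for lact :: "'a::cstar_algebra \<Rightarrow> 'x::complex_vector \<Rightarrow> 'x"
    and ract :: "'x \<Rightarrow> 'a \<Rightarrow> 'x"
    and ipL :: "'x \<Rightarrow> 'x \<Rightarrow> 'a"
    and ipR :: "'x \<Rightarrow> 'x \<Rightarrow> 'a" +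
  assumes lact_ract: "ract (lact a x) b = lact a (ract x b)"
    and ipL_ipR: "ract x (ipR y z) = lact (ipL x y) z"

definition right_inner_ideal :: "('x \<Rightarrow> 'x \<Rightarrow> 'a::cstar_algebra) \<Rightarrow> 'a set"
  where "right_inner_ideal ipR = closure (cspan {ipR x y | x y. True})"


section \<open>The spectrum of a C*-algebra\<close>

text \<open>A nondegenerate representation on a closed subspace \<open>M\<close> of \<open>'h\<close> is encoded by its extension by
  zero to \<open>'h\<close>; the subspace \<open>M\<close> is recovered as \<open>rep_space \<pi>\<close>. The zero representation is not
  counted as irreducible, so irreducible representations are nondegenerate.\<close>

definition rep_space :: "('a::cstar_algebra \<Rightarrow> 'h::chilbert_space bop) \<Rightarrow> 'h set"
  where "rep_space \<pi> = closure (cspan {bop_apply (\<pi> a) h | a h. True})"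

definition irreducible_rep :: "('a::cstar_algebra \<Rightarrow> 'h::chilbert_space bop) \<Rightarrow> bool"
  where "irreducible_rep \<pi> \<longleftrightarrow> star_hom \<pi> \<and> rep_space \<pi> \<noteq> {0} \<and>
    (\<forall>N. csubspace N \<and> closed N \<and> N \<subseteq> rep_space \<pi> \<and> (\<forall>a. \<forall>h\<in>N. bop_apply (\<pi> a) h \<in> N)
      \<longrightarrow> N = {0} \<or> N = rep_space \<pi>)"

text \<open>The values of the intertwiner \<open>U\<close> outside \<open>rep_space \<pi>\<close> are irrelevant.\<close>

definition unitarily_equivalent ::
  "('a::cstar_algebra \<Rightarrow> 'h::chilbert_space bop) \<Rightarrow> ('a \<Rightarrow> 'k::chilbert_space bop) \<Rightarrow> bool"
  where "unitarily_equivalent \<pi> \<sigma> \<longleftrightarrow> (\<exists>U. clinear U \<and> U ` rep_space \<pi> = rep_space \<sigma> \<and>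
    (\<forall>h\<in>rep_space \<pi>. \<forall>k\<in>rep_space \<pi>. cinner (U h) (U k) = cinner h k) \<and>
    (\<forall>a. \<forall>h\<in>rep_space \<pi>. U (bop_apply (\<pi> a) h) = bop_apply (\<sigma> a) (U h)))"

text \<open>An irreducible representation has a cyclic vector, hence a Hilbert space of dimension at most
  the cardinality of the algebra. So every irreducible representation is unitarily equivalent to one
  on a closed subspace of \<open>'a ell2\<close>, and the classes below are all of them.\<close>

definition spectrum :: "('a::cstar_algebra \<Rightarrow> 'a ell2 bop) set set"
  where "spectrum = {\<pi>. irreducible_rep \<pi>} //
    {(\<pi>, \<sigma>). irreducible_rep \<pi> \<and> irreducible_rep \<sigma> \<and> unitarily_equivalent \<pi> \<sigma>}"

definition ideal_spectrum :: "'a::cstar_algebra set \<Rightarrow> ('a \<Rightarrow> 'a ell2 bop) set set"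
  where "ideal_spectrum I = {P \<in> spectrum. \<exists>\<pi>\<in>P. \<exists>a\<in>I. \<pi> a \<noteq> 0}"

text \<open>The sets \<open>ideal_spectrum I\<close> are closed under unions and finite intersections, so they are
  precisely the open sets.\<close>

definition spectrum_topology :: "('a::cstar_algebra \<Rightarrow> 'a ell2 bop) set topology"
  where "spectrum_topology = topology_generated_by {ideal_spectrum I | I. closed_ideal I}"


section \<open>The dual partial homeomorphism and topological freeness\<close>

text \<open>\<open>\<sigma>\<close> is (a copy of) \<open>X-Ind(\<pi>)\<close>: the map \<open>t\<close>, \<open>t x h\<close> standing for \<open>x \<otimes> h\<close>, identifies
  \<open>rep_space \<sigma>\<close> with the completion of the algebraic tensor product for its given inner product.
  That \<open>t\<close> is bilinear and balanced over the algebra follows from the formula for the inner products.\<close>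

definition rieffel_induced ::
  "('a::cstar_algebra \<Rightarrow> 'x \<Rightarrow> 'x) \<Rightarrow> ('x \<Rightarrow> 'x \<Rightarrow> 'a) \<Rightarrow>
    ('a \<Rightarrow> 'h::chilbert_space bop) \<Rightarrow> ('a \<Rightarrow> 'k::chilbert_space bop) \<Rightarrow> bool"
  where "rieffel_induced lact ipR \<pi> \<sigma> \<longleftrightarrow> (\<exists>t :: 'x \<Rightarrow> 'h \<Rightarrow> 'k.
    (\<forall>x y. \<forall>h\<in>rep_space \<pi>. \<forall>k\<in>rep_space \<pi>.
      cinner (t x h) (t y k) = cinner h (bop_apply (\<pi> (ipR x y)) k)) \<and>
    closure (cspan {t x h | x h. h \<in> rep_space \<pi>}) = rep_space \<sigma> \<and>
    (\<forall>a x. \<forall>h\<in>rep_space \<pi>. bop_apply (\<sigma> a) (t x h) = t (lact a x) h))"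

text \<open>Partial maps are represented by their graphs; \<open>R ^^ n\<close> is then the graph of the \<open>n\<close>-fold
  composition on its natural domain.\<close>

definition dual_partial_homeo ::
  "('a::cstar_algebra \<Rightarrow> 'x \<Rightarrow> 'x) \<Rightarrow> ('x \<Rightarrow> 'x \<Rightarrow> 'a) \<Rightarrow>
    (('a \<Rightarrow> 'a ell2 bop) set \<times> ('a \<Rightarrow> 'a ell2 bop) set) set"
  where "dual_partial_homeo lact ipR = {(P, Q). P \<in> ideal_spectrum (right_inner_ideal ipR) \<and>
    Q \<in> spectrum \<and> (\<exists>\<pi>\<in>P. \<exists>\<sigma>\<in>Q. rieffel_induced lact ipR \<pi> \<sigma>)}"

definition topologically_free :: "'s topology \<Rightarrow> ('s \<times> 's) set \<Rightarrow> bool"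
  where "topologically_free T R \<longleftrightarrow> (\<forall>n::nat. n > 0 \<longrightarrow> T interior_of {x. (x, x) \<in> R ^^ n} = {})"


section \<open>Covariant representations and the crossed product\<close>

text \<open>Covariant representations on a Hilbert space \<open>'h\<close> are the case \<open>'b = 'h bop\<close>.\<close>

definition covariant_rep ::
  "('a::cstar_algebra \<Rightarrow> 'x::complex_vector \<Rightarrow> 'x) \<Rightarrow> ('x \<Rightarrow> 'a \<Rightarrow> 'x) \<Rightarrow>
    ('x \<Rightarrow> 'x \<Rightarrow> 'a) \<Rightarrow> ('x \<Rightarrow> 'x \<Rightarrow> 'a) \<Rightarrow> ('a \<Rightarrow> 'b::cstar_algebra) \<Rightarrow> ('x \<Rightarrow> 'b) \<Rightarrow> bool"
  where "covariant_rep lact ract ipL ipR \<pi>A \<pi>X \<longleftrightarrow> star_hom \<pi>A \<and> clinear \<pi>X \<and>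
    (\<forall>a x. \<pi>X (lact a x) = \<pi>A a * \<pi>X x) \<and>
    (\<forall>a x. \<pi>X (ract x a) = \<pi>X x * \<pi>A a) \<and>
    (\<forall>x y. \<pi>A (ipR x y) = star (\<pi>X x) * \<pi>X y) \<and>
    (\<forall>x y. \<pi>A (ipL x y) = \<pi>X x * star (\<pi>X y))"

definition integrated_form ::
  "('a \<Rightarrow> 'c::cstar_algebra) \<Rightarrow> ('x \<Rightarrow> 'c) \<Rightarrow> ('a \<Rightarrow> 'b::cstar_algebra) \<Rightarrow> ('x \<Rightarrow> 'b) \<Rightarrow> ('c \<Rightarrow> 'b) \<Rightarrow> bool"
  where "integrated_form jA jX \<pi>A \<pi>X \<rho> \<longleftrightarrow>
    star_hom \<rho> \<and> (\<forall>a. \<rho> (jA a) = \<pi>A a) \<and> (\<forall>x. \<rho> (jX x) = \<pi>X x)"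

definition closed_star_subalgebra :: "'c::cstar_algebra set \<Rightarrow> bool"
  where "closed_star_subalgebra S \<longleftrightarrow>
    csubspace S \<and> closed S \<and> (\<forall>a\<in>S. \<forall>b\<in>S. a * b \<in> S) \<and> (\<forall>a\<in>S. star a \<in> S)"

text \<open>The C*-algebra \<open>'c\<close> with the universal covariant representation \<open>(jA, jX)\<close> is the crossed
  product. HOL cannot quantify over all Hilbert spaces inside a definition, but it is no restriction
  to test universality on the single Hilbert space \<open>('a + 'x) ell2\<close>: covariant representations may be
  degenerate, every one is a direct sum of cyclic ones and a zero one, and a cyclic one lives on a
  space of dimension at most the cardinality of \<open>'a + 'x\<close> (or is zero), so it extends by zero to
  \<open>('a + 'x) ell2\<close>. Since \<open>'c\<close> is generated by the images, integrated forms are unique.\<close>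

definition crossed_product ::
  "('a::cstar_algebra \<Rightarrow> 'x::complex_vector \<Rightarrow> 'x) \<Rightarrow> ('x \<Rightarrow> 'a \<Rightarrow> 'x) \<Rightarrow>
    ('x \<Rightarrow> 'x \<Rightarrow> 'a) \<Rightarrow> ('x \<Rightarrow> 'x \<Rightarrow> 'a) \<Rightarrow> ('a \<Rightarrow> 'c::cstar_algebra) \<Rightarrow> ('x \<Rightarrow> 'c) \<Rightarrow> bool"
  where "crossed_product lact ract ipL ipR jA jX \<longleftrightarrow>
    covariant_rep lact ract ipL ipR jA jX \<and>
    (\<forall>S. closed_star_subalgebra S \<and> range jA \<union> range jX \<subseteq> S \<longrightarrow> S = UNIV) \<and>
    (\<forall>(\<pi>A :: 'a \<Rightarrow> ('a + 'x) ell2 bop) \<pi>X. covariant_rep lact ract ipL ipR \<pi>A \<pi>X \<longrightarrow>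
      (\<exists>\<rho>. integrated_form jA jX \<pi>A \<pi>X \<rho>))"

end

theory Submission
  imports Defs
begin

text \<open>The heart of the matter is the estimate \<open>norm b\<^sub>0 \<le> norm (\<rho> (\<Sum>k. b\<^sub>k))\<close> for trigonometric polynomials with
  \<open>b\<^sub>0\<close> in the image of \<open>A\<close> and \<open>b\<^sub>k\<close> in the span of the \<open>k\<close>-fold products from \<open>X\<close> (from its adjoints, for
  negative \<open>k\<close>). By topological freeness, \<open>norm b\<^sub>0\<close> is almost attained at an irreducible representation of
  \<open>A\<close> whose class is moved by the relevant powers of the dual homeomorphism. As \<open>\<pi>A\<close> is injective, a pure
  state of this representation extends to the operators on the given Hilbert space; in the resulting
  GNS space, the subspace carrying the irreducible representation and its images under \<open>X\<close>-induction
  are irreducible and inequivalent, hence orthogonal by Schur's lemma. So compressing to that subspace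
  kills every \<open>b\<^sub>k\<close> with \<open>k \<noteq> 0\<close>. Multiplying by elements of degree \<open>- k\<close>, an element of the kernel of
  \<open>\<rho>\<close> is seen to have vanishing Fourier coefficients, and gauge invariance of the norm of the crossed
  product together with Fejer means shows that such an element is zero.\<close>

section \<open>Square roots by power series\<close>

text \<open>The estimate controls single coefficients only, and their number grows with the degree,
  so one approximation of an element \<open>c\<close> of the kernel is not enough. An approximant
  \<open>p\<close> fixes the length \<open>N\<close> of the Fejer sums; a second one has accuracy
  \<open>e / N\<close>, so that the \<open>N * N\<close> coefficients in its Fejer sum contribute at
  most \<open>N * e\<close>, harmless beside the factor \<open>N\<close> carried by
  \<open>p\<close>. Gauge invariance handles the difference of the two.

  As \<open>A\<close> may lack a unit, order is defined in the unitization, where the extension of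
  an injective representation can fail to be injective. The elements whose vanishing matters are
  therefore arranged to have scalar part 0, so that they lie in \<open>A\<close>.

  Points of the spectrum and the test representations of the crossed product live on prescribed
  square-summable spaces. Representations arising elsewhere are moved there by counting a spanning
  set.

  Order theory rests on one power series for the square root and on the norm of
  \<open>h + \<i> k\<close> for commuting self-adjoint \<open>h\<close>, \<open>k\<close>; no
  spectrum of an element occurs.\<close>

function sqrt_coeff :: "nat \<Rightarrow> real" where
  "sqrt_coeff n = (if n < 2 then real n / 2 else (\<Sum>i\<in>{1..<n}. sqrt_coeff i * sqrt_coeff (n - i)) / 2)"
  by pat_completeness auto
termination by (relation "Wellfounded.measure id") auto

declare sqrt_coeff.simps [simp del]

lemma sqrt_coeff_0 [simp]: "sqrt_coeff 0 = 0"
  by (simp add: sqrt_coeff.simps[of 0])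

text \<open>The coefficients are those of \<open>f = 1 - sqrt (1 - y)\<close>, which solves
  \<open>f * f = 2 * f - y\<close>. This is that equation degree by degree; the defining recursion
  is the same equation solved for the coefficient of \<open>y ^ n\<close>.\<close>

lemma sqrt_coeff_convolution:
  "(\<Sum>i\<le>n. sqrt_coeff i * sqrt_coeff (n - i)) = 2 * sqrt_coeff n - (if n = 1 then 1 else 0)"
proof -
  have "(\<Sum>i\<le>n. sqrt_coeff i * sqrt_coeff (n - i)) = (\<Sum>i\<in>{1..<n}. sqrt_coeff i * sqrt_coeff (n - i))"
  proof (rule sum.mono_neutral_right)
    show "\<forall>i\<in>{..n} - {1..<n}. sqrt_coeff i * sqrt_coeff (n - i) = 0"
    proof
      fix i assume "i \<in> {..n} - {1..<n}"
      then have "i = 0 \<or> n - i = 0" by auto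
      then show "sqrt_coeff i * sqrt_coeff (n - i) = 0" by (elim disjE) simp_all
    qed
  qed auto
  then show ?thesis using sqrt_coeff.simps[of n] by (cases "n < 2") auto
qed

lemma sqrt_coeff_nonneg: "0 \<le> sqrt_coeff n"
proof (induction n rule: less_induct)
  case (less n)
  then show ?case
    unfolding sqrt_coeff.simps[of n] by (auto intro!: divide_nonneg_pos sum_nonneg mult_nonneg_nonneg)
qed

text \<open>Writing \<open>s n\<close> for the partial sum, the convolution identity gives
  \<open>2 * s (Suc n) \<le> 1 + s n * s n\<close>, so the bound 1 is inherited. It makes the series
  converge absolutely on the closed unit ball, boundary included.\<close>

lemma sqrt_coeff_partial_sum: "(\<Sum>i\<le>n. sqrt_coeff i) \<le> 1"
proof (induction n)
  case (Suc n)
  have "2 * (\<Sum>i\<le>Suc n. sqrt_coeff i)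
    = (\<Sum>k\<le>Suc n. (if k = 1 then 1 else 0) + (\<Sum>i\<le>k. sqrt_coeff i * sqrt_coeff (k - i)))"
    unfolding sum_distrib_left by (rule sum.cong) (auto simp add: sqrt_coeff_convolution)
  also have "\<dots> = 1 + (\<Sum>k\<le>Suc n. \<Sum>i\<le>k. sqrt_coeff i * sqrt_coeff (k - i))"
    unfolding sum.distrib by (subst sum.delta) simp_all
  also have "(\<Sum>k\<le>Suc n. \<Sum>i\<le>k. sqrt_coeff i * sqrt_coeff (k - i))
    = (\<Sum>(i,j)\<in>{(i,j). i + j \<le> Suc n}. sqrt_coeff i * sqrt_coeff j)"
    by (rule sum.triangle_reindex_eq[symmetric])
  \<comment> \<open>A pair with an entry \<open>Suc n\<close> has 0 as its other entry and
    contributes nothing, because \<open>sqrt_coeff 0 = 0\<close>. Only indices up to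
    \<open>n\<close> remain, where the induction hypothesis applies.\<close>
  also have "\<dots> = (\<Sum>(i,j)\<in>{(i,j). i + j \<le> Suc n} \<inter> {..n} \<times> {..n}. sqrt_coeff i * sqrt_coeff j)"
  proof (rule sum.mono_neutral_right)
    show "finite {(i,j). i + j \<le> Suc n}"
      by (rule finite_subset[of _ "{..Suc n} \<times> {..Suc n}"]) auto
    show "\<forall>x\<in>{(i,j). i + j \<le> Suc n} - {(i,j). i + j \<le> Suc n} \<inter> {..n} \<times> {..n}.
      (case x of (i, j) \<Rightarrow> sqrt_coeff i * sqrt_coeff j) = 0"
    proof (clarify)
      fix i j assume *: "i + j \<le> Suc n" "(i,j) \<notin> {(i,j). i + j \<le> Suc n} \<inter> {..n} \<times> {..n}"
      then have "i = 0 \<or> j = 0" by (cases i; cases j) auto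
      then show "sqrt_coeff i * sqrt_coeff j = 0" by auto
    qed
  qed auto
  also have "\<dots> \<le> (\<Sum>(i,j)\<in>{..n} \<times> {..n}. sqrt_coeff i * sqrt_coeff j)"
    by (rule sum_mono2) (auto simp: sqrt_coeff_nonneg)
  also have "\<dots> = (\<Sum>i\<le>n. sqrt_coeff i) * (\<Sum>i\<le>n. sqrt_coeff i)"
    by (simp add: sum_product sum.cartesian_product)
  also have "\<dots> \<le> 1 * 1" by (intro mult_mono Suc.IH sum_nonneg) (auto simp: sqrt_coeff_nonneg)
  finally show ?case by simp
qed simp

lemma summable_sqrt_coeff: "summable sqrt_coeff"
  by (rule bounded_imp_summable[where B = 1]) (auto simp: sqrt_coeff_nonneg sqrt_coeff_partial_sum)

lemma suminf_sqrt_coeff_le: "suminf sqrt_coeff \<le> 1"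
proof (rule LIMSEQ_le_const2[OF summable_LIMSEQ'[OF summable_sqrt_coeff]])
  show "\<exists>N. \<forall>n\<ge>N. (\<Sum>i\<le>n. sqrt_coeff i) \<le> 1" using sqrt_coeff_partial_sum by blast
qed

text \<open>The function \<open>1 - sqrt (1 - y)\<close>; square roots appear later as
  \<open>1 - sqrt_series y\<close>.\<close>

definition sqrt_series :: "'u::{real_normed_algebra_1, banach} \<Rightarrow> 'u"
  where "sqrt_series y = (\<Sum>n. sqrt_coeff n *\<^sub>R y ^ n)"

context
  fixes y :: "'u::{real_normed_algebra_1, banach}"
  assumes y: "norm y \<le> 1"
begin

lemma sqrt_series_norm_le: "norm (sqrt_coeff n *\<^sub>R y ^ n) \<le> sqrt_coeff n"
proof -
  have "norm (y ^ n) \<le> 1" using norm_power_ineq[of y n] power_le_one[OF norm_ge_zero y, of n] by linarith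
  then show ?thesis using mult_left_mono[of "norm (y ^ n)" 1 "sqrt_coeff n"] by (simp add: sqrt_coeff_nonneg)
qed

lemma sqrt_series_abs_summable: "summable (\<lambda>n. norm (sqrt_coeff n *\<^sub>R y ^ n))"
  by (rule summable_comparison_test'[OF summable_sqrt_coeff]) (use sqrt_series_norm_le in simp)

lemma sqrt_series_summable: "summable (\<lambda>n. sqrt_coeff n *\<^sub>R y ^ n)"
  by (rule summable_norm_cancel[OF sqrt_series_abs_summable])

lemma norm_sqrt_series: "norm (sqrt_series y) \<le> 1"
proof -
  have "norm (sqrt_series y) \<le> (\<Sum>n. norm (sqrt_coeff n *\<^sub>R y ^ n))"
    unfolding sqrt_series_def by (rule summable_norm[OF sqrt_series_abs_summable])
  also have "\<dots> \<le> suminf sqrt_coeff"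
    by (rule suminf_le[OF sqrt_series_norm_le sqrt_series_abs_summable summable_sqrt_coeff])
  finally show ?thesis using suminf_sqrt_coeff_le by simp
qed

lemma sqrt_series_square: "sqrt_series y * sqrt_series y = 2 * sqrt_series y - y"
proof -
  let ?a = "\<lambda>n. sqrt_coeff n *\<^sub>R y ^ n"
  have "(\<lambda>n. \<Sum>i\<le>n. ?a i * ?a (n - i)) sums (sqrt_series y * sqrt_series y)"
    unfolding sqrt_series_def by (rule Cauchy_product_sums[OF sqrt_series_abs_summable sqrt_series_abs_summable])
  moreover have "(\<Sum>i\<le>n. ?a i * ?a (n - i)) = 2 * ?a n - (if n = 1 then y else 0)" for n
  proof -
    have "(\<Sum>i\<le>n. ?a i * ?a (n - i)) = (\<Sum>i\<le>n. sqrt_coeff i * sqrt_coeff (n - i)) *\<^sub>R y ^ n"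
      unfolding scaleR_sum_left by (rule sum.cong) (auto simp: power_add[symmetric])
    moreover have "2 * ?a n = (2 * sqrt_coeff n) *\<^sub>R y ^ n"
      unfolding mult_2 scaleR_add_left ..
    ultimately show ?thesis
      unfolding sqrt_coeff_convolution by (cases "n = 1") (simp_all add: scaleR_left_diff_distrib)
  qed
  moreover have "(\<lambda>n. 2 * ?a n - (if n = 1 then y else 0)) sums (2 * sqrt_series y - y)"
    unfolding sqrt_series_def
    by (intro sums_diff sums_mult summable_sums sqrt_series_summable sums_single)
  ultimately show ?thesis by (simp add: sums_unique2)
qed

end

text \<open>Intertwining passes to powers and so to the series. With equal arguments, the square
  root commutes with whatever commutes with its argument; different arguments serve
  \<open>star x\<close>, which intertwines \<open>x * star x\<close> with
  \<open>star x * x\<close>.\<close>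

lemma sqrt_series_intertwine:
  fixes x y y' :: "'u::{real_normed_algebra_1, banach}"
  assumes "norm y \<le> 1" "norm y' \<le> 1" "x * y = y' * x"
  shows "x * sqrt_series y = sqrt_series y' * x"
proof -
  have p: "x * y ^ n = y' ^ n * x" for n
  proof (induction n)
    case (Suc n)
    have "x * y ^ Suc n = (y' * x) * y ^ n" using assms(3) by (simp flip: mult.assoc)
    then show ?case using Suc by (simp add: mult.assoc)
  qed simp
  have "x * sqrt_series y = (\<Sum>n. x * (sqrt_coeff n *\<^sub>R y ^ n))"
    unfolding sqrt_series_def using sqrt_series_summable[OF assms(1)] by (rule suminf_mult[symmetric])
  also have "\<dots> = (\<Sum>n. (sqrt_coeff n *\<^sub>R y' ^ n) * x)" by (simp add: p)
  also have "\<dots> = sqrt_series y' * x"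
    unfolding sqrt_series_def using sqrt_series_summable[OF assms(2)] by (rule suminf_mult2[symmetric])
  finally show ?thesis .
qed

section \<open>Involution and norm\<close>

lemma norm_star: "norm (star a) = norm (a::'a::cstar_algebra)"
proof -
  have le: "norm b \<le> norm (star b)" for b :: 'a
  proof (cases "b = 0")
    case False
    have "norm b * norm b \<le> norm (star b) * norm b"
      using norm_mult_ineq[of "star b" b] by (simp add: cstar_identity power2_eq_square)
    then show ?thesis using False by simp
  qed simp
  show ?thesis using le[of a] le[of "star a"] by (simp add: star_star)
qed

lemma star_zero [simp]: "star (0::'a::cstar_algebra) = 0"
  using norm_star[of "0::'a"] by simp

lemma star_scaleR: "star (r *\<^sub>R a) = r *\<^sub>R star (a::'a::cstar_algebra)"
  by (simp add: scaleR_scaleC star_scaleC)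

lemma star_minus: "star (- a) = - star (a::'a::cstar_algebra)"
  using star_scaleR[of "-1" a] by simp

lemma star_diff: "star (a - b) = star a - star (b::'a::cstar_algebra)"
  using star_add[of a "- b"] by (simp add: star_minus)

lemma bounded_linear_star: "bounded_linear (star :: 'a::cstar_algebra \<Rightarrow> 'a)"
  by (rule bounded_linear_intro[where K = 1]) (simp_all add: star_add star_scaleR norm_star)

lemma bounded_linear_scaleC: "bounded_linear (\<lambda>x::'a::complex_normed_vector. c *\<^sub>C x)"
  by (rule bounded_linear_intro[where K = "cmod c"])
    (simp_all add: scaleC_add_right scaleR_scaleC scaleC_scaleC norm_scaleC mult.commute)

lemma scaleC_diff_right: "c *\<^sub>C (x - y) = c *\<^sub>C x - c *\<^sub>C (y::'a::complex_vector)"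
  by (rule complex_vector.scale_right_diff_distrib)

section \<open>Unitization\<close>

datatype 'a unitization = Unitization (alg_part: 'a) (scalar_part: complex)

lemma unitization_eqI: "alg_part x = alg_part y \<Longrightarrow> scalar_part x = scalar_part y \<Longrightarrow> x = y"
  by (cases x; cases y) simp

instantiation unitization :: (cstar_algebra) complex_vector
begin

definition "0 = Unitization 0 0"
definition "x + y = Unitization (alg_part x + alg_part y) (scalar_part x + scalar_part y)"
definition "- x = Unitization (- alg_part x) (- scalar_part x)"
definition "x - y = Unitization (alg_part x - alg_part y) (scalar_part x - scalar_part y)"
definition "c *\<^sub>C x = Unitization (c *\<^sub>C alg_part x) (c * scalar_part x)"
definition "r *\<^sub>R x = Unitization (r *\<^sub>R alg_part x) (r *\<^sub>R scalar_part x)"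

lemmas unitization_vector_defs = zero_unitization_def plus_unitization_def uminus_unitization_def
  minus_unitization_def scaleC_unitization_def scaleR_unitization_def

instance
  by standard (auto simp: unitization_vector_defs algebra_simps scaleC_add_right scaleC_add_left
    scaleC_scaleC scaleC_one scaleR_scaleC scaleR_conv_of_real)

end

instantiation unitization :: (cstar_algebra) complex_normed_vector
begin

definition unit_action :: "'a unitization \<Rightarrow> 'a \<Rightarrow>\<^sub>L 'a"
  where "unit_action x = Blinfun (\<lambda>b. alg_part x * b + scalar_part x *\<^sub>C b)"

lemma unit_action_apply: "blinfun_apply (unit_action x) b = alg_part x * b + scalar_part x *\<^sub>C b"
  unfolding unit_action_def
  by (subst bounded_linear_Blinfun_apply) (intro bounded_linear_add bounded_linear_mult_right bounded_linear_scaleC, rule refl)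

text \<open>Left multiplication alone is not faithful if the algebra has a unit \<open>e\<close>:
  then \<open>Unitization e (- 1)\<close> acts as 0. The maximum with the character
  \<open>scalar_part\<close> repairs this, and the C*-identity survives since both seminorms satisfy
  it.\<close>

definition "norm x = max (norm (unit_action x)) (cmod (scalar_part x))"
definition dist_unitization :: "'a unitization \<Rightarrow> 'a unitization \<Rightarrow> real" where "dist_unitization x y = norm (x - y)"
definition sgn_unitization :: "'a unitization \<Rightarrow> 'a unitization" where "sgn_unitization x = x /\<^sub>R norm x"
definition [code del]: "(uniformity :: ('a unitization \<times> 'a unitization) filter)
  = (INF e\<in>{0 <..}. principal {(x, y). dist x y < e})"
definition [code del]: "open (U :: 'a unitization set)
  = (\<forall>x\<in>U. \<forall>\<^sub>F (x', y) in uniformity. x' = x \<longrightarrow> y \<in> U)"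

lemma unit_action_add: "unit_action (x + y) = unit_action x + unit_action y"
  by (rule blinfun_eqI) (simp add: unit_action_apply blinfun.add_left plus_unitization_def scaleC_add_left algebra_simps)

lemma norm_unit_action_alg: "norm (unit_action (Unitization a 0)) = norm a"
proof (rule antisym)
  show "norm (unit_action (Unitization a 0)) \<le> norm a"
    by (rule norm_blinfun_bound) (simp_all add: unit_action_apply norm_mult_ineq)
  have "norm a * norm a = norm (blinfun_apply (unit_action (Unitization a 0)) (star a))"
    using cstar_identity[of "star a"] by (simp add: unit_action_apply star_star norm_star power2_eq_square)
  also have "\<dots> \<le> norm (unit_action (Unitization a 0)) * norm a"
    using norm_blinfun[of "unit_action (Unitization a 0)" "star a"] by (simp add: norm_star)
  finally show "norm a \<le> norm (unit_action (Unitization a 0))"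
    by (cases "a = 0") auto
qed

lemma norm_unit_action_scaleC: "norm (unit_action (c *\<^sub>C x)) = cmod c * norm (unit_action x)"
proof -
  have le: "norm (unit_action (c *\<^sub>C x)) \<le> cmod c * norm (unit_action x)" for c x
  proof (rule norm_blinfun_bound)
    fix b
    have "blinfun_apply (unit_action (c *\<^sub>C x)) b = c *\<^sub>C blinfun_apply (unit_action x) b"
      by (simp add: unit_action_apply scaleC_unitization_def scaleC_add_right mult_scaleC_left scaleC_scaleC)
    then show "norm (blinfun_apply (unit_action (c *\<^sub>C x)) b) \<le> cmod c * norm (unit_action x) * norm b"
      using norm_blinfun[of "unit_action x" b] by (simp add: norm_scaleC mult.assoc mult_left_mono)
  qed simp
  show ?thesis
  proof (cases "c = 0")
    case True
    then show ?thesis using le[of 0 x] by simp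
  next
    case False
    have "cmod c * norm (unit_action x) \<le> norm (unit_action (c *\<^sub>C x))"
    proof -
      have "norm (unit_action x) \<le> cmod (inverse c) * norm (unit_action (c *\<^sub>C x))"
        using le[of "inverse c" "c *\<^sub>C x"] False by (simp add: scaleC_scaleC scaleC_one)
      then have "cmod c * norm (unit_action x) \<le> cmod c * (cmod (inverse c) * norm (unit_action (c *\<^sub>C x)))"
        by (rule mult_left_mono) simp
      also have "cmod c * (cmod (inverse c) * norm (unit_action (c *\<^sub>C x))) = norm (unit_action (c *\<^sub>C x))"
        unfolding mult.assoc[symmetric] norm_mult[symmetric] using False by simp
      finally show ?thesis .
    qed
    then show ?thesis using le[of c x] by simp
  qed
qed

instance
proof
  fix x y :: "'a unitization" and r :: real and c :: complex and U :: "'a unitization set"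
  show "dist x y = norm (x - y)" "sgn x = x /\<^sub>R norm x"
    by (fact dist_unitization_def, fact sgn_unitization_def)
  show "uniformity = (INF e\<in>{0 <..}. principal {(x :: 'a unitization, y). dist x y < e})"
    "open U = (\<forall>x\<in>U. \<forall>\<^sub>F (x', y) in uniformity. x' = x \<longrightarrow> y \<in> U)"
    by (fact uniformity_unitization_def, fact open_unitization_def)
  show "norm x = 0 \<longleftrightarrow> x = 0"
  proof
    assume "norm x = 0"
    then have *: "norm (unit_action x) = 0" "scalar_part x = 0"
      unfolding norm_unitization_def by (auto simp: max_def split: if_splits)
    moreover have "x = Unitization (alg_part x) 0" using *(2) by (intro unitization_eqI) auto
    ultimately have "alg_part x = 0" using norm_unit_action_alg by (metis norm_eq_zero)
    then show "x = 0" using *(2) by (intro unitization_eqI) (auto simp: zero_unitization_def)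
  next
    assume "x = 0"
    then show "norm x = 0"
      using norm_unit_action_alg[of 0] by (simp add: norm_unitization_def zero_unitization_def)
  qed
  show "norm (x + y) \<le> norm x + norm y"
    using norm_triangle_ineq[of "unit_action x" "unit_action y"] norm_triangle_ineq[of "scalar_part x" "scalar_part y"]
    unfolding norm_unitization_def unit_action_add by (auto simp: plus_unitization_def)
  show n: "norm (c *\<^sub>C x) = cmod c * norm x" for c
    unfolding norm_unitization_def norm_unit_action_scaleC
    by (simp add: scaleC_unitization_def norm_mult max_mult_distrib_left)
  show "norm (r *\<^sub>R x) = \<bar>r\<bar> * norm x"
    using n[of "complex_of_real r"] by (simp add: scaleR_scaleC)
qed

end

instantiation unitization :: (cstar_algebra) "{cstar_algebra, real_normed_algebra_1}"
begin

definition "1 = Unitization 0 1"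
definition "x * y = Unitization (alg_part x * alg_part y + scalar_part x *\<^sub>C alg_part y + scalar_part y *\<^sub>C alg_part x)
  (scalar_part x * scalar_part y)"
definition "star x = Unitization (star (alg_part x)) (cnj (scalar_part x))"

lemma unit_action_mult: "unit_action (x * y) = unit_action x o\<^sub>L unit_action y"
  by (rule blinfun_eqI)
    (simp add: unit_action_apply times_unitization_def algebra_simps mult_scaleC_left mult_scaleC_right
      scaleC_add_right scaleC_scaleC)

text \<open>The C*-identity of the algebra is applied to the image \<open>?b\<close> of
  \<open>b\<close>: the product \<open>star ?b * ?b\<close> equals \<open>star b\<close> times the
  image of \<open>b\<close> under \<open>star x * x\<close>.\<close>

lemma unit_action_star_le: "(norm (unit_action x))\<^sup>2 \<le> norm (unit_action (star x * x))"
proof -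
  have "norm (unit_action x) \<le> sqrt (norm (unit_action (star x * x)))"
  proof (rule norm_blinfun_bound)
    fix b
    let ?b = "blinfun_apply (unit_action x) b"
    have "star ?b * ?b = star b * blinfun_apply (unit_action (star x * x)) b"
      unfolding unit_action_mult
      by (simp add: unit_action_apply star_unitization_def star_add star_mult star_scaleC algebra_simps
          mult_scaleC_left mult_scaleC_right)
    then have "(norm ?b)\<^sup>2 = norm (star b * blinfun_apply (unit_action (star x * x)) b)"
      by (simp add: cstar_identity[symmetric])
    also have "\<dots> \<le> norm (star b) * norm (blinfun_apply (unit_action (star x * x)) b)" by (rule norm_mult_ineq)
    also have "\<dots> \<le> norm b * (norm (unit_action (star x * x)) * norm b)"
      by (simp add: norm_star mult_left_mono norm_blinfun)
    also have "\<dots> = (sqrt (norm (unit_action (star x * x))) * norm b)\<^sup>2"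
      by (simp add: power_mult_distrib power2_eq_square mult_ac)
    finally show "norm ?b \<le> sqrt (norm (unit_action (star x * x))) * norm b"
      by (rule power2_le_imp_le) simp
  qed simp
  then have "(norm (unit_action x))\<^sup>2 \<le> (sqrt (norm (unit_action (star x * x))))\<^sup>2" by (rule power_mono) simp
  then show ?thesis by simp
qed

instance
proof
  fix x y z :: "'a unitization" and r :: real and c :: complex
  show "x * y * z = x * (y * z)" "(x + y) * z = x * z + y * z" "x * (y + z) = x * y + x * z"
    and m: "(c *\<^sub>C x) * y = c *\<^sub>C (x * y)" "x * (c *\<^sub>C y) = c *\<^sub>C (x * y)" for c
    by (simp_all add: times_unitization_def unitization_vector_defs algebra_simps mult_scaleC_left mult_scaleC_right
      scaleC_add_right scaleC_add_left scaleC_scaleC)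
  show "(r *\<^sub>R x) * y = r *\<^sub>R (x * y)" "x * (r *\<^sub>R y) = r *\<^sub>R (x * y)"
    by (simp_all only: scaleR_scaleC m)
  show "1 * x = x" "x * 1 = x" "(0::'a unitization) \<noteq> 1"
    by (simp_all add: one_unitization_def zero_unitization_def times_unitization_def scaleC_one)
  show ss: "star (x + y) = star x + star y" "star (c *\<^sub>C x) = cnj c *\<^sub>C star x" "star (x * y) = star y * star x"
    "star (star x) = x" for x y :: "'a unitization"
    by (simp_all add: star_unitization_def unitization_vector_defs times_unitization_def star_add star_scaleC
        star_mult star_star algebra_simps)
  have mult_le: "norm (unit_action (x * y)) \<le> norm (unit_action x) * norm (unit_action y)" for x y :: "'a unitization"
    unfolding unit_action_mult by (rule norm_blinfun_compose)
  show "norm (x * y) \<le> norm x * norm y"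
  proof -
    have le: "norm (unit_action z) \<le> norm z" "cmod (scalar_part z) \<le> norm z" "0 \<le> norm z"
      for z :: "'a unitization"
    proof -
      show l: "norm (unit_action z) \<le> norm z" "cmod (scalar_part z) \<le> norm z"
        unfolding norm_unitization_def by (rule max.cobounded1, rule max.cobounded2)
      show "0 \<le> norm z" by (rule order_trans[OF _ l(1)]) simp
    qed
    have "norm (unit_action x) * norm (unit_action y) \<le> norm x * norm y"
      by (intro mult_mono le norm_ge_zero)
    moreover have "cmod (scalar_part x) * cmod (scalar_part y) \<le> norm x * norm y"
      by (intro mult_mono le norm_ge_zero)
    ultimately have "max (norm (unit_action (x * y))) (cmod (scalar_part (x * y))) \<le> norm x * norm y"
      using mult_le[of x y] by (simp add: times_unitization_def norm_mult)
    then show ?thesis unfolding norm_unitization_def[of "x * y"] .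
  qed
  have "norm (unit_action (1::'a unitization)) \<le> 1"
    by (rule norm_blinfun_bound) (simp_all add: unit_action_apply one_unitization_def scaleC_one)
  then show "norm (1::'a unitization) = 1"
    by (simp add: norm_unitization_def one_unitization_def)
  have le: "norm (unit_action (star x)) \<le> norm (unit_action x)" for x :: "'a unitization"
  proof (cases "norm (unit_action (star x)) = 0")
    case False
    have "(norm (unit_action (star x)))\<^sup>2 \<le> norm (unit_action x) * norm (unit_action (star x))"
      using unit_action_star_le[of "star x"] mult_le[of x "star x"] by (simp add: ss)
    then show ?thesis using False by (simp add: power2_eq_square)
  qed simp
  have "norm (unit_action (star x * x)) \<le> norm (unit_action x) * norm (unit_action x)"
    using mult_le[of "star x" x] mult_right_mono[OF le[of x], of "norm (unit_action x)"] by simp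
  then have 1: "norm (unit_action (star x * x)) = (norm (unit_action x))\<^sup>2"
    using unit_action_star_le[of x] by (simp add: power2_eq_square)
  show "norm (star x * x) = (norm x)\<^sup>2"
  proof -
    have max: "max (a\<^sup>2) (b\<^sup>2) = (max a b)\<^sup>2" if "0 \<le> a" "0 \<le> b" for a b :: real
      using that by (simp add: max_def)
    have "cmod (scalar_part (star x * x)) = (cmod (scalar_part x))\<^sup>2"
      by (simp add: times_unitization_def star_unitization_def norm_mult power2_eq_square)
    then show ?thesis
      unfolding norm_unitization_def 1 by (simp add: max)
  qed
next
  fix F :: "nat \<Rightarrow> 'a unitization"
  assume F: "Cauchy F"
  have s: "cmod (scalar_part x) \<le> norm x" for x :: "'a unitization"
    unfolding norm_unitization_def by (rule max.cobounded2)
  \<comment> \<open>The action of the algebra part is that of \<open>x\<close> minus that of its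
    scalar part, whence the factor 2. Both coordinates are now controlled by the norm, so
    completeness is inherited coordinatewise.\<close>
  have a: "norm (alg_part x) \<le> 2 * norm x" for x :: "'a unitization"
  proof -
    have "x = Unitization (alg_part x) 0 + Unitization 0 (scalar_part x)"
      by (simp add: plus_unitization_def)
    then have eq: "unit_action (Unitization (alg_part x) 0) = unit_action x - unit_action (Unitization 0 (scalar_part x))"
      using unit_action_add by (metis add_diff_cancel_right')
    have "norm (unit_action (Unitization 0 (scalar_part x))) \<le> cmod (scalar_part x)"
      by (rule norm_blinfun_bound) (simp_all add: unit_action_apply norm_scaleC)
    then have "norm (unit_action x) + norm (unit_action (Unitization 0 (scalar_part x)))
      \<le> norm (unit_action x) + cmod (scalar_part x)" by (rule add_left_mono)
    with norm_triangle_ineq4 have "norm (unit_action x - unit_action (Unitization 0 (scalar_part x)))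
      \<le> norm (unit_action x) + cmod (scalar_part x)" by (rule order_trans)
    then have "norm (alg_part x) \<le> norm (unit_action x) + cmod (scalar_part x)"
      unfolding norm_unit_action_alg[symmetric] eq .
    also have "\<dots> \<le> norm x + norm x"
      by (intro add_mono s) (simp only: norm_unitization_def max.cobounded1)
    finally show ?thesis by simp
  qed
  have "Cauchy (\<lambda>n. scalar_part (F n))" "Cauchy (\<lambda>n. alg_part (F n))"
  proof -
    show "Cauchy (\<lambda>n. scalar_part (F n))"
    proof (rule CauchyI)
      fix e :: real assume "0 < e"
      then obtain M where M: "\<And>m n. m \<ge> M \<Longrightarrow> n \<ge> M \<Longrightarrow> norm (F m - F n) < e" using F by (meson CauchyD)
      have "norm (scalar_part (F m) - scalar_part (F n)) < e" if "m \<ge> M" "n \<ge> M" for m n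
        using s[of "F m - F n"] M[OF that] by (simp add: minus_unitization_def)
      then show "\<exists>M. \<forall>m\<ge>M. \<forall>n\<ge>M. norm (scalar_part (F m) - scalar_part (F n)) < e" by blast
    qed
    show "Cauchy (\<lambda>n. alg_part (F n))"
    proof (rule CauchyI)
      fix e :: real assume "0 < e"
      then have "0 < e / 2" by simp
      then obtain M where M: "\<And>m n. m \<ge> M \<Longrightarrow> n \<ge> M \<Longrightarrow> norm (F m - F n) < e / 2" using F by (meson CauchyD)
      have "norm (alg_part (F m) - alg_part (F n)) < e" if "m \<ge> M" "n \<ge> M" for m n
        using a[of "F m - F n"] M[OF that] by (simp add: minus_unitization_def)
      then show "\<exists>M. \<forall>m\<ge>M. \<forall>n\<ge>M. norm (alg_part (F m) - alg_part (F n)) < e" by blast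
    qed
  qed
  then obtain c b where c: "(\<lambda>n. scalar_part (F n)) \<longlonglongrightarrow> c" and b: "(\<lambda>n. alg_part (F n)) \<longlonglongrightarrow> b"
    by (auto simp: Cauchy_convergent_iff convergent_def)
  have le: "norm (Unitization u d) \<le> norm u + cmod d" for u :: 'a and d
  proof -
    have "norm (unit_action (Unitization u d)) \<le> norm u + cmod d"
    proof (rule norm_blinfun_bound)
      show "norm (blinfun_apply (unit_action (Unitization u d)) v) \<le> (norm u + cmod d) * norm v" for v
        using norm_triangle_ineq[of "u * v" "d *\<^sub>C v"] norm_mult_ineq[of u v]
        by (simp add: unit_action_apply norm_scaleC distrib_right)
    qed simp
    then show ?thesis unfolding norm_unitization_def by simp
  qed
  have "(\<lambda>n. norm (alg_part (F n) - b) + cmod (scalar_part (F n) - c)) \<longlonglongrightarrow> 0 + 0"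
    by (intro tendsto_add tendsto_norm_zero LIM_zero b c)
  then have lim: "(\<lambda>n. norm (alg_part (F n) - b) + cmod (scalar_part (F n) - c)) \<longlonglongrightarrow> 0" by simp
  have "norm (F n - Unitization b c) \<le> norm (alg_part (F n) - b) + cmod (scalar_part (F n) - c)" for n
    using le[of "alg_part (F n) - b" "scalar_part (F n) - c"] by (simp add: minus_unitization_def)
  then have "(\<lambda>n. norm (F n - Unitization b c)) \<longlonglongrightarrow> 0"
    by (intro tendsto_sandwich[OF _ _ tendsto_const lim] always_eventually allI norm_ge_zero)
  then have "F \<longlonglongrightarrow> Unitization b c" by (simp add: tendsto_norm_zero_iff LIM_zero_iff)
  then show "convergent F" by (auto simp: convergent_def)
qed

end

abbreviation to_unit :: "'a::cstar_algebra \<Rightarrow> 'a unitization" where "to_unit a \<equiv> Unitization a 0"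

lemma norm_to_unit: "norm (to_unit a) = norm a"
  unfolding norm_unitization_def norm_unit_action_alg by simp

section \<open>Positive elements of unital C*-algebras\<close>

lemma one_minus_sqrt_series_square:
  fixes y :: "'u::{real_normed_algebra_1, banach}"
  assumes "norm y \<le> 1"
  shows "(1 - sqrt_series y) * (1 - sqrt_series y) = 1 - y"
  using sqrt_series_square[OF assms] by (simp add: algebra_simps mult_2)

lemma star_one [simp]: "star (1::'u::{cstar_algebra, real_normed_algebra_1}) = 1"
proof -
  have "star (star (1::'u) * 1) = star 1 * star (star 1)" by (rule star_mult)
  then show ?thesis by (simp add: star_star)
qed

lemma star_power: "star ((a::'u::{cstar_algebra, real_normed_algebra_1}) ^ n) = star a ^ n"
  by (induction n) (simp_all add: star_mult power_commutes)

lemma star_sqrt_series: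
  fixes y :: "'u::{cstar_algebra, real_normed_algebra_1}"
  assumes "norm y \<le> 1" and "star y = y"
  shows "star (sqrt_series y) = sqrt_series y"
  unfolding sqrt_series_def
  using bounded_linear.suminf[OF bounded_linear_star sqrt_series_summable[OF assms(1)]]
  by (simp add: star_scaleR star_power assms(2))

lemma star_mult_eq_0: "star x * x = 0 \<longleftrightarrow> x = (0::'a::cstar_algebra)"
  using cstar_identity[of x] by auto

text \<open>For \<open>u = h + \<i> k\<close>, commutation gives
  \<open>star u * u = h * h + k * k\<close>, while \<open>h\<close> is the real part of
  \<open>u\<close> and so not larger in norm. This one inequality replaces spectral arguments
  throughout the section.\<close>

lemma norm_le_sum_squares:
  fixes h k :: "'a::cstar_algebra"
  assumes h: "star h = h" and k: "star k = k" and hk: "h * k = k * h"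
  shows "(norm h)\<^sup>2 \<le> norm (h * h + k * k)"
proof -
  define u where "u = h + \<i> *\<^sub>C k"
  have su: "star u = h - \<i> *\<^sub>C k"
    by (simp add: u_def star_add star_scaleC h k complex_vector.scale_minus_left)
  have "star u * u = h * h + k * k"
    unfolding su unfolding u_def
    by (simp add: algebra_simps mult_scaleC_left mult_scaleC_right scaleC_scaleC hk)
  then have u: "(norm u)\<^sup>2 = norm (h * h + k * k)" by (simp add: cstar_identity[symmetric])
  have "2 *\<^sub>R h = u + star u" unfolding su unfolding u_def by (simp add: scaleR_2)
  then have "2 * norm h \<le> norm u + norm (star u)" using norm_triangle_ineq[of u "star u"]
    by (metis abs_numeral norm_scaleR)
  then have "norm h \<le> norm u" by (simp add: norm_star)
  then have "(norm h)\<^sup>2 \<le> (norm u)\<^sup>2" by (rule power_mono) simp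
  then show ?thesis by (simp add: u)
qed

text \<open>For self-adjoint \<open>a\<close> the inequality says that the spectrum lies between 0
  and \<open>2 * r\<close>. In this form sums are immediate, and \<open>1 - a / r\<close> is in the
  unit ball, ready for the square root series.\<close>

definition pos :: "'u::{cstar_algebra, real_normed_algebra_1} \<Rightarrow> bool"
  where "pos a \<longleftrightarrow> star a = a \<and> (\<exists>r\<ge>0. norm (r *\<^sub>R 1 - a) \<le> r)"

lemma pos_selfadjoint: "pos a \<Longrightarrow> star a = a"
  by (simp add: pos_def)

lemma pos_sqrt:
  fixes a :: "'u::{cstar_algebra, real_normed_algebra_1}"
  assumes "pos a"
  obtains k where "star k = k" "k * k = a" "\<And>x. x * a = a * x \<Longrightarrow> x * k = k * x"
proof -
  obtain r where r: "0 \<le> r" "norm (r *\<^sub>R 1 - a) \<le> r" using assms by (auto simp: pos_def)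
  show ?thesis
  proof (cases "r = 0")
    case True
    then have "a = 0" using r by simp
    then show ?thesis using that[of 0] by simp
  next
    case False
    then have "0 < r" using r by simp
    define y where "y = 1 - (1/r) *\<^sub>R a"
    have "y = (1/r) *\<^sub>R (r *\<^sub>R 1 - a)" using \<open>0 < r\<close> by (simp add: y_def scaleR_right_diff_distrib)
    then have y: "norm y \<le> 1" using r \<open>0 < r\<close> by simp
    have sy: "star y = y" using pos_selfadjoint[OF assms] by (simp add: y_def star_diff star_scaleR)
    define k where "k = sqrt r *\<^sub>R (1 - sqrt_series y)"
    show ?thesis
    proof (rule that[of k])
      show "star k = k" by (simp add: k_def star_scaleR star_diff star_sqrt_series[OF y sy])
      have "(1 - sqrt_series y) * (1 - sqrt_series y) = 1 - y"
        by (rule one_minus_sqrt_series_square[OF y])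
      then show "k * k = a" using \<open>0 < r\<close> by (simp add: k_def y_def)
      fix x assume "x * a = a * x"
      then have "x * y = y * x" by (simp add: y_def algebra_simps)
      from sqrt_series_intertwine[OF y y this] show "x * k = k * x" by (simp add: k_def algebra_simps)
    qed
  qed
qed

text \<open>The root \<open>k\<close> of \<open>1 - g * g\<close> commutes with \<open>g\<close> and
  \<open>k * k + g * g = 1\<close>, so \<open>norm k \<le> 1\<close> and the claim follows by
  squaring.\<close>

lemma norm_one_minus_square:
  fixes g :: "'u::{cstar_algebra, real_normed_algebra_1}"
  assumes g: "star g = g" "norm g \<le> 1"
  shows "norm (1 - g * g) \<le> 1"
proof -
  have n: "norm (g * g) \<le> 1" using norm_mult_ineq[of g g] mult_mono[OF g(2) g(2)] by simp
  have s: "star (g * g) = g * g" by (simp add: star_mult g)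
  define k where "k = 1 - sqrt_series (g * g)"
  have k: "star k = k" by (simp add: k_def star_diff star_sqrt_series[OF n s])
  have kk: "k * k = 1 - g * g"
    unfolding k_def by (rule one_minus_sqrt_series_square[OF n])
  have "g * (g * g) = (g * g) * g" by (simp add: mult.assoc)
  from sqrt_series_intertwine[OF n n this] have "g * k = k * g" by (simp add: k_def algebra_simps)
  from norm_le_sum_squares[OF k g(1) this[symmetric]] have "(norm k)\<^sup>2 \<le> 1" by (simp add: kk)
  then show ?thesis
    using norm_mult_ineq[of k k] by (simp add: kk power2_eq_square)
qed

lemma pos_square:
  fixes h :: "'u::{cstar_algebra, real_normed_algebra_1}"
  assumes "star h = h"
  shows "pos (h * h)"
proof (cases "h = 0")
  case True
  then show ?thesis by (auto simp: pos_def)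
next
  case False
  define g where "g = (1 / norm h) *\<^sub>R h"
  have g: "star g = g" "norm g \<le> 1" using False assms by (simp_all add: g_def star_scaleR)
  have "(norm h)\<^sup>2 *\<^sub>R 1 - h * h = (norm h)\<^sup>2 *\<^sub>R (1 - g * g)"
    using False by (simp add: g_def scaleR_right_diff_distrib power2_eq_square)
  then have "norm ((norm h)\<^sup>2 *\<^sub>R 1 - h * h) \<le> (norm h)\<^sup>2"
    using norm_one_minus_square[OF g] by (simp add: mult_left_le)
  moreover have "star (h * h) = h * h" by (simp add: star_mult assms)
  ultimately show ?thesis by (auto simp: pos_def intro!: exI[of _ "(norm h)\<^sup>2"])
qed

lemma pos_zero: "pos 0"
  using pos_square[of 0] by simp

lemma pos_add: "pos a \<Longrightarrow> pos b \<Longrightarrow> pos (a + b)"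
proof -
  assume "pos a" "pos b"
  then obtain r s where "star a = a" "star b = b" "0 \<le> r" "0 \<le> s"
    "norm (r *\<^sub>R 1 - a) \<le> r" "norm (s *\<^sub>R 1 - b) \<le> s" by (auto simp: pos_def)
  moreover have "(r + s) *\<^sub>R 1 - (a + b) = (r *\<^sub>R 1 - a) + (s *\<^sub>R 1 - b)" by (simp add: algebra_simps)
  then have "norm ((r + s) *\<^sub>R 1 - (a + b)) \<le> norm (r *\<^sub>R 1 - a) + norm (s *\<^sub>R 1 - b)"
    by (metis norm_triangle_ineq)
  ultimately show "pos (a + b)" unfolding pos_def
    by (intro conjI exI[of _ "r + s"]) (simp_all add: star_add)
qed

lemma pos_scaleR: "pos a \<Longrightarrow> 0 \<le> t \<Longrightarrow> pos (t *\<^sub>R a)"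
proof -
  assume "pos a" "0 \<le> t"
  then obtain r where "star a = a" "0 \<le> r" "norm (r *\<^sub>R 1 - a) \<le> r" by (auto simp: pos_def)
  moreover have "(t * r) *\<^sub>R 1 - t *\<^sub>R a = t *\<^sub>R (r *\<^sub>R 1 - a)" by (simp add: scaleR_right_diff_distrib)
  ultimately show "pos (t *\<^sub>R a)" using \<open>0 \<le> t\<close> unfolding pos_def
    by (intro conjI exI[of _ "t * r"]) (simp_all add: star_scaleR mult_left_mono)
qed

lemma pos_of_real: "0 \<le> t \<Longrightarrow> pos (t *\<^sub>R 1)"
  using pos_scaleR[of 1 t] pos_square[of 1] by simp

text \<open>The roots \<open>h\<close> of \<open>a\<close> and \<open>k\<close> of
  \<open>- a\<close> commute, and \<open>h * h + k * k = 0\<close> bounds the norm of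
  \<open>h\<close> by 0.\<close>

lemma pos_antisym:
  assumes "pos a" "pos (- a)"
  shows "a = 0"
proof -
  obtain h where h: "star h = h" "h * h = a" "\<And>x. x * a = a * x \<Longrightarrow> x * h = h * x"
    using pos_sqrt[OF assms(1)] by blast
  obtain k where k: "star k = k" "k * k = - a" "\<And>x. x * (- a) = - a * x \<Longrightarrow> x * k = k * x"
    using pos_sqrt[OF assms(2)] by blast
  have "h * (- a) = - a * h" by (simp add: mult.assoc flip: h(2))
  then have "h * k = k * h" by (rule k(3))
  from norm_le_sum_squares[OF h(1) k(1) this] have "h = 0" by (simp add: h(2) k(2))
  then show ?thesis using h(2) by simp
qed

lemma pos_norm_minus: "star w = w \<Longrightarrow> pos (norm w *\<^sub>R 1 - w)"
  unfolding pos_def by (intro conjI exI[of _ "norm w"]) (simp_all add: star_diff star_scaleR)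

lemma pos_norm_le:
  assumes "pos a" "pos (r *\<^sub>R 1 - a)" "0 \<le> r"
  shows "norm a \<le> r"
proof -
  obtain h where h: "star h = h" "h * h = a" "\<And>x. x * a = a * x \<Longrightarrow> x * h = h * x"
    using pos_sqrt[OF assms(1)] by blast
  obtain k where k: "star k = k" "k * k = r *\<^sub>R 1 - a"
    "\<And>x. x * (r *\<^sub>R 1 - a) = (r *\<^sub>R 1 - a) * x \<Longrightarrow> x * k = k * x"
    using pos_sqrt[OF assms(2)] by blast
  have "h * (r *\<^sub>R 1 - a) = (r *\<^sub>R 1 - a) * h" by (simp add: algebra_simps flip: h(2))
  then have "h * k = k * h" by (rule k(3))
  from norm_le_sum_squares[OF h(1) k(1) this] have "(norm h)\<^sup>2 \<le> r" using assms(3) by (simp add: h(2) k(2))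
  then show ?thesis using norm_mult_ineq[of h h] by (simp add: h(2) power2_eq_square)
qed

text \<open>With \<open>z = p - q\<close> one has \<open>(p + q) * z = p * p - q * q = 0\<close>.
  Splitting \<open>p\<close> and \<open>q\<close> into squares of \<open>m\<close> and
  \<open>k\<close> turns \<open>(p + q) * (z * z) = 0\<close> into a vanishing sum of two commuting
  squares, so \<open>m * z\<close> and \<open>k * z\<close> are 0.\<close>

lemma pos_square_eq_imp_eq:
  assumes p: "pos p" and q: "pos q" and eq: "p * p = q * q" and pq: "p * q = q * p"
  shows "p = q"
proof -
  obtain m where m: "star m = m" "m * m = p" "\<And>x. x * p = p * x \<Longrightarrow> x * m = m * x"
    using pos_sqrt[OF p] by blast
  obtain k where k: "star k = k" "k * k = q" "\<And>x. x * q = q * x \<Longrightarrow> x * k = k * x"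
    using pos_sqrt[OF q] by blast
  define z where "z = p - q"
  have sz: "star z = z" using p q by (simp add: z_def star_diff pos_selfadjoint)
  have zm: "z * m = m * z" by (rule m(3)) (simp add: z_def algebra_simps pq)
  have zk: "z * k = k * z" by (rule k(3)) (simp add: z_def algebra_simps pq)
  have "k * p = p * k" using k(3)[OF pq] by simp
  then have km: "k * m = m * k" by (rule m(3))
  have s: "star (m * z) = m * z" "star (k * z) = k * z" by (simp_all add: star_mult m k sz zm zk)
  have c: "(m * z) * (k * z) = (k * z) * (m * z)"
    by (metis km mult.assoc zk zm)
  have "(m * z) * (m * z) + (k * z) * (k * z) = (m * m) * (z * z) + (k * k) * (z * z)"
    by (metis mult.assoc zk zm)
  also have "\<dots> = ((p + q) * (p - q)) * z" by (simp add: m k z_def algebra_simps)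
  also have "(p + q) * (p - q) = 0" by (simp add: algebra_simps eq pq)
  finally have 0: "(m * z) * (m * z) + (k * z) * (k * z) = 0" by simp
  have "m * z = 0" using norm_le_sum_squares[OF s c] 0 by simp
  then have "p * z = 0" by (metis m(2) mult.assoc mult_zero_right)
  moreover have "k * z = 0" using norm_le_sum_squares[OF s(2) s(1) c[symmetric]] 0 by (simp add: add.commute)
  then have "q * z = 0" by (metis k(2) mult.assoc mult_zero_right)
  ultimately have "star z * z = 0" unfolding sz by (simp add: z_def algebra_simps)
  then show ?thesis by (simp add: star_mult_eq_0 z_def)
qed

text \<open>The absolute value, the square root of \<open>a * a\<close>, rescaled so that the series
  applies. The factor \<open>norm a\<close> gives the right value at \<open>a = 0\<close>, where the
  division yields 0.\<close>

definition pabs :: "'u::{cstar_algebra, real_normed_algebra_1} \<Rightarrow> 'u"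
  where "pabs a = norm a *\<^sub>R (1 - sqrt_series (1 - (1 / (norm a)\<^sup>2) *\<^sub>R (a * a)))"

context
  fixes a :: "'u::{cstar_algebra, real_normed_algebra_1}"
  assumes a: "star a = a"
begin

lemma pabs_arg: "norm (1 - (1 / (norm a)\<^sup>2) *\<^sub>R (a * a)) \<le> 1"
  "star (1 - (1 / (norm a)\<^sup>2) *\<^sub>R (a * a)) = 1 - (1 / (norm a)\<^sup>2) *\<^sub>R (a * a)"
proof -
  have eq: "(1 / (norm a)\<^sup>2) *\<^sub>R (a * a) = ((1 / norm a) *\<^sub>R a) * ((1 / norm a) *\<^sub>R a)"
    by (simp add: power2_eq_square)
  show "norm (1 - (1 / (norm a)\<^sup>2) *\<^sub>R (a * a)) \<le> 1"
    unfolding eq by (rule norm_one_minus_square) (simp_all add: star_scaleR a)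
  show "star (1 - (1 / (norm a)\<^sup>2) *\<^sub>R (a * a)) = 1 - (1 / (norm a)\<^sup>2) *\<^sub>R (a * a)"
    by (simp add: star_diff star_scaleR star_mult a)
qed

lemma star_pabs: "star (pabs a) = pabs a"
  unfolding pabs_def by (simp add: star_scaleR star_diff star_sqrt_series[OF pabs_arg])

lemma pabs_square: "pabs a * pabs a = a * a"
proof (cases "a = 0")
  case False
  have sq: "(r *\<^sub>R y) * (r *\<^sub>R y) = r\<^sup>2 *\<^sub>R (y * y)" for r and y :: 'u
    by (simp add: power2_eq_square)
  have "pabs a * pabs a = (norm a)\<^sup>2 *\<^sub>R ((1 / (norm a)\<^sup>2) *\<^sub>R (a * a))"
    unfolding pabs_def sq one_minus_sqrt_series_square[OF pabs_arg(1)] by simp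
  then show ?thesis using False by simp
qed (simp add: pabs_def)

lemma pos_pabs: "pos (pabs a)"
proof -
  have "norm a *\<^sub>R 1 - pabs a = norm a *\<^sub>R sqrt_series (1 - (1 / (norm a)\<^sup>2) *\<^sub>R (a * a))"
    by (simp add: pabs_def scaleR_right_diff_distrib)
  then have "norm (norm a *\<^sub>R 1 - pabs a) \<le> norm a"
    using norm_sqrt_series[OF pabs_arg(1)] by (simp add: mult_left_le)
  then show ?thesis unfolding pos_def by (auto simp: star_pabs intro: exI[of _ "norm a"])
qed

end

text \<open>The norms have to agree because they enter the rescaling in \<open>pabs\<close>. They do
  agree for \<open>star x * x\<close> and \<open>x * star x\<close>.\<close>

lemma pabs_intertwine:
  assumes "star a = a" "star b = b" "norm a = norm b" "x * a = b * x"
  shows "x * pabs a = pabs b * x"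
proof -
  have "x * (a * a) = b * b * x" using assms(4) by (metis mult.assoc)
  then have "x * (1 - (1 / (norm a)\<^sup>2) *\<^sub>R (a * a)) = (1 - (1 / (norm b)\<^sup>2) *\<^sub>R (b * b)) * x"
    by (simp add: assms(3) algebra_simps)
  from sqrt_series_intertwine[OF pabs_arg(1)[OF assms(1)] pabs_arg(1)[OF assms(2)] this]
  show ?thesis unfolding pabs_def by (simp add: assms(3) algebra_simps)
qed

lemma pabs_commute: "star a = a \<Longrightarrow> x * a = a * x \<Longrightarrow> x * pabs a = pabs a * x"
  by (rule pabs_intertwine) simp_all

lemma pabs_pos: "pos q \<Longrightarrow> pabs q = q"
  using pos_square_eq_imp_eq[OF pos_pabs[OF pos_selfadjoint], of q q]
    pabs_square[OF pos_selfadjoint, of q] pabs_commute[OF pos_selfadjoint, of q q] by simp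

lemma pabs_minus: "pabs (- a) = pabs a"
  by (simp add: pabs_def)

text \<open>For a self-adjoint element, \<open>star x\<close> intertwines the functional calculi of \<open>x * star x\<close> and
  \<open>star x * x\<close>; this replaces the comparison of their spectra.\<close>

lemma neg_star_mult_pos_imp_zero:
  fixes x :: "'u::{cstar_algebra, real_normed_algebra_1}"
  assumes "pos (- (star x * x))"
  shows "x = 0"
proof -
  define a b where "a = star x * x" and "b = x * star x"
  have a: "star a = a" and b: "star b = b" by (simp_all add: a_def b_def star_mult star_star)
  have n: "norm b = norm a"
    using cstar_identity[of x] cstar_identity[of "star x"] by (simp add: a_def b_def star_star norm_star)
  have pa: "pabs a = - a" using pabs_pos[OF assms] by (simp add: a_def pabs_minus)
  have "star x * pabs b = pabs a * star x"
    by (rule pabs_intertwine[OF b a n]) (simp add: a_def b_def mult.assoc)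
  then have "star x * (pabs b + b) = 0" by (simp add: pa algebra_simps) (simp add: a_def b_def mult.assoc)
  then have "b * (pabs b + b) = 0" by (simp add: b_def mult.assoc)
  then have bp: "b * pabs b = - (b * b)" by (simp add: algebra_simps eq_neg_iff_add_eq_0)
  have c: "b * pabs b = pabs b * b" by (rule pabs_commute[OF b]) simp
  have "star (pabs b + b) * (pabs b + b) = 0"
    using pabs_square[OF b] bp c by (simp add: star_add star_pabs[OF b] b algebra_simps)
  then have "pabs b = - b" by (simp add: star_mult_eq_0 eq_neg_iff_add_eq_0)
  then have nb: "pos (- b)" using pos_pabs[OF b] by simp
  \<comment> \<open>Up to real factors, \<open>u\<close> and \<open>v\<close> are the real and
    imaginary parts of \<open>x\<close>, and the sum of their squares is twice
    \<open>star x * x + x * star x\<close>. That sum is thus positive, and also negative by the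
    assumption and \<open>nb\<close>; hence \<open>a = - b\<close> is positive too.\<close>
  define u v where "u = x + star x" and "v = \<i> *\<^sub>C (x - star x)"
  have "star u = u" "star v = v"
    by (simp_all add: u_def v_def star_add star_star star_scaleC star_diff scaleC_diff_right complex_vector.scale_minus_left)
  then have "pos (u * u + v * v)" by (intro pos_add pos_square)
  moreover have "u * u + v * v = 2 *\<^sub>R (a + b)"
    unfolding u_def v_def
    by (simp add: mult_scaleC_left mult_scaleC_right scaleC_scaleC a_def b_def algebra_simps scaleR_2)
  ultimately have "pos ((1/2) *\<^sub>R (2 *\<^sub>R (a + b)))" using pos_scaleR[of "2 *\<^sub>R (a + b)" "1/2"] by simp
  then have "pos (a + b)" by simp
  moreover have "pos (- (a + b))" using pos_add[OF assms[folded a_def] nb] by simp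
  ultimately have "a + b = 0" by (rule pos_antisym)
  then have "a = - b" by (simp add: eq_neg_iff_add_eq_0)
  then have "pos a" using nb by simp
  then have "a = 0" using assms by (intro pos_antisym) (simp_all add: a_def)
  then show ?thesis by (simp add: a_def star_mult_eq_0)
qed

text \<open>Let \<open>n = \<bar>a\<bar> - a\<close>, twice the negative part. Then
  \<open>star (x * n) * (x * n) = n * a * n\<close> is minus a square, so \<open>x * n = 0\<close>
  by the preceding lemma. It follows that \<open>n * n * n = 0\<close> and therefore
  \<open>n = 0\<close>.\<close>

lemma pos_star_mult:
  fixes x :: "'u::{cstar_algebra, real_normed_algebra_1}"
  shows "pos (star x * x)"
proof -
  define a where "a = star x * x"
  have a: "star a = a" by (simp add: a_def star_mult star_star)
  define p where "p = pabs a"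
  have p: "pos p" "star p = p" "p * p = a * a" by (simp_all add: p_def pos_pabs star_pabs pabs_square a)
  have ap: "a * p = p * a" unfolding p_def by (rule pabs_commute[OF a]) simp
  obtain m where m: "star m = m" "m * m = p" "\<And>x. x * p = p * x \<Longrightarrow> x * m = m * x"
    using pos_sqrt[OF p(1)] by blast
  define n where "n = p - a"
  have n: "star n = n" by (simp add: n_def star_diff p a)
  have "n * p = p * n" by (simp add: n_def algebra_simps ap)
  then have nm: "n * m = m * n" by (rule m(3))
  have "n * (p + a) = 0" by (simp add: n_def algebra_simps ap p)
  then have na: "n * a = - (n * p)" by (simp add: algebra_simps eq_neg_iff_add_eq_0 add.commute)
  have npn: "n * p * n = (n * m) * (n * m)" by (metis m(2) mult.assoc nm)
  have "star (x * n) * (x * n) = n * a * n" by (simp add: star_mult n a_def mult.assoc)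
  also have "\<dots> = - ((n * m) * (n * m))" by (simp add: na npn)
  finally have eq: "- (star (x * n) * (x * n)) = (n * m) * (n * m)" by simp
  have "pos (- (star (x * n) * (x * n)))"
    unfolding eq by (rule pos_square) (simp add: star_mult n m nm)
  then have "x * n = 0" by (rule neg_star_mult_pos_imp_zero)
  then have "n * p * n = 0" "n * a * n = 0" using eq by (simp_all add: npn na)
  moreover have "n * n * n = n * p * n - n * a * n"
    by (subst (2) n_def) (simp add: left_diff_distrib right_diff_distrib)
  ultimately have "n * n * n = 0" by simp
  then have "star (n * n) * (n * n) = 0" by (simp add: star_mult n flip: mult.assoc)
  then have "star n * n = 0" by (simp add: star_mult_eq_0 n)
  then have "p = a" by (simp add: star_mult_eq_0 n_def)
  then show ?thesis using p by (simp add: a_def)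
qed

lemma pos_cstar_norm_minus:
  fixes x :: "'u::{cstar_algebra, real_normed_algebra_1}"
  shows "pos ((norm x)\<^sup>2 *\<^sub>R 1 - star x * x)"
  using pos_norm_minus[of "star x * x"] by (simp add: star_mult star_star cstar_identity)

section \<open>A Hahn--Banach theorem with extreme functionals\<close>

definition sublinear :: "('v::real_vector \<Rightarrow> real) \<Rightarrow> bool"
  where "sublinear p \<longleftrightarrow> (\<forall>x y. p (x + y) \<le> p x + p y) \<and> (\<forall>r x. 0 < r \<longrightarrow> p (r *\<^sub>R x) \<le> r * p x)"

lemma sublinear_add: "sublinear p \<Longrightarrow> p (x + y) \<le> p x + p y"
  by (simp add: sublinear_def)

lemma sublinear_scale:
  assumes "sublinear p" "0 < r" shows "p (r *\<^sub>R x) = r * p x"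
proof (rule antisym)
  show "p (r *\<^sub>R x) \<le> r * p x" using assms by (simp add: sublinear_def)
  have "p ((1 / r) *\<^sub>R (r *\<^sub>R x)) \<le> (1 / r) * p (r *\<^sub>R x)"
    using assms unfolding sublinear_def by (meson divide_pos_pos zero_less_one)
  then show "r * p x \<le> p (r *\<^sub>R x)" using assms(2) by (simp add: field_simps)
qed

lemma sublinear_zero: "sublinear p \<Longrightarrow> p 0 = 0"
  using sublinear_scale[of p 2 0] by simp

lemma sublinear_scale_nonneg: "sublinear p \<Longrightarrow> 0 \<le> r \<Longrightarrow> p (r *\<^sub>R x) = r * p x"
  by (cases "r = 0") (simp_all add: sublinear_zero sublinear_scale)

lemma sublinear_minus_le: "sublinear p \<Longrightarrow> - p (- x) \<le> p x"
  using sublinear_add[of p x "- x"] by (simp add: sublinear_zero)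

text \<open>\<open>q\<close> encodes the face of those functionals below \<open>p\<close> that are even below \<open>q\<close>. This makes
  Zorn's lemma produce extreme functionals without any topology on the dual space.\<close>

definition face_below :: "('v::real_vector \<Rightarrow> real) \<Rightarrow> ('v \<Rightarrow> real) \<Rightarrow> bool"
  where "face_below p q \<longleftrightarrow> sublinear q \<and> (\<forall>x. q x \<le> p x) \<and>
    (\<forall>f g t. linear f \<and> linear g \<and> (\<forall>x. f x \<le> p x) \<and> (\<forall>x. g x \<le> p x) \<and> 0 < t \<and> t < 1 \<and>
      (\<forall>x. t * f x + (1 - t) * g x \<le> q x) \<longrightarrow> (\<forall>x. f x \<le> q x))"

text \<open>Cuts out the subface on which \<open>x\<close> is maximal: for sublinear
  \<open>q\<close>, a linear functional lies below \<open>push_face x q\<close> exactly if it lies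
  below \<open>q\<close> and takes the value \<open>q x\<close> at \<open>x\<close>.\<close>

definition push_face :: "'v::real_vector \<Rightarrow> ('v \<Rightarrow> real) \<Rightarrow> 'v \<Rightarrow> real"
  where "push_face x q a = (INF t\<in>{0..}. q (a + t *\<^sub>R x) - t * q x)"

context
  fixes q :: "'v::real_vector \<Rightarrow> real" and x :: 'v
  assumes q: "sublinear q"
begin

lemma push_face_bdd: "bdd_below ((\<lambda>t. q (a + t *\<^sub>R x) - t * q x) ` {0..})"
proof (rule bdd_belowI2)
  fix t :: real assume "t \<in> {0..}"
  then have "t * q x = q (t *\<^sub>R x)" using q by (simp add: sublinear_scale_nonneg)
  also have "\<dots> \<le> q (a + t *\<^sub>R x) + q (- a)" using sublinear_add[OF q, of "a + t *\<^sub>R x" "- a"] by simp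
  finally show "- q (- a) \<le> q (a + t *\<^sub>R x) - t * q x" by simp
qed

lemma push_face_le: "0 \<le> t \<Longrightarrow> push_face x q a \<le> q (a + t *\<^sub>R x) - t * q x"
  unfolding push_face_def by (rule cINF_lower[OF push_face_bdd]) simp

lemma push_face_geI: "(\<And>t. 0 \<le> t \<Longrightarrow> b \<le> q (a + t *\<^sub>R x) - t * q x) \<Longrightarrow> b \<le> push_face x q a"
  unfolding push_face_def by (rule cINF_greatest) auto

lemma push_face_below: "push_face x q a \<le> q a"
  using push_face_le[of 0 a] by simp

lemma sublinear_push_face: "sublinear (push_face x q)"
  unfolding sublinear_def
proof (intro conjI allI impI)
  fix a b
  have "push_face x q (a + b) - (q (b + s *\<^sub>R x) - s * q x) \<le> push_face x q a" if "0 \<le> s" for s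
  proof (rule push_face_geI)
    fix t :: real assume "0 \<le> t"
    then have "push_face x q (a + b) \<le> q ((a + b) + (t + s) *\<^sub>R x) - (t + s) * q x"
      using that by (intro push_face_le) simp
    also have "(a + b) + (t + s) *\<^sub>R x = (a + t *\<^sub>R x) + (b + s *\<^sub>R x)" by (simp add: algebra_simps)
    finally show "push_face x q (a + b) - (q (b + s *\<^sub>R x) - s * q x) \<le> q (a + t *\<^sub>R x) - t * q x"
      using sublinear_add[OF q, of "a + t *\<^sub>R x" "b + s *\<^sub>R x"] by (simp add: algebra_simps)
  qed
  then have "push_face x q (a + b) - push_face x q a \<le> push_face x q b"
    by (intro push_face_geI) (simp add: algebra_simps)
  then show "push_face x q (a + b) \<le> push_face x q a + push_face x q b" by simp
next
  fix r :: real and a assume r: "0 < r"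
  have "push_face x q (r *\<^sub>R a) / r \<le> push_face x q a"
  proof (rule push_face_geI)
    fix t :: real assume "0 \<le> t"
    then have "push_face x q (r *\<^sub>R a) \<le> q (r *\<^sub>R a + (r * t) *\<^sub>R x) - (r * t) * q x"
      using r by (intro push_face_le) simp
    also have "r *\<^sub>R a + (r * t) *\<^sub>R x = r *\<^sub>R (a + t *\<^sub>R x)" by (simp add: algebra_simps)
    also have "q (r *\<^sub>R (a + t *\<^sub>R x)) = r * q (a + t *\<^sub>R x)" using q r by (rule sublinear_scale)
    finally show "push_face x q (r *\<^sub>R a) / r \<le> q (a + t *\<^sub>R x) - t * q x"
      using r by (simp add: field_simps)
  qed
  then show "push_face x q (r *\<^sub>R a) \<le> r * push_face x q a" using r by (simp add: field_simps)
qed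

lemma push_face_minus: "push_face x q (- x) \<le> - q x"
  using push_face_le[of 1 "- x"] by (simp add: sublinear_zero[OF q])

end

text \<open>If a proper convex combination of \<open>f\<close> and \<open>g\<close> lies below
  \<open>push_face x q\<close>, then its value at \<open>x\<close> is at least \<open>q x\<close>.
  As \<open>f x\<close> and \<open>g x\<close> are at most \<open>q x\<close>, both must equal
  it.\<close>

lemma face_below_push_face:
  assumes "face_below p q"
  shows "face_below p (push_face x q)"
proof -
  have q: "sublinear q" using assms by (simp add: face_below_def)
  have face: "f y \<le> q y" if "linear f" "linear g" "\<And>x. f x \<le> p x" "\<And>x. g x \<le> p x" "0 < t" "t < 1"
    "\<And>x. t * f x + (1 - t) * g x \<le> q x" for f g t y
    using assms that unfolding face_below_def by blast
  show ?thesis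
    unfolding face_below_def
  proof (intro conjI allI impI)
    show "sublinear (push_face x q)" by (rule sublinear_push_face[OF q])
    fix y show "push_face x q y \<le> p y"
      using push_face_below[OF q, of x y] assms unfolding face_below_def by (meson order_trans)
  next
    fix f g :: "'a \<Rightarrow> real" and t :: real and y
    assume a: "linear f \<and> linear g \<and> (\<forall>x. f x \<le> p x) \<and> (\<forall>x. g x \<le> p x) \<and> 0 < t \<and> t < 1 \<and>
      (\<forall>xa. t * f xa + (1 - t) * g xa \<le> push_face x q xa)"
    then have le: "t * f z + (1 - t) * g z \<le> q z" for z
      using push_face_below[OF q, of x z] by (meson order_trans)
    have f: "f z \<le> q z" for z using face[of f g t] a le by blast
    have g: "g z \<le> q z" for z using face[of g f "1 - t"] a le by (simp add: add.commute)
    have "t * f (- x) + (1 - t) * g (- x) \<le> - q x"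
      using a push_face_minus[OF q, of x] by (meson order_trans)
    then have "q x \<le> t * f x + (1 - t) * g x" using a by (simp add: linear_neg)
    moreover have "(1 - t) * g x \<le> (1 - t) * q x" using g a by (intro mult_left_mono) auto
    ultimately have "t * q x \<le> t * f x" by (simp add: algebra_simps)
    then have fx: "f x = q x" using f[of x] a by simp
    show "f y \<le> push_face x q y"
    proof (rule push_face_geI[OF q])
      fix s :: real
      show "f y \<le> q (y + s *\<^sub>R x) - s * q x"
        using f[of "y + s *\<^sub>R x"] a by (simp add: linear_add linear_scale fx)
    qed
  qed
qed

text \<open>Subadditivity of the infimum uses the chain: two members \<open>q\<close> and
  \<open>r\<close> have a common lower member, to which subadditivity can be applied. The infimum is
  finite because every member is at least \<open>- p (- x)\<close>.\<close>

lemma face_below_chain_Inf: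
  assumes ne: "C \<noteq> {}" and face: "\<And>q. q \<in> C \<Longrightarrow> face_below p q"
    and chain: "\<And>q r. q \<in> C \<Longrightarrow> r \<in> C \<Longrightarrow> (\<forall>x. q x \<le> r x) \<or> (\<forall>x. r x \<le> q x)"
  shows "face_below p (\<lambda>x. INF q\<in>C. q x)" "\<And>q x. q \<in> C \<Longrightarrow> (INF q\<in>C. q x) \<le> q x"
proof -
  have sub: "sublinear q" if "q \<in> C" for q using face[OF that] by (simp add: face_below_def)
  have bdd: "bdd_below ((\<lambda>q. q x) ` C)" for x
  proof (rule bdd_belowI2)
    fix q assume "q \<in> C"
    have "- p (- x) \<le> - q (- x)" using face[OF \<open>q \<in> C\<close>] by (simp add: face_below_def)
    then show "- p (- x) \<le> q x" using sublinear_minus_le[OF sub[OF \<open>q \<in> C\<close>], of x] by simp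
  qed
  show low: "(INF q\<in>C. q x) \<le> q x" if "q \<in> C" for q x by (rule cINF_lower[OF bdd that])
  have great: "(\<And>q. q \<in> C \<Longrightarrow> b \<le> q x) \<Longrightarrow> b \<le> (INF q\<in>C. q x)" for b x
    by (rule cINF_greatest[OF ne])
  obtain q0 where q0: "q0 \<in> C" using ne by blast
  show "face_below p (\<lambda>x. INF q\<in>C. q x)"
    unfolding face_below_def sublinear_def
  proof (intro conjI allI impI)
    fix x y
    have "(INF q\<in>C. q (x + y)) - r y \<le> (INF q\<in>C. q x)" if "r \<in> C" for r
    proof (rule great)
      fix q assume "q \<in> C"
      then obtain m where m: "m \<in> C" "\<And>z. m z \<le> q z" "\<And>z. m z \<le> r z" using chain[OF \<open>q \<in> C\<close> \<open>r \<in> C\<close>] \<open>r \<in> C\<close>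
        by (elim disjE) (auto intro: that)
      show "(INF q\<in>C. q (x + y)) - r y \<le> q x"
        using low[OF m(1), of "x + y"] sublinear_add[OF sub[OF m(1)], of x y] m(2)[of x] m(3)[of y] by linarith
    qed
    then have "(INF q\<in>C. q (x + y)) - (INF q\<in>C. q x) \<le> (INF q\<in>C. q y)"
      by (intro great) (simp add: algebra_simps)
    then show "(INF q\<in>C. q (x + y)) \<le> (INF q\<in>C. q x) + (INF q\<in>C. q y)" by simp
  next
    fix r :: real and x assume r: "0 < r"
    have "(INF q\<in>C. q (r *\<^sub>R x)) / r \<le> (INF q\<in>C. q x)"
    proof (rule great)
      fix q assume "q \<in> C"
      then show "(INF q\<in>C. q (r *\<^sub>R x)) / r \<le> q x"
        using low[OF \<open>q \<in> C\<close>, of "r *\<^sub>R x"] sublinear_scale[OF sub[OF \<open>q \<in> C\<close>] r, of x] r by (simp add: field_simps)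
    qed
    then show "(INF q\<in>C. q (r *\<^sub>R x)) \<le> r * (INF q\<in>C. q x)" using r by (simp add: field_simps)
  next
    fix x show "(INF q\<in>C. q x) \<le> p x"
      using low[OF q0, of x] face[OF q0] unfolding face_below_def by (meson order_trans)
  next
    fix f g :: "'a \<Rightarrow> real" and t x
    assume a: "linear f \<and> linear g \<and> (\<forall>x. f x \<le> p x) \<and> (\<forall>x. g x \<le> p x) \<and> 0 < t \<and> t < 1 \<and>
      (\<forall>x. t * f x + (1 - t) * g x \<le> (INF q\<in>C. q x))"
    show "f x \<le> (INF q\<in>C. q x)"
    proof (rule great)
      fix q assume q: "q \<in> C"
      then have "\<forall>x. t * f x + (1 - t) * g x \<le> q x" using a low[OF q] by (meson order_trans)
      then show "f x \<le> q x" using face[OF q] a unfolding face_below_def by blast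
    qed
  qed
qed

text \<open>A minimal face \<open>m\<close> is unchanged by \<open>push_face x m\<close>, which
  gives \<open>m (- x) = - m x\<close>, so \<open>m\<close> is linear and the face is a single
  functional. Being a face makes it extreme; starting Zorn's lemma at \<open>push_face x0 p\<close>
  forces the value at \<open>x0\<close>.\<close>

theorem hahn_banach_extreme:
  fixes p :: "'v::real_vector \<Rightarrow> real"
  assumes p: "sublinear p"
  obtains f where "linear f" "\<And>x. f x \<le> p x" "f x0 = p x0"
    "\<And>g h t. linear g \<Longrightarrow> linear h \<Longrightarrow> (\<And>x. g x \<le> p x) \<Longrightarrow> (\<And>x. h x \<le> p x) \<Longrightarrow> 0 < t \<Longrightarrow> t < 1 \<Longrightarrow>
      (\<And>x. f x = t * g x + (1 - t) * h x) \<Longrightarrow> g = f"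
proof -
  have "face_below p p" unfolding face_below_def using p by auto
  then have q0: "face_below p (push_face x0 p)" by (rule face_below_push_face)
  define A where "A = {q. face_below p q \<and> (\<forall>x. q x \<le> push_face x0 p x)}"
  have "\<exists>m\<in>A. \<forall>a\<in>A. (\<forall>x. a x \<le> m x) \<longrightarrow> a = m"
  proof (rule predicate_Zorn)
    show "partial_order_on A (relation_of (\<lambda>q r. \<forall>x. r x \<le> q x) A)"
      by (rule partial_order_on_relation_ofI) (auto intro!: ext intro: order_trans antisym)
    fix C assume C: "C \<in> Chains (relation_of (\<lambda>q r. \<forall>x. r x \<le> q x) A)"
    show "\<exists>u\<in>A. \<forall>a\<in>C. \<forall>x. u x \<le> a x"
    proof (cases "C = {}")
      case True
      then show ?thesis using q0 by (auto simp: A_def)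
    next
      case False
      have CA: "C \<subseteq> A" using C by (auto simp: Chains_def relation_of_def)
      have ch: "\<And>q r. q \<in> C \<Longrightarrow> r \<in> C \<Longrightarrow> (\<forall>x. q x \<le> r x) \<or> (\<forall>x. r x \<le> q x)"
        using C by (auto simp: Chains_def relation_of_def)
      have fb: "\<And>q. q \<in> C \<Longrightarrow> face_below p q" using CA by (auto simp: A_def)
      have I: "face_below p (\<lambda>x. INF q\<in>C. q x)" "\<And>q x. q \<in> C \<Longrightarrow> (INF q\<in>C. q x) \<le> q x"
        using face_below_chain_Inf[where p = p and C = C] False fb ch by blast+
      obtain q where "q \<in> C" using False by blast
      then have "(INF q\<in>C. q x) \<le> push_face x0 p x" for x
        using I(2)[OF \<open>q \<in> C\<close>, of x] CA \<open>q \<in> C\<close> unfolding A_def by (blast intro: order_trans)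
      then have "(\<lambda>x. INF q\<in>C. q x) \<in> A" using I(1) by (simp add: A_def)
      then show ?thesis
        by (rule bexI[rotated]) (intro ballI allI I(2))
    qed
  qed
  then obtain m where m: "m \<in> A" "\<And>a. a \<in> A \<Longrightarrow> (\<And>x. a x \<le> m x) \<Longrightarrow> a = m" by blast
  have fm: "face_below p m" and sm: "sublinear m" using m(1) by (auto simp: A_def face_below_def)
  have neg: "m (- x) = - m x" for x
  proof -
    have "push_face x m \<in> A"
    proof -
      have "push_face x m y \<le> push_face x0 p y" for y
      proof (rule order_trans[OF push_face_below[OF sm]])
        show "m y \<le> push_face x0 p y" using m(1) by (simp add: A_def)
      qed
      then show ?thesis using face_below_push_face[OF fm] by (simp add: A_def)
    qed
    then have "push_face x m = m" using push_face_below[OF sm, of x] by (rule m(2))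
    then have "m (- x) \<le> - m x" using push_face_minus[OF sm, of x] by simp
    then show ?thesis using sublinear_minus_le[OF sm, of x] by simp
  qed
  have lin: "linear m"
  proof (rule linearI)
    fix x y show "m (x + y) = m x + m y"
      using sublinear_add[OF sm, of x y] sublinear_add[OF sm, of "x + y" "- y"] by (simp add: neg)
  next
    fix r x
    show "m (r *\<^sub>R x) = r *\<^sub>R m x"
    proof (cases "0 \<le> r")
      case False
      then have "m ((- r) *\<^sub>R x) = - r * m x" using sm by (intro sublinear_scale_nonneg) auto
      then show ?thesis using neg[of "r *\<^sub>R x"] by simp
    qed (simp add: sublinear_scale_nonneg[OF sm])
  qed
  show ?thesis
  proof (rule that[OF lin])
    show mp: "m x \<le> p x" for x using fm by (simp add: face_below_def)
    have "m (- x0) \<le> push_face x0 p (- x0)" using m(1) by (simp add: A_def)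
    then have "m (- x0) \<le> - p x0" using push_face_minus[OF p, of x0] by simp
    then show "m x0 = p x0" using mp[of x0] by (simp add: neg)
    fix g h t
    assume *: "linear g" "linear h" "\<And>x. g x \<le> p x" "\<And>x. h x \<le> p x" "0 < t" "t < 1"
      "\<And>x. m x = t * g x + (1 - t) * h x"
    then have "t * g x + (1 - t) * h x \<le> m x" for x by simp
    then have le: "g x \<le> m x" for x using fm * unfolding face_below_def by blast
    have "m x \<le> g x" for x using le[of "- x"] by (simp add: neg linear_neg[OF *(1)])
    then show "g = m" using le by (auto intro: antisym)
  qed
qed

text \<open>The extension condition is absorbed into a smaller sublinear \<open>q\<close>: a linear
  functional lies below \<open>q\<close> exactly if it lies below \<open>p\<close> and its
  composition with \<open>j\<close> is \<open>g\<close>.\<close>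

theorem hahn_banach_range:
  fixes p :: "'v::real_vector \<Rightarrow> real" and j :: "'a::real_vector \<Rightarrow> 'v"
  assumes p: "sublinear p" and j: "linear j" and g: "linear g" and le: "\<And>a. g a \<le> p (j a)"
  obtains f where "linear f" "\<And>x. f x \<le> p x" "\<And>a. f (j a) = g a"
proof -
  define q where "q v = (INF a. p (v - j a) + g a)" for v
  have bdd: "bdd_below (range (\<lambda>a. p (v - j a) + g a))" for v
  proof (rule bdd_belowI2)
    fix a
    have "g (- a) \<le> p (- j a)" using le[of "- a"] by (simp add: linear_neg[OF j])
    also have "\<dots> \<le> p (v - j a) + p (- v)" using sublinear_add[OF p, of "v - j a" "- v"] by simp
    finally show "- p (- v) \<le> p (v - j a) + g a" by (simp add: linear_neg[OF g])
  qed
  have low: "q v \<le> p (v - j a) + g a" for v a unfolding q_def by (rule cINF_lower[OF bdd]) simp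
  have great: "(\<And>a. b \<le> p (v - j a) + g a) \<Longrightarrow> b \<le> q v" for b v
    unfolding q_def by (rule cINF_greatest) auto
  have "sublinear q"
    unfolding sublinear_def
  proof (intro conjI allI impI)
    fix v w
    have "q (v + w) - (p (w - j b) + g b) \<le> q v" for b
    proof (rule great)
      fix a
      have "(v + w) - j (a + b) = (v - j a) + (w - j b)" by (simp only: linear_add[OF j]) simp
      then have "p ((v + w) - j (a + b)) \<le> p (v - j a) + p (w - j b)" using sublinear_add[OF p] by metis
      then show "q (v + w) - (p (w - j b) + g b) \<le> p (v - j a) + g a"
        using low[of "v + w" "a + b"] unfolding linear_add[OF g] by linarith
    qed
    then have "q (v + w) - q v \<le> q w" by (intro great) (simp add: algebra_simps)
    then show "q (v + w) \<le> q v + q w" by simp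
  next
    fix r :: real and v assume r: "0 < r"
    have "q (r *\<^sub>R v) / r \<le> q v"
    proof (rule great)
      fix a
      have "r *\<^sub>R v - j (r *\<^sub>R a) = r *\<^sub>R (v - j a)" by (simp add: linear_scale[OF j] scaleR_right_diff_distrib)
      then have "p (r *\<^sub>R v - j (r *\<^sub>R a)) = r * p (v - j a)" by (simp only: sublinear_scale[OF p r])
      then show "q (r *\<^sub>R v) / r \<le> p (v - j a) + g a"
        using low[of "r *\<^sub>R v" "r *\<^sub>R a"] r by (simp add: linear_scale[OF g] field_simps)
    qed
    then show "q (r *\<^sub>R v) \<le> r * q v" using r by (simp add: field_simps)
  qed
  then obtain f where f: "linear f" "\<And>x. f x \<le> q x"
    by (rule hahn_banach_extreme[of q 0]) (rule that)
  have fj: "f (j a) \<le> g a" for a using f(2)[of "j a"] low[of "j a" a] by (simp add: sublinear_zero[OF p])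
  show ?thesis
  proof (rule that[OF f(1)])
    show "f x \<le> p x" for x using f(2)[of x] low[of x 0] by (simp add: linear_0[OF j] linear_0[OF g])
    show "f (j a) = g a" for a
      using fj[of a] fj[of "- a"] by (simp add: linear_neg[OF j] linear_neg[OF g] linear_neg[OF f(1)])
  qed
qed

section \<open>Positive semidefinite forms and projections\<close>

locale psd_form =
  fixes s :: "'v::complex_vector \<Rightarrow> 'v \<Rightarrow> complex"
  assumes form_commute: "s x y = cnj (s y x)"
    and form_add_right: "s x (y + z) = s x y + s x z"
    and form_scale_right: "s x (c *\<^sub>C y) = c * s x y"
    and form_nonneg: "0 \<le> Re (s x x)"
begin

lemma form_add_left: "s (x + y) z = s x z + s y z"
  using form_add_right[of z x y] by (metis form_commute complex_cnj_add)

lemma form_scale_left: "s (c *\<^sub>C x) y = cnj c * s x y"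
  using form_scale_right[of y c x] by (metis form_commute complex_cnj_mult)

lemma form_minus_right: "s x (- y) = - s x y"
  using form_scale_right[of x "-1" y] by simp

lemma form_minus_left: "s (- x) y = - s x y"
  using form_scale_left[of "-1" x y] by simp

lemma form_diff_right: "s x (y - z) = s x y - s x z"
  using form_add_right[of x y "- z"] by (simp add: form_minus_right)

lemma form_diff_left: "s (x - y) z = s x z - s y z"
  using form_add_left[of x "- y" z] by (simp add: form_minus_left)

lemma form_zero [simp]: "s x 0 = 0" "s 0 x = 0"
  using form_scale_right[of x 0 0] form_scale_left[of 0 0 x] by simp_all

lemma form_scaleR_right: "s x (r *\<^sub>R y) = complex_of_real r * s x y"
  by (simp add: scaleR_scaleC form_scale_right)

lemma form_scaleR_left: "s (r *\<^sub>R x) y = complex_of_real r * s x y"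
  by (simp add: scaleR_scaleC form_scale_left)

lemma form_Re_commute: "Re (s x y) = Re (s y x)"
  by (subst form_commute) simp

lemma form_self: "s x x = complex_of_real (Re (s x x))"
  using form_commute[of x x] by (simp add: complex_eq_iff)

text \<open>Near-minimality of \<open>v\<close> along \<open>w\<close> bounds the inner product.
  Testing with \<open>c = r * s w v\<close> gives a quadratic inequality in \<open>r\<close>,
  sharpest at \<open>r = 1 / B\<close>; if \<open>B = 0\<close>, large \<open>r\<close> force
  \<open>A = 0\<close>. The choice \<open>\<delta> = Re (s v v)\<close> yields
  Cauchy-Schwarz.\<close>

lemma form_variation:
  assumes "\<And>c. Re (s v v) - \<delta> \<le> Re (s (v - c *\<^sub>C w) (v - c *\<^sub>C w))"
  shows "(cmod (s w v))\<^sup>2 \<le> \<delta> * Re (s w w)"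
proof -
  define A B where "A = (cmod (s w v))\<^sup>2" and "B = Re (s w w)"
  have B: "0 \<le> B" by (simp add: B_def form_nonneg)
  have r: "2 * r * A - r\<^sup>2 * A * B \<le> \<delta>" for r
  proof -
    define c where "c = complex_of_real r * s w v"
    have cs: "cnj c * s w v = complex_of_real (r * A)"
      by (simp add: c_def A_def complex_norm_square[symmetric] mult.commute mult.left_commute flip: complex_norm_square)
    have sv: "c * s v w = complex_of_real (r * A)"
      using cs form_commute[of v w] by (metis complex_cnj_cnj complex_cnj_complex_of_real complex_cnj_mult)
    have cc: "c * (cnj c * s w w) = complex_of_real (r\<^sup>2 * A * B)"
    proof -
      have "c * (cnj c * s w w) = complex_of_real ((cmod c)\<^sup>2) * complex_of_real B"
        unfolding B_def form_self[symmetric] complex_norm_square by (rule mult.assoc[symmetric])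
      also have "(cmod c)\<^sup>2 = r\<^sup>2 * A" by (simp add: c_def A_def norm_mult power_mult_distrib)
      finally show ?thesis by simp
    qed
    have "s (v - c *\<^sub>C w) (v - c *\<^sub>C w) = s v v - c * s v w - cnj c * s w v + c * (cnj c * s w w)"
      by (simp add: form_diff_left form_diff_right form_scale_left form_scale_right algebra_simps)
    then have "Re (s (v - c *\<^sub>C w) (v - c *\<^sub>C w)) = Re (s v v) - r * A - r * A + r\<^sup>2 * A * B"
      by (simp add: cs sv cc del: of_real_mult of_real_power)
    then show ?thesis using assms[of c] by (simp add: mult_ac)
  qed
  have "A \<le> \<delta> * B"
  proof (cases "B = 0")
    case True
    have "A = 0"
    proof (rule ccontr)
      assume "A \<noteq> 0"
      then have "2 * ((\<bar>\<delta>\<bar> + 1) / A) * A = 2 * \<bar>\<delta>\<bar> + 2" by simp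
      then show False using r[of "(\<bar>\<delta>\<bar> + 1) / A"] True by simp
    qed
    then show ?thesis using True by simp
  next
    case False
    then have "2 * (1 / B) * A - (1 / B)\<^sup>2 * A * B = A / B" by (simp add: field_simps power2_eq_square)
    then have "A / B \<le> \<delta>" using r[of "1 / B"] by simp
    then show ?thesis using False B by (simp add: pos_divide_le_eq)
  qed
  then show ?thesis by (simp add: A_def B_def)
qed

lemma form_Cauchy_Schwarz: "(cmod (s w v))\<^sup>2 \<le> Re (s w w) * Re (s v v)"
  using form_variation[of v "Re (s v v)" w] form_nonneg by (simp add: mult.commute)

text \<open>In an incomplete semidefinite space a projection need not exist, so a minimizing
  sequence stands in for it. The parallelogram law makes it Cauchy, and
  \<open>form_variation\<close> with error \<open>1 / Suc n\<close> makes the residuals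
  asymptotically orthogonal to \<open>W\<close>.\<close>

lemma approx_projection:
  assumes W: "0 \<in> W" "\<And>x y. x \<in> W \<Longrightarrow> y \<in> W \<Longrightarrow> x + y \<in> W" "\<And>c x. x \<in> W \<Longrightarrow> c *\<^sub>C x \<in> W"
  obtains u :: "nat \<Rightarrow> 'v" where "\<And>n. u n \<in> W"
    "\<And>n m. Re (s (u n - u m) (u n - u m)) \<le> 2 / Suc n + 2 / Suc m"
    "\<And>n w. w \<in> W \<Longrightarrow> (cmod (s w (v - u n)))\<^sup>2 \<le> Re (s w w) / Suc n"
proof -
  define g where "g u = Re (s (v - u) (v - u))" for u
  have bdd: "bdd_below (g ` W)" by (rule bdd_belowI2[where m = 0]) (simp add: g_def form_nonneg)
  define d where "d = Inf (g ` W)"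
  have d: "d \<le> g u" if "u \<in> W" for u unfolding d_def using bdd that by (intro cInf_lower) auto
  have "\<exists>u\<in>W. g u < d + 1 / Suc n" for n
    using cInf_lessD[of "g ` W" "d + 1 / Suc n"] W(1) by (auto simp: d_def)
  then obtain u where u: "\<And>n. u n \<in> W" "\<And>n. g (u n) < d + 1 / Suc n" by metis
  have minus: "x - y \<in> W" if "x \<in> W" "y \<in> W" for x y
    using W(2)[OF that(1) W(3)[OF that(2), of "-1"]] by simp
  show ?thesis
  proof (rule that[of u])
    show "u n \<in> W" for n by (rule u)
    show "Re (s (u n - u m) (u n - u m)) \<le> 2 / Suc n + 2 / Suc m" for n m
    proof -
      have par: "Re (s (x - y) (x - y)) = 2 * g x + 2 * g y - 4 * g ((1/2) *\<^sub>R (x + y))" for x y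
        unfolding g_def using form_Re_commute[of v x] form_Re_commute[of v y] form_Re_commute[of x y]
        by (simp add: form_diff_left form_diff_right form_scaleR_left form_scaleR_right form_add_left form_add_right field_simps)
      have "(1/2) *\<^sub>R (u n + u m) \<in> W"
        unfolding scaleR_scaleC using u by (intro W)
      then show ?thesis using par[of "u n" "u m"] u(2)[of n] u(2)[of m] d[of "(1/2) *\<^sub>R (u n + u m)"] by linarith
    qed
    fix n w assume w: "w \<in> W"
    have "(cmod (s w (v - u n)))\<^sup>2 \<le> (1 / Suc n) * Re (s w w)"
    proof (rule form_variation)
      fix c
      have "u n + c *\<^sub>C w \<in> W" using u w W by blast
      then have "d \<le> g (u n + c *\<^sub>C w)" by (rule d)
      then show "Re (s (v - u n) (v - u n)) - 1 / Suc n \<le> Re (s (v - u n - c *\<^sub>C w) (v - u n - c *\<^sub>C w))"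
        using u(2)[of n] by (simp add: g_def diff_diff_eq)
    qed
    then show "(cmod (s w (v - u n)))\<^sup>2 \<le> Re (s w w) / Suc n" by simp
  qed
qed

end

section \<open>Closed subspaces and orthogonal projections of a Hilbert space\<close>

lemma psd_form_cinner: "psd_form (cinner :: 'h::chilbert_space \<Rightarrow> _)"
  by unfold_locales (rule cinner_commute, rule cinner_add_right, rule cinner_scaleC_right, simp add: norm_power2_cinner[symmetric])

lemma csubspaceD:
  assumes "csubspace W"
  shows "0 \<in> W" "\<And>x y. x \<in> W \<Longrightarrow> y \<in> W \<Longrightarrow> x + y \<in> W" "\<And>c x. x \<in> W \<Longrightarrow> c *\<^sub>C x \<in> W"
    "\<And>x y. x \<in> W \<Longrightarrow> y \<in> W \<Longrightarrow> x - y \<in> W"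
  using complex_vector.subspace_0[OF assms] complex_vector.subspace_add[OF assms]
    complex_vector.subspace_scale[OF assms] complex_vector.subspace_diff[OF assms] by blast+

lemma csubspaceI:
  "0 \<in> W \<Longrightarrow> (\<And>x y. x \<in> W \<Longrightarrow> y \<in> W \<Longrightarrow> x + y \<in> W) \<Longrightarrow> (\<And>c x. x \<in> W \<Longrightarrow> c *\<^sub>C x \<in> W) \<Longrightarrow> csubspace W"
  by (rule complex_vector.subspaceI)

lemma closure_seqE:
  assumes "x \<in> closure (S :: 'a::first_countable_topology set)"
  obtains u where "\<And>n. u n \<in> S" "u \<longlonglongrightarrow> x"
  using assms unfolding closure_sequential by blast

lemma closure_seqI: "(\<And>n. u n \<in> S) \<Longrightarrow> u \<longlonglongrightarrow> x \<Longrightarrow> x \<in> closure (S :: 'a::first_countable_topology set)"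
  unfolding closure_sequential by blast

lemma csubspace_closure:
  fixes W :: "'a::complex_normed_vector set"
  assumes "csubspace W" shows "csubspace (closure W)"
proof (rule csubspaceI)
  show "0 \<in> closure W" using csubspaceD(1)[OF assms] closure_subset by blast
  show "x + y \<in> closure W" if xy: "x \<in> closure W" "y \<in> closure W" for x y
  proof -
    obtain u where u: "\<And>n. u n \<in> W" "u \<longlonglongrightarrow> x" using closure_seqE[OF xy(1)] by blast
    obtain v where v: "\<And>n. v n \<in> W" "v \<longlonglongrightarrow> y" using closure_seqE[OF xy(2)] by blast
    show ?thesis
      by (rule closure_seqI[of "\<lambda>n. u n + v n"]) (intro csubspaceD(2)[OF assms] tendsto_add u v)+
  qed
  show "c *\<^sub>C x \<in> closure W" if xc: "x \<in> closure W" for c x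
  proof -
    obtain u where u: "\<And>n. u n \<in> W" "u \<longlonglongrightarrow> x" using closure_seqE[OF xc] by blast
    show ?thesis
      by (rule closure_seqI[of "\<lambda>n. c *\<^sub>C u n"])
        (intro csubspaceD(3)[OF assms] u bounded_linear.tendsto[OF bounded_linear_scaleC])+
  qed
qed

lemma tendsto_cinner_right: "f \<longlonglongrightarrow> x \<Longrightarrow> (\<lambda>n. cinner y (f n)) \<longlonglongrightarrow> cinner y x"
proof -
  have "bounded_linear (cinner y)"
    by (rule bounded_linear_intro[where K = "norm y"])
      (simp_all add: cinner_add_right cinner_scaleR_right scaleR_conv_of_real, metis cmod_cinner_le mult.commute)
  then show "f \<longlonglongrightarrow> x \<Longrightarrow> (\<lambda>n. cinner y (f n)) \<longlonglongrightarrow> cinner y x" by (rule bounded_linear.tendsto)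
qed

lemma tendsto_cinner:
  assumes "f \<longlonglongrightarrow> x" "g \<longlonglongrightarrow> y"
  shows "(\<lambda>n. cinner (f n) (g n)) \<longlonglongrightarrow> cinner x y"
proof -
  have "bounded_bilinear (cinner :: 'a \<Rightarrow> 'a \<Rightarrow> complex)"
    by (rule bounded_bilinear.intro)
      (auto simp: cinner_add_right cinner_add_left cinner_scaleR_right cinner_scaleR_left scaleR_conv_of_real
        intro!: exI[of _ 1] cmod_cinner_le)
  then show ?thesis using assms by (rule bounded_bilinear.tendsto)
qed

lemma tendsto_bop_apply: "f \<longlonglongrightarrow> x \<Longrightarrow> (\<lambda>n. bop_apply T (f n)) \<longlonglongrightarrow> bop_apply T x"
  unfolding bop_apply.rep_eq by (rule blinfun.tendsto[OF tendsto_const])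

lemma orthogonal_projection_exists:
  fixes M :: "'h::chilbert_space set"
  assumes M: "csubspace M" "closed M"
  shows "\<exists>m\<in>M. \<forall>y\<in>M. cinner y (x - m) = 0"
proof -
  interpret psd_form "cinner :: 'h \<Rightarrow> _" by (rule psd_form_cinner)
  obtain u where u: "\<And>n. u n \<in> M"
    "\<And>n m. Re (cinner (u n - u m) (u n - u m)) \<le> 2 / Suc n + 2 / Suc m"
    "\<And>n w. w \<in> M \<Longrightarrow> (cmod (cinner w (x - u n)))\<^sup>2 \<le> Re (cinner w w) / Suc n"
    using approx_projection[OF csubspaceD(1-3)[OF M(1)], of x] by blast
  have "Cauchy u"
  proof (rule CauchyI)
    fix e :: real assume "0 < e"
    then obtain N where N: "4 / e\<^sup>2 < real N" using reals_Archimedean2 by blast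
    have "norm (u i - u j) < e" if "i \<ge> N" "j \<ge> N" for i j
    proof -
      have Ni: "2 / real (Suc n) < e\<^sup>2 / 2" if "n \<ge> N" for n
      proof -
        have "4 / e\<^sup>2 < real (Suc n)" using N that by simp
        then show ?thesis using \<open>0 < e\<close> by (simp add: field_simps)
      qed
      have "(norm (u i - u j))\<^sup>2 < e\<^sup>2"
        using u(2)[of i j] Ni[OF that(1)] Ni[OF that(2)] by (simp add: norm_power2_cinner)
      then show ?thesis using \<open>0 < e\<close> by (simp add: power2_less_imp_less)
    qed
    then show "\<exists>N. \<forall>i\<ge>N. \<forall>j\<ge>N. norm (u i - u j) < e" by blast
  qed
  then obtain m where m: "u \<longlonglongrightarrow> m" by (auto simp: Cauchy_convergent_iff convergent_def)
  have "cinner y (x - m) = 0" if "y \<in> M" for y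
  proof -
    have "(\<lambda>n. (cmod (cinner y (x - u n)))\<^sup>2) \<longlonglongrightarrow> (cmod (cinner y (x - m)))\<^sup>2"
      by (intro tendsto_power tendsto_norm tendsto_cinner_right tendsto_diff tendsto_const m)
    moreover have "(\<lambda>n. Re (cinner y y) * (1 / Suc n)) \<longlonglongrightarrow> Re (cinner y y) * 0"
      by (intro tendsto_mult tendsto_const LIMSEQ_Suc lim_1_over_n)
    ultimately have "(cmod (cinner y (x - m)))\<^sup>2 \<le> Re (cinner y y) * 0"
      by (rule LIMSEQ_le) (use u(3)[OF that] in auto)
    then show ?thesis by simp
  qed
  moreover have "m \<in> M" using closed_sequentially[OF M(2), of u m] u(1) m by blast
  ultimately show ?thesis by blast
qed

definition proj :: "'h::chilbert_space set \<Rightarrow> 'h bop"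
  where "proj M = (SOME P. \<forall>x. bop_apply P x \<in> M \<and> (\<forall>y\<in>M. cinner y (x - bop_apply P x) = 0))"

lemma orthogonal_projection_unique:
  assumes M: "csubspace M" and "a \<in> M" "b \<in> M" "\<forall>y\<in>M. cinner y (x - a) = 0" "\<forall>y\<in>M. cinner y (x - b) = 0"
  shows "a = b"
proof -
  have "a - b \<in> M" using assms by (intro csubspaceD(4)[OF M])
  then have "cinner (a - b) (x - b) - cinner (a - b) (x - a) = 0" using assms by simp
  then have "cinner (a - b) (a - b) = 0" by (simp add: cinner_diff_right)
  then show ?thesis by (simp add: cinner_self)
qed

context
  fixes M :: "'h::chilbert_space set"
  assumes M: "csubspace M" "closed M"
begin

lemma proj_props: "bop_apply (proj M) x \<in> M \<and> (\<forall>y\<in>M. cinner y (x - bop_apply (proj M) x) = 0)"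
proof -
  obtain p where p: "\<And>x. p x \<in> M" "\<And>x y. y \<in> M \<Longrightarrow> cinner y (x - p x) = 0"
    using orthogonal_projection_exists[OF M] by metis
  have "\<exists>P. bop_apply P = p"
  proof (rule bop_of_function)
    fix x y :: 'h and c
    show "p (x + y) = p x + p y"
    proof (rule orthogonal_projection_unique[OF M(1) p(1)])
      have "cinner z (x + y - (p x + p y)) = cinner z (x - p x) + cinner z (y - p y)" for z
        by (simp add: cinner_diff_right cinner_add_right)
      then show "\<forall>z\<in>M. cinner z (x + y - (p x + p y)) = 0" using p(2) by simp
    qed (auto intro: p csubspaceD(2)[OF M(1)])
    show "p (c *\<^sub>C x) = c *\<^sub>C p x"
    proof (rule orthogonal_projection_unique[OF M(1) p(1)])
      have "cinner z (c *\<^sub>C x - c *\<^sub>C p x) = c * cinner z (x - p x)" for z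
        by (simp add: cinner_diff_right cinner_scaleC_right algebra_simps)
      then show "\<forall>z\<in>M. cinner z (c *\<^sub>C x - c *\<^sub>C p x) = 0" using p(2) by simp
    qed (auto intro: p csubspaceD(3)[OF M(1)])
    have "(norm x)\<^sup>2 = (norm (p x + (x - p x)))\<^sup>2" by simp
    also have "\<dots> = (norm (p x))\<^sup>2 + (norm (x - p x))\<^sup>2" unfolding norm_add_power2 by (simp add: p)
    finally have "(norm (p x))\<^sup>2 \<le> (norm x)\<^sup>2" by simp
    then have "norm (p x) \<le> norm x" by (rule power2_le_imp_le) simp
    then show "norm (p x) \<le> 1 * norm x" by simp
  qed
  then have "\<exists>P. \<forall>x. bop_apply P x \<in> M \<and> (\<forall>y\<in>M. cinner y (x - bop_apply P x) = 0)" using p by metis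
  from someI_ex[OF this] show ?thesis unfolding proj_def by blast
qed

lemma proj_in: "bop_apply (proj M) x \<in> M"
  using proj_props by blast

lemma proj_orthogonal: "y \<in> M \<Longrightarrow> cinner y (x - bop_apply (proj M) x) = 0"
  using proj_props by blast

lemma proj_eqI: "m \<in> M \<Longrightarrow> (\<And>y. y \<in> M \<Longrightarrow> cinner y (x - m) = 0) \<Longrightarrow> bop_apply (proj M) x = m"
  by (rule orthogonal_projection_unique[OF M(1)]) (use proj_props in auto)

lemma proj_id: "x \<in> M \<Longrightarrow> bop_apply (proj M) x = x"
  by (rule proj_eqI) simp_all

lemma proj_eq_0: "(\<And>y. y \<in> M \<Longrightarrow> cinner y x = 0) \<Longrightarrow> bop_apply (proj M) x = 0"
  by (rule proj_eqI) (simp_all add: csubspaceD(1)[OF M(1)])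

lemma cinner_proj: "y \<in> M \<Longrightarrow> cinner y (bop_apply (proj M) x) = cinner y x"
  using proj_orthogonal[of y x] by (simp add: cinner_diff_right)

lemma star_proj: "star (proj M) = proj M"
proof (rule bop_eqI, rule cinner_eq_all)
  fix x y
  have "cinner (bop_apply (star (proj M)) x) y = cinner x (bop_apply (proj M) y)" by (rule cinner_star_left)
  also have "\<dots> = cinner (bop_apply (proj M) x) (bop_apply (proj M) y)"
    using cinner_proj[OF proj_in, of y x] by (metis cinner_commute)
  also have "\<dots> = cinner (bop_apply (proj M) x) y" by (rule cinner_proj[OF proj_in])
  finally show "cinner (bop_apply (star (proj M)) x) y = cinner (bop_apply (proj M) x) y" .
qed

lemma norm_proj_le: "norm (bop_apply (proj M) x) \<le> norm x"
proof -
  have "(norm (bop_apply (proj M) x))\<^sup>2 = Re (cinner (bop_apply (proj M) x) x)"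
    unfolding norm_power2_cinner by (simp add: cinner_proj[OF proj_in])
  also have "\<dots> \<le> norm (bop_apply (proj M) x) * norm x" by (rule Re_cinner_le)
  finally show ?thesis by (cases "bop_apply (proj M) x = 0") (simp_all add: power2_eq_square)
qed

end

section \<open>Extension of bounded linear relations by continuity\<close>

text \<open>Using a relation avoids a separate proof that a map given on generators is well defined:
  the bound, applied to the difference of two pairs with the same first entry, forces
  single-valuedness, also for the closure. Outside the closed domain \<open>f\<close> is
  unspecified.\<close>

lemma bounded_relation_extension:
  fixes G :: "('p::complex_normed_vector \<times> 'q::{complex_normed_vector, banach}) set"
  assumes add: "\<And>x y x' y'. (x, y) \<in> G \<Longrightarrow> (x', y') \<in> G \<Longrightarrow> (x + x', y + y') \<in> G"
    and scale: "\<And>x y c. (x, y) \<in> G \<Longrightarrow> (c *\<^sub>C x, c *\<^sub>C y) \<in> G"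
    and bound: "\<And>x y. (x, y) \<in> G \<Longrightarrow> norm y \<le> C * norm x"
  obtains f where
    "\<And>x. x \<in> closure (fst ` G) \<Longrightarrow> (x, f x) \<in> closure G"
    "\<And>x y. (x, y) \<in> closure G \<Longrightarrow> f x = y"
    "\<And>x y. (x, y) \<in> closure G \<Longrightarrow> norm y \<le> C * norm x"
    "\<And>x y. x \<in> closure (fst ` G) \<Longrightarrow> y \<in> closure (fst ` G) \<Longrightarrow> f (x + y) = f x + f y"
    "\<And>c x. x \<in> closure (fst ` G) \<Longrightarrow> f (c *\<^sub>C x) = c *\<^sub>C f x"
proof -
  have seq: "\<exists>u v. (\<forall>n. (u n, v n) \<in> G) \<and> u \<longlonglongrightarrow> x \<and> v \<longlonglongrightarrow> y" if xyG: "(x, y) \<in> closure G" for x y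
  proof -
    obtain w where w: "\<And>n. w n \<in> G" "w \<longlonglongrightarrow> (x, y)" using closure_seqE[OF xyG] by blast
    then show ?thesis
      using tendsto_fst[OF w(2)] tendsto_snd[OF w(2)]
      by (intro exI[of _ "\<lambda>n. fst (w n)"] exI[of _ "\<lambda>n. snd (w n)"]) simp
  qed
  have seqI: "(x, y) \<in> closure G" if "\<And>n. (u n, v n) \<in> G" "u \<longlonglongrightarrow> x" "v \<longlonglongrightarrow> y" for u v x y
    by (rule closure_seqI[of "\<lambda>n. (u n, v n)"]) (intro that tendsto_Pair)+
  have cadd: "(x + x', y + y') \<in> closure G" if xy: "(x, y) \<in> closure G" "(x', y') \<in> closure G" for x y x' y'
  proof -
    obtain u v where u: "\<forall>n. (u n, v n) \<in> G" "u \<longlonglongrightarrow> x" "v \<longlonglongrightarrow> y"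
      using seq[OF xy(1)] by blast
    obtain u' v' where u': "\<forall>n. (u' n, v' n) \<in> G" "u' \<longlonglongrightarrow> x'" "v' \<longlonglongrightarrow> y'" using seq[OF xy(2)] by blast
    show ?thesis
      by (rule seqI[of "\<lambda>n. u n + u' n" "\<lambda>n. v n + v' n"])
        (intro add tendsto_add u(1)[rule_format] u'(1)[rule_format] u(2,3) u'(2,3))+
  qed
  have cscale: "(c *\<^sub>C x, c *\<^sub>C y) \<in> closure G" if xy: "(x, y) \<in> closure G" for c x y
  proof -
    obtain u v where u: "\<forall>n. (u n, v n) \<in> G" "u \<longlonglongrightarrow> x" "v \<longlonglongrightarrow> y"
      using seq[OF xy] by blast
    show ?thesis
      by (rule seqI[of "\<lambda>n. c *\<^sub>C u n" "\<lambda>n. c *\<^sub>C v n"])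
        (intro scale u(1)[rule_format] bounded_linear.tendsto[OF bounded_linear_scaleC] u(2,3))+
  qed
  have cbound: "norm y \<le> C * norm x" if xy: "(x, y) \<in> closure G" for x y
  proof -
    obtain u v where uv: "\<forall>n. (u n, v n) \<in> G" "u \<longlonglongrightarrow> x" "v \<longlonglongrightarrow> y" using seq[OF xy] by blast
    show ?thesis
    proof (rule LIMSEQ_le)
      show "(\<lambda>n. norm (v n)) \<longlonglongrightarrow> norm y" by (intro tendsto_norm uv)
      show "(\<lambda>n. C * norm (u n)) \<longlonglongrightarrow> C * norm x" by (intro tendsto_mult tendsto_const tendsto_norm uv)
    qed (use bound[OF uv(1)[rule_format]] in auto)
  qed
  have unique: "y = y'" if "(x, y) \<in> closure G" "(x, y') \<in> closure G" for x y y'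
    using cbound[OF cadd[OF that(1) cscale[OF that(2), of "-1"]]] by simp
  have ex: "\<exists>y. (x, y) \<in> closure G" if x: "x \<in> closure (fst ` G)" for x
  proof -
    obtain u where u: "\<And>n. u n \<in> fst ` G" "u \<longlonglongrightarrow> x" using closure_seqE[OF x] by blast
    from u(1) have "\<forall>n. \<exists>v. (u n, v) \<in> G" by force
    then obtain v where v: "\<And>n. (u n, v n) \<in> G" by metis
    have vb: "norm (v m - v n) \<le> C * norm (u m - u n)" for m n
      using bound[OF add[OF v[of m] scale[OF v[of n], of "-1"]]] by simp
    have "Cauchy v"
    proof (rule CauchyI)
      fix e :: real assume "0 < e"
      then have "0 < e / (\<bar>C\<bar> + 1)" by simp
      then obtain N where N: "\<And>m n. m \<ge> N \<Longrightarrow> n \<ge> N \<Longrightarrow> norm (u m - u n) < e / (\<bar>C\<bar> + 1)"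
        using LIMSEQ_imp_Cauchy[OF u(2)] by (meson CauchyD)
      have "norm (v m - v n) < e" if "m \<ge> N" "n \<ge> N" for m n
      proof -
        have "norm (v m - v n) \<le> (\<bar>C\<bar> + 1) * norm (u m - u n)"
          by (rule order_trans[OF vb]) (intro mult_right_mono, auto)
        also have "\<dots> < (\<bar>C\<bar> + 1) * (e / (\<bar>C\<bar> + 1))" using N[OF that] by (intro mult_strict_left_mono) auto
        also have "\<dots> = e" by (simp add: add_nonneg_eq_0_iff)
        finally show ?thesis .
      qed
      then show "\<exists>N. \<forall>m\<ge>N. \<forall>n\<ge>N. norm (v m - v n) < e" by blast
    qed
    then obtain y where "v \<longlonglongrightarrow> y" by (auto simp: Cauchy_convergent_iff convergent_def)
    then show ?thesis using seqI[OF v u(2)] by blast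
  qed
  define f where "f x = (THE y. (x, y) \<in> closure G)" for x
  have f1: "f x = y" if "(x, y) \<in> closure G" for x y
    unfolding f_def using unique that by (intro the_equality) blast+
  have f2: "(x, f x) \<in> closure G" if "x \<in> closure (fst ` G)" for x
    using ex[OF that] f1 by metis
  show ?thesis
  proof (rule that[of f])
    show "f (x + y) = f x + f y" if "x \<in> closure (fst ` G)" "y \<in> closure (fst ` G)" for x y
      using f1[OF cadd[OF f2[OF that(1)] f2[OF that(2)]]] .
    show "f (c *\<^sub>C x) = c *\<^sub>C f x" if "x \<in> closure (fst ` G)" for c x
      using f1[OF cscale[OF f2[OF that]]] .
  qed (fact f2 f1 cbound)+
qed

lemma closure_memI: "x \<in> S \<Longrightarrow> x \<in> closure S"
  by (rule subsetD[OF closure_subset])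

section \<open>Realizing semidefinite forms in spaces of square-summable families\<close>

lemma ell2_unit_vector:
  obtains e :: "'i ell2" where "norm e = 1" "\<And>i. i \<noteq> j \<Longrightarrow> Rep_ell2 e i = 0"
    "\<And>a. Rep_ell2 a j = 0 \<Longrightarrow> cinner a e = 0"
proof -
  define f :: "'i \<Rightarrow> complex" where "f i = (if i = j then 1 else 0)" for i
  have "square_summable f"
    unfolding square_summable_def
    by (rule finite_nonzero_values_imp_summable_on, rule finite_subset[of _ "{j}"]) (auto simp: f_def)
  then have f: "Rep_ell2 (Abs_ell2 f) = f" by (simp add: Abs_ell2_inverse)
  show ?thesis
  proof (rule that[of "Abs_ell2 f"])
    have "(\<Sum>\<^sub>\<infinity>i. (cmod (f i))\<^sup>2) = 1"
      using infsum_cong_neutral[of "{j}" UNIV "\<lambda>i. (cmod (f i))\<^sup>2" "\<lambda>i. (cmod (f i))\<^sup>2"] by (simp add: f_def)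
    then show "norm (Abs_ell2 f) = 1"
      by (simp add: norm_ell2.rep_eq f sq_norm_def)
    show "Rep_ell2 (Abs_ell2 f) i = 0" if "i \<noteq> j" for i using that by (simp add: f f_def)
    fix a assume a: "Rep_ell2 a j = 0"
    have "(\<Sum>\<^sub>\<infinity>i. cnj (Rep_ell2 a i) * f i) = 0"
      by (rule infsum_0) (use a in \<open>auto simp: f_def\<close>)
    then show "cinner a (Abs_ell2 f) = 0" by (simp add: cinner_ell2.rep_eq f)
  qed
qed

lemma ell2_coordinate_le: "cmod (Rep_ell2 f i) \<le> norm f"
  using L2_set_le_sq_norm[of "Rep_ell2 f" "{i}"] Rep_ell2[of f] by (simp add: norm_ell2.rep_eq)

lemma ell2_coordinate_limit:
  assumes "f \<longlonglongrightarrow> z" "\<And>n. Rep_ell2 (f n) i = 0"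
  shows "Rep_ell2 z i = 0"
proof -
  have "(\<lambda>n. norm (z - f n)) \<longlonglongrightarrow> norm (z - z)" by (intro tendsto_norm tendsto_diff tendsto_const assms)
  moreover have "cmod (Rep_ell2 z i) \<le> norm (z - f n)" for n
    using ell2_coordinate_le[of "z - f n" i] assms(2)[of n] by (simp add: Rep_ell2_minus)
  ultimately have "cmod (Rep_ell2 z i) \<le> norm (z - z)" by (intro LIMSEQ_le_const) auto
  then show ?thesis by simp
qed

text \<open>A graph of an isometric linear map on a subspace. The last clause confines the
  coordinates in use to the indices \<open>g\<close> of vectors of \<open>D\<close> already
  embedded, so that a new \<open>v\<close> in \<open>D\<close> finds the coordinate
  \<open>g v\<close> free.\<close>

definition partial_embedding ::
  "('v::complex_vector \<Rightarrow> 'v \<Rightarrow> complex) \<Rightarrow> 'v set \<Rightarrow> ('v \<Rightarrow> 'i) \<Rightarrow> ('v \<times> 'i ell2) set \<Rightarrow> bool"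
  where "partial_embedding s D g G \<longleftrightarrow> (0, 0) \<in> G \<and>
    (\<forall>x a y b. (x, a) \<in> G \<longrightarrow> (y, b) \<in> G \<longrightarrow> (x + y, a + b) \<in> G) \<and>
    (\<forall>c x a. (x, a) \<in> G \<longrightarrow> (c *\<^sub>C x, c *\<^sub>C a) \<in> G) \<and>
    (\<forall>x a y b. (x, a) \<in> G \<longrightarrow> (y, b) \<in> G \<longrightarrow> cinner a b = s x y) \<and>
    (\<forall>x a i. (x, a) \<in> G \<longrightarrow> Rep_ell2 a i \<noteq> 0 \<longrightarrow> i \<in> g ` (D \<inter> fst ` G))"

lemma partial_embeddingD:
  assumes "partial_embedding s D g G"
  shows "(0, 0) \<in> G" and "(x, a) \<in> G \<Longrightarrow> (y, b) \<in> G \<Longrightarrow> (x + y, a + b) \<in> G"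
    and "(x, a) \<in> G \<Longrightarrow> (c *\<^sub>C x, c *\<^sub>C a) \<in> G"
    and "(x, a) \<in> G \<Longrightarrow> (y, b) \<in> G \<Longrightarrow> cinner a b = s x y"
    and "(x, a) \<in> G \<Longrightarrow> Rep_ell2 a i \<noteq> 0 \<Longrightarrow> i \<in> g ` (D \<inter> fst ` G)"
  using assms unfolding partial_embedding_def by simp_all

text \<open>The image of a new vector \<open>v\<close> is the limit of the images of approximate projections of \<open>v\<close> to
  the current domain, plus a multiple of the unit vector at the unused coordinate \<open>g v\<close>.\<close>

lemma partial_embedding_extend:
  fixes s :: "'v::complex_vector \<Rightarrow> 'v \<Rightarrow> complex" and g :: "'v \<Rightarrow> 'i"
  assumes "psd_form s" and inj: "inj_on g D" and G: "partial_embedding s D g G"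
    and v: "v \<in> D" "v \<notin> fst ` G"
  shows "\<exists>G'. partial_embedding s D g G' \<and> G \<subseteq> G' \<and> v \<in> fst ` G'"
proof -
  interpret psd_form s by fact
  note G0 = partial_embeddingD(1)[OF G] and Gadd = partial_embeddingD(2)[OF G]
    and Gscale = partial_embeddingD(3)[OF G] and Ginner = partial_embeddingD(4)[OF G]
    and Gsupp = partial_embeddingD(5)[OF G]
  have Gdiff: "(x - y, a - b) \<in> G" if "(x, a) \<in> G" "(y, b) \<in> G" for x a y b
    using Gadd[OF that(1) Gscale[OF that(2), of "-1"]] by simp
  have W: "0 \<in> fst ` G" "\<And>x y. x \<in> fst ` G \<Longrightarrow> y \<in> fst ` G \<Longrightarrow> x + y \<in> fst ` G"
    "\<And>c x. x \<in> fst ` G \<Longrightarrow> c *\<^sub>C x \<in> fst ` G"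
  proof -
    show "0 \<in> fst ` G" using G0 by force
    show "x + y \<in> fst ` G" if "x \<in> fst ` G" "y \<in> fst ` G" for x y using that Gadd by force
    show "c *\<^sub>C x \<in> fst ` G" if "x \<in> fst ` G" for c x using that Gscale by force
  qed
  obtain u where u: "\<And>n. u n \<in> fst ` G"
    "\<And>n m. Re (s (u n - u m) (u n - u m)) \<le> 2 / Suc n + 2 / Suc m"
    "\<And>n w. w \<in> fst ` G \<Longrightarrow> (cmod (s w (v - u n)))\<^sup>2 \<le> Re (s w w) / Suc n"
    using approx_projection[OF W, of v] by blast
  have "\<forall>n. \<exists>a. (u n, a) \<in> G" using u(1) by force
  then obtain a where a: "\<And>n. (u n, a n) \<in> G" by metis
  have "Cauchy a"
  proof (rule CauchyI)
    fix e :: real assume "0 < e"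
    then obtain N where N: "4 / e\<^sup>2 < real N" using reals_Archimedean2 by blast
    have "norm (a i - a j) < e" if "i \<ge> N" "j \<ge> N" for i j
    proof -
      have Ni: "2 / real (Suc n) < e\<^sup>2 / 2" if "n \<ge> N" for n
      proof -
        have "4 / e\<^sup>2 < real (Suc n)" using N that by simp
        then show ?thesis using \<open>0 < e\<close> by (simp add: field_simps)
      qed
      have "cinner (a i - a j) (a i - a j) = s (u i - u j) (u i - u j)" by (intro Ginner Gdiff a)
      then have "(norm (a i - a j))\<^sup>2 < e\<^sup>2"
        using u(2)[of i j] Ni[OF that(1)] Ni[OF that(2)] by (simp add: norm_power2_cinner)
      then show ?thesis using \<open>0 < e\<close> by (simp add: power2_less_imp_less)
    qed
    then show "\<exists>N. \<forall>i\<ge>N. \<forall>j\<ge>N. norm (a i - a j) < e" by blast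
  qed
  then obtain z where z: "a \<longlonglongrightarrow> z" by (auto simp: Cauchy_convergent_iff convergent_def)
  have bz: "cinner b z = s x v" if xb: "(x, b) \<in> G" for x b
  proof -
    have "(\<lambda>n. (cmod (s x (v - u n)))\<^sup>2) \<longlonglongrightarrow> 0"
    proof (rule tendsto_sandwich[OF _ _ tendsto_const])
      show "(\<lambda>n. Re (s x x) / Suc n) \<longlonglongrightarrow> 0"
        using tendsto_mult[OF tendsto_const LIMSEQ_Suc[OF lim_1_over_n], of "Re (s x x)"] by simp
      have "x \<in> fst ` G" using xb by force
      then show "\<forall>\<^sub>F n in sequentially. (cmod (s x (v - u n)))\<^sup>2 \<le> Re (s x x) / Suc n" using u(3) by simp
    qed simp
    then have "(\<lambda>n. s x v - s x (u n)) \<longlonglongrightarrow> 0"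
      by (simp add: form_diff_right tendsto_norm_zero_iff)
    then have "(\<lambda>n. s x v - (s x v - s x (u n))) \<longlonglongrightarrow> s x v - 0" by (intro tendsto_diff tendsto_const)
    then have "(\<lambda>n. s x (u n)) \<longlonglongrightarrow> s x v" by simp
    moreover have "(\<lambda>n. s x (u n)) \<longlonglongrightarrow> cinner b z"
      using tendsto_cinner_right[OF z, of b] Ginner[OF xb a] by simp
    ultimately show ?thesis using LIMSEQ_unique by blast
  qed
  \<comment> \<open>Bessel's inequality, obtained as a limit of Cauchy-Schwarz between
    \<open>u n\<close> and \<open>v\<close>. The missing length is later supplied by
    \<open>\<gamma>\<close>, whose radicand is nonnegative by this bound.\<close>
  have nz: "(norm z)\<^sup>2 \<le> Re (s v v)"
  proof -
    have "(\<lambda>n. (cmod (cinner (a n) z))\<^sup>2) \<longlonglongrightarrow> (cmod (cinner z z))\<^sup>2"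
      by (intro tendsto_power tendsto_norm tendsto_cinner z tendsto_const)
    moreover have "(\<lambda>n. (norm (a n))\<^sup>2 * Re (s v v)) \<longlonglongrightarrow> (norm z)\<^sup>2 * Re (s v v)"
      by (intro tendsto_mult tendsto_power tendsto_norm z tendsto_const)
    moreover have "(cmod (cinner (a n) z))\<^sup>2 \<le> (norm (a n))\<^sup>2 * Re (s v v)" for n
      using form_Cauchy_Schwarz[of "u n" v] bz[OF a] Ginner[OF a a, of n n] by (simp add: norm_power2_cinner)
    ultimately have "(cmod (cinner z z))\<^sup>2 \<le> (norm z)\<^sup>2 * Re (s v v)" by (intro LIMSEQ_le) auto
    then have "(norm z)\<^sup>2 * (norm z)\<^sup>2 \<le> (norm z)\<^sup>2 * Re (s v v)"
      unfolding cinner_self by (simp add: power2_eq_square norm_mult)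
    then show ?thesis
    proof (cases "norm z = 0")
      case True
      then show ?thesis using form_nonneg by simp
    next
      case False
      then have "0 < (norm z)\<^sup>2" by simp
      with \<open>(norm z)\<^sup>2 * (norm z)\<^sup>2 \<le> (norm z)\<^sup>2 * Re (s v v)\<close> show ?thesis
        by (rule mult_left_le_imp_le)
    qed
  qed
  have gv: "g v \<notin> g ` (D \<inter> fst ` G)" using inj v by (auto simp: inj_on_def)
  have zv: "Rep_ell2 z (g v) = 0"
    by (rule ell2_coordinate_limit[OF z]) (use Gsupp[OF a] gv in blast)
  obtain e :: "'i ell2" where e: "norm e = 1" "\<And>i. i \<noteq> g v \<Longrightarrow> Rep_ell2 e i = 0"
    "\<And>b. Rep_ell2 b (g v) = 0 \<Longrightarrow> cinner b e = 0" using ell2_unit_vector[of "g v"] by blast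
  define \<gamma> where "\<gamma> = complex_of_real (sqrt (Re (s v v) - (norm z)\<^sup>2))"
  define w where "w = z + \<gamma> *\<^sub>C e"
  have ze: "cinner z e = 0" by (rule e(3)[OF zv])
  then have ez: "cinner e z = 0" by (subst cinner_commute) simp
  have ww: "cinner w w = s v v"
  proof -
    have "cnj \<gamma> * \<gamma> = complex_of_real (Re (s v v) - (norm z)\<^sup>2)"
      unfolding \<gamma>_def using nz by (simp flip: of_real_mult)
    moreover have "cinner w w = cinner z z + cnj \<gamma> * \<gamma>"
      by (simp add: w_def cinner_add_left cinner_add_right cinner_scaleC_left cinner_scaleC_right ze ez cinner_self[of e] e(1))
    moreover have "s v v = complex_of_real (Re (s v v))" by (rule form_self)
    ultimately show ?thesis by (simp add: cinner_self)
  qed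
  have bw: "cinner b w = s x v" if xb: "(x, b) \<in> G" for x b
  proof -
    have "Rep_ell2 b (g v) = 0" using Gsupp[OF xb] gv by blast
    then show ?thesis using bz[OF xb] by (simp add: w_def cinner_add_right cinner_scaleC_right e(3))
  qed
  have wb: "cinner w b = s v x" if "(x, b) \<in> G" for x b
    using bw[OF that] by (metis cinner_commute form_commute)
  define G' where "G' = {(x + c *\<^sub>C v, b + c *\<^sub>C w) | x b c. (x, b) \<in> G}"
  have sub: "G \<subseteq> G'"
  proof
    fix y assume "y \<in> G"
    then show "y \<in> G'" unfolding G'_def by (cases y) (force intro: exI[of _ 0])
  qed
  have vw: "(v, w) \<in> G'" unfolding G'_def using G0 by (force intro: exI[of _ 1] simp: scaleC_one)
  have vG': "v \<in> fst ` G'" using vw by force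
  have "partial_embedding s D g G'"
    unfolding partial_embedding_def
  proof (intro conjI allI impI)
    show "(0, 0) \<in> G'" using sub G0 by blast
  next
    fix x a y b assume "(x, a) \<in> G'" "(y, b) \<in> G'"
    then obtain x' a' c y' b' d where *: "(x', a') \<in> G" "x = x' + c *\<^sub>C v" "a = a' + c *\<^sub>C w"
      "(y', b') \<in> G" "y = y' + d *\<^sub>C v" "b = b' + d *\<^sub>C w" unfolding G'_def by blast
    have "x + y = (x' + y') + (c + d) *\<^sub>C v" "a + b = (a' + b') + (c + d) *\<^sub>C w"
      by (simp_all add: * scaleC_add_left)
    then show "(x + y, a + b) \<in> G'" using Gadd[OF *(1) *(4)] unfolding G'_def by blast
    have "cinner a b = s x' y' + d * s x' v + (cnj c * s v y' + cnj c * (d * s v v))"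
      unfolding * by (simp add: cinner_add_left cinner_add_right cinner_scaleC_left cinner_scaleC_right
        Ginner[OF *(1) *(4)] bw[OF *(1)] wb[OF *(4)] ww algebra_simps)
    also have "\<dots> = s x y"
      unfolding * by (simp add: form_add_left form_add_right form_scale_left form_scale_right algebra_simps)
    finally show "cinner a b = s x y" .
  next
    fix c x a assume "(x, a) \<in> G'"
    then obtain x' a' d where *: "(x', a') \<in> G" "x = x' + d *\<^sub>C v" "a = a' + d *\<^sub>C w" unfolding G'_def by blast
    have "c *\<^sub>C x = c *\<^sub>C x' + (c * d) *\<^sub>C v" "c *\<^sub>C a = c *\<^sub>C a' + (c * d) *\<^sub>C w"
      by (simp_all add: * scaleC_add_right scaleC_scaleC)
    then show "(c *\<^sub>C x, c *\<^sub>C a) \<in> G'" using Gscale[OF *(1), of c] unfolding G'_def by blast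
  next
    fix x b i assume "(x, b) \<in> G'" and nz: "Rep_ell2 b i \<noteq> 0"
    then obtain x' b' c where *: "(x', b') \<in> G" "b = b' + c *\<^sub>C w" unfolding G'_def by blast
    have mono: "g ` (D \<inter> fst ` G) \<subseteq> g ` (D \<inter> fst ` G')" using sub by blast
    consider "i = g v" | "i \<noteq> g v" "Rep_ell2 b' i \<noteq> 0" | "i \<noteq> g v" "Rep_ell2 b' i = 0" by blast
    then show "i \<in> g ` (D \<inter> fst ` G')"
    proof cases
      case 1
      then show ?thesis using vG' v(1) by blast
    next
      case 2
      then show ?thesis using Gsupp[OF *(1)] mono by blast
    next
      case 3
      then have "Rep_ell2 z i \<noteq> 0"
        using nz e(2)[of i] by (auto simp: *(2) w_def plus_ell2.rep_eq scaleC_ell2.rep_eq)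
      then obtain n where "Rep_ell2 (a n) i \<noteq> 0" using ell2_coordinate_limit[OF z, of i] by blast
      then show ?thesis using Gsupp[OF a] mono by blast
    qed
  qed
  then show ?thesis using sub vG' by blast
qed

text \<open>The point is the index type: one coordinate for each element of a spanning set
  \<open>D\<close> suffices. Hence the constructions below can be realized on the square-summable
  spaces over which the spectrum and the universal property are defined.\<close>

theorem psd_form_embedding:
  fixes s :: "'v::complex_vector \<Rightarrow> 'v \<Rightarrow> complex" and g :: "'v \<Rightarrow> 'i"
  assumes s: "psd_form s" and inj: "inj_on g D"
  obtains t :: "'v \<Rightarrow> 'i ell2"
    where "\<And>x y. x \<in> cspan D \<Longrightarrow> y \<in> cspan D \<Longrightarrow> cinner (t x) (t y) = s x y"
proof -
  interpret psd_form s by fact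
  define A where "A = {G. partial_embedding s D g G}"
  have "\<exists>M\<in>A. \<forall>X\<in>A. M \<subseteq> X \<longrightarrow> X = M"
  proof (rule subset_Zorn_nonempty)
    have "Rep_ell2 0 i = 0" for i :: 'i by (simp add: zero_ell2.rep_eq)
    then have "partial_embedding s D g {(0, 0)}" by (simp add: partial_embedding_def)
    then show "A \<noteq> {}" by (auto simp: A_def)
    fix C assume ne: "C \<noteq> {}" and ch: "subset.chain A C"
    have CA: "partial_embedding s D g G" if "G \<in> C" for G
      using ch that by (auto simp: A_def subset.chain_def)
    have two: "\<exists>G\<in>C. p \<in> G \<and> q \<in> G" if pq: "p \<in> \<Union>C" "q \<in> \<Union>C" for p q
    proof -
      obtain G H where "G \<in> C" "H \<in> C" "p \<in> G" "q \<in> H" using pq by blast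
      moreover have "G \<subseteq> H \<or> H \<subseteq> G" using ch \<open>G \<in> C\<close> \<open>H \<in> C\<close> by (auto simp: subset.chain_def)
      ultimately show ?thesis by blast
    qed
    have "partial_embedding s D g (\<Union>C)"
      unfolding partial_embedding_def
    proof (intro conjI allI impI)
      show "(0, 0) \<in> \<Union>C" using ne CA[THEN partial_embeddingD(1)] by blast
    next
      fix x a y b assume "(x, a) \<in> \<Union>C" "(y, b) \<in> \<Union>C"
      then have "\<exists>G\<in>C. (x, a) \<in> G \<and> (y, b) \<in> G" by (rule two)
      then obtain G where G: "G \<in> C" "(x, a) \<in> G" "(y, b) \<in> G" by blast
      show "(x + y, a + b) \<in> \<Union>C" using partial_embeddingD(2)[OF CA[OF G(1)] G(2,3)] G(1) by blast
      show "cinner a b = s x y" by (rule partial_embeddingD(4)[OF CA[OF G(1)] G(2,3)])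
    next
      fix c x a assume "(x, a) \<in> \<Union>C"
      then obtain G where G: "G \<in> C" "(x, a) \<in> G" by blast
      show "(c *\<^sub>C x, c *\<^sub>C a) \<in> \<Union>C" using partial_embeddingD(3)[OF CA[OF G(1)] G(2)] G(1) by blast
    next
      fix x a i assume "(x, a) \<in> \<Union>C" and nz: "Rep_ell2 a i \<noteq> 0"
      then obtain G where G: "G \<in> C" "(x, a) \<in> G" by blast
      have "i \<in> g ` (D \<inter> fst ` G)" using partial_embeddingD(5)[OF CA[OF G(1)] G(2) nz] .
      with G(1) show "i \<in> g ` (D \<inter> fst ` \<Union>C)" by blast
    qed
    then show "\<Union>C \<in> A" by (simp add: A_def)
  qed
  then obtain G where G: "partial_embedding s D g G" and max: "\<And>X. partial_embedding s D g X \<Longrightarrow> G \<subseteq> X \<Longrightarrow> X = G"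
    by (auto simp: A_def)
  have "D \<subseteq> fst ` G"
  proof
    fix v assume v: "v \<in> D"
    show "v \<in> fst ` G"
    proof (rule ccontr)
      assume "v \<notin> fst ` G"
      then show False using partial_embedding_extend[OF s inj G v] max by blast
    qed
  qed
  moreover have "csubspace (fst ` G)"
  proof (rule csubspaceI)
    show "0 \<in> fst ` G" using partial_embeddingD(1)[OF G] by force
    show "x + y \<in> fst ` G" if "x \<in> fst ` G" "y \<in> fst ` G" for x y
      using that partial_embeddingD(2)[OF G] by force
    show "c *\<^sub>C x \<in> fst ` G" if "x \<in> fst ` G" for c x
      using that partial_embeddingD(3)[OF G] by force
  qed
  ultimately have span: "cspan D \<subseteq> fst ` G" by (rule complex_vector.span_minimal)
  define t where "t x = (SOME a. (x, a) \<in> G)" for x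
  have t: "(x, t x) \<in> G" if "x \<in> cspan D" for x
  proof -
    have "\<exists>a. (x, a) \<in> G" using that span by force
    then show ?thesis unfolding t_def by (rule someI_ex)
  qed
  show ?thesis
    by (rule that[of t]) (intro partial_embeddingD(4)[OF G] t)
qed

text \<open>A map preserving inner products is additive and homogeneous automatically: the defect
  has norm 0 when its inner product with itself is expanded.\<close>

lemma form_embedding_linear:
  assumes "psd_form s" and W: "csubspace W" and t: "\<And>x y. x \<in> W \<Longrightarrow> y \<in> W \<Longrightarrow> cinner (t x) (t y) = s x y"
  shows "x \<in> W \<Longrightarrow> y \<in> W \<Longrightarrow> t (x + y) = t x + t (y::'v::complex_vector)"
    and "x \<in> W \<Longrightarrow> t (c *\<^sub>C x) = c *\<^sub>C (t x :: 'k::chilbert_space)"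
proof -
  interpret psd_form s by fact
  note W = csubspaceD[OF W]
  show "t (x + y) = t x + t y" if "x \<in> W" "y \<in> W"
  proof -
    have "cinner (t (x + y) - (t x + t y)) (t (x + y) - (t x + t y)) = 0"
      using that W(2)[OF that] by (simp add: cinner_diff_left cinner_diff_right cinner_add_left cinner_add_right t
        form_add_left form_add_right)
    then show ?thesis by (simp add: cinner_self)
  qed
  show "t (c *\<^sub>C x) = c *\<^sub>C t x" if "x \<in> W"
  proof -
    have "cinner (t (c *\<^sub>C x) - c *\<^sub>C t x) (t (c *\<^sub>C x) - c *\<^sub>C t x) = 0"
      using that W(3)[OF that, of c] by (simp add: cinner_diff_left cinner_diff_right cinner_scaleC_left cinner_scaleC_right t
        form_scale_left form_scale_right)
    then show ?thesis by (simp add: cinner_self)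
  qed
qed

section \<open>Transport of operators and the GNS construction\<close>

lemma bop_apply_zero [simp]: "bop_apply T 0 = 0"
  using bop_apply_scaleC[of T 0 0] by simp

lemma bop_apply_diff: "bop_apply T (x - y) = bop_apply T x - bop_apply T y"
  using bop_apply_add[of T "x - y" y] by simp

lemma clinear_add: "clinear f \<Longrightarrow> f (x + y) = f x + f y"
  by (simp add: Vector_Spaces.linear_def module_hom_def module_hom_axioms_def)

lemma clinear_scaleC: "clinear f \<Longrightarrow> f (c *\<^sub>C x) = c *\<^sub>C f x"
  by (simp add: Vector_Spaces.linear_def module_hom_def module_hom_axioms_def)

lemma clinear_diff: "clinear f \<Longrightarrow> f (x - y) = f x - f y"
  using clinear_add[of f "x - y" y] by simp

lemma clinear_zero: "clinear f \<Longrightarrow> f 0 = 0"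
  using clinear_scaleC[of f 0 0] by simp

lemma clinear_scaleR: "clinear f \<Longrightarrow> f (r *\<^sub>R x) = r *\<^sub>R f x"
  by (simp add: scaleR_scaleC clinear_scaleC)

lemma bop_eq_on_closure:
  assumes "\<And>y. y \<in> S \<Longrightarrow> bop_apply A y = bop_apply B y" "x \<in> closure S"
  shows "bop_apply A x = bop_apply B x"
proof -
  obtain u where u: "\<And>n. u n \<in> S" "u \<longlonglongrightarrow> x" using closure_seqE[OF assms(2)] by blast
  have "(\<lambda>n. bop_apply A (u n)) \<longlonglongrightarrow> bop_apply A x" "(\<lambda>n. bop_apply B (u n)) \<longlonglongrightarrow> bop_apply B x"
    using u(2) by (rule tendsto_bop_apply)+
  then show ?thesis using assms(1)[OF u(1)] LIMSEQ_unique by simp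
qed

lemma bop_eq_by_decomposition:
  assumes S: "csubspace S"
    and "\<And>y. y \<in> S \<Longrightarrow> bop_apply A y = bop_apply B y"
    and "\<And>y. (\<And>z. z \<in> S \<Longrightarrow> cinner z y = 0) \<Longrightarrow> bop_apply A y = bop_apply B y"
  shows "A = B"
proof (rule bop_eqI)
  fix x
  have M: "csubspace (closure S)" "closed (closure S)" by (simp_all add: csubspace_closure[OF S])
  let ?p = "bop_apply (proj (closure S)) x"
  have "bop_apply A ?p = bop_apply B ?p"
    using assms(2) proj_in[OF M] by (rule bop_eq_on_closure)
  moreover have "bop_apply A (x - ?p) = bop_apply B (x - ?p)"
    by (intro assms(3) proj_orthogonal[OF M] closure_memI)
  ultimately show "bop_apply A x = bop_apply B x"
    using bop_apply_add[of A ?p "x - ?p"] bop_apply_add[of B ?p "x - ?p"] by simp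
qed

locale transport =
  fixes W :: "'w::complex_vector set" and t :: "'w \<Rightarrow> 'k::chilbert_space"
  assumes W: "csubspace W"
    and t_add: "x \<in> W \<Longrightarrow> y \<in> W \<Longrightarrow> t (x + y) = t x + t y"
    and t_scale: "x \<in> W \<Longrightarrow> t (c *\<^sub>C x) = c *\<^sub>C t x"
begin

text \<open>The last clause is boundedness for the norm pulled back along \<open>t\<close>; it also
  makes \<open>L\<close> compatible with the vectors that \<open>t\<close> kills, so that
  \<open>L\<close> descends to the image.\<close>

definition transportable :: "('w \<Rightarrow> 'w) \<Rightarrow> bool"
  where "transportable L \<longleftrightarrow> (\<forall>x\<in>W. L x \<in> W) \<and> (\<forall>x\<in>W. \<forall>y\<in>W. L (x + y) = L x + L y) \<and>
    (\<forall>c. \<forall>x\<in>W. L (c *\<^sub>C x) = c *\<^sub>C L x) \<and> (\<exists>K\<ge>0. \<forall>x\<in>W. norm (t (L x)) \<le> K * norm (t x))"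

text \<open>Prescribing 0 on the orthogonal complement of the image of \<open>W\<close> makes
  \<open>T\<close> unique. Identities between lifts can then be checked on that image, and lifted
  representations are extensions by zero, as in the encoding of the spectrum.\<close>

definition is_transport :: "('w \<Rightarrow> 'w) \<Rightarrow> 'k bop \<Rightarrow> bool"
  where "is_transport L T \<longleftrightarrow> (\<forall>x\<in>W. bop_apply T (t x) = t (L x)) \<and>
    (\<forall>y. (\<forall>x\<in>W. cinner (t x) y = 0) \<longrightarrow> bop_apply T y = 0)"

definition lift :: "('w \<Rightarrow> 'w) \<Rightarrow> 'k bop"
  where "lift L = (SOME T. is_transport L T)"

lemma csubspace_image: "csubspace (t ` W)"
proof (rule csubspaceI)
  have "t 0 = 0" using t_scale[OF csubspaceD(1)[OF W], of 0] by simp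
  then show "0 \<in> t ` W" using csubspaceD(1)[OF W] by (metis imageI)
  show "x + y \<in> t ` W" if "x \<in> t ` W" "y \<in> t ` W" for x y
    using that t_add csubspaceD(2)[OF W] by (smt (verit) image_iff)
  show "c *\<^sub>C x \<in> t ` W" if "x \<in> t ` W" for c x
    using that t_scale csubspaceD(3)[OF W] by (smt (verit) image_iff)
qed

lemma is_transport_unique:
  assumes "is_transport L S" "is_transport L T" shows "S = T"
  by (rule bop_eq_by_decomposition[OF csubspace_image]) (use assms in \<open>auto simp: is_transport_def\<close>)

lemma is_transport_lift:
  assumes L: "transportable L"
  shows "is_transport L (lift L)"
proof -
  obtain K where K: "0 \<le> K" "\<And>x. x \<in> W \<Longrightarrow> norm (t (L x)) \<le> K * norm (t x)"
    and LW: "\<And>x. x \<in> W \<Longrightarrow> L x \<in> W" and Ladd: "\<And>x y. x \<in> W \<Longrightarrow> y \<in> W \<Longrightarrow> L (x + y) = L x + L y"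
    and Lscale: "\<And>c x. x \<in> W \<Longrightarrow> L (c *\<^sub>C x) = c *\<^sub>C L x"
    using L unfolding transportable_def by blast
  define G where "G = (\<lambda>x. (t x, t (L x))) ` W"
  have G: "(x + x', y + y') \<in> G" if xy: "(x, y) \<in> G" "(x', y') \<in> G" for x y x' y'
  proof -
    obtain w w' where w: "w \<in> W" "w' \<in> W" "x = t w" "y = t (L w)" "x' = t w'" "y' = t (L w')"
      using xy unfolding G_def by blast
    then have "(x + x', y + y') = (t (w + w'), t (L (w + w')))"
      using LW by (simp add: t_add Ladd)
    then show ?thesis using csubspaceD(2)[OF W w(1,2)] unfolding G_def by blast
  qed
  have G2: "(c *\<^sub>C x, c *\<^sub>C y) \<in> G" if xy: "(x, y) \<in> G" for c x y
  proof -
    obtain w where w: "w \<in> W" "x = t w" "y = t (L w)" using xy by (auto simp: G_def)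
    then have "(c *\<^sub>C x, c *\<^sub>C y) = (t (c *\<^sub>C w), t (L (c *\<^sub>C w)))"
      using LW by (simp add: t_scale Lscale)
    then show ?thesis using csubspaceD(3)[OF W w(1)] unfolding G_def by blast
  qed
  have G3: "norm y \<le> K * norm x" if "(x, y) \<in> G" for x y
    using that K(2) by (auto simp: G_def)
  obtain f where f: "\<And>x. x \<in> closure (fst ` G) \<Longrightarrow> (x, f x) \<in> closure G"
    "\<And>x y. (x, y) \<in> closure G \<Longrightarrow> f x = y"
    "\<And>x y. (x, y) \<in> closure G \<Longrightarrow> norm y \<le> K * norm x"
    "\<And>x y. x \<in> closure (fst ` G) \<Longrightarrow> y \<in> closure (fst ` G) \<Longrightarrow> f (x + y) = f x + f y"
    "\<And>c x. x \<in> closure (fst ` G) \<Longrightarrow> f (c *\<^sub>C x) = c *\<^sub>C f x"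
    using bounded_relation_extension[OF G G2 G3] by blast
  have fst: "fst ` G = t ` W" by (force simp: G_def)
  define M where "M = closure (t ` W)"
  have M: "csubspace M" "closed M" by (simp_all add: M_def csubspace_closure csubspace_image)
  let ?P = "bop_apply (proj M)"
  have Pin: "?P x \<in> closure (fst ` G)" for x using proj_in[OF M, of x] by (simp add: M_def fst)
  have "\<exists>T. bop_apply T = (\<lambda>x. f (?P x))"
  proof (rule bop_of_function)
    show "norm (f (?P x)) \<le> K * norm x" for x
      using f(3)[OF f(1)[OF Pin[of x]]] mult_left_mono[OF norm_proj_le[OF M, of x] K(1)] by simp
  qed (simp_all add: bop_apply_add bop_apply_scaleC f(4)[OF Pin Pin] f(5)[OF Pin])
  then obtain T where T: "bop_apply T = (\<lambda>x. f (?P x))" ..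
  have "is_transport L T"
    unfolding is_transport_def
  proof (intro conjI ballI allI impI)
    fix x assume x: "x \<in> W"
    have "t x \<in> t ` W" using x by (rule imageI)
    then have "t x \<in> M" unfolding M_def by (rule closure_memI)
    have "(t x, t (L x)) \<in> G" unfolding G_def using x by blast
    then have "(t x, t (L x)) \<in> closure G" by (rule closure_memI)
    then have "f (t x) = t (L x)" by (rule f(2))
    with \<open>t x \<in> M\<close> show "bop_apply T (t x) = t (L x)" by (simp add: T proj_id[OF M])
  next
    fix y assume y: "\<forall>x\<in>W. cinner (t x) y = 0"
    have "cinner z y = 0" if z: "z \<in> M" for z
    proof -
      obtain u where u: "\<And>n. u n \<in> t ` W" "u \<longlonglongrightarrow> z" using closure_seqE[OF z[unfolded M_def]] by blast
      have "(\<lambda>n. cinner (u n) y) \<longlonglongrightarrow> cinner z y" by (intro tendsto_cinner u tendsto_const)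
      moreover have "cinner (u n) y = 0" for n using u(1)[of n] y by auto
      ultimately show ?thesis by (simp add: LIMSEQ_const_iff)
    qed
    then have "?P y = 0" by (rule proj_eq_0[OF M])
    moreover have "f 0 = 0" using f(5)[OF Pin[of 0], of 0] by simp
    ultimately show "bop_apply T y = 0" by (simp add: T)
  qed
  then show ?thesis unfolding lift_def by (rule someI)
qed

lemma lift_eqI: "is_transport L T \<Longrightarrow> transportable L \<Longrightarrow> lift L = T"
  using is_transport_unique is_transport_lift by blast

lemma lift_apply: "transportable L \<Longrightarrow> x \<in> W \<Longrightarrow> bop_apply (lift L) (t x) = t (L x)"
  using is_transport_lift by (auto simp: is_transport_def)

lemma lift_orthogonal: "transportable L \<Longrightarrow> (\<And>x. x \<in> W \<Longrightarrow> cinner (t x) y = 0) \<Longrightarrow> bop_apply (lift L) y = 0"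
  using is_transport_lift by (auto simp: is_transport_def)

lemma lift_add:
  assumes "transportable L" "transportable L'" "transportable L''" "\<And>x. x \<in> W \<Longrightarrow> L'' x = L x + L' x"
  shows "lift L'' = lift L + lift L'"
proof (rule lift_eqI[OF _ assms(3)])
  show "is_transport L'' (lift L + lift L')"
    using assms(4) t_add assms(1,2) unfolding is_transport_def
    by (auto simp: bop_apply_linear_left lift_apply lift_orthogonal transportable_def)
qed

lemma lift_scaleC:
  assumes "transportable L" "transportable L'" "\<And>x. x \<in> W \<Longrightarrow> L' x = c *\<^sub>C L x"
  shows "lift L' = c *\<^sub>C lift L"
proof (rule lift_eqI[OF _ assms(2)])
  show "is_transport L' (c *\<^sub>C lift L)"
    using assms(3) t_scale assms(1) unfolding is_transport_def
    by (auto simp: bop_apply_scaleC_left lift_apply lift_orthogonal transportable_def)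
qed

lemma lift_mult:
  assumes "transportable L" "transportable L'" "transportable L''" "\<And>x. x \<in> W \<Longrightarrow> L'' x = L (L' x)"
  shows "lift L'' = lift L * lift L'"
proof (rule lift_eqI[OF _ assms(3)])
  have "L' x \<in> W" if "x \<in> W" for x using assms(2) that by (simp add: transportable_def)
  then show "is_transport L'' (lift L * lift L')"
    using assms(4) assms(1,2) unfolding is_transport_def
    by (auto simp: bop_apply_times lift_apply lift_orthogonal)
qed

lemma lift_star:
  assumes L: "transportable L" and L': "transportable L'"
    and adj: "\<And>x y. x \<in> W \<Longrightarrow> y \<in> W \<Longrightarrow> cinner (t (L x)) (t y) = cinner (t x) (t (L' y))"
  shows "lift L' = star (lift L)"
proof (rule lift_eqI[OF _ L'])
  have L'W: "L' y \<in> W" if "y \<in> W" for y using L' that by (simp add: transportable_def)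
  have LW: "L y \<in> W" if "y \<in> W" for y using L that by (simp add: transportable_def)
  define M where "M = closure (t ` W)"
  have M: "csubspace M" "closed M" by (simp_all add: M_def csubspace_closure csubspace_image)
  \<comment> \<open>An adjoint vanishes on the orthogonal complement of the range. So the range must
    stay in \<open>M\<close> for \<open>star (lift L)\<close> to satisfy the second clause of
    \<open>is_transport\<close>.\<close>
  have range: "bop_apply (lift L) z \<in> M" for z
  proof -
    have "bop_apply (lift L) (bop_apply (proj M) z) = bop_apply (lift L) z"
    proof -
      have "bop_apply (lift L) (z - bop_apply (proj M) z) = 0"
        by (intro lift_orthogonal[OF L] proj_orthogonal[OF M]) (simp add: M_def closure_memI)
      then show ?thesis by (simp add: bop_apply_diff)
    qed
    moreover have "bop_apply (lift L) m \<in> M" if m: "m \<in> M" for m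
    proof -
      obtain u where u: "\<And>n. u n \<in> t ` W" "u \<longlonglongrightarrow> m" using closure_seqE[OF m[unfolded M_def]] by blast
      have "bop_apply (lift L) (u n) \<in> t ` W" for n using u(1)[of n] lift_apply[OF L] LW by auto
      then show ?thesis unfolding M_def using tendsto_bop_apply[OF u(2)] by (rule closure_seqI)
    qed
    ultimately show ?thesis using proj_in[OF M, of z] by metis
  qed
  show "is_transport L' (star (lift L))"
    unfolding is_transport_def
  proof (intro conjI ballI allI impI)
    fix y assume y: "y \<in> W"
    show "bop_apply (star (lift L)) (t y) = t (L' y)"
    proof (rule cinner_eq_all)
      fix z
      let ?p = "bop_apply (proj M) z"
      have 1: "cinner (t y) (bop_apply (lift L) m) = cinner (t (L' y)) m" if m: "m \<in> M" for m
      proof -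
        obtain u where u: "\<And>n. u n \<in> t ` W" "u \<longlonglongrightarrow> m" using closure_seqE[OF m[unfolded M_def]] by blast
        have "cinner (t y) (bop_apply (lift L) (u n)) = cinner (t (L' y)) (u n)" for n
        proof -
          obtain w where "w \<in> W" "u n = t w" using u(1) by blast
          then show ?thesis using adj[OF \<open>w \<in> W\<close> y] lift_apply[OF L] by (metis cinner_commute)
        qed
        moreover have "(\<lambda>n. cinner (t y) (bop_apply (lift L) (u n))) \<longlonglongrightarrow> cinner (t y) (bop_apply (lift L) m)"
          by (intro tendsto_cinner_right tendsto_bop_apply u)
        moreover have "(\<lambda>n. cinner (t (L' y)) (u n)) \<longlonglongrightarrow> cinner (t (L' y)) m"
          by (intro tendsto_cinner_right u)
        ultimately show ?thesis using LIMSEQ_unique by simp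
      qed
      have "bop_apply (lift L) (z - ?p) = 0"
        by (intro lift_orthogonal[OF L] proj_orthogonal[OF M]) (simp add: M_def closure_memI)
      then have "cinner (bop_apply (star (lift L)) (t y)) z = cinner (t y) (bop_apply (lift L) ?p)"
        by (simp add: cinner_star_left bop_apply_diff)
      also have "\<dots> = cinner (t (L' y)) ?p" by (rule 1[OF proj_in[OF M]])
      also have "\<dots> = cinner (t (L' y)) z"
        by (rule cinner_proj[OF M]) (simp add: M_def closure_memI L'W[OF y])
      finally show "cinner (bop_apply (star (lift L)) (t y)) z = cinner (t (L' y)) z" .
    qed
  next
    fix y assume y: "\<forall>x\<in>W. cinner (t x) y = 0"
    show "bop_apply (star (lift L)) y = 0"
    proof (rule cinner_eq_all)
      fix z
      obtain u where u: "\<And>n. u n \<in> t ` W" "u \<longlonglongrightarrow> bop_apply (lift L) z"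
        using closure_seqE[OF range[of z, unfolded M_def]] by blast
      have "(\<lambda>n. cinner y (u n)) \<longlonglongrightarrow> cinner y (bop_apply (lift L) z)" by (intro tendsto_cinner_right u)
      moreover have "cinner y (u n) = 0" for n
      proof -
        obtain w where "w \<in> W" "u n = t w" using u(1) by blast
        then have "cinner (u n) y = 0" using y by simp
        then show ?thesis by (subst cinner_commute) simp
      qed
      ultimately have "cinner y (bop_apply (lift L) z) = 0" by (simp add: LIMSEQ_const_iff)
      then show "cinner (bop_apply (star (lift L)) y) z = cinner 0 z" by (simp add: cinner_star_left)
    qed
  qed
qed

end

section \<open>Representations\<close>

lemma star_hom_clinear: "star_hom \<phi> \<Longrightarrow> clinear \<phi>"
  and star_hom_mult: "star_hom \<phi> \<Longrightarrow> \<phi> (a * b) = \<phi> a * \<phi> b"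
  and star_hom_star: "star_hom \<phi> \<Longrightarrow> \<phi> (star a) = star (\<phi> a)"
  by (simp_all add: star_hom_def)

lemma star_hom_add: "star_hom \<phi> \<Longrightarrow> \<phi> (a + b) = \<phi> a + \<phi> b"
  and star_hom_scaleC: "star_hom \<phi> \<Longrightarrow> \<phi> (c *\<^sub>C a) = c *\<^sub>C \<phi> a"
  and star_hom_scaleR: "star_hom \<phi> \<Longrightarrow> \<phi> (r *\<^sub>R a) = r *\<^sub>R \<phi> a"
  and star_hom_diff: "star_hom \<phi> \<Longrightarrow> \<phi> (a - b) = \<phi> a - \<phi> b"
  and star_hom_zero: "star_hom \<phi> \<Longrightarrow> \<phi> 0 = 0"
  using star_hom_clinear[of \<phi>] by (simp_all add: clinear_add clinear_scaleC clinear_scaleR clinear_diff clinear_zero)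

lemma star_homI:
  assumes "\<And>a b. \<phi> (a + b) = \<phi> a + \<phi> b" "\<And>c a. \<phi> (c *\<^sub>C a) = c *\<^sub>C \<phi> a"
    "\<And>a b. \<phi> (a * b) = \<phi> a * \<phi> b" "\<And>a. \<phi> (star a) = star (\<phi> a)"
  shows "star_hom \<phi>"
  unfolding star_hom_def using assms by (auto intro: clinearI)

lemma star_hom_compose: "star_hom \<phi> \<Longrightarrow> star_hom \<psi> \<Longrightarrow> star_hom (\<lambda>a. \<psi> (\<phi> a))"
  by (rule star_homI) (simp_all add: star_hom_add star_hom_scaleC star_hom_mult star_hom_star)

lemma star_hom_to_unit: "star_hom to_unit"
  by (rule star_homI) (simp_all add: unitization_vector_defs times_unitization_def star_unitization_def)

lemma unitization_decompose: "z = to_unit (alg_part z) + scalar_part z *\<^sub>C 1"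
  by (rule unitization_eqI) (simp_all add: unitization_vector_defs one_unitization_def)

lemma scalar_part_simps:
  "scalar_part (x + y) = scalar_part x + scalar_part y" "scalar_part (x - y) = scalar_part x - scalar_part y"
  "scalar_part (x * y) = scalar_part x * scalar_part y" "scalar_part (star x) = cnj (scalar_part x)"
  "scalar_part (r *\<^sub>R x) = r *\<^sub>R scalar_part x" "scalar_part (c *\<^sub>C x) = c * scalar_part x"
  "scalar_part 1 = 1" "scalar_part 0 = 0" "scalar_part (- x) = - scalar_part x"
  by (simp_all add: unitization_vector_defs times_unitization_def star_unitization_def one_unitization_def)

lemma scalar_part_0_to_unit: "scalar_part z = 0 \<Longrightarrow> z = to_unit (alg_part z)"
  by (rule unitization_eqI) simp_all

text \<open>The Hilbert space may be zero, and then \<open>0 \<noteq> 1\<close> fails among its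
  operators; hence the identity is a separate constant and not the unit of a unital class.\<close>

definition id_bop :: "'h::chilbert_space bop"
  where "id_bop = (SOME T. bop_apply T = (\<lambda>x. x))"

lemma bop_apply_id [simp]: "bop_apply id_bop x = x"
proof -
  have "\<exists>T. bop_apply T = (\<lambda>x::'a. x)" by (rule bop_of_function[where K = 1]) simp_all
  from someI_ex[OF this] show ?thesis by (simp add: id_bop_def)
qed

lemma star_id_bop: "star id_bop = id_bop"
  by (rule bop_eqI, rule cinner_eq_all) (simp add: cinner_star_left)

definition unit_rep :: "('a::cstar_algebra \<Rightarrow> 'h::chilbert_space bop) \<Rightarrow> 'a unitization \<Rightarrow> 'h bop"
  where "unit_rep \<rho> z = \<rho> (alg_part z) + scalar_part z *\<^sub>C id_bop"

lemma unit_rep_apply: "bop_apply (unit_rep \<rho> z) h = bop_apply (\<rho> (alg_part z)) h + scalar_part z *\<^sub>C h"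
  by (simp add: unit_rep_def bop_apply_linear_left bop_apply_scaleC_left)

lemma unit_rep_to_unit: "unit_rep \<rho> (to_unit a) = \<rho> a"
  by (simp add: unit_rep_def)

lemma unit_rep_one: "star_hom \<rho> \<Longrightarrow> unit_rep \<rho> 1 = id_bop"
  by (simp add: unit_rep_def one_unitization_def star_hom_zero scaleC_one)

lemma star_hom_unit_rep:
  assumes "star_hom \<rho>" shows "star_hom (unit_rep \<rho>)"
proof (rule star_homI)
  fix x y :: "'a unitization" and c
  show "unit_rep \<rho> (x + y) = unit_rep \<rho> x + unit_rep \<rho> y"
    by (simp add: unit_rep_def plus_unitization_def star_hom_add[OF assms] scaleC_add_left)
  show "unit_rep \<rho> (c *\<^sub>C x) = c *\<^sub>C unit_rep \<rho> x"
    by (simp add: unit_rep_def scaleC_unitization_def star_hom_scaleC[OF assms] scaleC_add_right scaleC_scaleC)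
  show "unit_rep \<rho> (x * y) = unit_rep \<rho> x * unit_rep \<rho> y"
    by (rule bop_eqI) (simp add: unit_rep_apply bop_apply_times times_unitization_def star_hom_add[OF assms]
        star_hom_scaleC[OF assms] star_hom_mult[OF assms] bop_apply_linear_left bop_apply_scaleC_left
        bop_apply_add bop_apply_scaleC scaleC_add_right scaleC_scaleC algebra_simps)
  show "unit_rep \<rho> (star x) = star (unit_rep \<rho> x)"
    by (simp add: unit_rep_def star_unitization_def star_hom_star[OF assms] star_add star_scaleC star_id_bop)
qed

lemma norm_bop_apply_power2:
  assumes "star_hom \<theta>"
  shows "cinner (bop_apply (\<theta> z) h) (bop_apply (\<theta> z) h) = cinner h (bop_apply (\<theta> (star z * z)) h)"
  by (simp add: star_hom_mult[OF assms] star_hom_star[OF assms] bop_apply_times cinner_star_right)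

lemma star_hom_pos:
  assumes \<theta>: "star_hom \<theta>" and z: "pos z"
  shows "0 \<le> Re (cinner h (bop_apply (\<theta> z) h))"
proof -
  obtain k where k: "star k = k" "k * k = z" using pos_sqrt[OF z] by metis
  have "cinner h (bop_apply (\<theta> z) h) = cinner (bop_apply (\<theta> k) h) (bop_apply (\<theta> k) h)"
    using norm_bop_apply_power2[OF \<theta>, of k h] by (simp add: k)
  then show ?thesis by (simp add: norm_power2_cinner[symmetric])
qed

text \<open>In the unitization \<open>(norm c)\<^sup>2 - star c * c\<close> is positive, hence a
  square of a self-adjoint element, and its image has a nonnegative quadratic form.\<close>

lemma star_hom_contractive:
  fixes \<rho> :: "'c::cstar_algebra \<Rightarrow> 'h::chilbert_space bop"
  assumes \<rho>: "star_hom \<rho>"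
  shows "norm (\<rho> c) \<le> norm c"
proof (rule norm_bop_bound)
  fix h
  let ?\<theta> = "unit_rep \<rho>" and ?z = "to_unit c"
  note \<theta> = star_hom_unit_rep[OF \<rho>]
  have "0 \<le> Re (cinner h (bop_apply (?\<theta> ((norm ?z)\<^sup>2 *\<^sub>R 1 - star ?z * ?z)) h))"
    by (rule star_hom_pos[OF \<theta> pos_cstar_norm_minus])
  also have "\<dots> = (norm c)\<^sup>2 * (norm h)\<^sup>2 - Re (cinner h (bop_apply (?\<theta> (star ?z * ?z)) h))"
    by (simp only: star_hom_diff[OF \<theta>] star_hom_scaleR[OF \<theta>] unit_rep_one[OF \<rho>] norm_to_unit bop_apply_linear_left
        cinner_diff_right bop_apply_id cinner_scaleR_right cinner_self) (simp add: norm_power2_cinner)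
  also have "cinner h (bop_apply (?\<theta> (star ?z * ?z)) h) = cinner (bop_apply (\<rho> c) h) (bop_apply (\<rho> c) h)"
    using norm_bop_apply_power2[OF \<theta>, of ?z h] by (simp add: unit_rep_to_unit)
  finally have "(norm (bop_apply (\<rho> c) h))\<^sup>2 \<le> (norm c * norm h)\<^sup>2"
    by (simp add: norm_power2_cinner power_mult_distrib)
  then show "norm (bop_apply (\<rho> c) h) \<le> norm c * norm h" by (rule power2_le_imp_le) simp
qed simp

text \<open>The root \<open>k\<close> of \<open>(norm a)\<^sup>2 - star a * a\<close> exists only in
  the unitization, but \<open>k * x\<close> has scalar part 0 and returns to the algebra. This
  bounds left multiplication in the GNS construction without a unit.\<close>

lemma star_mult_bound:
  fixes a x :: "'a::cstar_algebra"
  obtains z where "(norm a)\<^sup>2 *\<^sub>R (star x * x) - star (a * x) * (a * x) = star z * z"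
proof -
  obtain k where k: "star k = k" "k * k = (norm (to_unit a))\<^sup>2 *\<^sub>R 1 - star (to_unit a) * to_unit a"
    using pos_sqrt[OF pos_cstar_norm_minus[of "to_unit a"]] by metis
  have "scalar_part (k * to_unit x) = 0" by (simp add: scalar_part_simps)
  then have z: "k * to_unit x = to_unit (alg_part (k * to_unit x))" by (rule scalar_part_0_to_unit)
  note h = star_hom_mult[OF star_hom_to_unit, symmetric] star_hom_star[OF star_hom_to_unit, symmetric]
    star_hom_scaleR[OF star_hom_to_unit, symmetric] star_hom_diff[OF star_hom_to_unit, symmetric]
  have "star (k * to_unit x) * (k * to_unit x) = star (to_unit x) * (k * k) * to_unit x"
    by (simp add: star_mult k(1) mult.assoc)
  also have "\<dots> = (norm a)\<^sup>2 *\<^sub>R (star (to_unit x) * to_unit x) - star (to_unit a * to_unit x) * (to_unit a * to_unit x)"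
    unfolding k(2) norm_to_unit by (simp add: algebra_simps star_mult)
  also have "\<dots> = to_unit ((norm a)\<^sup>2 *\<^sub>R (star x * x) - star (a * x) * (a * x))"
    by (simp only: h)
  finally have "to_unit (star (alg_part (k * to_unit x)) * alg_part (k * to_unit x))
    = to_unit ((norm a)\<^sup>2 *\<^sub>R (star x * x) - star (a * x) * (a * x))"
    by (subst (asm) (1 2) z) (simp only: h)
  then show ?thesis using that[of "alg_part (k * to_unit x)"] by simp
qed

section \<open>Positive functionals and the GNS construction\<close>

definition positive_functional :: "('v::cstar_algebra \<Rightarrow> complex) \<Rightarrow> bool"
  where "positive_functional F \<longleftrightarrow> (\<forall>x y. F (x + y) = F x + F y) \<and> (\<forall>c x. F (c *\<^sub>C x) = c * F x) \<and>
    (\<forall>x. F (star x) = cnj (F x)) \<and> (\<forall>x. 0 \<le> Re (F (star x * x)))"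

lemma positive_functional_complexify:
  fixes f :: "'v::cstar_algebra \<Rightarrow> real"
  assumes f: "linear f" and fs: "\<And>x. f (star x) = f x" and fp: "\<And>x. 0 \<le> f (star x * x)"
  shows "positive_functional (\<lambda>x. Complex (f x) (- f (\<i> *\<^sub>C x)))"
  unfolding positive_functional_def
proof (intro conjI allI)
  fix x y :: 'v and c
  show "Complex (f (x + y)) (- f (\<i> *\<^sub>C (x + y))) = Complex (f x) (- f (\<i> *\<^sub>C x)) + Complex (f y) (- f (\<i> *\<^sub>C y))"
    by (simp add: linear_add[OF f] scaleC_add_right complex_eq_iff)
  have ii: "\<i> *\<^sub>C \<i> *\<^sub>C x = - x" by (simp add: scaleC_scaleC)
  have comm: "\<i> *\<^sub>C (r *\<^sub>R y) = r *\<^sub>R (\<i> *\<^sub>C y)" for r and y :: 'v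
    by (simp add: scaleR_scaleC scaleC_scaleC mult.commute)
  have "Re c *\<^sub>R x + Im c *\<^sub>R (\<i> *\<^sub>C x) = (complex_of_real (Re c) + complex_of_real (Im c) * \<i>) *\<^sub>C x"
    by (simp only: scaleR_scaleC scaleC_scaleC scaleC_add_left)
  also have "complex_of_real (Re c) + complex_of_real (Im c) * \<i> = c" by (simp add: complex_eq_iff)
  finally have c: "c *\<^sub>C x = Re c *\<^sub>R x + Im c *\<^sub>R (\<i> *\<^sub>C x)" ..
  then have 1: "f (c *\<^sub>C x) = Re c * f x + Im c * f (\<i> *\<^sub>C x)" by (simp add: linear_add[OF f] linear_scale[OF f])
  have "\<i> *\<^sub>C c *\<^sub>C x = Re c *\<^sub>R (\<i> *\<^sub>C x) - Im c *\<^sub>R x"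
    unfolding c by (simp add: scaleC_add_right comm ii)
  then have 2: "f (\<i> *\<^sub>C c *\<^sub>C x) = Re c * f (\<i> *\<^sub>C x) - Im c * f x" by (simp add: linear_diff[OF f] linear_scale[OF f])
  show "Complex (f (c *\<^sub>C x)) (- f (\<i> *\<^sub>C c *\<^sub>C x)) = c * Complex (f x) (- f (\<i> *\<^sub>C x))"
    unfolding 1 2 by (simp add: complex_eq_iff)
  have "\<i> *\<^sub>C star x = - star (\<i> *\<^sub>C x)" by (simp add: star_scaleC complex_vector.scale_minus_left)
  then show "Complex (f (star x)) (- f (\<i> *\<^sub>C star x)) = cnj (Complex (f x) (- f (\<i> *\<^sub>C x)))"
    by (simp add: fs linear_neg[OF f] complex_eq_iff)
  show "0 \<le> Re (Complex (f (star x * x)) (- f (\<i> *\<^sub>C (star x * x))))" by (simp add: fp)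
qed

text \<open>In the absence of a unit there is no distinguished cyclic vector, so the space is
  described by the map \<open>t\<close> from the whole algebra. The algebra itself is the spanning
  set, which gives the index type \<open>'v\<close>; the last clause records that
  \<open>\<tau>\<close> is extended by zero.\<close>

theorem gns_construction:
  fixes F :: "'v::cstar_algebra \<Rightarrow> complex"
  assumes F: "positive_functional F"
  obtains t :: "'v \<Rightarrow> 'v ell2" and \<tau> :: "'v \<Rightarrow> 'v ell2 bop"
  where "star_hom \<tau>" "clinear t" "\<And>x y. cinner (t x) (t y) = F (star x * y)"
    "\<And>x y. bop_apply (\<tau> x) (t y) = t (x * y)"
    "\<forall>x h. (\<forall>y. cinner (t y) h = 0) \<longrightarrow> bop_apply (\<tau> x) h = 0"
proof -
  have Fadd: "F (x + y) = F x + F y" and Fscale: "F (c *\<^sub>C x) = c * F x" and Fstar: "F (star x) = cnj (F x)"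
    and Fpos: "0 \<le> Re (F (star x * x))" for x y c
    using F unfolding positive_functional_def by blast+
  define s where "s x y = F (star x * y)" for x y
  have s: "psd_form s"
  proof
    fix x y z c
    show "s x y = cnj (s y x)" using Fstar[of "star y * x"] by (simp add: s_def star_mult star_star)
    show "s x (y + z) = s x y + s x z" by (simp add: s_def distrib_left Fadd)
    show "s x (c *\<^sub>C y) = c * s x y" by (simp add: s_def mult_scaleC_right Fscale)
    show "0 \<le> Re (s x x)" by (simp add: s_def Fpos)
  qed
  obtain t :: "'v \<Rightarrow> 'v ell2" where "\<And>x y. x \<in> cspan UNIV \<Longrightarrow> y \<in> cspan UNIV \<Longrightarrow> cinner (t x) (t y) = s x y"
    using psd_form_embedding[OF s, of id UNIV] by (metis inj_on_id)
  then have t: "cinner (t x) (t y) = s x y" for x y by simp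
  have U: "csubspace (UNIV :: 'v set)" by simp
  note lin = form_embedding_linear[OF s U t]
  interpret transport UNIV t by unfold_locales (simp_all add: lin)
  have tr: "transportable (\<lambda>x. a * x)" for a
    unfolding transportable_def
  proof (intro conjI ballI allI exI[of _ "norm a"] norm_ge_zero)
    fix x
    obtain z where "(norm a)\<^sup>2 *\<^sub>R (star x * x) - star (a * x) * (a * x) = star z * z"
      using star_mult_bound[of a x] by blast
    then have "(norm a)\<^sup>2 *\<^sub>R (star x * x) = star (a * x) * (a * x) + star z * z" by (simp add: algebra_simps)
    then have "F ((norm a)\<^sup>2 *\<^sub>R (star x * x)) = F (star (a * x) * (a * x)) + F (star z * z)" by (simp add: Fadd)
    then have "(norm a)\<^sup>2 * Re (s x x) = Re (s (a * x) (a * x)) + Re (F (star z * z))"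
      by (simp add: scaleR_scaleC Fscale s_def complex_eq_iff)
    then have "(norm (t (a * x)))\<^sup>2 \<le> (norm a * norm (t x))\<^sup>2"
      using Fpos[of z] by (simp add: norm_power2_cinner t power_mult_distrib)
    then show "norm (t (a * x)) \<le> norm a * norm (t x)" by (rule power2_le_imp_le) simp
  qed (simp_all add: distrib_left mult_scaleC_right)
  define \<tau> where "\<tau> a = lift (\<lambda>x. a * x)" for a
  show ?thesis
  proof (rule that[of \<tau> t])
    show "star_hom \<tau>"
    proof (rule star_homI)
      fix a b :: 'v and c
      show "\<tau> (a + b) = \<tau> a + \<tau> b" unfolding \<tau>_def by (rule lift_add[OF tr tr tr]) (simp add: distrib_right)
      show "\<tau> (c *\<^sub>C a) = c *\<^sub>C \<tau> a" unfolding \<tau>_def by (rule lift_scaleC[OF tr tr]) (simp add: mult_scaleC_left)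
      show "\<tau> (a * b) = \<tau> a * \<tau> b" unfolding \<tau>_def by (rule lift_mult[OF tr tr tr]) (simp add: mult.assoc)
      show "\<tau> (star a) = star (\<tau> a)" unfolding \<tau>_def
        by (rule lift_star[OF tr tr]) (simp add: t s_def star_mult mult.assoc)
    qed
    show "clinear t" by (rule clinearI) (simp_all add: lin)
    show "cinner (t x) (t y) = F (star x * y)" for x y by (simp add: t s_def)
    show "bop_apply (\<tau> x) (t y) = t (x * y)" for x y unfolding \<tau>_def by (rule lift_apply[OF tr]) simp
    show "\<forall>x h. (\<forall>y. cinner (t y) h = 0) \<longrightarrow> bop_apply (\<tau> x) h = 0"
      unfolding \<tau>_def by (intro allI impI lift_orthogonal[OF tr]) simp
  qed
qed

section \<open>Representation spaces and invariant subspaces\<close>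

lemma csubspace_rep_space: "csubspace (rep_space \<pi>)" and closed_rep_space: "closed (rep_space \<pi>)"
  unfolding rep_space_def by (simp_all add: csubspace_closure)

lemma apply_in_rep_space: "bop_apply (\<pi> a) h \<in> rep_space \<pi>"
  unfolding rep_space_def by (intro closure_memI complex_vector.span_base) blast

lemma rep_space_least:
  assumes "csubspace M" "closed M" "\<And>a h. bop_apply (\<pi> a) h \<in> M"
  shows "rep_space \<pi> \<subseteq> M"
  unfolding rep_space_def
  by (intro closure_minimal complex_vector.span_minimal assms) (use assms(3) in blast)

lemma apply_eq_0_if_orthogonal:
  assumes "star_hom \<pi>" "\<And>a k. cinner (bop_apply (\<pi> a) k) h = 0"
  shows "bop_apply (\<pi> a) h = 0"
proof (rule cinner_eq_all)
  fix z
  have "cinner z (bop_apply (\<pi> a) h) = cinner (bop_apply (\<pi> (star a)) z) h"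
    by (simp add: star_hom_star[OF assms(1)] cinner_star_left)
  then have "cinner z (bop_apply (\<pi> a) h) = 0" by (simp add: assms(2))
  then show "cinner (bop_apply (\<pi> a) h) z = cinner 0 z" by (subst cinner_commute) simp
qed

definition invariant :: "('a::cstar_algebra \<Rightarrow> 'h::chilbert_space bop) \<Rightarrow> 'h set \<Rightarrow> bool"
  where "invariant \<pi> M \<longleftrightarrow> csubspace M \<and> closed M \<and> (\<forall>a. \<forall>h\<in>M. bop_apply (\<pi> a) h \<in> M)"

lemma invariantD:
  assumes "invariant \<pi> M"
  shows "csubspace M" "closed M" "h \<in> M \<Longrightarrow> bop_apply (\<pi> a) h \<in> M"
  using assms by (simp_all add: invariant_def)

lemma proj_commute:
  assumes \<pi>: "star_hom \<pi>" and M: "invariant \<pi> M"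
  shows "bop_apply (proj M) (bop_apply (\<pi> a) h) = bop_apply (\<pi> a) (bop_apply (proj M) h)"
proof (rule proj_eqI[OF invariantD(1,2)[OF M]])
  show "bop_apply (\<pi> a) (bop_apply (proj M) h) \<in> M"
    by (intro invariantD(3)[OF M] proj_in invariantD[OF M])
  fix y assume "y \<in> M"
  then have "bop_apply (\<pi> (star a)) y \<in> M" by (rule invariantD(3)[OF M])
  then have "cinner (bop_apply (\<pi> (star a)) y) (h - bop_apply (proj M) h) = 0"
    by (rule proj_orthogonal[OF invariantD(1,2)[OF M]])
  then show "cinner y (bop_apply (\<pi> a) h - bop_apply (\<pi> a) (bop_apply (proj M) h)) = 0"
    by (simp add: star_hom_star[OF \<pi>] cinner_star_left bop_apply_diff)
qed

section \<open>Pure states and irreducible representations\<close>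

definition re_part :: "'a::cstar_algebra \<Rightarrow> 'a"
  where "re_part z = (1/2) *\<^sub>R (z + star z)"

lemma star_re_part: "star (re_part z) = re_part z"
  by (simp add: re_part_def star_scaleR star_add star_star add.commute)

lemma re_part_add: "re_part (x + y) = re_part x + re_part y"
  by (simp add: re_part_def star_add scaleR_add_right)

lemma re_part_scaleR: "re_part (r *\<^sub>R x) = r *\<^sub>R re_part x"
  by (simp add: re_part_def star_scaleR scaleR_add_right)

lemma re_part_minus: "re_part (- x) = - re_part x"
  using re_part_scaleR[of "-1" x] by simp

lemma re_part_selfadjoint: "star x = x \<Longrightarrow> re_part x = x"
  by (simp add: re_part_def flip: scaleR_2)

lemma re_part_skew: "star x = - x \<Longrightarrow> re_part x = 0"
  by (simp add: re_part_def)

lemma Re_cinner_re_part: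
  assumes "star_hom \<phi>"
  shows "Re (cinner h (bop_apply (\<phi> (re_part z)) h)) = Re (cinner h (bop_apply (\<phi> z) h))"
proof -
  have "Re (cinner h (bop_apply (\<phi> (star z)) h)) = Re (cinner h (bop_apply (\<phi> z) h))"
    unfolding star_hom_star[OF assms] cinner_star_right by (subst cinner_commute) simp
  then show ?thesis
    by (simp add: re_part_def star_hom_scaleR[OF assms] star_hom_add[OF assms] bop_apply_linear_left
        cinner_scaleR_right cinner_add_right)
qed

lemma pos_scalar_nonneg: "pos (t *\<^sub>R (1::'u::{cstar_algebra, real_normed_algebra_1})) \<Longrightarrow> 0 \<le> t"
proof (rule ccontr)
  assume p: "pos (t *\<^sub>R (1::'u))" and "\<not> 0 \<le> t"
  then have "pos ((- t) *\<^sub>R (1::'u))" by (intro pos_of_real) simp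
  then have "pos (- (t *\<^sub>R (1::'u)))" by simp
  with p have "t *\<^sub>R (1::'u) = 0" by (rule pos_antisym)
  then show False using \<open>\<not> 0 \<le> t\<close> by simp
qed

section \<open>The sublinear functional whose extreme minorants are the pure states\<close>

definition upper_bounds :: "'u::{cstar_algebra, real_normed_algebra_1} \<Rightarrow> real set"
  where "upper_bounds z = {r. pos (r *\<^sub>R 1 - re_part z)}"

text \<open>The largest spectral value of the real part of \<open>z\<close>. A real-linear
  functional lies below \<open>max_value\<close> exactly if it is the real part of a state, so
  extreme functionals correspond to pure states.\<close>

definition max_value :: "'u::{cstar_algebra, real_normed_algebra_1} \<Rightarrow> real"
  where "max_value z = Inf (upper_bounds z)"

lemma upper_bounds_norm: "norm (re_part z) \<in> upper_bounds z"
  unfolding upper_bounds_def by (simp add: pos_norm_minus star_re_part)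

lemma upper_bounds_bdd: "bdd_below (upper_bounds (z::'u::{cstar_algebra, real_normed_algebra_1}))"
proof (rule bdd_belowI)
  fix r assume "r \<in> upper_bounds z"
  then have "pos (r *\<^sub>R 1 - re_part z + (norm (- re_part z) *\<^sub>R 1 - (- re_part z)))"
    unfolding upper_bounds_def by (intro pos_add pos_norm_minus) (simp_all add: star_minus star_re_part)
  then have "pos ((r + norm (re_part z)) *\<^sub>R (1::'u))" by (simp add: scaleR_add_left)
  then show "- norm (re_part z) \<le> r" using pos_scalar_nonneg by fastforce
qed

lemma max_value_le: "r \<in> upper_bounds z \<Longrightarrow> max_value z \<le> r"
  unfolding max_value_def by (rule cInf_lower[OF _ upper_bounds_bdd])

lemma max_value_geI: "(\<And>r. r \<in> upper_bounds z \<Longrightarrow> b \<le> r) \<Longrightarrow> b \<le> max_value z"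
  unfolding max_value_def using upper_bounds_norm by (intro cInf_greatest) auto

lemma max_value_less:
  assumes "max_value z < r" shows "r \<in> upper_bounds z"
proof -
  obtain r' where r': "r' \<in> upper_bounds z" "r' < r"
    using cInf_lessD[of "upper_bounds z" r] assms upper_bounds_norm unfolding max_value_def by blast
  then have "pos ((r' *\<^sub>R 1 - re_part z) + (r - r') *\<^sub>R 1)"
    unfolding upper_bounds_def by (intro pos_add pos_of_real) auto
  then show ?thesis by (simp add: upper_bounds_def algebra_simps)
qed

lemma sublinear_max_value: "sublinear (max_value :: 'u::{cstar_algebra, real_normed_algebra_1} \<Rightarrow> real)"
  unfolding sublinear_def
proof (intro conjI allI impI)
  fix x y :: 'u
  show "max_value (x + y) \<le> max_value x + max_value y"
  proof (rule field_le_epsilon)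
    fix e :: real assume "0 < e"
    then have "max_value x + e / 2 \<in> upper_bounds x" "max_value y + e / 2 \<in> upper_bounds y"
      by (auto intro: max_value_less)
    then have "pos (((max_value x + e / 2) *\<^sub>R 1 - re_part x) + ((max_value y + e / 2) *\<^sub>R 1 - re_part y))"
      unfolding upper_bounds_def by (intro pos_add) auto
    moreover have "((max_value x + e / 2) *\<^sub>R 1 - re_part x) + ((max_value y + e / 2) *\<^sub>R 1 - re_part y)
      = ((max_value x + e / 2) + (max_value y + e / 2)) *\<^sub>R 1 - re_part (x + y)"
      unfolding re_part_add scaleR_add_left[of "max_value x + e / 2"] by simp
    ultimately have "(max_value x + e / 2) + (max_value y + e / 2) \<in> upper_bounds (x + y)"
      by (simp add: upper_bounds_def)
    from max_value_le[OF this] show "max_value (x + y) \<le> max_value x + max_value y + e" by simp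
  qed
next
  fix r :: real and x :: 'u assume r: "0 < r"
  show "max_value (r *\<^sub>R x) \<le> r * max_value x"
  proof (rule field_le_epsilon)
    fix e :: real assume "0 < e"
    then have "max_value x + e / r \<in> upper_bounds x" using r by (auto intro: max_value_less)
    then have "pos (r *\<^sub>R ((max_value x + e / r) *\<^sub>R 1 - re_part x))"
      unfolding upper_bounds_def using r by (intro pos_scaleR) auto
    moreover have "r * (max_value x + e / r) = r * max_value x + e" using r by (simp add: field_simps)
    ultimately have "r * max_value x + e \<in> upper_bounds (r *\<^sub>R x)"
      by (simp add: upper_bounds_def re_part_scaleR scaleR_right_diff_distrib)
    from max_value_le[OF this] show "max_value (r *\<^sub>R x) \<le> r * max_value x + e" .
  qed
qed

lemma max_value_star_mult:
  fixes z :: "'u::{cstar_algebra, real_normed_algebra_1}"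
  shows "max_value (star z * z) = (norm z)\<^sup>2"
proof (rule antisym)
  have re: "re_part (star z * z) = star z * z" by (rule re_part_selfadjoint) (simp add: star_mult star_star)
  show "max_value (star z * z) \<le> (norm z)\<^sup>2"
    by (rule max_value_le) (simp add: upper_bounds_def re pos_cstar_norm_minus)
  show "(norm z)\<^sup>2 \<le> max_value (star z * z)"
  proof (rule max_value_geI)
    fix r assume "r \<in> upper_bounds (star z * z)"
    then have r: "pos (r *\<^sub>R 1 - star z * z)" by (simp add: upper_bounds_def re)
    then have "pos ((r *\<^sub>R 1 - star z * z) + star z * z)" by (rule pos_add[OF _ pos_star_mult])
    then have "0 \<le> r" using pos_scalar_nonneg by fastforce
    from pos_norm_le[OF pos_star_mult r this] show "(norm z)\<^sup>2 \<le> r" by (simp add: cstar_identity)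
  qed
qed

lemma rep_one_apply:
  fixes \<tau> :: "'u::{cstar_algebra, real_normed_algebra_1} \<Rightarrow> 'h::chilbert_space bop"
  assumes \<tau>: "star_hom \<tau>" and h: "h \<in> rep_space \<tau>"
  shows "bop_apply (\<tau> 1) h = h"
proof -
  have "bop_apply (\<tau> 1) h = bop_apply id_bop h"
  proof (rule bop_eq_on_closure[OF _ h[unfolded rep_space_def]])
    fix y assume "y \<in> cspan {bop_apply (\<tau> a) h | a h. True}"
    then show "bop_apply (\<tau> 1) y = bop_apply id_bop y"
    proof (induction rule: complex_vector.span_induct_alt)
      case (step c x y)
      then obtain a k where "x = bop_apply (\<tau> a) k" by blast
      then have "bop_apply (\<tau> 1) x = x" by (simp flip: bop_apply_times star_hom_mult[OF \<tau>])
      then show ?case using step by (simp add: bop_apply_add bop_apply_scaleC)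
    qed simp
  qed
  then show ?thesis by simp
qed

text \<open>Pure states have irreducible GNS representations: an invariant subspace \<open>N\<close>
  splits the cyclic vector orthogonally, and with it the state into a convex combination. Choosing
  the extreme functional maximal at \<open>star z * z\<close> makes the cyclic vector attain the
  norm of \<open>z\<close>.\<close>

theorem irreducible_rep_norming_unital:
  fixes z :: "'u::{cstar_algebra, real_normed_algebra_1}"
  obtains \<tau> :: "'u \<Rightarrow> 'u ell2 bop" where "irreducible_rep \<tau>" "norm (\<tau> z) = norm z"
proof -
  obtain f where f: "linear f" and fle: "\<And>x. f x \<le> max_value (x::'u)" and fz: "f (star z * z) = max_value (star z * z)"
    and extreme: "\<And>g h t. linear g \<Longrightarrow> linear h \<Longrightarrow> (\<And>x. g x \<le> max_value x) \<Longrightarrow> (\<And>x. h x \<le> max_value x) \<Longrightarrow>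
      0 < t \<Longrightarrow> t < 1 \<Longrightarrow> (\<And>x. f x = t * g x + (1 - t) * h x) \<Longrightarrow> g = f"
  proof (rule hahn_banach_extreme[OF sublinear_max_value, of "star z * z"], goal_cases)
    case (1 f)
    show ?case
    proof (rule 1(1)[OF 1(2-4)])
      fix g h :: "'u \<Rightarrow> real" and t :: real
      assume "linear g" "linear h" "\<And>x. g x \<le> max_value x" "\<And>x. h x \<le> max_value x" "0 < t" "t < 1"
        "\<And>x. f x = t * g x + (1 - t) * h x"
      then show "g = f" by (rule 1(5)[of g h t])
    qed
  qed
  have skew: "f x = 0" if x: "re_part x = 0" for x
  proof -
    have "0 \<in> upper_bounds x" "0 \<in> upper_bounds (- x)" by (simp_all add: upper_bounds_def x re_part_minus pos_zero)
    then have "f x \<le> 0" "f (- x) \<le> 0" using fle max_value_le by (blast intro: order_trans)+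
    then show ?thesis by (simp add: linear_neg[OF f])
  qed
  have "re_part (star x - x) = 0" for x :: 'u
    by (rule re_part_skew) (simp add: star_diff star_star)
  then have fstar: "f (star x) = f x" for x using skew[of "star x - x"] by (simp add: linear_diff[OF f])
  have fpos: "0 \<le> f x" if x: "pos x" for x
  proof -
    have "re_part x = x" by (rule re_part_selfadjoint[OF pos_selfadjoint[OF x]])
    then have "0 \<in> upper_bounds (- x)" using x by (simp add: upper_bounds_def re_part_minus)
    then have "f (- x) \<le> 0" using fle max_value_le by (blast intro: order_trans)
    then show ?thesis by (simp add: linear_neg[OF f])
  qed
  have f1: "f 1 = 1"
  proof (rule antisym)
    have "re_part (1::'u) = 1" by (rule re_part_selfadjoint) simp
    then have "1 \<in> upper_bounds (1::'u)" "-1 \<in> upper_bounds (- (1::'u))"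
      by (simp_all add: upper_bounds_def re_part_minus pos_zero)
    then have "f 1 \<le> 1" "f (- 1) \<le> -1" using fle max_value_le by (blast intro: order_trans)+
    then show "f 1 \<le> 1" "1 \<le> f 1" by (simp_all add: linear_neg[OF f])
  qed
  define F where "F = (\<lambda>x. Complex (f x) (- f (\<i> *\<^sub>C x)))"
  have F: "positive_functional F"
    unfolding F_def by (rule positive_functional_complexify[OF f fstar]) (rule fpos[OF pos_star_mult])
  obtain t :: "'u \<Rightarrow> 'u ell2" and \<tau> :: "'u \<Rightarrow> 'u ell2 bop" where \<tau>: "star_hom \<tau>" and "clinear t"
    and t: "\<And>x y. cinner (t x) (t y) = F (star x * y)" and \<tau>t: "\<And>x y. bop_apply (\<tau> x) (t y) = t (x * y)"
    and \<tau>0': "\<forall>x h. (\<forall>y. cinner (t y) h = 0) \<longrightarrow> bop_apply (\<tau> x) h = 0"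
    by (rule gns_construction[OF F]) (rule that)
  have \<tau>0: "bop_apply (\<tau> x) h = 0" if "\<And>y. cinner (t y) h = 0" for x h using \<tau>0' that by blast
  define \<xi> where "\<xi> = t 1"
  have \<tau>\<xi>: "bop_apply (\<tau> x) \<xi> = t x" for x by (simp add: \<xi>_def \<tau>t)
  have Re\<xi>: "Re (cinner \<xi> (bop_apply (\<tau> x) \<xi>)) = f x" for x
    unfolding \<tau>\<xi> by (simp add: \<xi>_def t F_def)
  have n\<xi>: "(norm \<xi>)\<^sup>2 = 1"
    using Re\<xi>[of 1] by (simp add: \<tau>\<xi> f1 norm_power2_cinner flip: \<xi>_def)
  note \<tau>1 = rep_one_apply[OF \<tau>]
  have irr: "irreducible_rep \<tau>"
    unfolding irreducible_rep_def
  proof (intro conjI allI impI)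
    show "star_hom \<tau>" by fact
    have \<xi>r: "\<xi> \<in> rep_space \<tau>" using apply_in_rep_space[of \<tau> 1 \<xi>] by (simp add: \<tau>\<xi> flip: \<xi>_def)
    show "rep_space \<tau> \<noteq> {0}"
    proof
      assume "rep_space \<tau> = {0}"
      then have "\<xi> = 0" using \<xi>r by simp
      then show False using n\<xi> by simp
    qed
    fix N assume "csubspace N \<and> closed N \<and> N \<subseteq> rep_space \<tau> \<and> (\<forall>a. \<forall>h\<in>N. bop_apply (\<tau> a) h \<in> N)"
    then have N: "csubspace N" "closed N" and Nr: "N \<subseteq> rep_space \<tau>" and NI: "invariant \<tau> N"
      by (auto simp: invariant_def)
    define \<zeta> where "\<zeta> = bop_apply (proj N) \<xi>"
    define \<omega> where "\<omega> = \<xi> - \<zeta>"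
    have \<zeta>N: "\<zeta> \<in> N" unfolding \<zeta>_def by (rule proj_in[OF N])
    have \<omega>N: "cinner y \<omega> = 0" if "y \<in> N" for y
      unfolding \<omega>_def \<zeta>_def by (rule proj_orthogonal[OF N that])
    have \<zeta>\<omega>: "cinner \<zeta> (bop_apply (\<tau> x) \<omega>) = 0" for x
    proof -
      have "cinner (bop_apply (\<tau> (star x)) \<zeta>) \<omega> = 0" by (intro \<omega>N invariantD(3)[OF NI] \<zeta>N)
      then show ?thesis by (simp add: star_hom_star[OF \<tau>] cinner_star_left)
    qed
    have \<omega>\<zeta>: "cinner \<omega> (bop_apply (\<tau> x) \<zeta>) = 0" for x
      using \<omega>N[OF invariantD(3)[OF NI \<zeta>N], of x] by (subst cinner_commute) simp
    define \<alpha> where "\<alpha> = (norm \<zeta>)\<^sup>2"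
    have \<xi>: "\<xi> = \<zeta> + \<omega>" by (simp add: \<omega>_def)
    have \<beta>: "(norm \<omega>)\<^sup>2 = 1 - \<alpha>"
    proof -
      have "(norm \<xi>)\<^sup>2 = (norm \<zeta>)\<^sup>2 + (norm \<omega>)\<^sup>2"
        unfolding \<xi> norm_add_power2 by (simp add: \<omega>N[OF \<zeta>N])
      then show ?thesis by (simp add: n\<xi> \<alpha>_def)
    qed
    have \<tau>1\<zeta>: "bop_apply (\<tau> 1) \<zeta> = \<zeta>" "bop_apply (\<tau> 1) \<omega> = \<omega>"
      using \<zeta>N Nr \<xi>r by (auto simp: \<tau>1 \<omega>_def bop_apply_diff)
    have split: "f x = Re (cinner \<zeta> (bop_apply (\<tau> x) \<zeta>)) + Re (cinner \<omega> (bop_apply (\<tau> x) \<omega>))" for x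
      unfolding Re\<xi>[symmetric] \<xi> by (simp add: bop_apply_add cinner_add_left cinner_add_right \<zeta>\<omega> \<omega>\<zeta>)
    \<comment> \<open>Normalized vector functionals again lie below \<open>max_value\<close>, so the
      two summands in \<open>split\<close> are admissible for extremality. That
      \<open>\<tau> 1\<close> fixes \<open>v\<close> is what evaluates the scalar term as
      \<open>r * (norm v)\<^sup>2\<close>.\<close>
    have vec: "Re (cinner v (bop_apply (\<tau> x) v)) \<le> (norm v)\<^sup>2 * max_value x"
      if v: "bop_apply (\<tau> 1) v = v" and nv: "0 < (norm v)\<^sup>2" for v x
    proof -
      have "Re (cinner v (bop_apply (\<tau> x) v)) / (norm v)\<^sup>2 \<le> max_value x"
      proof (rule max_value_geI)
        fix r assume "r \<in> upper_bounds x"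
        then have "0 \<le> Re (cinner v (bop_apply (\<tau> (r *\<^sub>R 1 - re_part x)) v))"
          unfolding upper_bounds_def by (intro star_hom_pos[OF \<tau>]) simp
        also have "\<dots> = r * (norm v)\<^sup>2 - Re (cinner v (bop_apply (\<tau> x) v))"
          by (simp add: star_hom_diff[OF \<tau>] star_hom_scaleR[OF \<tau>] bop_apply_linear_left cinner_diff_right
              cinner_scaleR_right v Re_cinner_re_part[OF \<tau>] norm_power2_cinner)
        finally show "Re (cinner v (bop_apply (\<tau> x) v)) / (norm v)\<^sup>2 \<le> r"
          using nv by (simp add: pos_divide_le_eq)
      qed
      then show ?thesis using nv by (simp add: pos_divide_le_eq mult.commute)
    qed
    have lin: "linear (\<lambda>x. Re (cinner v (bop_apply (\<tau> x) v)) / c)" for v and c :: real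
      by (rule linearI) (simp_all add: star_hom_add[OF \<tau>] star_hom_scaleR[OF \<tau>] bop_apply_linear_left
        cinner_add_right cinner_scaleR_right add_divide_distrib)
    have "\<alpha> = 0 \<or> \<alpha> = 1"
    proof (rule ccontr)
      assume "\<not> (\<alpha> = 0 \<or> \<alpha> = 1)"
      moreover have "0 \<le> \<alpha>" "\<alpha> \<le> 1" using \<beta> zero_le_power2[of "norm \<omega>"] by (simp_all add: \<alpha>_def)
      ultimately have \<alpha>: "0 < \<alpha>" "\<alpha> < 1" by auto
      have "(\<lambda>x. Re (cinner \<zeta> (bop_apply (\<tau> x) \<zeta>)) / \<alpha>) = f"
      proof (rule extreme[OF lin lin _ _ \<alpha>, of \<zeta> \<alpha> \<omega> "1 - \<alpha>"])
        show "Re (cinner \<zeta> (bop_apply (\<tau> x) \<zeta>)) / \<alpha> \<le> max_value x" for x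
          using vec[OF \<tau>1\<zeta>(1), of x] \<alpha> by (simp add: \<alpha>_def pos_divide_le_eq mult.commute)
        show "Re (cinner \<omega> (bop_apply (\<tau> x) \<omega>)) / (1 - \<alpha>) \<le> max_value x" for x
          using vec[OF \<tau>1\<zeta>(2), of x] \<alpha> by (simp add: \<beta> pos_divide_le_eq mult.commute)
        show "f x = \<alpha> * (Re (cinner \<zeta> (bop_apply (\<tau> x) \<zeta>)) / \<alpha>)
          + (1 - \<alpha>) * (Re (cinner \<omega> (bop_apply (\<tau> x) \<omega>)) / (1 - \<alpha>))" for x
          using \<alpha> by (simp add: split)
      qed
      then have eq: "Re (cinner \<zeta> (bop_apply (\<tau> x) \<zeta>)) = \<alpha> * f x" for x
        using \<alpha> by (auto simp: fun_eq_iff field_simps)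
      \<comment> \<open>By extremality the functional of \<open>\<zeta>\<close> is
        \<open>\<alpha>\<close> times that of \<open>\<xi>\<close>. Hence
        \<open>\<zeta> - \<alpha> \<xi>\<close> is orthogonal to every \<open>t x\<close>, so it is
        0, and comparing squared norms gives \<open>\<alpha> = \<alpha>\<^sup>2\<close>.\<close>
      have re: "Re (cinner (\<zeta> - \<alpha> *\<^sub>R \<xi>) (t x)) = 0" for x
      proof -
        have "cinner \<zeta> (bop_apply (\<tau> x) \<xi>) = cinner \<zeta> (bop_apply (\<tau> x) \<zeta>)"
          unfolding \<xi> by (simp add: bop_apply_add cinner_add_right \<zeta>\<omega>)
        then show ?thesis using eq[of x]
          by (simp add: cinner_diff_left cinner_scaleR_left flip: \<tau>\<xi> add: Re\<xi>)
      qed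
      have "cinner (\<zeta> - \<alpha> *\<^sub>R \<xi>) (t x) = 0" for x
      proof (rule complex_eqI)
        have "t (\<i> *\<^sub>C x) = \<i> *\<^sub>C t x" by (rule clinear_scaleC[OF \<open>clinear t\<close>])
        then show "Im (cinner (\<zeta> - \<alpha> *\<^sub>R \<xi>) (t x)) = Im 0"
          using re[of "\<i> *\<^sub>C x"] by (simp add: cinner_scaleC_right)
      qed (simp add: re)
      then have "cinner (t x) (\<zeta> - \<alpha> *\<^sub>R \<xi>) = 0" for x by (subst cinner_commute) simp
      then have "bop_apply (\<tau> 1) (\<zeta> - \<alpha> *\<^sub>R \<xi>) = 0" by (rule \<tau>0)
      then have "\<zeta> = \<alpha> *\<^sub>R \<xi>"
        by (simp add: bop_apply_diff \<tau>1\<zeta> scaleR_scaleC bop_apply_scaleC \<tau>1[OF \<xi>r])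
      then have "(norm \<zeta>)\<^sup>2 = \<alpha>\<^sup>2" using n\<xi> by (simp add: power_mult_distrib)
      then have "\<alpha> = \<alpha>\<^sup>2" by (simp only: \<alpha>_def)
      then show False using \<alpha> by (simp add: power2_eq_square)
    qed
    then show "N = {0} \<or> N = rep_space \<tau>"
    proof
      assume "\<alpha> = 0"
      then have "\<omega> = \<xi>" by (simp add: \<alpha>_def \<omega>_def)
      have "n = 0" if n: "n \<in> N" for n
      proof -
        have "cinner (t y) n = 0" for y
        proof -
          have "cinner (bop_apply (\<tau> (star y)) n) \<xi> = 0"
            using \<omega>N[OF invariantD(3)[OF NI n]] \<open>\<omega> = \<xi>\<close> by simp
          then have "cinner n (t y) = 0" by (simp add: star_hom_star[OF \<tau>] cinner_star_left \<tau>\<xi>)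
          then show ?thesis by (subst cinner_commute) simp
        qed
        then have "bop_apply (\<tau> 1) n = 0" by (rule \<tau>0)
        then show ?thesis using \<tau>1[of n] n Nr by auto
      qed
      then show ?thesis using csubspaceD(1)[OF N(1)] by auto
    next
      assume "\<alpha> = 1"
      then have "\<xi> = \<zeta>" using \<beta> by (simp add: \<omega>_def)
      then have tN: "t y \<in> N" for y using invariantD(3)[OF NI \<zeta>N, of y] \<tau>\<xi> by metis
      have "bop_apply (\<tau> a) h \<in> N" for a h
      proof -
        have "bop_apply (\<tau> a) (h - bop_apply (proj N) h) = 0"
          by (rule \<tau>0) (rule proj_orthogonal[OF N tN])
        then have "bop_apply (\<tau> a) h = bop_apply (\<tau> a) (bop_apply (proj N) h)" by (simp add: bop_apply_diff)
        then show ?thesis using invariantD(3)[OF NI proj_in[OF N]] by simp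
      qed
      then have "rep_space \<tau> \<subseteq> N" by (rule rep_space_least[OF N])
      then show ?thesis using Nr by blast
    qed
  qed
  have "(norm (bop_apply (\<tau> z) \<xi>))\<^sup>2 = (norm z)\<^sup>2"
    using norm_bop_apply_power2[OF \<tau>, of z \<xi>] Re\<xi>[of "star z * z"] by (simp add: norm_power2_cinner fz max_value_star_mult)
  then have "norm z = norm (bop_apply (\<tau> z) \<xi>)" by simp
  also have "\<dots> \<le> norm (\<tau> z) * norm \<xi>" by (rule norm_bop_apply)
  also have "norm \<xi> = 1" using n\<xi> power2_eq_imp_eq[of "norm \<xi>" 1] by simp
  finally have "norm (\<tau> z) = norm z" using star_hom_contractive[OF \<tau>, of z] by simp
  then show ?thesis using irr that by blast
qed

text \<open>A subspace of the representation space invariant under the algebra is invariant under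
  the unitization, since the unit acts there as the identity. So the restriction stays irreducible;
  it is nonzero because its norm at \<open>a\<close> is \<open>norm a\<close>.\<close>

theorem irreducible_rep_norming:
  fixes a :: "'a::cstar_algebra"
  assumes "a \<noteq> 0"
  obtains \<pi> :: "'a \<Rightarrow> 'a unitization ell2 bop" where "irreducible_rep \<pi>" "norm (\<pi> a) = norm a"
proof -
  obtain \<tau> :: "'a unitization \<Rightarrow> 'a unitization ell2 bop" where irr: "irreducible_rep \<tau>" and n: "norm (\<tau> (to_unit a)) = norm (to_unit a)"
    by (rule irreducible_rep_norming_unital) (rule that)
  have \<tau>: "star_hom \<tau>" using irr by (simp add: irreducible_rep_def)
  define \<pi> where "\<pi> b = \<tau> (to_unit b)" for b
  have \<pi>: "star_hom \<pi>" unfolding \<pi>_def by (rule star_hom_compose[OF star_hom_to_unit \<tau>])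
  have sub: "rep_space \<pi> \<subseteq> rep_space \<tau>"
    by (rule rep_space_least[OF csubspace_rep_space closed_rep_space]) (simp add: \<pi>_def apply_in_rep_space)
  have norm: "norm (\<pi> a) = norm a" by (simp add: \<pi>_def n norm_to_unit)
  note \<tau>1 = rep_one_apply[OF \<tau>]
  have "irreducible_rep \<pi>"
    unfolding irreducible_rep_def
  proof (intro conjI allI impI)
    show "star_hom \<pi>" by fact
    show "rep_space \<pi> \<noteq> {0}"
    proof
      assume 0: "rep_space \<pi> = {0}"
      have "bop_apply (\<pi> a) h = 0" for h using apply_in_rep_space[of \<pi> a h] by (simp add: 0)
      then have "\<pi> a = 0" by (intro bop_eqI) (simp add: bop_apply_linear_left)
      then show False using norm assms by simp
    qed
    fix N assume N: "csubspace N \<and> closed N \<and> N \<subseteq> rep_space \<pi> \<and> (\<forall>a. \<forall>h\<in>N. bop_apply (\<pi> a) h \<in> N)"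
    have "bop_apply (\<tau> z) h \<in> N" if h: "h \<in> N" for z h
    proof -
      have h1: "bop_apply (\<tau> 1) h = h" using \<tau>1 h N sub by blast
      have "bop_apply (\<tau> z) h = bop_apply (\<pi> (alg_part z)) h + scalar_part z *\<^sub>C h"
        by (subst unitization_decompose[of z])
          (simp add: star_hom_add[OF \<tau>] star_hom_scaleC[OF \<tau>] bop_apply_linear_left bop_apply_scaleC_left h1 \<pi>_def)
      then show ?thesis using N h csubspaceD(2,3)[of N] by simp
    qed
    then have "N = {0} \<or> N = rep_space \<tau>"
      using irr N sub unfolding irreducible_rep_def by (meson order_trans)
    then show "N = {0} \<or> N = rep_space \<pi>" using N sub by blast
  qed
  then show ?thesis using norm that by blast
qed

section \<open>Irreducible subspaces, equivalence and Schur's lemma\<close>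

text \<open>Irreducibility of a subspace inside one ambient, possibly degenerate representation, so
  that a subspace and those induced from it can be compared in place. Requiring a nonzero action
  excludes lines on which the algebra acts as 0.\<close>

definition irr :: "('a::cstar_algebra \<Rightarrow> 'h::chilbert_space bop) \<Rightarrow> 'h set \<Rightarrow> bool"
  where "irr \<pi> M \<longleftrightarrow> invariant \<pi> M \<and> (\<exists>a. \<exists>h\<in>M. bop_apply (\<pi> a) h \<noteq> 0) \<and>
    (\<forall>N. invariant \<pi> N \<and> N \<subseteq> M \<longrightarrow> N = {0} \<or> N = M)"

definition uequiv ::
  "('a::cstar_algebra \<Rightarrow> 'h::chilbert_space bop) \<Rightarrow> 'h set \<Rightarrow> ('a \<Rightarrow> 'k::chilbert_space bop) \<Rightarrow> 'k set \<Rightarrow> bool"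
  where "uequiv \<pi> M \<sigma> N \<longleftrightarrow> (\<exists>U. clinear U \<and> U ` M = N \<and>
    (\<forall>h\<in>M. \<forall>k\<in>M. cinner (U h) (U k) = cinner h k) \<and>
    (\<forall>a. \<forall>h\<in>M. U (bop_apply (\<pi> a) h) = bop_apply (\<sigma> a) (U h)))"

lemma unitarily_equivalent_iff: "unitarily_equivalent \<pi> \<sigma> \<longleftrightarrow> uequiv \<pi> (rep_space \<pi>) \<sigma> (rep_space \<sigma>)"
  by (simp add: unitarily_equivalent_def uequiv_def)

lemma irr_invariant: "irr \<pi> M \<Longrightarrow> invariant \<pi> M"
  by (simp add: irr_def)

lemma irrD: "irr \<pi> M \<Longrightarrow> invariant \<pi> N \<Longrightarrow> N \<subseteq> M \<Longrightarrow> N = {0} \<or> N = M"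
  by (simp add: irr_def)

lemma invariant_rep_space: "invariant \<pi> (rep_space \<pi>)"
  by (simp add: invariant_def csubspace_rep_space closed_rep_space apply_in_rep_space)

lemma irreducible_rep_irr:
  assumes "irreducible_rep \<pi>" shows "star_hom \<pi>" "irr \<pi> (rep_space \<pi>)"
proof -
  show \<pi>: "star_hom \<pi>" using assms by (simp add: irreducible_rep_def)
  have "\<exists>a. \<exists>h\<in>rep_space \<pi>. bop_apply (\<pi> a) h \<noteq> 0"
  proof (rule ccontr)
    assume *: "\<not> ?thesis"
    have "bop_apply (\<pi> a) h = 0" for a h
    proof -
      have "bop_apply (\<pi> (star a)) (bop_apply (\<pi> a) h) = 0" using * apply_in_rep_space by blast
      then have "cinner (bop_apply (\<pi> a) h) (bop_apply (\<pi> a) h) = 0"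
        by (simp add: star_hom_star[OF \<pi>] cinner_star_right[symmetric])
      then show ?thesis by (simp add: cinner_self)
    qed
    then have "rep_space \<pi> \<subseteq> {0}"
      by (intro rep_space_least csubspaceI) simp_all
    then show False using assms csubspaceD(1)[OF csubspace_rep_space] by (auto simp: irreducible_rep_def)
  qed
  then show "irr \<pi> (rep_space \<pi>)"
    using assms invariant_rep_space unfolding irr_def irreducible_rep_def invariant_def by blast
qed

lemma irr_irreducible_rep:
  assumes "star_hom \<pi>" "irr \<pi> (rep_space \<pi>)" shows "irreducible_rep \<pi>"
  using assms unfolding irr_def irreducible_rep_def invariant_def by (auto simp: apply_in_rep_space)

lemma uequiv_refl: "uequiv \<pi> M \<pi> M"
  unfolding uequiv_def by (rule exI[of _ "\<lambda>x. x"]) (auto intro: clinearI)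

lemma uequiv_trans:
  assumes "uequiv \<pi> M \<sigma> N" "uequiv \<sigma> N \<rho> L"
  shows "uequiv \<pi> M \<rho> L"
proof -
  obtain U where U: "clinear U" "U ` M = N" "\<And>h k. h \<in> M \<Longrightarrow> k \<in> M \<Longrightarrow> cinner (U h) (U k) = cinner h k"
    "\<And>a h. h \<in> M \<Longrightarrow> U (bop_apply (\<pi> a) h) = bop_apply (\<sigma> a) (U h)"
    using assms(1) unfolding uequiv_def by blast
  obtain V where V: "clinear V" "V ` N = L" "\<And>h k. h \<in> N \<Longrightarrow> k \<in> N \<Longrightarrow> cinner (V h) (V k) = cinner h k"
    "\<And>a h. h \<in> N \<Longrightarrow> V (bop_apply (\<sigma> a) h) = bop_apply (\<rho> a) (V h)"
    using assms(2) unfolding uequiv_def by blast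
  have UM: "U h \<in> N" if "h \<in> M" for h using that U(2) by blast
  show ?thesis
    unfolding uequiv_def
  proof (intro exI[of _ "\<lambda>x. V (U x)"] conjI ballI allI)
    show "clinear (\<lambda>x. V (U x))"
      by (rule clinearI) (simp_all add: clinear_add[OF U(1)] clinear_add[OF V(1)] clinear_scaleC[OF U(1)] clinear_scaleC[OF V(1)])
    show "(\<lambda>x. V (U x)) ` M = L" using U(2) V(2) by (metis image_image)
  qed (simp_all add: U(3,4) V(3,4) UM)
qed

lemma uequiv_sym:
  assumes "invariant \<pi> M" "invariant \<sigma> N" "uequiv \<pi> M \<sigma> N"
  shows "uequiv \<sigma> N \<pi> M"
proof -
  note M = invariantD[OF assms(1)] and N = invariantD[OF assms(2)]
  obtain U where U: "clinear U" "U ` M = N" "\<And>h k. h \<in> M \<Longrightarrow> k \<in> M \<Longrightarrow> cinner (U h) (U k) = cinner h k"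
    "\<And>a h. h \<in> M \<Longrightarrow> U (bop_apply (\<pi> a) h) = bop_apply (\<sigma> a) (U h)"
    using assms(3) unfolding uequiv_def by blast
  have inj: "h = k" if "h \<in> M" "k \<in> M" "U h = U k" for h k
  proof -
    have "U (h - k) = 0" by (simp add: clinear_diff[OF U(1)] that)
    then have "cinner (h - k) (h - k) = 0" using U(3)[of "h - k" "h - k"] csubspaceD(4)[OF M(1) that(1,2)] by simp
    then show ?thesis by (simp add: cinner_self)
  qed
  have "\<forall>y\<in>N. \<exists>x\<in>M. U x = y" using U(2) by blast
  then obtain V where V: "\<And>y. y \<in> N \<Longrightarrow> V y \<in> M" "\<And>y. y \<in> N \<Longrightarrow> U (V y) = y" by metis
  \<comment> \<open>An intertwiner has to be linear on the whole ambient space, but the inverse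
    \<open>V\<close> is meaningful only on \<open>N\<close>; composing with the projection extends
    it.\<close>
  let ?P = "bop_apply (proj N)"
  note Pin = proj_in[OF N(1,2)] and Pid = proj_id[OF N(1,2)]
  have VU: "V (U x) = x" if "x \<in> M" for x
  proof -
    have "U x \<in> N" using that U(2) by blast
    then show ?thesis by (intro inj V that)
  qed
  show ?thesis
    unfolding uequiv_def
  proof (intro exI[of _ "\<lambda>x. V (?P x)"] conjI ballI allI)
    show "clinear (\<lambda>x. V (?P x))"
    proof (rule clinearI)
      fix x y c
      have "U (V (?P x) + V (?P y)) = ?P (x + y)"
        by (simp add: clinear_add[OF U(1)] V(2)[OF Pin] bop_apply_add)
      then show "V (?P (x + y)) = V (?P x) + V (?P y)"
        by (intro inj V(1) Pin csubspaceD(2)[OF M(1)]) (simp add: V(2)[OF Pin])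
      have "U (c *\<^sub>C V (?P x)) = ?P (c *\<^sub>C x)"
        by (simp add: clinear_scaleC[OF U(1)] V(2)[OF Pin] bop_apply_scaleC)
      then show "V (?P (c *\<^sub>C x)) = c *\<^sub>C V (?P x)"
        by (intro inj V(1) Pin csubspaceD(3)[OF M(1)]) (simp add: V(2)[OF Pin])
    qed
    show "(\<lambda>x. V (?P x)) ` N = M"
    proof
      show "(\<lambda>x. V (?P x)) ` N \<subseteq> M" using V(1) Pin by blast
      show "M \<subseteq> (\<lambda>x. V (?P x)) ` N"
      proof
        fix x assume x: "x \<in> M"
        then have Ux: "U x \<in> N" using U(2) by blast
        then have "x = V (?P (U x))" by (simp add: Pid VU[OF x])
        then show "x \<in> (\<lambda>x. V (?P x)) ` N" using Ux by (rule image_eqI)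
      qed
    qed
    fix h assume h: "h \<in> N"
    show "cinner (V (?P h)) (V (?P k)) = cinner h k" if k: "k \<in> N" for k
      using U(3)[OF V(1)[OF h] V(1)[OF k]] by (simp add: Pid h k V(2))
    fix a
    have "U (bop_apply (\<pi> a) (V h)) = bop_apply (\<sigma> a) h" by (simp add: U(4) V h)
    then show "V (?P (bop_apply (\<sigma> a) h)) = bop_apply (\<pi> a) (V (?P h))"
      by (intro inj V(1) Pin M(3)) (simp_all add: Pid h N(3) V)
  qed
qed

lemma uequiv_irr:
  assumes "irr \<pi> M" "invariant \<sigma> N" "uequiv \<pi> M \<sigma> N"
  shows "irr \<sigma> N"
proof -
  note M = invariantD[OF irr_invariant[OF assms(1)]]
  obtain U where U: "clinear U" "U ` M = N" "\<And>h k. h \<in> M \<Longrightarrow> k \<in> M \<Longrightarrow> cinner (U h) (U k) = cinner h k"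
    "\<And>a h. h \<in> M \<Longrightarrow> U (bop_apply (\<pi> a) h) = bop_apply (\<sigma> a) (U h)"
    using assms(3) unfolding uequiv_def by blast
  have nU: "norm (U h) = norm h" if "h \<in> M" for h
    using U(3)[OF that that] by (simp add: norm_eq_sqrt_cinner)
  show ?thesis
    unfolding irr_def
  proof (intro conjI allI impI)
    show "invariant \<sigma> N" by fact
    obtain a h where ah: "h \<in> M" "bop_apply (\<pi> a) h \<noteq> 0" using assms(1) unfolding irr_def by blast
    then have "norm (bop_apply (\<sigma> a) (U h)) \<noteq> 0" using nU[OF M(3)[OF ah(1)], of a] U(4)[OF ah(1), of a] by simp
    moreover have "U h \<in> N" using ah(1) U(2) by blast
    ultimately show "\<exists>a. \<exists>h\<in>N. bop_apply (\<sigma> a) h \<noteq> 0" by fastforce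
    fix N' assume N': "invariant \<sigma> N' \<and> N' \<subseteq> N"
    then have N'I: "csubspace N'" "closed N'" "\<And>h a. h \<in> N' \<Longrightarrow> bop_apply (\<sigma> a) h \<in> N'"
      by (simp_all add: invariant_def)
    define M' where "M' = {h\<in>M. U h \<in> N'}"
    have "invariant \<pi> M'"
      unfolding invariant_def
    proof (intro conjI allI ballI)
      have "U 0 = 0" using clinear_scaleC[OF U(1), of 0 0] by simp
      then show "csubspace M'"
        using csubspaceD[OF M(1)] csubspaceD[OF N'I(1)]
        by (intro csubspaceI) (auto simp: M'_def clinear_add[OF U(1)] clinear_scaleC[OF U(1)])
      show "closed M'"
        unfolding closed_sequential_limits
      proof (intro allI impI)
        fix u l assume ul: "(\<forall>n. u n \<in> M') \<and> u \<longlonglongrightarrow> l"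
        then have uM: "\<And>n. u n \<in> M" "\<And>n. U (u n) \<in> N'" and lim: "u \<longlonglongrightarrow> l" by (auto simp: M'_def)
        have l: "l \<in> M" by (rule closed_sequentially[OF M(2) uM(1) lim])
        have eq: "norm (U (u n) - U l) = norm (u n - l)" for n
          using nU[OF csubspaceD(4)[OF M(1) uM(1) l]] by (simp add: clinear_diff[OF U(1)])
        have "(\<lambda>n. norm (u n - l)) \<longlonglongrightarrow> 0" using lim by (simp add: LIM_zero_iff tendsto_norm_zero_iff)
        then have "(\<lambda>n. norm (U (u n) - U l)) \<longlonglongrightarrow> 0" by (simp only: eq)
        then have "(\<lambda>n. U (u n)) \<longlonglongrightarrow> U l" by (simp add: LIM_zero_iff tendsto_norm_zero_iff)
        then have "U l \<in> N'" by (rule closed_sequentially[OF N'I(2) uM(2)])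
        then show "l \<in> M'" using l by (simp add: M'_def)
      qed
      show "bop_apply (\<pi> a) h \<in> M'" if "h \<in> M'" for a h
        using that by (simp add: M'_def M(3) U(4) N'I(3))
    qed
    moreover have "M' \<subseteq> M" by (auto simp: M'_def)
    ultimately consider "M' = {0}" | "M' = M" using irrD[OF assms(1)] by blast
    then show "N' = {0} \<or> N' = N"
    proof cases
      case 1
      have "N' \<subseteq> {0}"
      proof
        fix y assume y: "y \<in> N'"
        then obtain x where x: "x \<in> M" "y = U x" using N' U(2) by blast
        then have "x \<in> M'" using y by (simp add: M'_def)
        then have "x = 0" using 1 by simp
        then show "y \<in> {0}" using x clinear_scaleC[OF U(1), of 0 0] by simp
      qed
      then show ?thesis using csubspaceD(1)[OF N'I(1)] by blast
    next
      case 2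
      then have "N \<subseteq> N'" using U(2) unfolding M'_def by blast
      then show ?thesis using N' by blast
    qed
  qed
qed

lemma uequiv_norm_bound:
  assumes \<pi>: "star_hom \<pi>" and eq: "uequiv \<pi> (rep_space \<pi>) \<sigma> N"
    and K: "0 \<le> K" "\<And>y. y \<in> N \<Longrightarrow> norm (bop_apply (\<sigma> a) y) \<le> K * norm y"
  shows "norm (\<pi> a) \<le> K"
proof -
  note R = csubspace_rep_space[of \<pi>] closed_rep_space[of \<pi>]
  obtain U where U: "U ` rep_space \<pi> = N" "\<And>h k. h \<in> rep_space \<pi> \<Longrightarrow> k \<in> rep_space \<pi> \<Longrightarrow> cinner (U h) (U k) = cinner h k"
    "\<And>a h. h \<in> rep_space \<pi> \<Longrightarrow> U (bop_apply (\<pi> a) h) = bop_apply (\<sigma> a) (U h)"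
    using eq unfolding uequiv_def by blast
  have nU: "norm (U h) = norm h" if "h \<in> rep_space \<pi>" for h
    using U(2)[OF that that] by (simp add: norm_eq_sqrt_cinner)
  show ?thesis
  proof (rule norm_bop_bound[OF K(1)])
    fix h
    let ?p = "bop_apply (proj (rep_space \<pi>)) h"
    have p: "?p \<in> rep_space \<pi>" by (rule proj_in[OF R])
    have "bop_apply (\<pi> a) (h - ?p) = 0"
      by (rule apply_eq_0_if_orthogonal[OF \<pi>]) (rule proj_orthogonal[OF R apply_in_rep_space])
    then have "norm (bop_apply (\<pi> a) h) = norm (bop_apply (\<pi> a) ?p)" by (simp add: bop_apply_diff)
    also have "\<dots> = norm (bop_apply (\<sigma> a) (U ?p))" using nU[OF apply_in_rep_space[of \<pi> a ?p]] U(3)[OF p] by simp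
    also have "\<dots> \<le> K * norm (U ?p)" by (rule K(2)) (use U(1) p in blast)
    also have "\<dots> \<le> K * norm h" unfolding nU[OF p] by (intro mult_left_mono norm_proj_le[OF R] K(1))
    finally show "norm (bop_apply (\<pi> a) h) \<le> K * norm h" .
  qed
qed

lemma uequiv_norm_le:
  "star_hom \<pi> \<Longrightarrow> uequiv \<pi> (rep_space \<pi>) \<sigma> N \<Longrightarrow> norm (\<pi> a) \<le> norm (\<sigma> a)"
  by (rule uequiv_norm_bound[where \<pi> = \<pi> and \<sigma> = \<sigma>]) (simp_all add: norm_bop_apply)

section \<open>Closed orbits and cyclic vectors\<close>

lemma csubspace_clinear_image:
  assumes f: "clinear f" and S: "csubspace S"
  shows "csubspace (f ` S)"
proof (rule csubspaceI)
  have "f 0 \<in> f ` S" by (rule imageI[OF csubspaceD(1)[OF S]])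
  then show "0 \<in> f ` S" by (simp add: clinear_zero[OF f])
next
  fix x y assume "x \<in> f ` S" "y \<in> f ` S"
  then obtain a b where ab: "a \<in> S" "b \<in> S" "x = f a" "y = f b" by blast
  have "f (a + b) \<in> f ` S" by (rule imageI[OF csubspaceD(2)[OF S ab(1,2)]])
  then show "x + y \<in> f ` S" by (simp add: clinear_add[OF f] ab)
next
  fix c x assume "x \<in> f ` S"
  then obtain a where a: "a \<in> S" "x = f a" by blast
  have "f (c *\<^sub>C a) \<in> f ` S" by (rule imageI[OF csubspaceD(3)[OF S a(1)]])
  then show "c *\<^sub>C x \<in> f ` S" by (simp add: clinear_scaleC[OF f] a)
qed

lemma clinear_bop_apply: "clinear (bop_apply T)"
  by (rule clinearI) (simp_all add: bop_apply_add bop_apply_scaleC)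

lemma orbit_invariant:
  assumes w: "clinear w" "\<And>c a. bop_apply (\<rho> c) (w a) = w (c * a)"
  shows "invariant \<rho> (closure (range w))"
  unfolding invariant_def
proof (intro conjI allI ballI)
  show "csubspace (closure (range w))"
    by (intro csubspace_closure csubspace_clinear_image w(1)) simp
  fix a h assume h: "h \<in> closure (range w)"
  obtain f where f: "\<And>n. f n \<in> range w" "f \<longlonglongrightarrow> h" using closure_seqE[OF h] by blast
  have "bop_apply (\<rho> a) (f n) \<in> range w" for n using f(1)[of n] w(2) by auto
  then show "bop_apply (\<rho> a) h \<in> closure (range w)" using tendsto_bop_apply[OF f(2)] by (rule closure_seqI)
qed simp

text \<open>Equal Gram matrices make \<open>u a \<mapsto> v a\<close> isometric, hence extendable to
  the closures. Orbit maps take the place of cyclic vectors because, without a unit, a cyclic vector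
  need not be of the form \<open>u a\<close>.\<close>

lemma orbit_equivalence:
  fixes u :: "'a::cstar_algebra \<Rightarrow> 'h::chilbert_space" and v :: "'a \<Rightarrow> 'k::chilbert_space"
  assumes "clinear u" "clinear v"
    and inner: "\<And>a b. cinner (u a) (u b) = cinner (v a) (v b)"
    and \<pi>u: "\<And>c a. bop_apply (\<pi> c) (u a) = u (c * a)" and \<sigma>v: "\<And>c a. bop_apply (\<sigma> c) (v a) = v (c * a)"
  shows "uequiv \<pi> (closure (range u)) \<sigma> (closure (range v))"
    and "invariant \<pi> (closure (range u))" "invariant \<sigma> (closure (range v))"
proof -
  show I: "invariant \<pi> (closure (range u))" "invariant \<sigma> (closure (range v))"
    by (rule orbit_invariant[OF assms(1) \<pi>u], rule orbit_invariant[OF assms(2) \<sigma>v])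
  note M = invariantD[OF I(1)]
  have norm: "norm (u a) = norm (v a)" for a using inner[of a a] by (simp add: norm_eq_sqrt_cinner)
  define G where "G = range (\<lambda>a. (u a, v a))"
  have G: "(x + x', y + y') \<in> G" if xy: "(x, y) \<in> G" "(x', y') \<in> G" for x y x' y'
  proof -
    obtain a b where "x = u a" "y = v a" "x' = u b" "y' = v b" using xy unfolding G_def by blast
    then have "(x + x', y + y') = (u (a + b), v (a + b))" by (simp add: clinear_add assms(1,2))
    then show ?thesis unfolding G_def by blast
  qed
  have G2: "(c *\<^sub>C x, c *\<^sub>C y) \<in> G" if xy: "(x, y) \<in> G" for c x y
  proof -
    obtain a where "x = u a" "y = v a" using xy unfolding G_def by blast
    then have "(c *\<^sub>C x, c *\<^sub>C y) = (u (c *\<^sub>C a), v (c *\<^sub>C a))" by (simp add: clinear_scaleC assms(1,2))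
    then show ?thesis unfolding G_def by blast
  qed
  have G3: "norm y \<le> 1 * norm x" "norm x \<le> 1 * norm y" if "(x, y) \<in> G" for x y
    using that norm by (auto simp: G_def)
  obtain f where f: "\<And>x. x \<in> closure (fst ` G) \<Longrightarrow> (x, f x) \<in> closure G"
    "\<And>x y. (x, y) \<in> closure G \<Longrightarrow> f x = y"
    "\<And>x y. (x, y) \<in> closure G \<Longrightarrow> norm y \<le> 1 * norm x"
    "\<And>x y. x \<in> closure (fst ` G) \<Longrightarrow> y \<in> closure (fst ` G) \<Longrightarrow> f (x + y) = f x + f y"
    "\<And>c x. x \<in> closure (fst ` G) \<Longrightarrow> f (c *\<^sub>C x) = c *\<^sub>C f x"
    using bounded_relation_extension[OF G G2 G3(1)] by blast
  \<comment> \<open>Extending the inverse relation in the same way yields preimages, and with them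
    surjectivity onto the second closed orbit.\<close>
  define G' where "G' = prod.swap ` G"
  have G': "(x, y) \<in> G' \<longleftrightarrow> (y, x) \<in> G" for x y unfolding G'_def by force
  have H: "(x + x', y + y') \<in> G'" if "(x, y) \<in> G'" "(x', y') \<in> G'" for x y x' y'
    using that unfolding G' by (rule G)
  have H2: "(c *\<^sub>C x, c *\<^sub>C y) \<in> G'" if "(x, y) \<in> G'" for c x y
    using that unfolding G' by (rule G2)
  have H3: "norm y \<le> 1 * norm x" if "(x, y) \<in> G'" for x y
    using that unfolding G' by (rule G3(2))
  obtain g where g: "\<And>x. x \<in> closure (fst ` G') \<Longrightarrow> (x, g x) \<in> closure G'"
    "\<And>x y. (x, y) \<in> closure G' \<Longrightarrow> g x = y"
    "\<And>x y. (x, y) \<in> closure G' \<Longrightarrow> norm y \<le> 1 * norm x"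
    "\<And>x y. x \<in> closure (fst ` G') \<Longrightarrow> y \<in> closure (fst ` G') \<Longrightarrow> g (x + y) = g x + g y"
    "\<And>c x. x \<in> closure (fst ` G') \<Longrightarrow> g (c *\<^sub>C x) = c *\<^sub>C g x"
    using bounded_relation_extension[OF H H2 H3] by blast
  have fstG: "fst ` G = range u" "fst ` G' = range v" by (force simp: G_def G'_def)+
  have seq: "\<exists>w. (\<lambda>n. u (w n)) \<longlonglongrightarrow> x \<and> (\<lambda>n. v (w n)) \<longlonglongrightarrow> y" if xy: "(x, y) \<in> closure G" for x y
  proof -
    obtain p where p: "\<And>n. p n \<in> G" "p \<longlonglongrightarrow> (x, y)" using closure_seqE[OF xy] by blast
    have "\<exists>a. p n = (u a, v a)" for n using p(1)[of n] by (auto simp: G_def)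
    then obtain w where w: "\<And>n. p n = (u (w n), v (w n))" by metis
    then show ?thesis using tendsto_fst[OF p(2)] tendsto_snd[OF p(2)] by (intro exI[of _ w]) simp
  qed
  have seqI: "(x, y) \<in> closure G" if "(\<lambda>n. u (w n)) \<longlonglongrightarrow> x" "(\<lambda>n. v (w n)) \<longlonglongrightarrow> y" for w x y
    by (rule closure_seqI[of "\<lambda>n. (u (w n), v (w n))"]) (auto simp: G_def intro: tendsto_Pair that)
  have cinner: "cinner x x' = cinner y y'" if xy: "(x, y) \<in> closure G" "(x', y') \<in> closure G" for x y x' y'
  proof -
    obtain w where w: "(\<lambda>n. u (w n)) \<longlonglongrightarrow> x" "(\<lambda>n. v (w n)) \<longlonglongrightarrow> y" using seq[OF xy(1)] by blast
    obtain w' where w': "(\<lambda>n. u (w' n)) \<longlonglongrightarrow> x'" "(\<lambda>n. v (w' n)) \<longlonglongrightarrow> y'" using seq[OF xy(2)] by blast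
    have "(\<lambda>n. cinner (u (w n)) (u (w' n))) \<longlonglongrightarrow> cinner x x'" by (rule tendsto_cinner[OF w(1) w'(1)])
    moreover have "(\<lambda>n. cinner (u (w n)) (u (w' n))) \<longlonglongrightarrow> cinner y y'"
      unfolding inner by (rule tendsto_cinner[OF w(2) w'(2)])
    ultimately show ?thesis by (rule LIMSEQ_unique)
  qed
  let ?P = "bop_apply (proj (closure (range u)))"
  note Pin = proj_in[OF M(1,2)] and Pid = proj_id[OF M(1,2)]
  show "uequiv \<pi> (closure (range u)) \<sigma> (closure (range v))"
    unfolding uequiv_def
  proof (intro exI[of _ "\<lambda>x. f (?P x)"] conjI ballI allI)
    show "clinear (\<lambda>x. f (?P x))"
      by (rule clinearI) (simp_all add: bop_apply_add bop_apply_scaleC f(4,5) fstG Pin)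
    show "(\<lambda>x. f (?P x)) ` closure (range u) = closure (range v)"
    proof
      show "(\<lambda>x. f (?P x)) ` closure (range u) \<subseteq> closure (range v)"
      proof (rule image_subsetI)
        fix x assume x: "x \<in> closure (range u)"
        then obtain w where "(\<lambda>n. v (w n)) \<longlonglongrightarrow> f x" using seq[OF f(1)] by (auto simp: fstG)
        then have "f x \<in> closure (range v)" by (intro closure_seqI[of "\<lambda>n. v (w n)"]) auto
        then show "f (?P x) \<in> closure (range v)" by (simp add: Pid x)
      qed
      show "closure (range v) \<subseteq> (\<lambda>x. f (?P x)) ` closure (range u)"
      proof
        fix y assume "y \<in> closure (range v)"
        then have yg: "(y, g y) \<in> closure G'" using g(1) by (simp add: fstG)
        obtain p where p: "\<And>n. p n \<in> G'" "p \<longlonglongrightarrow> (y, g y)" using closure_seqE[OF yg] by blast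
        have "\<exists>a. p n = (v a, u a)" for n using p(1)[of n] by (auto simp: G_def G'_def)
        then obtain w where w: "\<And>n. p n = (v (w n), u (w n))" by metis
        then have lim: "(\<lambda>n. u (w n)) \<longlonglongrightarrow> g y" "(\<lambda>n. v (w n)) \<longlonglongrightarrow> y"
          using tendsto_fst[OF p(2)] tendsto_snd[OF p(2)] by simp_all
        then have "f (g y) = y" by (intro f(2) seqI)
        moreover have gy: "g y \<in> closure (range u)" using lim(1) by (intro closure_seqI[of "\<lambda>n. u (w n)"]) auto
        ultimately have "y = f (?P (g y))" by (simp add: Pid)
        then show "y \<in> (\<lambda>x. f (?P x)) ` closure (range u)" using gy by (rule image_eqI)
      qed
    qed
    fix h assume h: "h \<in> closure (range u)"
    show "cinner (f (?P h)) (f (?P k)) = cinner h k" if k: "k \<in> closure (range u)" for k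
      using cinner[OF f(1) f(1), of h k] h k by (simp add: fstG Pid)
    fix a
    obtain w where w: "(\<lambda>n. u (w n)) \<longlonglongrightarrow> h" "(\<lambda>n. v (w n)) \<longlonglongrightarrow> f h" using seq[OF f(1)] h by (auto simp: fstG)
    have "(bop_apply (\<pi> a) h, bop_apply (\<sigma> a) (f h)) \<in> closure G"
      by (rule seqI[of "\<lambda>n. a * w n"])
        (simp_all add: tendsto_bop_apply[OF w(1)] tendsto_bop_apply[OF w(2)] flip: \<pi>u \<sigma>v)
    then have "f (bop_apply (\<pi> a) h) = bop_apply (\<sigma> a) (f h)" by (rule f(2))
    then show "f (?P (bop_apply (\<pi> a) h)) = bop_apply (\<sigma> a) (f (?P h))"
      using h M(3)[OF h, of a] by (simp add: Pid)
  qed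
qed

lemma clinear_orbit: "star_hom \<pi> \<Longrightarrow> clinear (\<lambda>a. bop_apply (\<pi> a) \<xi>)"
  by (rule clinearI) (simp_all add: star_hom_add star_hom_scaleC bop_apply_linear_left bop_apply_scaleC_left)

lemma irr_cyclic:
  assumes \<pi>: "star_hom \<pi>" and irr: "irr \<pi> M" and \<xi>: "\<xi> \<in> M" "bop_apply (\<pi> a) \<xi> \<noteq> 0"
  shows "closure (range (\<lambda>a. bop_apply (\<pi> a) \<xi>)) = M"
proof -
  note M = invariantD[OF irr_invariant[OF irr]]
  have "invariant \<pi> (closure (range (\<lambda>a. bop_apply (\<pi> a) \<xi>)))"
    by (rule orbit_equivalence(2)[where v = "\<lambda>a. bop_apply (\<pi> a) \<xi>" and \<sigma> = \<pi>])
      (simp_all add: clinear_orbit[OF \<pi>] star_hom_mult[OF \<pi>] bop_apply_times)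
  moreover have "closure (range (\<lambda>a. bop_apply (\<pi> a) \<xi>)) \<subseteq> M"
    by (rule closure_minimal[OF _ M(2)]) (use M(3)[OF \<xi>(1)] in blast)
  moreover have "bop_apply (\<pi> a) \<xi> \<in> closure (range (\<lambda>a. bop_apply (\<pi> a) \<xi>))" by (intro closure_memI rangeI)
  ultimately show ?thesis using irrD[OF irr] \<xi>(2) by blast
qed

text \<open>The vector functional of a nonzero cyclic vector in \<open>M\<close> is fed into the GNS
  construction, whose space has index type \<open>'a\<close>. This gives an irreducible subspace of
  any Hilbert space a class in the spectrum.\<close>

theorem irr_copy:
  fixes \<tau> :: "'a::cstar_algebra \<Rightarrow> 'h::chilbert_space bop"
  assumes \<tau>: "star_hom \<tau>" and irr: "irr \<tau> M"
  obtains \<sigma> :: "'a \<Rightarrow> 'a ell2 bop" where "irreducible_rep \<sigma>" "uequiv \<tau> M \<sigma> (rep_space \<sigma>)"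
proof -
  obtain a0 \<xi> where \<xi>: "\<xi> \<in> M" "bop_apply (\<tau> a0) \<xi> \<noteq> 0" using irr unfolding irr_def by blast
  define F where "F a = cinner \<xi> (bop_apply (\<tau> a) \<xi>)" for a
  have F2: "F (star a * b) = cinner (bop_apply (\<tau> a) \<xi>) (bop_apply (\<tau> b) \<xi>)" for a b
    by (simp add: F_def star_hom_mult[OF \<tau>] star_hom_star[OF \<tau>] bop_apply_times cinner_star_right)
  have "positive_functional F"
    unfolding positive_functional_def
  proof (intro conjI allI)
    show "F (star x) = cnj (F x)" for x
      by (simp add: F_def star_hom_star[OF \<tau>] cinner_star_right) (rule cinner_commute)
    show "0 \<le> Re (F (star x * x))" for x by (simp add: F2 norm_power2_cinner[symmetric])
  qed (simp_all add: F_def star_hom_add[OF \<tau>] star_hom_scaleC[OF \<tau>] bop_apply_linear_left bop_apply_scaleC_left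
      cinner_add_right cinner_scaleC_right)
  then obtain t :: "'a \<Rightarrow> 'a ell2" and \<sigma> :: "'a \<Rightarrow> 'a ell2 bop" where \<sigma>: "star_hom \<sigma>" and t: "clinear t"
    and tt: "\<And>x y. cinner (t x) (t y) = F (star x * y)" and \<sigma>t: "\<And>x y. bop_apply (\<sigma> x) (t y) = t (x * y)"
    and \<sigma>0: "\<forall>x h. (\<forall>y. cinner (t y) h = 0) \<longrightarrow> bop_apply (\<sigma> x) h = 0"
    by (rule gns_construction) (rule that)
  define N where "N = closure (range t)"
  have eq: "uequiv \<tau> M \<sigma> N" and I: "invariant \<sigma> N"
    using orbit_equivalence(1,3)[OF clinear_orbit[OF \<tau>] t, of \<xi> \<tau> \<sigma>]
    by (simp_all add: tt F2 \<sigma>t irr_cyclic[OF \<tau> irr \<xi>] N_def star_hom_mult[OF \<tau>] bop_apply_times)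
  note N = invariantD[OF I]
  have irrN: "irr \<sigma> N" by (rule uequiv_irr[OF irr I eq])
  have "rep_space \<sigma> \<subseteq> N"
  proof (rule rep_space_least[OF N(1,2)])
    fix a h
    have "cinner (t y) (h - bop_apply (proj N) h) = 0" for y
      by (rule proj_orthogonal[OF N(1,2)]) (simp add: N_def closure_memI)
    then have "bop_apply (\<sigma> a) (h - bop_apply (proj N) h) = 0" using \<sigma>0 by blast
    then have "bop_apply (\<sigma> a) h = bop_apply (\<sigma> a) (bop_apply (proj N) h)" by (simp add: bop_apply_diff)
    then show "bop_apply (\<sigma> a) h \<in> N" using N(3)[OF proj_in[OF N(1,2)]] by simp
  qed
  moreover obtain a h where "bop_apply (\<sigma> a) h \<noteq> 0" using irrN unfolding irr_def by blast
  then have "rep_space \<sigma> \<noteq> {0}" using apply_in_rep_space[of \<sigma> a h] by auto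
  ultimately have "rep_space \<sigma> = N" using irrD[OF irrN invariant_rep_space] by blast
  then show ?thesis using that[of \<sigma>] irr_irreducible_rep[OF \<sigma>] irrN eq by simp
qed

lemma closure_proj_image:
  assumes "clinear U" "csubspace M" "closed M" and iso: "\<And>h. h \<in> M \<Longrightarrow> norm (U h) = norm (h::'h::chilbert_space)"
  shows "csubspace (U ` M)" "closed (U ` M :: 'k::chilbert_space set)"
proof -
  note M = csubspaceD[OF assms(2)]
  show "csubspace (U ` M)" by (rule csubspace_clinear_image[OF assms(1,2)])
  show "closed (U ` M)"
    unfolding closed_sequential_limits
  proof (intro allI impI)
    fix y l assume yl: "(\<forall>n. y n \<in> U ` M) \<and> y \<longlonglongrightarrow> l"
    then have "\<forall>n. \<exists>x. x \<in> M \<and> y n = U x" and y: "y \<longlonglongrightarrow> l" by blast+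
    from choice[OF this(1)] obtain x where x: "\<And>n. x n \<in> M" "\<And>n. y n = U (x n)" by blast
    have nx: "norm (x m - x n) = norm (y m - y n)" for m n
      using iso[OF M(4)[OF x(1) x(1)]] by (simp add: x(2) clinear_diff[OF assms(1)])
    have "Cauchy y" using y by (rule LIMSEQ_imp_Cauchy)
    then have "Cauchy x" unfolding Cauchy_iff nx .
    then obtain z where z: "x \<longlonglongrightarrow> z" by (auto simp: Cauchy_convergent_iff convergent_def)
    have zM: "z \<in> M" by (rule closed_sequentially[OF assms(3) x(1) z])
    have "norm (y n - U z) = norm (x n - z)" for n
      using iso[OF M(4)[OF x(1) zM]] by (simp add: x(2) clinear_diff[OF assms(1)])
    then have "(\<lambda>n. norm (y n - U z)) \<longlonglongrightarrow> 0" using z by (simp add: LIM_zero_iff tendsto_norm_zero_iff)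
    then have "y \<longlonglongrightarrow> U z" by (simp add: LIM_zero_iff tendsto_norm_zero_iff)
    with y have "l = U z" by (rule LIMSEQ_unique)
    then show "l \<in> U ` M" using zM by blast
  qed
qed

text \<open>For every real \<open>\<kappa>\<close>, irreducibility makes one of the two factors of
  \<open>(\<bar>S - \<kappa>\<bar> - (S - \<kappa>)) (\<bar>S - \<kappa>\<bar> + (S - \<kappa>)) = 0\<close> vanish, so \<open>S \<ge> \<kappa>\<close> or \<open>S \<le> \<kappa>\<close>.\<close>

lemma schur_dichotomy:
  fixes \<tau> :: "'a::cstar_algebra \<Rightarrow> 'h::chilbert_space bop"
  assumes \<tau>: "star_hom \<tau>" and irr: "irr \<tau> M" and S: "star S = S"
    and comm: "\<And>a. \<tau> a * S = S * \<tau> a" "proj M * S = S * proj M"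
  shows "(\<forall>h\<in>M. \<kappa> * (norm h)\<^sup>2 \<le> Re (cinner h (bop_apply S h))) \<or> (\<forall>h\<in>M. Re (cinner h (bop_apply S h)) \<le> \<kappa> * (norm h)\<^sup>2)"
proof -
  note M = invariantD[OF irr_invariant[OF irr]]
  \<comment> \<open>The functional calculus is available in unital algebras only, so the absolute
    value is formed in the unitization of the operators and mapped back by
    \<open>\<theta>\<close>.\<close>
  define \<theta> :: "'h bop unitization \<Rightarrow> 'h bop" where "\<theta> = unit_rep (\<lambda>T. T)"
  have \<theta>: "star_hom \<theta>" unfolding \<theta>_def by (rule star_hom_unit_rep) (simp add: star_homI)
  have \<theta>u: "\<theta> (to_unit T) = T" for T by (simp add: \<theta>_def unit_rep_to_unit)
  have \<theta>1: "\<theta> 1 = id_bop" unfolding \<theta>_def by (rule unit_rep_one) (simp add: star_homI)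
  define A where "A = to_unit S - \<kappa> *\<^sub>R 1"
  have A: "star A = A"
    by (simp add: A_def star_diff star_scaleR star_hom_star[OF star_hom_to_unit, symmetric] S)
  define Y B where "Y = \<theta> (pabs A)" and "B = \<theta> A"
  have B: "bop_apply B h = bop_apply S h - \<kappa> *\<^sub>R h" for h
    by (simp add: B_def A_def star_hom_diff[OF \<theta>] star_hom_scaleR[OF \<theta>] \<theta>u \<theta>1 bop_apply_linear_left)
  have YY: "Y * Y = B * B" unfolding Y_def B_def by (simp add: pabs_square[OF A] flip: star_hom_mult[OF \<theta>])
  have YB: "Y * B = B * Y" unfolding Y_def B_def
    by (simp add: pabs_commute[OF A, of A] flip: star_hom_mult[OF \<theta>])
  have comY: "T * Y = Y * T" "T * B = B * T" if "T * S = S * T" for T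
  proof -
    have "to_unit T * to_unit S = to_unit S * to_unit T" by (simp only: that star_hom_mult[OF star_hom_to_unit, symmetric])
    then have c: "to_unit T * A = A * to_unit T" by (simp add: A_def algebra_simps)
    have "\<theta> (to_unit T * pabs A) = \<theta> (pabs A * to_unit T)" by (simp add: pabs_commute[OF A c])
    then show "T * Y = Y * T" by (simp add: star_hom_mult[OF \<theta>] \<theta>u Y_def)
    have "\<theta> (to_unit T * A) = \<theta> (A * to_unit T)" by (simp add: c)
    then show "T * B = B * T" by (simp add: star_hom_mult[OF \<theta>] \<theta>u B_def)
  qed
  have Ypos: "0 \<le> Re (cinner h (bop_apply Y h))" for h
    unfolding Y_def by (rule star_hom_pos[OF \<theta> pos_pabs[OF A]])
  define Z where "Z = Y - B"
  have comZ: "T * Z = Z * T" if "T * S = S * T" for T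
    using comY[OF that] by (simp add: Z_def algebra_simps)
  have BZ: "(Y + B) * Z = 0" by (simp add: Z_def algebra_simps YY YB)
  have ZM: "bop_apply Z h \<in> M" if "h \<in> M" for h
  proof -
    have "bop_apply (proj M) (bop_apply Z h) = bop_apply Z (bop_apply (proj M) h)"
      using comZ[OF comm(2)] by (metis bop_apply_times)
    then show ?thesis using proj_in[OF M(1,2), of "bop_apply Z h"] by (simp add: proj_id[OF M(1,2) that])
  qed
  define N where "N = closure (bop_apply Z ` M)"
  have "invariant \<tau> N"
    unfolding invariant_def
  proof (intro conjI allI ballI)
    show "csubspace N"
      unfolding N_def by (intro csubspace_closure csubspace_clinear_image clinear_bop_apply M(1))
    show "closed N" by (simp add: N_def)
    fix a h assume h: "h \<in> N"
    obtain f where f: "\<And>n. f n \<in> bop_apply Z ` M" "f \<longlonglongrightarrow> h" using closure_seqE[OF h[unfolded N_def]] by blast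
    have "bop_apply (\<tau> a) (f n) \<in> bop_apply Z ` M" for n
    proof -
      obtain k where k: "k \<in> M" "f n = bop_apply Z k" using f(1)[of n] by blast
      have "bop_apply (\<tau> a) (f n) = bop_apply Z (bop_apply (\<tau> a) k)"
        unfolding k(2) using comZ[OF comm(1)] by (metis bop_apply_times)
      then show ?thesis using M(3)[OF k(1)] by blast
    qed
    then show "bop_apply (\<tau> a) h \<in> N" unfolding N_def using tendsto_bop_apply[OF f(2)] by (rule closure_seqI)
  qed
  moreover have "N \<subseteq> M" unfolding N_def by (rule closure_minimal[OF _ M(2)]) (use ZM in blast)
  ultimately consider "N = {0}" | "N = M" using irrD[OF irr] by blast
  then show ?thesis
  proof cases
    case 1
    have "\<kappa> * (norm h)\<^sup>2 \<le> Re (cinner h (bop_apply S h))" if h: "h \<in> M" for h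
    proof -
      have "bop_apply Z h \<in> N" unfolding N_def using h by (intro closure_memI imageI)
      then have "bop_apply Y h = bop_apply B h" using 1 by (simp add: Z_def bop_apply_linear_left)
      then show ?thesis using Ypos[of h] by (simp add: B cinner_diff_right cinner_scaleR_right norm_power2_cinner)
    qed
    then show ?thesis by blast
  next
    case 2
    have "Re (cinner h (bop_apply S h)) \<le> \<kappa> * (norm h)\<^sup>2" if h: "h \<in> M" for h
    proof -
      have "bop_apply (Y + B) h = bop_apply 0 h"
      proof (rule bop_eq_on_closure)
        show "h \<in> closure (bop_apply Z ` M)" using h 2 by (simp add: N_def)
        fix y assume "y \<in> bop_apply Z ` M"
        then obtain k where "y = bop_apply Z k" by blast
        then show "bop_apply (Y + B) y = bop_apply 0 y" using BZ by (metis bop_apply_linear_left(4) bop_apply_times)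
      qed
      then have "bop_apply Y h + bop_apply B h = 0" by (simp add: bop_apply_linear_left)
      then have "Re (cinner h (bop_apply Y h)) + Re (cinner h (bop_apply B h)) = 0"
        by (simp flip: cinner_add_right plus_complex.sel)
      then show ?thesis using Ypos[of h] by (simp add: B cinner_diff_right cinner_scaleR_right norm_power2_cinner)
    qed
    then show ?thesis by blast
  qed
qed

text \<open>The compression of the projection onto \<open>N\<close> to \<open>M\<close> commutes
  with the representation. By the dichotomy for every \<open>\<kappa>\<close> it is a scalar, the
  supremum \<open>\<mu>\<close> of its lower bounds. Since \<open>\<mu> > 0\<close>, dividing the
  projection by \<open>sqrt \<mu>\<close> gives an isometric intertwiner, onto because
  \<open>N\<close> is irreducible.\<close>

theorem nonorthogonal_irr_uequiv:
  fixes \<tau> :: "'a::cstar_algebra \<Rightarrow> 'h::chilbert_space bop"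
  assumes \<tau>: "star_hom \<tau>" and irrM: "irr \<tau> M" and irrN: "irr \<tau> N"
    and hk: "h0 \<in> M" "k0 \<in> N" "cinner k0 h0 \<noteq> 0"
  shows "uequiv \<tau> M \<tau> N"
proof -
  note M = invariantD[OF irr_invariant[OF irrM]] and N = invariantD[OF irr_invariant[OF irrN]]
  let ?P = "proj M" and ?Q = "proj N"
  define S where "S = ?P * ?Q * ?P"
  have S: "star S = S" by (simp add: S_def star_mult star_proj[OF M(1,2)] star_proj[OF N(1,2)] mult.assoc)
  have c1: "\<tau> a * S = S * \<tau> a" for a
    by (rule bop_eqI) (simp add: S_def bop_apply_times proj_commute[OF \<tau> irr_invariant[OF irrM]]
        proj_commute[OF \<tau> irr_invariant[OF irrN]])
  have c2: "?P * S = S * ?P"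
    by (rule bop_eqI) (simp add: S_def bop_apply_times proj_id[OF M(1,2)] proj_in[OF M(1,2)])
  have Sq: "Re (cinner h (bop_apply S h)) = (norm (bop_apply ?Q h))\<^sup>2" if h: "h \<in> M" for h
  proof -
    have "cinner h (bop_apply S h) = cinner h (bop_apply ?Q h)"
      by (simp add: S_def bop_apply_times proj_id[OF M(1,2) h] cinner_proj[OF M(1,2) h])
    also have "\<dots> = cinner (bop_apply ?Q h) (bop_apply ?Q h)"
      using cinner_proj[OF N(1,2) proj_in[OF N(1,2)], of h h] by (metis cinner_commute)
    finally show ?thesis by (simp add: norm_power2_cinner)
  qed
  have dich: "(\<forall>h\<in>M. \<kappa> * (norm h)\<^sup>2 \<le> (norm (bop_apply ?Q h))\<^sup>2) \<or> (\<forall>h\<in>M. (norm (bop_apply ?Q h))\<^sup>2 \<le> \<kappa> * (norm h)\<^sup>2)" for \<kappa>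
    using schur_dichotomy[OF \<tau> irrM S c1 c2, of \<kappa>] Sq by simp
  define L where "L = {\<kappa>. \<forall>h\<in>M. \<kappa> * (norm h)\<^sup>2 \<le> (norm (bop_apply ?Q h))\<^sup>2}"
  have h0: "h0 \<noteq> 0" using hk by auto
  have "\<kappa> \<le> 1" if "\<kappa> \<in> L" for \<kappa>
  proof -
    have "\<kappa> * (norm h0)\<^sup>2 \<le> (norm (bop_apply ?Q h0))\<^sup>2" using that hk(1) by (simp add: L_def)
    also have "\<dots> \<le> 1 * (norm h0)\<^sup>2" using norm_proj_le[OF N(1,2), of h0] by (simp add: power_mono)
    finally show ?thesis using h0 by (simp add: mult_le_cancel_right)
  qed
  then have bdd: "bdd_above L" by (rule bdd_aboveI)
  have L0: "0 \<in> L" by (simp add: L_def)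
  define \<mu> where "\<mu> = Sup L"
  have eq: "(norm (bop_apply ?Q h))\<^sup>2 = \<mu> * (norm h)\<^sup>2" if h: "h \<in> M" for h
  proof (cases "h = 0")
    case False
    then have pos: "0 < (norm h)\<^sup>2" by simp
    have "\<mu> \<le> (norm (bop_apply ?Q h))\<^sup>2 / (norm h)\<^sup>2"
      unfolding \<mu>_def
    proof (rule cSup_least)
      show "L \<noteq> {}" using L0 by blast
      show "\<kappa> \<le> (norm (bop_apply ?Q h))\<^sup>2 / (norm h)\<^sup>2" if "\<kappa> \<in> L" for \<kappa>
        using that h pos by (simp add: L_def pos_le_divide_eq)
    qed
    moreover have "(norm (bop_apply ?Q h))\<^sup>2 / (norm h)\<^sup>2 \<le> \<mu>"
    proof (rule dense_ge)
      fix \<kappa> assume "\<mu> < \<kappa>"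
      then have "\<kappa> \<notin> L" using cSup_upper[OF _ bdd] unfolding \<mu>_def by (meson not_le)
      then have "(norm (bop_apply ?Q h))\<^sup>2 \<le> \<kappa> * (norm h)\<^sup>2" using dich[of \<kappa>] h unfolding L_def by blast
      then show "(norm (bop_apply ?Q h))\<^sup>2 / (norm h)\<^sup>2 \<le> \<kappa>" using pos by (simp add: pos_divide_le_eq)
    qed
    ultimately have "(norm (bop_apply ?Q h))\<^sup>2 / (norm h)\<^sup>2 = \<mu>" by (rule antisym[rotated])
    then show ?thesis using pos by (simp add: field_simps)
  qed simp
  have "bop_apply ?Q h0 \<noteq> 0" using hk(3) cinner_proj[OF N(1,2) hk(2), of h0] by auto
  then have "0 < \<mu> * (norm h0)\<^sup>2" unfolding eq[OF hk(1), symmetric] by simp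
  then have \<mu>: "0 < \<mu>" by (simp add: zero_less_mult_iff)
  define U where "U h = (1 / sqrt \<mu>) *\<^sub>R bop_apply ?Q h" for h
  have Us: "U h = complex_of_real (1 / sqrt \<mu>) *\<^sub>C bop_apply ?Q h" for h
    by (simp only: U_def scaleR_scaleC)
  have U: "clinear U"
    by (rule clinearI) (simp_all add: Us bop_apply_add bop_apply_scaleC scaleC_add_right scaleC_scaleC mult.commute)
  have nU: "(norm (U h))\<^sup>2 = (norm h)\<^sup>2" if "h \<in> M" for h
    using eq[OF that] \<mu> by (simp add: U_def power_mult_distrib power_divide)
  have ReU: "Re (cinner (U h) (U k)) = Re (cinner h k)" if "h \<in> M" "k \<in> M" for h k
    using nU[OF csubspaceD(2)[OF M(1) that]] nU[OF that(1)] nU[OF that(2)]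
    by (simp add: clinear_add[OF U] norm_add_power2)
  have iU: "cinner (U h) (U k) = cinner h k" if "h \<in> M" "k \<in> M" for h k
  proof (rule complex_eqI)
    show "Im (cinner (U h) (U k)) = Im (cinner h k)"
      using ReU[OF that(1) csubspaceD(3)[OF M(1) that(2), of \<i>]] by (simp add: clinear_scaleC[OF U] cinner_scaleC_right)
  qed (rule ReU[OF that])
  have nU': "norm (U h) = norm h" if "h \<in> M" for h using nU[OF that] by (rule power2_eq_imp_eq) simp_all
  have U\<tau>: "U (bop_apply (\<tau> a) h) = bop_apply (\<tau> a) (U h)" for a h
    by (simp add: Us proj_commute[OF \<tau> irr_invariant[OF irrN]] bop_apply_scaleC)
  have sub: "U ` M \<subseteq> N"
    using csubspaceD(3)[OF N(1) proj_in[OF N(1,2)]] by (auto simp: Us)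
  have "invariant \<tau> (U ` M)"
    unfolding invariant_def
  proof (intro conjI allI ballI closure_proj_image[OF U M(1,2) nU'])
    fix a y assume "y \<in> U ` M"
    then obtain h where h: "h \<in> M" "y = U h" by blast
    have "bop_apply (\<tau> a) y = U (bop_apply (\<tau> a) h)" by (simp add: h(2) U\<tau>)
    then show "bop_apply (\<tau> a) y \<in> U ` M" using M(3)[OF h(1)] by blast
  qed
  moreover have "U ` M \<noteq> {0}"
  proof
    assume "U ` M = {0}"
    then have "U h0 = 0" using hk(1) by blast
    then show False using nU'[OF hk(1)] h0 by simp
  qed
  ultimately have "U ` M = N" using irrD[OF irrN _ sub] by blast
  then show ?thesis unfolding uequiv_def using U iU U\<tau> by blast
qed

section \<open>Positivity under injective homomorphisms and points of the spectrum\<close>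

text \<open>For \<open>v\<close> in the range of \<open>\<theta> Z\<close>, with
  \<open>Z = \<bar>y\<bar> - y\<close>, the product \<open>(\<bar>y\<bar> + y) * Z = 0\<close> makes
  two nonnegative quadratic forms at \<open>v\<close> add up to 0. Hence
  \<open>\<bar>y\<bar>\<close> and \<open>y\<close> both kill \<open>v\<close>, so \<open>Z\<close>
  does too, and \<open>v = 0\<close>.\<close>

lemma pabs_minus_vanishes:
  fixes \<theta> :: "'u::{cstar_algebra, real_normed_algebra_1} \<Rightarrow> 'h::chilbert_space bop"
  assumes \<theta>: "star_hom \<theta>" and y: "star y = y" and pos: "\<And>h. 0 \<le> Re (cinner h (bop_apply (\<theta> y) h))"
  shows "\<theta> (pabs y - y) = 0"
proof -
  obtain m where m: "star m = m" "m * m = pabs y" using pos_sqrt[OF pos_pabs[OF y]] by metis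
  define Z where "Z = pabs y - y"
  have sZ: "star Z = Z" by (simp add: Z_def star_diff y star_pabs[OF y])
  have c: "y * pabs y = pabs y * y" by (rule pabs_commute[OF y]) simp
  have "(pabs y + y) * Z = 0" by (simp add: Z_def algebra_simps pabs_square[OF y] c)
  then have 0: "bop_apply (\<theta> (pabs y)) (bop_apply (\<theta> Z) h) + bop_apply (\<theta> y) (bop_apply (\<theta> Z) h) = 0" for h
    by (simp add: star_hom_zero[OF \<theta>] bop_apply_linear_left flip: bop_apply_times star_hom_mult[OF \<theta>] distrib_right
        bop_apply_linear_left(1) star_hom_add[OF \<theta>])
  have "bop_apply (\<theta> Z) h = 0" for h
  proof -
    define v where "v = bop_apply (\<theta> Z) h"
    have "Re (cinner v (bop_apply (\<theta> (pabs y)) v)) + Re (cinner v (bop_apply (\<theta> y) v)) = 0"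
      using 0[of h] by (simp flip: cinner_add_right plus_complex.sel v_def)
    moreover have mv: "cinner (bop_apply (\<theta> m) v) (bop_apply (\<theta> m) v) = cinner v (bop_apply (\<theta> (pabs y)) v)"
      using norm_bop_apply_power2[OF \<theta>, of m v] by (simp add: m)
    ultimately have "Re (cinner (bop_apply (\<theta> m) v) (bop_apply (\<theta> m) v)) \<le> 0" using pos[of v] by simp
    then have "bop_apply (\<theta> m) v = 0" by (simp add: norm_power2_cinner[symmetric])
    then have p: "bop_apply (\<theta> (pabs y)) v = 0" by (simp add: star_hom_mult[OF \<theta>] bop_apply_times flip: m(2))
    then have "bop_apply (\<theta> y) v = 0" using 0[of h] by (simp flip: v_def)
    then have "bop_apply (\<theta> Z) v = 0" using p by (simp add: Z_def star_hom_diff[OF \<theta>] bop_apply_linear_left)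
    moreover have "cinner v v = cinner h (bop_apply (\<theta> Z) v)"
      using norm_bop_apply_power2[OF \<theta>, of Z h] by (simp add: v_def sZ star_hom_mult[OF \<theta>] bop_apply_times)
    ultimately show ?thesis by (simp add: cinner_self flip: v_def)
  qed
  then show ?thesis unfolding Z_def[symmetric] by (intro bop_eqI) (simp add: bop_apply_linear_left)
qed

text \<open>The character \<open>scalar_part\<close> sends the absolute value to the absolute value
  of \<open>r\<close>. As \<open>0 \<le> r\<close>, the difference \<open>pabs y - y\<close>
  therefore lies in the algebra itself.\<close>

lemma scalar_part_pabs:
  assumes y: "star y = y" and r: "scalar_part y = complex_of_real r" "0 \<le> r"
  shows "scalar_part (pabs y) = complex_of_real r"
proof -
  obtain m where m: "star m = m" "m * m = pabs y" using pos_sqrt[OF pos_pabs[OF y]] by metis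
  have "cnj (scalar_part m) = scalar_part m" using arg_cong[OF m(1), of scalar_part] by (simp add: scalar_part_simps)
  then obtain t where t: "scalar_part m = complex_of_real t" by (metis Reals_cases Reals_cnj_iff)
  have p: "scalar_part (pabs y) = complex_of_real (t * t)" by (simp add: m(2)[symmetric] scalar_part_simps t)
  have "scalar_part (pabs y * pabs y) = scalar_part (y * y)" by (simp add: pabs_square[OF y])
  then have "complex_of_real ((t * t)\<^sup>2) = complex_of_real (r\<^sup>2)"
    by (simp only: scalar_part_simps p r of_real_mult of_real_power power2_eq_square)
  then have "(t * t)\<^sup>2 = r\<^sup>2" by (simp only: of_real_eq_iff)
  then have "t * t = r" using r(2) by (rule power2_eq_imp_eq[OF _ zero_le_square])
  then show ?thesis by (simp add: p)
qed

text \<open>Injectivity of \<open>\<pi>\<close> says nothing about its extension to the unitization.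
  It becomes usable because, for \<open>0 \<le> r\<close>, the element \<open>pabs y - y\<close>
  killed by the extension has scalar part 0.\<close>

lemma pos_reflect:
  fixes \<pi> :: "'a::cstar_algebra \<Rightarrow> 'h::chilbert_space bop"
  assumes \<pi>: "star_hom \<pi>" and inj: "inj \<pi>" and a: "star a = a" and r: "0 \<le> r"
    and le: "\<And>h. Re (cinner h (bop_apply (\<pi> a) h)) \<le> r * (norm h)\<^sup>2"
  shows "pos (r *\<^sub>R 1 - to_unit a)"
proof -
  define y where "y = r *\<^sub>R 1 - to_unit a"
  have y: "star y = y"
    by (simp add: y_def star_diff star_scaleR a flip: star_hom_star[OF star_hom_to_unit])
  have sy: "scalar_part y = complex_of_real r" by (simp only: y_def scalar_part_simps) (simp add: scaleR_conv_of_real)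
  have "0 \<le> Re (cinner h (bop_apply (unit_rep \<pi> y) h))" for h
    using le[of h] by (simp add: y_def star_hom_diff[OF star_hom_unit_rep[OF \<pi>]] star_hom_scaleR[OF star_hom_unit_rep[OF \<pi>]]
        unit_rep_one[OF \<pi>] unit_rep_to_unit bop_apply_linear_left cinner_diff_right cinner_scaleR_right norm_power2_cinner)
  then have "unit_rep \<pi> (pabs y - y) = 0" by (rule pabs_minus_vanishes[OF star_hom_unit_rep[OF \<pi>] y])
  moreover have s0: "scalar_part (pabs y - y) = 0" by (simp add: scalar_part_simps scalar_part_pabs[OF y sy r] sy)
  ultimately have "\<pi> (alg_part (pabs y - y)) = \<pi> 0" by (simp add: unit_rep_def star_hom_zero[OF \<pi>])
  then have "alg_part (pabs y - y) = 0" by (rule injD[OF inj])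
  then have "pabs y - y = 0" using scalar_part_0_to_unit[OF s0] by (simp add: zero_unitization_def)
  then show ?thesis using pos_pabs[OF y] by (simp add: y_def)
qed

section \<open>Equivalence classes as points of the spectrum\<close>

definition spec_class :: "('a::cstar_algebra \<Rightarrow> 'a ell2 bop) \<Rightarrow> ('a \<Rightarrow> 'a ell2 bop) set"
  where "spec_class \<pi> = {(\<pi>, \<sigma>). irreducible_rep \<pi> \<and> irreducible_rep \<sigma> \<and> unitarily_equivalent \<pi> \<sigma>} `` {\<pi>}"

lemma spec_class_in_spectrum: "irreducible_rep \<pi> \<Longrightarrow> spec_class \<pi> \<in> spectrum"
  unfolding spec_class_def spectrum_def by (rule quotientI) simp

lemma spec_class_self: "irreducible_rep \<pi> \<Longrightarrow> \<pi> \<in> spec_class \<pi>"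
  by (simp add: spec_class_def unitarily_equivalent_iff uequiv_refl)

lemma spec_class_eqI:
  assumes "irreducible_rep \<pi>" "irreducible_rep \<sigma>" "uequiv \<pi> (rep_space \<pi>) \<sigma> (rep_space \<sigma>)"
  shows "spec_class \<pi> = spec_class \<sigma>"
proof -
  have "uequiv \<sigma> (rep_space \<sigma>) \<pi> (rep_space \<pi>)" by (rule uequiv_sym[OF invariant_rep_space invariant_rep_space assms(3)])
  then show ?thesis using assms by (auto simp: spec_class_def unitarily_equivalent_iff intro: uequiv_trans)
qed

lemma spectrum_cases:
  assumes "P \<in> spectrum" "\<pi> \<in> P"
  shows "irreducible_rep \<pi>" "P = spec_class \<pi>"
proof -
  obtain \<sigma> where \<sigma>: "irreducible_rep \<sigma>" "P = spec_class \<sigma>"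
    using assms(1) unfolding spectrum_def spec_class_def by (auto elim: quotientE)
  then have *: "irreducible_rep \<pi>" "uequiv \<sigma> (rep_space \<sigma>) \<pi> (rep_space \<pi>)"
    using assms(2) by (auto simp: spec_class_def unitarily_equivalent_iff)
  show "irreducible_rep \<pi>" by fact
  show "P = spec_class \<pi>" unfolding \<sigma>(2) by (rule spec_class_eqI[OF \<sigma>(1) *])
qed

lemma star_hom_kernel_closed:
  fixes \<pi> :: "'a::cstar_algebra \<Rightarrow> 'h::chilbert_space bop"
  assumes \<pi>: "star_hom \<pi>" shows "closed {x. \<pi> x = 0}"
proof -
  have "bounded_linear \<pi>"
    by (rule bounded_linear_intro[where K = 1])
      (simp_all add: star_hom_add[OF \<pi>] star_hom_scaleR[OF \<pi>] star_hom_contractive[OF \<pi>])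
  then have "continuous_on UNIV \<pi>" by (simp add: linear_continuous_on)
  then show ?thesis by (rule closed_Collect_eq[OF _ continuous_on_const])
qed

text \<open>The common kernel \<open>I\<close> of the irreducible representations \<open>\<pi>\<close> with \<open>norm (\<pi> a) \<le> \<delta>\<close> describes an
  open set of points with \<open>norm (\<pi> a) > \<delta>\<close>. It is nonempty, since the negative part of
  \<open>\<delta>\<^sup>2 - star a * a\<close> lies in \<open>I\<close> but is not killed where the norm of \<open>a\<close> is attained.\<close>

lemma spectrum_point_outside:
  fixes a :: "'a::cstar_algebra"
  assumes free: "topologically_free spectrum_topology R" and \<delta>: "0 \<le> \<delta>" "\<delta> < norm a" and n: "0 < (n::nat)"
  obtains \<pi> :: "'a \<Rightarrow> 'a ell2 bop" where "irreducible_rep \<pi>" "\<delta> < norm (\<pi> a)" "(spec_class \<pi>, spec_class \<pi>) \<notin> R ^^ n"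
proof -
  define small :: "('a \<Rightarrow> 'a ell2 bop) set" where "small = {\<pi>. irreducible_rep \<pi> \<and> norm (\<pi> a) \<le> \<delta>}"
  have small: "star_hom \<pi>" "norm (\<pi> a) \<le> \<delta>" if "\<pi> \<in> small" for \<pi>
    using that irreducible_rep_irr(1) by (auto simp: small_def)
  define I where "I = (\<Inter>\<pi>\<in>small. {x. \<pi> x = 0})"
  have I: "closed_ideal I"
    unfolding closed_ideal_def
  proof (intro conjI ballI allI)
    show "csubspace I"
      by (rule csubspaceI) (auto simp: I_def star_hom_zero[OF small(1)] star_hom_add[OF small(1)] star_hom_scaleC[OF small(1)])
    show "closed I" unfolding I_def by (intro closed_INT ballI star_hom_kernel_closed small(1))
    fix x b assume "x \<in> I"
    then show "x * b \<in> I" "b * x \<in> I" by (auto simp: I_def star_hom_mult[OF small(1)])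
  qed
  then have "openin spectrum_topology (ideal_spectrum I)"
    unfolding spectrum_topology_def by (intro topology_generated_by_Basis) blast
  have "a \<noteq> 0" using \<delta> by auto
  obtain \<rho> :: "'a \<Rightarrow> 'a unitization ell2 bop" where \<rho>: "irreducible_rep \<rho>" "norm (\<rho> a) = norm a"
    by (rule irreducible_rep_norming[OF \<open>a \<noteq> 0\<close>]) (rule that)
  note \<rho>' = irreducible_rep_irr[OF \<rho>(1)]
  obtain \<sigma> :: "'a \<Rightarrow> 'a ell2 bop" where \<sigma>: "irreducible_rep \<sigma>" "uequiv \<rho> (rep_space \<rho>) \<sigma> (rep_space \<sigma>)"
    by (rule irr_copy[OF \<rho>']) (rule that)
  have \<sigma>h: "star_hom \<sigma>" using irreducible_rep_irr(1)[OF \<sigma>(1)] .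
  have \<sigma>a: "norm a \<le> norm (\<sigma> a)" using uequiv_norm_le[OF \<rho>'(1) \<sigma>(2), of a] by (simp add: \<rho>(2))
  define y where "y = \<delta>\<^sup>2 *\<^sub>R 1 - to_unit (star a * a)"
  have y: "star y = y"
    by (simp add: y_def star_diff star_scaleR star_mult star_star flip: star_hom_star[OF star_hom_to_unit])
  have sy: "scalar_part y = complex_of_real (\<delta>\<^sup>2)" by (simp only: y_def scalar_part_simps) (simp add: scaleR_conv_of_real)
  \<comment> \<open>Twice the negative part of \<open>y\<close> belongs to the algebra and not
    merely to its unitization, so it can be tested for membership in the ideal
    \<open>I\<close>.\<close>
  have s0: "scalar_part (pabs y - y) = 0" by (simp only: scalar_part_simps scalar_part_pabs[OF y sy zero_le_power2] sy) simp
  have val: "Re (cinner h (bop_apply (unit_rep \<pi> y) h)) = \<delta>\<^sup>2 * (norm h)\<^sup>2 - (norm (bop_apply (\<pi> a) h))\<^sup>2"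
    if \<pi>: "star_hom \<pi>" for \<pi> :: "'a \<Rightarrow> 'a ell2 bop" and h
    using norm_bop_apply_power2[OF \<pi>, of a h]
    by (simp add: y_def star_hom_diff[OF star_hom_unit_rep[OF \<pi>]] star_hom_scaleR[OF star_hom_unit_rep[OF \<pi>]]
        unit_rep_one[OF \<pi>] unit_rep_to_unit bop_apply_linear_left cinner_diff_right cinner_scaleR_right norm_power2_cinner)
  define x where "x = alg_part (pabs y - y)"
  have ux: "unit_rep \<pi> (pabs y - y) = \<pi> x" for \<pi> :: "'a \<Rightarrow> 'a ell2 bop" by (simp add: unit_rep_def s0 x_def)
  have "x \<in> I"
    unfolding I_def
  proof (intro INT_I CollectI)
    fix \<pi> assume \<pi>: "\<pi> \<in> small"
    have "0 \<le> Re (cinner h (bop_apply (unit_rep \<pi> y) h))" for h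
    proof -
      have "norm (bop_apply (\<pi> a) h) \<le> norm (\<pi> a) * norm h" by (rule norm_bop_apply)
      also have "\<dots> \<le> \<delta> * norm h" by (intro mult_right_mono small(2)[OF \<pi>]) simp
      finally have "(norm (bop_apply (\<pi> a) h))\<^sup>2 \<le> (\<delta> * norm h)\<^sup>2" by (rule power_mono) simp
      then show ?thesis by (simp add: val[OF small(1)[OF \<pi>]] power_mult_distrib)
    qed
    then have "unit_rep \<pi> (pabs y - y) = 0"
      by (rule pabs_minus_vanishes[OF star_hom_unit_rep[OF small(1)[OF \<pi>]] y])
    then show "\<pi> x = 0" by (simp add: ux)
  qed
  moreover have "\<sigma> x \<noteq> 0"
  proof
    assume "\<sigma> x = 0"
    then have eq: "unit_rep \<sigma> (pabs y) = unit_rep \<sigma> y"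
      using ux[of \<sigma>] by (simp add: star_hom_diff[OF star_hom_unit_rep[OF \<sigma>h]])
    have "norm (\<sigma> a) \<le> \<delta>"
    proof (rule norm_bop_bound[OF \<delta>(1)])
      fix h
      have "0 \<le> Re (cinner h (bop_apply (unit_rep \<sigma> y) h))"
        using star_hom_pos[OF star_hom_unit_rep[OF \<sigma>h] pos_pabs[OF y], of h] by (simp add: eq)
      then have "(norm (bop_apply (\<sigma> a) h))\<^sup>2 \<le> (\<delta> * norm h)\<^sup>2" by (simp add: val[OF \<sigma>h] power_mult_distrib)
      then show "norm (bop_apply (\<sigma> a) h) \<le> \<delta> * norm h" by (rule power2_le_imp_le) (simp add: \<delta>)
    qed
    then show False using \<sigma>a \<delta> by simp
  qed
  ultimately have "spec_class \<sigma> \<in> ideal_spectrum I"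
    unfolding ideal_spectrum_def using spec_class_in_spectrum[OF \<sigma>(1)] spec_class_self[OF \<sigma>(1)] by blast
  moreover have "spectrum_topology interior_of {P. (P, P) \<in> R ^^ n} = {}"
    using free n by (simp add: topologically_free_def)
  ultimately have "\<not> ideal_spectrum I \<subseteq> {P. (P, P) \<in> R ^^ n}"
    using interior_of_maximal[OF _ \<open>openin spectrum_topology (ideal_spectrum I)\<close>] by blast
  then obtain P where P: "P \<in> ideal_spectrum I" "(P, P) \<notin> R ^^ n" by blast
  then obtain \<pi> b where \<pi>: "P \<in> spectrum" "\<pi> \<in> P" "b \<in> I" "\<pi> b \<noteq> 0" unfolding ideal_spectrum_def by blast
  note \<pi>' = spectrum_cases[OF \<pi>(1,2)]
  have "\<delta> < norm (\<pi> a)"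
  proof (rule ccontr)
    assume "\<not> \<delta> < norm (\<pi> a)"
    then have "\<pi> \<in> small" using \<pi>'(1) by (simp add: small_def)
    then show False using \<pi>(3,4) by (auto simp: I_def)
  qed
  then show ?thesis using that[of \<pi>] \<pi>' P(2) by simp
qed

section \<open>Extension of irreducible representations\<close>

text \<open>The larger of 0 and the supremum of the real part of the numerical range. The cut at 0
  fits functionals that are positive of norm at most 1 but perhaps not unital, and the condition
  \<open>0 \<le> r\<close> of \<open>pos_reflect\<close>.\<close>

definition upper_value :: "'h::chilbert_space bop \<Rightarrow> real"
  where "upper_value T = Inf {r. 0 \<le> r \<and> (\<forall>h. Re (cinner h (bop_apply T h)) \<le> r * (norm h)\<^sup>2)}"

lemma upper_value_bdd: "bdd_below {r. 0 \<le> r \<and> (\<forall>h. Re (cinner h (bop_apply T h)) \<le> r * (norm h)\<^sup>2)}"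
  by (rule bdd_belowI[of _ 0]) simp

lemma upper_value_le:
  "0 \<le> r \<Longrightarrow> (\<And>h. Re (cinner h (bop_apply T h)) \<le> r * (norm h)\<^sup>2) \<Longrightarrow> upper_value T \<le> r"
  unfolding upper_value_def by (rule cInf_lower[OF _ upper_value_bdd]) simp

lemma norm_upper_bound: "Re (cinner h (bop_apply T h)) \<le> norm T * (norm h)\<^sup>2"
proof -
  have "Re (cinner h (bop_apply T h)) \<le> norm h * norm (bop_apply T h)" by (rule Re_cinner_le)
  also have "\<dots> \<le> norm h * (norm T * norm h)" by (intro mult_left_mono norm_bop_apply) simp
  finally show ?thesis by (simp add: power2_eq_square mult_ac)
qed

lemma upper_value_ne: "{r. 0 \<le> r \<and> (\<forall>h. Re (cinner h (bop_apply T h)) \<le> r * (norm h)\<^sup>2)} \<noteq> {}"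
  using norm_upper_bound[of _ T] norm_ge_zero[of T] by blast

lemma upper_value_nonneg: "0 \<le> upper_value T"
  unfolding upper_value_def by (rule cInf_greatest[OF upper_value_ne]) simp

lemma upper_value_bound: "Re (cinner h (bop_apply T h)) \<le> upper_value T * (norm h)\<^sup>2"
proof (cases "h = 0")
  case False
  then have p: "0 < (norm h)\<^sup>2" by simp
  have "Re (cinner h (bop_apply T h)) / (norm h)\<^sup>2 \<le> upper_value T"
    unfolding upper_value_def
  proof (rule cInf_greatest[OF upper_value_ne])
    fix r assume "r \<in> {r. 0 \<le> r \<and> (\<forall>h. Re (cinner h (bop_apply T h)) \<le> r * (norm h)\<^sup>2)}"
    then show "Re (cinner h (bop_apply T h)) / (norm h)\<^sup>2 \<le> r" using p by (simp add: pos_divide_le_eq)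
  qed
  then show ?thesis using p by (simp add: pos_divide_le_eq)
qed simp

lemma sublinear_upper_value: "sublinear upper_value"
  unfolding sublinear_def
proof (intro conjI allI impI)
  fix S T :: "'a bop"
  show "upper_value (S + T) \<le> upper_value S + upper_value T"
  proof (rule upper_value_le)
    show "Re (cinner h (bop_apply (S + T) h)) \<le> (upper_value S + upper_value T) * (norm h)\<^sup>2" for h
      using upper_value_bound[of h S] upper_value_bound[of h T]
      by (simp add: bop_apply_linear_left cinner_add_right distrib_right)
  qed (simp add: upper_value_nonneg)
next
  fix r :: real and T :: "'a bop" assume r: "0 < r"
  show "upper_value (r *\<^sub>R T) \<le> r * upper_value T"
  proof (rule upper_value_le)
    show "Re (cinner h (bop_apply (r *\<^sub>R T) h)) \<le> (r * upper_value T) * (norm h)\<^sup>2" for h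
      using upper_value_bound[of h T] r by (simp add: bop_apply_linear_left cinner_scaleR_right mult.assoc)
  qed (use r in \<open>simp add: upper_value_nonneg\<close>)
qed

lemma cinner_Complex:
  assumes "star_hom \<pi>"
  shows "Complex (Re (cinner \<xi> (bop_apply (\<pi> a) \<xi>))) (- Re (cinner \<xi> (bop_apply (\<pi> (\<i> *\<^sub>C a)) \<xi>)))
    = cinner \<xi> (bop_apply (\<pi> a) \<xi>)"
  by (simp add: complex_eq_iff star_hom_scaleC[OF assms] bop_apply_scaleC_left cinner_scaleC_right)

text \<open>A vector state of \<open>\<sigma>\<close>, carried along \<open>\<pi>\<close>, extends
  to a positive functional on all operators. In its GNS space the vectors \<open>t (\<pi> a)\<close>
  have the inner products of \<open>\<sigma>(a) \<xi>\<close>, so their closure \<open>M\<close>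
  carries a copy of \<open>\<sigma>\<close>.\<close>

theorem irreducible_rep_extension:
  fixes \<pi> :: "'a::cstar_algebra \<Rightarrow> 'h::chilbert_space bop" and \<sigma> :: "'a \<Rightarrow> 'k::chilbert_space bop"
  assumes \<pi>: "star_hom \<pi>" and inj: "inj \<pi>" and irr: "irreducible_rep \<sigma>"
  obtains \<tau> :: "'h bop \<Rightarrow> 'h bop ell2 bop" and M
  where "star_hom \<tau>" "irr (\<lambda>a. \<tau> (\<pi> a)) M" "uequiv \<sigma> (rep_space \<sigma>) (\<lambda>a. \<tau> (\<pi> a)) M"
proof -
  note \<sigma> = irreducible_rep_irr[OF irr]
  note R = invariantD[OF invariant_rep_space[of \<sigma>]]
  obtain a0 \<xi>0 where \<xi>0: "\<xi>0 \<in> rep_space \<sigma>" "bop_apply (\<sigma> a0) \<xi>0 \<noteq> 0" using \<sigma>(2) unfolding irr_def by blast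
  then have "\<xi>0 \<noteq> 0" by auto
  define \<xi> where "\<xi> = complex_of_real (1 / norm \<xi>0) *\<^sub>C \<xi>0"
  have n\<xi>: "norm \<xi> = 1" using \<open>\<xi>0 \<noteq> 0\<close> by (simp add: \<xi>_def norm_scaleC norm_divide)
  have \<xi>: "\<xi> \<in> rep_space \<sigma>" unfolding \<xi>_def by (rule csubspaceD(3)[OF R(1) \<xi>0(1)])
  have \<xi>': "bop_apply (\<sigma> a0) \<xi> \<noteq> 0"
  proof
    assume "bop_apply (\<sigma> a0) \<xi> = 0"
    then have "norm (complex_of_real (1 / norm \<xi>0) *\<^sub>C bop_apply (\<sigma> a0) \<xi>0) = 0" by (simp add: \<xi>_def bop_apply_scaleC)
    then show False using \<xi>0(2) \<open>\<xi>0 \<noteq> 0\<close> by (simp add: norm_scaleC norm_divide)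
  qed
  have cyc: "closure (range (\<lambda>a. bop_apply (\<sigma> a) \<xi>)) = rep_space \<sigma>" by (rule irr_cyclic[OF \<sigma> \<xi> \<xi>'])
  define g where "g a = Re (cinner \<xi> (bop_apply (\<sigma> a) \<xi>))" for a
  have lin_g: "linear g"
    by (rule linearI) (simp_all add: g_def star_hom_add[OF \<sigma>(1)] star_hom_scaleR[OF \<sigma>(1)] bop_apply_linear_left
      cinner_add_right cinner_scaleR_right)
  have lin_\<pi>: "linear \<pi>" by (rule linearI) (simp_all add: star_hom_add[OF \<pi>] star_hom_scaleR[OF \<pi>])
  \<comment> \<open>An upper bound for the operator \<open>\<pi> a\<close> is pulled back to the
    algebra by \<open>pos_reflect\<close> and then pushed forward by \<open>\<sigma>\<close>. This
    is where the injectivity of \<open>\<pi>\<close> enters.\<close>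
  have le: "g a \<le> upper_value (\<pi> a)" for a
  proof -
    have "pos (upper_value (\<pi> a) *\<^sub>R 1 - to_unit (re_part a))"
    proof (rule pos_reflect[OF \<pi> inj star_re_part upper_value_nonneg])
      show "Re (cinner h (bop_apply (\<pi> (re_part a)) h)) \<le> upper_value (\<pi> a) * (norm h)\<^sup>2" for h
        unfolding Re_cinner_re_part[OF \<pi>] by (rule upper_value_bound)
    qed
    from star_hom_pos[OF star_hom_unit_rep[OF \<sigma>(1)] this, of \<xi>]
    show ?thesis
      by (simp add: star_hom_diff[OF star_hom_unit_rep[OF \<sigma>(1)]] star_hom_scaleR[OF star_hom_unit_rep[OF \<sigma>(1)]]
          unit_rep_one[OF \<sigma>(1)] unit_rep_to_unit bop_apply_linear_left cinner_diff_right cinner_scaleR_right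
          Re_cinner_re_part[OF \<sigma>(1)] g_def norm_power2_cinner[symmetric] n\<xi>)
  qed
  obtain f where f: "linear f" "\<And>x. f x \<le> upper_value x" "\<And>a. f (\<pi> a) = g a"
    by (rule hahn_banach_range[OF sublinear_upper_value lin_\<pi> lin_g le]) (rule that)
  have f0: "f T \<le> 0" if T: "\<And>h. Re (cinner h (bop_apply T h)) \<le> 0" for T
  proof -
    have "upper_value T \<le> 0" by (rule upper_value_le) (simp_all add: T)
    then show ?thesis using f(2)[of T] by simp
  qed
  have star_Re: "Re (cinner h (bop_apply (star T) h)) = Re (cinner h (bop_apply T h))" for T :: "'h bop" and h
    unfolding cinner_star_right by (subst cinner_commute) simp
  have fs: "f (star T) = f T" for T
  proof -
    have "f (star T - T) \<le> 0" by (rule f0) (simp add: bop_apply_linear_left cinner_diff_right star_Re)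
    moreover have "f (T - star T) \<le> 0" by (rule f0) (simp add: bop_apply_linear_left cinner_diff_right star_Re)
    ultimately show ?thesis by (simp add: linear_diff[OF f(1)])
  qed
  have fp: "0 \<le> f (star T * T)" for T
  proof -
    have "f (- (star T * T)) \<le> 0"
    proof (rule f0)
      fix h
      have "cinner h (bop_apply (star T * T) h) = cinner (bop_apply T h) (bop_apply T h)"
        by (simp add: bop_apply_times cinner_star_right)
      then show "Re (cinner h (bop_apply (- (star T * T)) h)) \<le> 0"
        by (simp add: bop_apply_linear_left cinner_minus_right norm_power2_cinner[symmetric])
    qed
    then show ?thesis by (simp add: linear_neg[OF f(1)])
  qed
  define F where "F = (\<lambda>T. Complex (f T) (- f (\<i> *\<^sub>C T)))"
  have F: "positive_functional F" unfolding F_def by (rule positive_functional_complexify[OF f(1) fs fp])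
  have F\<pi>: "F (\<pi> a) = cinner \<xi> (bop_apply (\<sigma> a) \<xi>)" for a
    unfolding F_def star_hom_scaleC[OF \<pi>, symmetric] f(3) g_def by (rule cinner_Complex[OF \<sigma>(1)])
  obtain t :: "'h bop \<Rightarrow> 'h bop ell2" and \<tau> :: "'h bop \<Rightarrow> 'h bop ell2 bop" where \<tau>: "star_hom \<tau>" and t: "clinear t"
    and tt: "\<And>x y. cinner (t x) (t y) = F (star x * y)" and \<tau>t: "\<And>x y. bop_apply (\<tau> x) (t y) = t (x * y)"
    and "\<forall>x h. (\<forall>y. cinner (t y) h = 0) \<longrightarrow> bop_apply (\<tau> x) h = 0"
    by (rule gns_construction[OF F]) (rule that)
  define M where "M = closure (range (\<lambda>a. t (\<pi> a)))"
  have v: "clinear (\<lambda>a. t (\<pi> a))"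
    by (rule clinearI) (simp_all add: star_hom_add[OF \<pi>] star_hom_scaleC[OF \<pi>] clinear_add[OF t] clinear_scaleC[OF t])
  have inner: "cinner (bop_apply (\<sigma> a) \<xi>) (bop_apply (\<sigma> b) \<xi>) = cinner (t (\<pi> a)) (t (\<pi> b))" for a b
  proof -
    have "cinner (t (\<pi> a)) (t (\<pi> b)) = F (\<pi> (star a * b))"
      by (simp add: tt star_hom_mult[OF \<pi>] star_hom_star[OF \<pi>])
    also have "\<dots> = cinner (bop_apply (\<sigma> a) \<xi>) (bop_apply (\<sigma> b) \<xi>)"
      by (simp add: F\<pi> star_hom_mult[OF \<sigma>(1)] star_hom_star[OF \<sigma>(1)] bop_apply_times cinner_star_right)
    finally show ?thesis ..
  qed
  have 1: "bop_apply (\<sigma> c) (bop_apply (\<sigma> a) \<xi>) = bop_apply (\<sigma> (c * a)) \<xi>" for c a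
    by (simp add: star_hom_mult[OF \<sigma>(1)] bop_apply_times)
  have 2: "bop_apply (\<tau> (\<pi> c)) (t (\<pi> a)) = t (\<pi> (c * a))" for c a by (simp add: \<tau>t star_hom_mult[OF \<pi>])
  note orb = orbit_equivalence[OF clinear_orbit[OF \<sigma>(1), of \<xi>] v inner 1 2, folded M_def, unfolded cyc]
  show ?thesis using that[OF \<tau> uequiv_irr[OF \<sigma>(2) orb(3) orb(1)] orb(1)] .
qed

section \<open>Iterated Rieffel induction inside a covariant representation\<close>

lemma covariant_repD:
  assumes "covariant_rep lact ract ipL ipR \<pi>A \<pi>X"
  shows "star_hom \<pi>A" "clinear \<pi>X" "\<pi>X (lact a x) = \<pi>A a * \<pi>X x" "\<pi>X (ract x a) = \<pi>X x * \<pi>A a"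
    "\<pi>A (ipR x y) = star (\<pi>X x) * \<pi>X y" "\<pi>A (ipL x y) = \<pi>X x * star (\<pi>X y)"
  using assms by (simp_all add: covariant_rep_def)

lemma covariant_rep_compose:
  assumes "covariant_rep lact ract ipL ipR \<pi>A \<pi>X" "star_hom \<phi>"
  shows "covariant_rep lact ract ipL ipR (\<lambda>a. \<phi> (\<pi>A a)) (\<lambda>x. \<phi> (\<pi>X x))"
  unfolding covariant_rep_def
proof (intro conjI allI)
  note c = covariant_repD[OF assms(1)]
  show "star_hom (\<lambda>a. \<phi> (\<pi>A a))" by (rule star_hom_compose[OF c(1) assms(2)])
  show "clinear (\<lambda>x. \<phi> (\<pi>X x))"
    by (rule clinearI) (simp_all add: clinear_add[OF c(2)] clinear_scaleC[OF c(2)] star_hom_add[OF assms(2)] star_hom_scaleC[OF assms(2)])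
qed (simp_all add: covariant_repD(3-6)[OF assms(1)] star_hom_mult[OF assms(2)] star_hom_star[OF assms(2)])

lemma bop_closure_span_into:
  assumes "csubspace N" "closed N" "\<And>y. y \<in> S \<Longrightarrow> bop_apply T y \<in> N" "y \<in> closure (cspan S)"
  shows "bop_apply T y \<in> N"
proof -
  have span: "bop_apply T z \<in> N" if "z \<in> cspan S" for z
    using that
  proof (induction rule: complex_vector.span_induct_alt)
    case base
    then show ?case using csubspaceD(1)[OF assms(1)] by simp
  next
    case (step c x y)
    then show ?case
      using csubspaceD(2)[OF assms(1) csubspaceD(3)[OF assms(1) assms(3)[OF step(1)], of c] step(2)]
      by (simp add: bop_apply_add bop_apply_scaleC)
  qed
  obtain u where u: "\<And>n. u n \<in> cspan S" "u \<longlonglongrightarrow> y" using closure_seqE[OF assms(4)] by blast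
  show ?thesis by (rule closed_sequentially[OF assms(2) span[OF u(1)] tendsto_bop_apply[OF u(2)]])
qed

text \<open>In a covariant representation this is a concrete copy of the tensor product of
  \<open>X\<close> with \<open>M\<close>: \<open>\<tau>X x h\<close> has the inner products of
  \<open>x \<otimes> h\<close>, by the formula for \<open>ipR\<close>.\<close>

definition xspan :: "('x \<Rightarrow> 'h::chilbert_space bop) \<Rightarrow> 'h set \<Rightarrow> 'h set"
  where "xspan \<tau>X M = closure (cspan {bop_apply (\<tau>X x) h | x h. h \<in> M})"

lemma xspan_subspace: "csubspace (xspan \<tau>X M)" and closed_xspan: "closed (xspan \<tau>X M)"
  unfolding xspan_def by (simp_all add: csubspace_closure)

lemma in_xspan: "h \<in> M \<Longrightarrow> bop_apply (\<tau>X x) h \<in> xspan \<tau>X M"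
  unfolding xspan_def by (intro closure_memI complex_vector.span_base) blast

lemma xspan_into:
  assumes "csubspace N" "closed N" "\<And>x h. h \<in> M \<Longrightarrow> bop_apply T (bop_apply (\<tau>X x) h) \<in> N" "y \<in> xspan \<tau>X M"
  shows "bop_apply T y \<in> N"
  by (rule bop_closure_span_into[OF assms(1,2) _ assms(4)[unfolded xspan_def]]) (use assms(3) in blast)

lemma xspan_least:
  assumes "csubspace N" "closed N" "\<And>x h. h \<in> M \<Longrightarrow> bop_apply (\<tau>X x) h \<in> N"
  shows "xspan \<tau>X M \<subseteq> N"
  unfolding xspan_def by (intro closure_minimal complex_vector.span_minimal assms) (use assms(3) in blast)

text \<open>Irreducibility passes through the adjoints of \<open>X\<close>. For invariant
  \<open>N\<close> inside the induced space, the span \<open>N1\<close> of the adjoints applied to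
  \<open>N\<close> is 0 or \<open>M\<close>. If it is 0, then \<open>N\<close> is orthogonal to the
  whole induced space; if it is \<open>M\<close>, the formula for \<open>ipL\<close> brings the
  induced space back into \<open>N\<close>.\<close>

lemma rieffel_step:
  fixes \<tau>A :: "'a::cstar_algebra \<Rightarrow> 'h::chilbert_space bop" and \<tau>X :: "'x::complex_vector \<Rightarrow> 'h bop"
    and \<sigma> :: "'a \<Rightarrow> 'a ell2 bop"
  assumes cov: "covariant_rep lact ract ipL ipR \<tau>A \<tau>X" and irr: "irr \<tau>A M"
    and \<sigma>: "irreducible_rep \<sigma>" and eq: "uequiv \<tau>A M \<sigma> (rep_space \<sigma>)" and ne: "xspan \<tau>X M \<noteq> {0}"
  obtains \<sigma>' where "irr \<tau>A (xspan \<tau>X M)" "irreducible_rep \<sigma>'" "uequiv \<tau>A (xspan \<tau>X M) \<sigma>' (rep_space \<sigma>')"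
    "(spec_class \<sigma>, spec_class \<sigma>') \<in> dual_partial_homeo lact ipR"
proof -
  note c = covariant_repD[OF cov]
  note M = invariantD[OF irr_invariant[OF irr]]
  define M' where "M' = xspan \<tau>X M"
  have M': "csubspace M'" "closed M'" by (simp_all add: M'_def xspan_subspace closed_xspan)
  have XM: "bop_apply (\<tau>X x) h \<in> M'" if "h \<in> M" for x h unfolding M'_def using that by (rule in_xspan)
  have inv: "invariant \<tau>A M'"
    unfolding invariant_def
  proof (intro conjI M' allI ballI)
    fix a h assume "h \<in> M'"
    then show "bop_apply (\<tau>A a) h \<in> M'"
      unfolding M'_def
    proof (rule xspan_into[OF xspan_subspace closed_xspan, rotated])
      show "bop_apply (\<tau>A a) (bop_apply (\<tau>X x) h) \<in> xspan \<tau>X M" if "h \<in> M" for x h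
        using in_xspan[where \<tau>X = \<tau>X and x = "lact a x", OF that] by (simp add: c(3) bop_apply_times)
    qed
  qed
  have "\<exists>x h. h \<in> M \<and> bop_apply (\<tau>X x) h \<noteq> 0"
  proof (rule ccontr)
    assume "\<not> ?thesis"
    then have "xspan \<tau>X M \<subseteq> {0}" by (intro xspan_least csubspaceI) auto
    then show False using ne csubspaceD(1)[OF xspan_subspace] by blast
  qed
  then obtain x0 h0 where h0: "h0 \<in> M" "bop_apply (\<tau>X x0) h0 \<noteq> 0" by blast
  have ip: "cinner h (bop_apply (\<tau>A (ipR x y)) k) = cinner (bop_apply (\<tau>X x) h) (bop_apply (\<tau>X y) k)" for x y h k
    by (simp add: c(5) bop_apply_times cinner_star_right)
  have irr': "irr \<tau>A M'"
    unfolding irr_def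
  proof (intro conjI allI impI)
    show "invariant \<tau>A M'" by fact
    let ?T = "\<tau>X x0"
    \<comment> \<open>With \<open>T = \<tau>X x0\<close>, the operator of \<open>ipL x0 x0\<close>
      is \<open>T * star T\<close>. If it killed \<open>T h0\<close>, then
      \<open>star T T h0\<close> would have norm 0, and hence \<open>T h0\<close> as well.\<close>
    have "bop_apply (\<tau>A (ipL x0 x0)) (bop_apply ?T h0) \<noteq> 0"
    proof
      assume "bop_apply (\<tau>A (ipL x0 x0)) (bop_apply ?T h0) = 0"
      then have 0: "bop_apply ?T (bop_apply (star ?T) (bop_apply ?T h0)) = 0" by (simp add: c(6) bop_apply_times)
      let ?v = "bop_apply (star ?T) (bop_apply ?T h0)"
      have "cinner ?v ?v = cinner (bop_apply ?T h0) (bop_apply ?T ?v)" by (rule cinner_star_left)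
      then have "cinner ?v ?v = 0" by (simp add: 0)
      then have v: "?v = 0" by (simp add: cinner_self)
      have "cinner (bop_apply ?T h0) (bop_apply ?T h0) = cinner h0 ?v" by (simp add: cinner_star_right)
      then have "bop_apply ?T h0 = 0" unfolding v by (simp add: cinner_self)
      then show False using h0 by simp
    qed
    then show "\<exists>a. \<exists>h\<in>M'. bop_apply (\<tau>A a) h \<noteq> 0" using XM[OF h0(1)] by blast
    fix N assume N: "invariant \<tau>A N \<and> N \<subseteq> M'"
    then have NI: "csubspace N" "closed N" "\<And>h a. h \<in> N \<Longrightarrow> bop_apply (\<tau>A a) h \<in> N" and NM: "N \<subseteq> M'"
      by (simp_all add: invariant_def)
    let ?X' = "\<lambda>x. star (\<tau>X x)"
    define N1 where "N1 = xspan ?X' N"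
    have X'M: "bop_apply (?X' x) y \<in> M" if y: "y \<in> M'" for x y
    proof (rule xspan_into[OF M(1,2) _ y[unfolded M'_def]])
      show "bop_apply (?X' x) (bop_apply (\<tau>X z) h) \<in> M" if "h \<in> M" for z h
        using M(3)[OF that, of "ipR x z"] by (simp add: c(5) bop_apply_times)
    qed
    have N1M: "N1 \<subseteq> M"
      unfolding N1_def by (rule xspan_least[OF M(1,2)]) (use X'M NM in blast)
    have "invariant \<tau>A N1"
      unfolding invariant_def
    proof (intro conjI allI ballI)
      fix a h assume "h \<in> N1"
      then show "bop_apply (\<tau>A a) h \<in> N1"
        unfolding N1_def
      proof (rule xspan_into[OF xspan_subspace closed_xspan, rotated])
        fix x h assume h: "h \<in> N"
        have "\<tau>A a * ?X' x = star (\<tau>X x * \<tau>A (star a))"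
          by (simp add: star_mult star_hom_star[OF c(1)] star_star)
        then have "\<tau>A a * ?X' x = ?X' (ract x (star a))" by (simp add: c(4))
        then have "bop_apply (\<tau>A a) (bop_apply (?X' x) h) = bop_apply (?X' (ract x (star a))) h"
          by (simp flip: bop_apply_times)
        then show "bop_apply (\<tau>A a) (bop_apply (?X' x) h) \<in> xspan ?X' N"
          using in_xspan[where \<tau>X = ?X' and x = "ract x (star a)", OF h] by simp
      qed
    qed (simp_all add: N1_def xspan_subspace closed_xspan)
    then consider "N1 = {0}" | "N1 = M" using irrD[OF irr _ N1M] by blast
    then show "N = {0} \<or> N = M'"
    proof cases
      case 1
      have "n = 0" if n: "n \<in> N" for n
      proof -
        have ort: "cinner n (bop_apply (\<tau>X x) h) = 0" for x h
        proof -
          have "bop_apply (?X' x) n \<in> N1" unfolding N1_def by (rule in_xspan[where \<tau>X = ?X', OF n])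
          then have "bop_apply (?X' x) n = 0" using 1 by simp
          then have "cinner (bop_apply (?X' x) n) h = 0" by simp
          then show ?thesis by (simp add: cinner_star_left)
        qed
        have "xspan \<tau>X M \<subseteq> {y. cinner n y = 0}"
        proof (rule xspan_least)
          show "csubspace {y. cinner n y = 0}"
            by (rule csubspaceI) (simp_all add: cinner_add_right cinner_scaleC_right)
          show "closed {y. cinner n y = 0}"
            unfolding closed_sequential_limits
          proof (intro allI impI)
            fix u l assume u: "(\<forall>m. u m \<in> {y. cinner n y = 0}) \<and> u \<longlonglongrightarrow> l"
            then have "(\<lambda>m. cinner n (u m)) \<longlonglongrightarrow> cinner n l" by (intro tendsto_cinner_right) simp
            then have "(\<lambda>m. 0) \<longlonglongrightarrow> cinner n l" using u by simp
            then show "l \<in> {y. cinner n y = 0}" by (simp add: LIMSEQ_const_iff)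
          qed
        qed (simp add: ort)
        then have "cinner n n = 0" using n NM by (auto simp: M'_def)
        then show ?thesis by (simp add: cinner_self)
      qed
      then show ?thesis using csubspaceD(1)[OF NI(1)] by auto
    next
      case 2
      have "M' \<subseteq> N"
        unfolding M'_def
      proof (rule xspan_least[OF NI(1,2)])
        fix x h assume "h \<in> M"
        then have "h \<in> xspan ?X' N" using 2 by (simp add: N1_def)
        then show "bop_apply (\<tau>X x) h \<in> N"
        proof (rule xspan_into[OF NI(1,2), rotated])
          show "bop_apply (\<tau>X x) (bop_apply (?X' y) n) \<in> N" if "n \<in> N" for y n
            using NI(3)[OF that, of "ipL x y"] by (simp add: c(6) bop_apply_times)
        qed
      qed
      then show ?thesis using NM by blast
    qed
  qed
  obtain \<sigma>' :: "'a \<Rightarrow> 'a ell2 bop" where \<sigma>': "irreducible_rep \<sigma>'" "uequiv \<tau>A M' \<sigma>' (rep_space \<sigma>')"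
    by (rule irr_copy[OF c(1) irr']) (rule that)
  have "uequiv \<sigma> (rep_space \<sigma>) \<tau>A M"
    by (rule uequiv_sym[OF irr_invariant[OF irr] invariant_rep_space eq])
  then obtain W where W: "clinear W" "W ` rep_space \<sigma> = M"
    "\<And>h k. h \<in> rep_space \<sigma> \<Longrightarrow> k \<in> rep_space \<sigma> \<Longrightarrow> cinner (W h) (W k) = cinner h k"
    "\<And>a h. h \<in> rep_space \<sigma> \<Longrightarrow> W (bop_apply (\<sigma> a) h) = bop_apply (\<tau>A a) (W h)"
    unfolding uequiv_def by blast
  have WM: "W h \<in> M" if "h \<in> rep_space \<sigma>" for h using that W(2) by blast
  obtain V where V: "clinear V" "V ` M' = rep_space \<sigma>'"
    "\<And>h k. h \<in> M' \<Longrightarrow> k \<in> M' \<Longrightarrow> cinner (V h) (V k) = cinner h k"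
    "\<And>a h. h \<in> M' \<Longrightarrow> V (bop_apply (\<tau>A a) h) = bop_apply (\<sigma>' a) (V h)"
    using \<sigma>'(2) unfolding uequiv_def by blast
  have nV: "norm (V h) = norm h" if "h \<in> M'" for h
    using V(3)[OF that that] by (simp add: norm_eq_sqrt_cinner)
  have "rieffel_induced lact ipR \<sigma> \<sigma>'"
    unfolding rieffel_induced_def
  \<comment> \<open>\<open>W\<close> carries the space of \<open>\<sigma>\<close> onto
    \<open>M\<close> and \<open>V\<close> carries the induced space onto that of
    \<open>\<sigma>'\<close>; between them \<open>\<tau>X x\<close> performs the tensoring with
    \<open>x\<close>.\<close>
  proof (intro exI[of _ "\<lambda>x h. V (bop_apply (\<tau>X x) (W h))"] conjI allI ballI)
    fix x y h k assume h: "h \<in> rep_space \<sigma>" and k: "k \<in> rep_space \<sigma>"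
    have "cinner (V (bop_apply (\<tau>X x) (W h))) (V (bop_apply (\<tau>X y) (W k))) = cinner (W h) (bop_apply (\<tau>A (ipR x y)) (W k))"
      by (simp add: V(3) XM WM h k ip)
    also have "\<dots> = cinner (W h) (W (bop_apply (\<sigma> (ipR x y)) k))" by (simp add: W(4) k)
    also have "\<dots> = cinner h (bop_apply (\<sigma> (ipR x y)) k)" by (simp add: W(3) h apply_in_rep_space)
    finally show "cinner (V (bop_apply (\<tau>X x) (W h))) (V (bop_apply (\<tau>X y) (W k))) = cinner h (bop_apply (\<sigma> (ipR x y)) k)" .
  next
    fix a x h assume h: "h \<in> rep_space \<sigma>"
    show "bop_apply (\<sigma>' a) (V (bop_apply (\<tau>X x) (W h))) = V (bop_apply (\<tau>X (lact a x)) (W h))"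
      by (simp add: V(4)[symmetric] XM WM h c(3) bop_apply_times)
  next
    define S where "S = {V (bop_apply (\<tau>X x) (W h)) | x h. h \<in> rep_space \<sigma>}"
    have SM: "V (bop_apply (\<tau>X x) m) \<in> S" if m: "m \<in> M" for x m
    proof -
      obtain h where "h \<in> rep_space \<sigma>" "m = W h" using m W(2) by blast
      then show ?thesis by (auto simp: S_def)
    qed
    have "closure (cspan S) = rep_space \<sigma>'"
    proof
      show "closure (cspan S) \<subseteq> rep_space \<sigma>'"
      proof (intro closure_minimal complex_vector.span_minimal csubspace_rep_space closed_rep_space)
        show "S \<subseteq> rep_space \<sigma>'" using V(2) XM WM by (auto simp: S_def)
      qed
      have span: "V y \<in> cspan S" if "y \<in> cspan {bop_apply (\<tau>X x) h | x h. h \<in> M}" for y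
        using that
      proof (induction rule: complex_vector.span_induct_alt)
        case base
        show ?case by (simp add: clinear_zero[OF V(1)] complex_vector.span_zero)
      next
        case (step c x y)
        then obtain z m where "m \<in> M" "x = bop_apply (\<tau>X z) m" by blast
        then have "V x \<in> cspan S" using SM by (simp add: complex_vector.span_base)
        then show ?case using step(2)
          by (simp add: clinear_add[OF V(1)] clinear_scaleC[OF V(1)] complex_vector.span_add complex_vector.span_scale)
      qed
      show "rep_space \<sigma>' \<subseteq> closure (cspan S)"
      proof
        fix z assume "z \<in> rep_space \<sigma>'"
        then obtain y where y: "y \<in> M'" "z = V y" using V(2) by blast
        obtain u where u: "\<And>n. u n \<in> cspan {bop_apply (\<tau>X x) h | x h. h \<in> M}" "u \<longlonglongrightarrow> y"
          using closure_seqE[OF y(1)[unfolded M'_def xspan_def]] by blast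
        have uM: "u n \<in> M'" for n unfolding M'_def xspan_def by (rule closure_memI[OF u(1)])
        have eq: "norm (V (u n) - V y) = norm (u n - y)" for n
          using nV[OF csubspaceD(4)[OF M'(1) uM y(1)]] by (simp add: clinear_diff[OF V(1)])
        have "(\<lambda>n. norm (u n - y)) \<longlonglongrightarrow> 0" using u(2) by (simp add: LIM_zero_iff tendsto_norm_zero_iff)
        then have "(\<lambda>n. norm (V (u n) - V y)) \<longlonglongrightarrow> 0" by (simp only: eq)
        then have "(\<lambda>n. V (u n)) \<longlonglongrightarrow> z" unfolding y(2) by (simp add: LIM_zero_iff tendsto_norm_zero_iff)
        then show "z \<in> closure (cspan S)" by (rule closure_seqI[rotated]) (rule span[OF u(1)])
      qed
    qed
    then show "closure (cspan {V (bop_apply (\<tau>X x) (W h)) | x h. h \<in> rep_space \<sigma>}) = rep_space \<sigma>'"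
      by (simp add: S_def)
  qed
  moreover have "spec_class \<sigma> \<in> ideal_spectrum (right_inner_ideal ipR)"
  proof -
    have "ipR x0 x0 \<in> right_inner_ideal ipR"
      unfolding right_inner_ideal_def by (intro closure_memI complex_vector.span_base) blast
    moreover have "\<sigma> (ipR x0 x0) \<noteq> 0"
    proof
      assume 0: "\<sigma> (ipR x0 x0) = 0"
      obtain k where k: "k \<in> rep_space \<sigma>" "h0 = W k" using h0(1) W(2) by blast
      have "bop_apply (\<tau>A (ipR x0 x0)) h0 = 0"
        using W(4)[OF k(1), of "ipR x0 x0"] by (simp add: k(2) 0 bop_apply_linear_left clinear_zero[OF W(1)])
      then have "cinner (bop_apply (\<tau>X x0) h0) (bop_apply (\<tau>X x0) h0) = 0" by (simp flip: ip)
      then show False using h0(2) by (simp add: cinner_self)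
    qed
    ultimately show ?thesis
      unfolding ideal_spectrum_def using spec_class_in_spectrum[OF \<sigma>] spec_class_self[OF \<sigma>] by blast
  qed
  ultimately have "(spec_class \<sigma>, spec_class \<sigma>') \<in> dual_partial_homeo lact ipR"
    unfolding dual_partial_homeo_def
    using spec_class_in_spectrum[OF \<sigma>'(1)] spec_class_self[OF \<sigma>] spec_class_self[OF \<sigma>'(1)] by blast
  then show ?thesis using that[of \<sigma>'] irr' \<sigma>' by (simp add: M'_def)
qed

text \<open>A nonzero space after \<open>Suc k\<close> inductions forces the space after
  \<open>k\<close> inductions to be nonzero, so the single step can be iterated.\<close>

lemma rieffel_chain:
  fixes \<tau>A :: "'a::cstar_algebra \<Rightarrow> 'h::chilbert_space bop" and \<tau>X :: "'x::complex_vector \<Rightarrow> 'h bop"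
    and \<sigma> :: "'a \<Rightarrow> 'a ell2 bop"
  assumes cov: "covariant_rep lact ract ipL ipR \<tau>A \<tau>X" and irr: "irr \<tau>A M"
    and \<sigma>: "irreducible_rep \<sigma>" and eq: "uequiv \<tau>A M \<sigma> (rep_space \<sigma>)" and ne: "(xspan \<tau>X ^^ k) M \<noteq> {0}"
  shows "irr \<tau>A ((xspan \<tau>X ^^ k) M) \<and> (\<exists>\<sigma>'. irreducible_rep \<sigma>' \<and>
    uequiv \<tau>A ((xspan \<tau>X ^^ k) M) \<sigma>' (rep_space \<sigma>') \<and> (spec_class \<sigma>, spec_class \<sigma>') \<in> dual_partial_homeo lact ipR ^^ k)"
  using ne
proof (induction k)
  case 0
  then show ?case using irr \<sigma> eq by auto
next
  case (Suc k)
  let ?N = "(xspan \<tau>X ^^ k) M"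
  have "?N \<noteq> {0}"
  proof
    assume "?N = {0}"
    then have "xspan \<tau>X ?N \<subseteq> {0}" by (intro xspan_least csubspaceI) auto
    then show False using Suc.prems csubspaceD(1)[OF xspan_subspace[of \<tau>X ?N]] by auto
  qed
  with Suc.IH obtain \<sigma>' where *: "irr \<tau>A ?N" "irreducible_rep \<sigma>'" "uequiv \<tau>A ?N \<sigma>' (rep_space \<sigma>')"
    "(spec_class \<sigma>, spec_class \<sigma>') \<in> dual_partial_homeo lact ipR ^^ k" by blast
  have ne: "xspan \<tau>X ?N \<noteq> {0}" using Suc.prems by simp
  obtain \<sigma>'' where "irr \<tau>A (xspan \<tau>X ?N)" "irreducible_rep \<sigma>''" "uequiv \<tau>A (xspan \<tau>X ?N) \<sigma>'' (rep_space \<sigma>'')"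
    "(spec_class \<sigma>', spec_class \<sigma>'') \<in> dual_partial_homeo lact ipR"
    by (rule rieffel_step[OF cov *(1,2,3) ne]) (rule that)
  then show ?case using *(4) by (auto intro!: relpow_Suc_I)
qed

text \<open>A nonzero inner product would make the \<open>k\<close>-fold induced subspace equivalent
  to \<open>M\<close>. Its class is reached from that of \<open>\<sigma>\<close> by the
  \<open>k\<close>-th power, so the latter would have a fixed point where none is allowed.\<close>

lemma rieffel_orthogonal:
  fixes \<tau>A :: "'a::cstar_algebra \<Rightarrow> 'h::chilbert_space bop" and \<tau>X :: "'x::complex_vector \<Rightarrow> 'h bop"
    and \<sigma> :: "'a \<Rightarrow> 'a ell2 bop"
  assumes cov: "covariant_rep lact ract ipL ipR \<tau>A \<tau>X" and irr: "irr \<tau>A M"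
    and \<sigma>: "irreducible_rep \<sigma>" and eq: "uequiv \<tau>A M \<sigma> (rep_space \<sigma>)"
    and free: "(spec_class \<sigma>, spec_class \<sigma>) \<notin> dual_partial_homeo lact ipR ^^ k"
    and h: "h \<in> M" and y: "y \<in> (xspan \<tau>X ^^ k) M"
  shows "cinner h y = 0"
proof (rule ccontr)
  assume n: "cinner h y \<noteq> 0"
  let ?N = "(xspan \<tau>X ^^ k) M"
  have "?N \<noteq> {0}"
  proof
    assume "?N = {0}"
    with y have "y = 0" by simp
    then show False using n by simp
  qed
  from rieffel_chain[OF cov irr \<sigma> eq this] obtain \<sigma>' where N: "irr \<tau>A ?N" and \<sigma>': "irreducible_rep \<sigma>'"
    "uequiv \<tau>A ?N \<sigma>' (rep_space \<sigma>')" "(spec_class \<sigma>, spec_class \<sigma>') \<in> dual_partial_homeo lact ipR ^^ k" by blast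
  have "uequiv \<tau>A ?N \<tau>A M" by (rule nonorthogonal_irr_uequiv[OF covariant_repD(1)[OF cov] N irr y h n])
  then have "uequiv \<tau>A ?N \<sigma> (rep_space \<sigma>)" using eq by (rule uequiv_trans)
  moreover have "uequiv \<sigma>' (rep_space \<sigma>') \<tau>A ?N"
    by (rule uequiv_sym[OF irr_invariant[OF N] invariant_rep_space \<sigma>'(2)])
  ultimately have "uequiv \<sigma>' (rep_space \<sigma>') \<sigma> (rep_space \<sigma>)" by (rule uequiv_trans[rotated])
  then have "spec_class \<sigma>' = spec_class \<sigma>" by (rule spec_class_eqI[OF \<sigma>'(1) \<sigma>])
  then show False using free \<sigma>'(3) by simp
qed

lemma relpow_fixed_mult: "(x, x) \<in> R ^^ k \<Longrightarrow> (x, x) \<in> R ^^ (k * m)"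
proof (induction m)
  case (Suc m)
  then have "(x, x) \<in> R ^^ k O R ^^ (k * m)" by blast
  then show ?case by (simp add: relpow_add)
qed simp

section \<open>Integrated forms on arbitrary Hilbert spaces\<close>

text \<open>Pairing folds a list into one element. The length is stored as well, because folding
  from the fixed base \<open>n 0\<close> can be undone only when the length is known.\<close>

lemma infinite_inj_list:
  fixes f :: "'l \<Rightarrow> 'i"
  assumes inf: "infinite (UNIV :: 'i set)" and f: "inj f"
  obtains e :: "'l list \<Rightarrow> 'i" where "inj e"
proof -
  have "(card_of (UNIV \<times> UNIV :: ('i \<times> 'i) set), card_of (UNIV :: 'i set)) \<in> ordIso" using inf by (rule card_of_Times_same_infinite)
  then obtain p :: "'i \<times> 'i \<Rightarrow> 'i" where "bij_betw p (UNIV \<times> UNIV) UNIV" using card_of_ordIso by blast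
  then have p: "inj p" by (simp add: bij_betw_def)
  obtain n :: "nat \<Rightarrow> 'i" where n: "inj n" using inf unfolding infinite_iff_countable_subset by blast
  define enc where "enc = foldr (\<lambda>x y. p (f x, y)) "
  have enc: "u = w" if "length u = length w" "enc u (n 0) = enc w (n 0)" for u w
    using that
  proof (induction u w rule: list_induct2)
    case (Cons x xs y ys)
    then have "(f x, enc xs (n 0)) = (f y, enc ys (n 0))" by (simp add: enc_def inj_eq[OF p])
    then show ?case using Cons.IH by (simp add: inj_eq[OF f])
  qed simp
  define e where "e w = p (n (length w), enc w (n 0))" for w
  have "inj e"
    by (rule injI) (use enc in \<open>auto simp: e_def inj_eq[OF p] inj_eq[OF n]\<close>)
  then show ?thesis by (rule that)
qed

text \<open>The letters are elements of the algebra, elements of the bimodule, and a second copy of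
  the bimodule for adjoints; \<open>n 0\<close> and \<open>n 1\<close> serve as tags.\<close>

lemma infinite_inj_letters:
  assumes inf: "infinite (UNIV :: ('a + 'x) set)"
  obtains f :: "('a + 'x) + 'x \<Rightarrow> 'a + 'x" where "inj f"
proof -
  have "(card_of (UNIV \<times> UNIV :: (('a + 'x) \<times> ('a + 'x)) set), card_of (UNIV :: ('a + 'x) set)) \<in> ordIso"
    using inf by (rule card_of_Times_same_infinite)
  then obtain p :: "('a + 'x) \<times> ('a + 'x) \<Rightarrow> 'a + 'x" where "bij_betw p (UNIV \<times> UNIV) UNIV" using card_of_ordIso by blast
  then have p: "inj p" by (simp add: bij_betw_def)
  obtain n :: "nat \<Rightarrow> 'a + 'x" where n: "inj n" using inf unfolding infinite_iff_countable_subset by blast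
  have "n 0 \<noteq> n 1" using n by (simp add: inj_eq)
  then have "inj (\<lambda>l. case l of Inl z \<Rightarrow> p (n 0, z) | Inr x \<Rightarrow> p (n 1, Inr x))"
    by (intro injI) (auto simp: inj_eq[OF p] split: sum.splits)
  then show ?thesis by (rule that)
qed

text \<open>The graph of the integrated form on noncommutative polynomials in the generators and
  their adjoints. Single-valuedness is not built in; it results from the norm estimate.\<close>

inductive_set joint_algebra :: "('a \<Rightarrow> 'c::cstar_algebra) \<Rightarrow> ('x \<Rightarrow> 'c) \<Rightarrow> ('a \<Rightarrow> 'b::cstar_algebra) \<Rightarrow> ('x \<Rightarrow> 'b) \<Rightarrow> ('c \<times> 'b) set"
  for jA jX \<pi>A \<pi>X where
  joint_A: "(jA a, \<pi>A a) \<in> joint_algebra jA jX \<pi>A \<pi>X"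
| joint_X: "(jX x, \<pi>X x) \<in> joint_algebra jA jX \<pi>A \<pi>X"
| joint_X_star: "(star (jX x), star (\<pi>X x)) \<in> joint_algebra jA jX \<pi>A \<pi>X"
| joint_add: "(c, S) \<in> joint_algebra jA jX \<pi>A \<pi>X \<Longrightarrow> (d, T) \<in> joint_algebra jA jX \<pi>A \<pi>X \<Longrightarrow>
    (c + d, S + T) \<in> joint_algebra jA jX \<pi>A \<pi>X"
| joint_scale: "(c, S) \<in> joint_algebra jA jX \<pi>A \<pi>X \<Longrightarrow> (z *\<^sub>C c, z *\<^sub>C S) \<in> joint_algebra jA jX \<pi>A \<pi>X"
| joint_mult: "(c, S) \<in> joint_algebra jA jX \<pi>A \<pi>X \<Longrightarrow> (d, T) \<in> joint_algebra jA jX \<pi>A \<pi>X \<Longrightarrow>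
    (c * d, S * T) \<in> joint_algebra jA jX \<pi>A \<pi>X"

lemma joint_star:
  assumes "(c, S) \<in> joint_algebra jA jX \<pi>A \<pi>X" "star_hom jA" "star_hom \<pi>A"
  shows "(star c, star S) \<in> joint_algebra jA jX \<pi>A \<pi>X"
  using assms(1)
proof induction
  case (joint_A a)
  show ?case using joint_algebra.joint_A[of jA "star a" \<pi>A jX \<pi>X] by (simp add: star_hom_star assms(2,3))
qed (simp_all add: star_star star_add star_scaleC star_mult joint_algebra.intros)

text \<open>The counting of words requires \<open>'a + 'x\<close> to be infinite, which can fail for
  the zero algebra. In that case definiteness of the inner product makes the bimodule zero
  too.\<close>

lemma joint_algebra_trivial:
  fixes \<pi>A :: "'a::cstar_algebra \<Rightarrow> 'b::cstar_algebra" and \<pi>X :: "'x::complex_vector \<Rightarrow> 'b"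
  assumes "hilbert_bimodule lact ract ipL ipR" "covariant_rep lact ract ipL ipR \<pi>A \<pi>X"
    and triv: "\<And>a::'a. a = 0" and "(c, S) \<in> joint_algebra jA jX \<pi>A \<pi>X"
  shows "S = 0"
proof -
  interpret hilbert_bimodule lact ract ipL ipR by fact
  note cov = covariant_repD[OF assms(2)]
  have x: "x = 0" for x :: 'x by (rule ipR_definite) (rule triv)
  have X0: "\<pi>X x = 0" for x by (subst x[of x]) (rule clinear_zero[OF cov(2)])
  have A0: "\<pi>A a = 0" for a by (subst triv[of a]) (rule star_hom_zero[OF cov(1)])
  show ?thesis using assms(4) by induction (simp_all add: X0 A0)
qed

text \<open>A vector \<open>h\<close> generates a space spanned by the words in the generators applied to \<open>h\<close>. There are
  no more of them than elements of \<open>'a + 'x\<close>, so this space embeds into \<open>('a + 'x) ell2\<close>, where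
  universality applies.\<close>

lemma joint_algebra_norm_le:
  fixes jA :: "'a::cstar_algebra \<Rightarrow> 'c::cstar_algebra" and jX :: "'x::complex_vector \<Rightarrow> 'c"
    and \<pi>A :: "'a \<Rightarrow> 'h::chilbert_space bop" and \<pi>X :: "'x \<Rightarrow> 'h bop"
  assumes bim: "hilbert_bimodule lact ract ipL ipR" and cp: "crossed_product lact ract ipL ipR jA jX"
    and cov: "covariant_rep lact ract ipL ipR \<pi>A \<pi>X" and cS: "(c, S) \<in> joint_algebra jA jX \<pi>A \<pi>X"
  shows "norm S \<le> norm c"
proof (cases "\<forall>a::'a. a = 0")
  case True
  then have "S = 0" using joint_algebra_trivial[OF bim cov _ cS] by blast
  then show ?thesis by simp
next
  case False
  then obtain a0 :: 'a where a0: "a0 \<noteq> 0" by blast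
  have "inj (\<lambda>r::real. r *\<^sub>R a0)" using a0 by (intro injI) simp
  then have "infinite (range (\<lambda>r::real. r *\<^sub>R a0))" using infinite_UNIV_char_0 finite_imageD by blast
  then have "infinite (UNIV :: 'a set)" using finite_subset subset_UNIV by blast
  then have "infinite (UNIV :: ('a + 'x) set)" by (simp add: finite_Plus_UNIV_iff)
  then obtain e :: "(('a + 'x) + 'x) list \<Rightarrow> 'a + 'x" where e: "inj e"
    using infinite_inj_letters infinite_inj_list by metis
  note c = covariant_repD[OF cov]
  define lop where "lop l = (case l of Inl (Inl a) \<Rightarrow> \<pi>A a | Inl (Inr x) \<Rightarrow> \<pi>X x | Inr x \<Rightarrow> star (\<pi>X x))" for l
  show ?thesis
  proof (rule norm_bop_bound)
    fix h
    define F where "F w = foldr (\<lambda>l. bop_apply (lop l)) w h" for w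
    define D where "D = range F"
    define g where "g d = e (SOME w. F w = d)" for d
    have "inj_on g D"
    proof (rule inj_onI)
      fix d d' assume "d \<in> D" "d' \<in> D" "g d = g d'"
      then have eq: "(SOME w. F w = d) = (SOME w. F w = d')" by (simp add: g_def inj_eq[OF e])
      have d: "F (SOME w. F w = d) = d" using \<open>d \<in> D\<close> unfolding D_def by (auto intro: someI)
      have d': "F (SOME w. F w = d') = d'" using \<open>d' \<in> D\<close> unfolding D_def by (auto intro: someI)
      show "d = d'" using d unfolding eq d' by (rule sym)
    qed
    then obtain t :: "'h \<Rightarrow> ('a + 'x) ell2" where t: "\<And>x y. x \<in> cspan D \<Longrightarrow> y \<in> cspan D \<Longrightarrow> cinner (t x) (t y) = cinner x y"
      by (rule psd_form_embedding[OF psd_form_cinner]) (rule that)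
    define W where "W = cspan D"
    have W: "csubspace W" by (simp add: W_def)
    have tW: "cinner (t x) (t y) = cinner x y" if "x \<in> W" "y \<in> W" for x y using t that by (simp add: W_def)
    have nt: "norm (t x) = norm x" if "x \<in> W" for x using tW[OF that that] by (simp add: norm_eq_sqrt_cinner)
    interpret transport W t
      using form_embedding_linear[OF psd_form_cinner W tW] by unfold_locales (use W in blast)+
    \<comment> \<open>Operators leaving the span \<open>W\<close> of all words applied to
      \<open>h\<close> invariant. On them passage to the embedded copy of \<open>W\<close> respects
      products, and adjoints when the adjoint also preserves \<open>W\<close>; this is why adjoint
      letters are included in the words.\<close>
    define pres where "pres = {T. \<forall>v\<in>W. bop_apply T v \<in> W}"
    have lop: "lop l \<in> pres" for l
    proof -
      have "bop_apply (lop l) v \<in> W" if "v \<in> cspan D" for v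
        using that
      proof (induction rule: complex_vector.span_induct_alt)
        case base
        show ?case using csubspaceD(1)[OF W] by simp
      next
        case (step z x y)
        then obtain w where "x = F w" by (auto simp: D_def)
        then have "bop_apply (lop l) x = F (l # w)" by (simp add: F_def)
        then have "bop_apply (lop l) x \<in> W" unfolding W_def by (intro complex_vector.span_base) (simp add: D_def)
        then show ?case using step(2) csubspaceD(2,3)[OF W] by (simp add: bop_apply_add bop_apply_scaleC)
      qed
      then show ?thesis by (simp add: pres_def W_def)
    qed
    have pA: "\<pi>A a \<in> pres" for a using lop[of "Inl (Inl a)"] by (simp add: lop_def)
    have pX: "\<pi>X x \<in> pres" for x using lop[of "Inl (Inr x)"] by (simp add: lop_def)
    have pX': "star (\<pi>X x) \<in> pres" for x using lop[of "Inr x"] by (simp add: lop_def)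
    have padd: "S + T \<in> pres" if "S \<in> pres" "T \<in> pres" for S T
      using that csubspaceD(2)[OF W] by (simp add: pres_def bop_apply_linear_left)
    have pscale: "z *\<^sub>C S \<in> pres" if "S \<in> pres" for S z
      using that csubspaceD(3)[OF W] by (simp add: pres_def bop_apply_scaleC_left)
    have pmult: "S * T \<in> pres" if "S \<in> pres" "T \<in> pres" for S T
      using that by (simp add: pres_def bop_apply_times)
    have tr: "transportable (bop_apply T)" if "T \<in> pres" for T
      unfolding transportable_def
    proof (intro conjI ballI allI exI[of _ "norm T"] norm_ge_zero)
      show "bop_apply T x \<in> W" if "x \<in> W" for x using that \<open>T \<in> pres\<close> by (simp add: pres_def)
      then show "norm (t (bop_apply T x)) \<le> norm T * norm (t x)" if "x \<in> W" for x
        using that by (simp add: nt norm_bop_apply)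
    qed (simp_all add: bop_apply_add bop_apply_scaleC)
    define \<Lambda> where "\<Lambda> T = lift (bop_apply T)" for T
    have Ladd: "\<Lambda> (S + T) = \<Lambda> S + \<Lambda> T" if "S \<in> pres" "T \<in> pres" for S T
      unfolding \<Lambda>_def by (rule lift_add) (simp_all add: tr that padd bop_apply_linear_left)
    have Lscale: "\<Lambda> (z *\<^sub>C S) = z *\<^sub>C \<Lambda> S" if "S \<in> pres" for S z
      unfolding \<Lambda>_def by (rule lift_scaleC) (simp_all add: tr that pscale bop_apply_scaleC_left)
    have Lmult: "\<Lambda> (S * T) = \<Lambda> S * \<Lambda> T" if "S \<in> pres" "T \<in> pres" for S T
      unfolding \<Lambda>_def by (rule lift_mult) (simp_all add: tr that pmult bop_apply_times)
    have Lstar: "\<Lambda> (star S) = star (\<Lambda> S)" if S: "S \<in> pres" "star S \<in> pres" for S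
      unfolding \<Lambda>_def
    proof (rule lift_star[OF tr[OF S(1)] tr[OF S(2)]])
      fix x y assume x: "x \<in> W" and y: "y \<in> W"
      have "bop_apply S x \<in> W" "bop_apply (star S) y \<in> W" using S x y by (simp_all add: pres_def)
      then show "cinner (t (bop_apply S x)) (t y) = cinner (t x) (t (bop_apply (star S) y))"
        by (simp add: tW x y cinner_star_right)
    qed
    have cov': "covariant_rep lact ract ipL ipR (\<lambda>a. \<Lambda> (\<pi>A a)) (\<lambda>x. \<Lambda> (\<pi>X x))"
      unfolding covariant_rep_def
    proof (intro conjI allI)
      show "star_hom (\<lambda>a. \<Lambda> (\<pi>A a))"
      proof (rule star_homI)
        show "\<Lambda> (\<pi>A (star a)) = star (\<Lambda> (\<pi>A a))" for a
          using Lstar[OF pA[of a]] pA[of "star a"] by (simp add: star_hom_star[OF c(1)])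
      qed (simp_all add: star_hom_add[OF c(1)] star_hom_scaleC[OF c(1)] star_hom_mult[OF c(1)] Ladd Lscale Lmult pA)
      show "clinear (\<lambda>x. \<Lambda> (\<pi>X x))"
        by (rule clinearI) (simp_all add: clinear_add[OF c(2)] clinear_scaleC[OF c(2)] Ladd Lscale pX)
    qed (simp_all add: c(3-6) Lmult Lstar pA pX pX')
    then obtain \<rho> where \<rho>: "integrated_form jA jX (\<lambda>a. \<Lambda> (\<pi>A a)) (\<lambda>x. \<Lambda> (\<pi>X x)) \<rho>"
      using cp unfolding crossed_product_def by blast
    then have \<rho>h: "star_hom \<rho>" and \<rho>A: "\<And>a. \<rho> (jA a) = \<Lambda> (\<pi>A a)" and \<rho>X: "\<And>x. \<rho> (jX x) = \<Lambda> (\<pi>X x)"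
      by (simp_all add: integrated_form_def)
    have "S \<in> pres \<and> \<rho> c = \<Lambda> S"
      using cS
      by induction (simp_all add: pA pX pX' padd pscale pmult \<rho>A \<rho>X Ladd Lscale Lmult Lstar star_hom_star[OF \<rho>h]
          star_hom_add[OF \<rho>h] star_hom_scaleC[OF \<rho>h] star_hom_mult[OF \<rho>h])
    then have S: "S \<in> pres" "\<rho> c = \<Lambda> S" by blast+
    have "F [] \<in> W" unfolding W_def by (intro complex_vector.span_base) (simp add: D_def)
    then have h: "h \<in> W" by (simp add: F_def)
    then have Sh: "bop_apply S h \<in> W" using S(1) by (simp add: pres_def)
    have "norm (bop_apply S h) = norm (bop_apply (\<rho> c) (t h))"
      unfolding S(2) \<Lambda>_def by (simp add: lift_apply[OF tr[OF S(1)] h] nt[OF Sh])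
    also have "\<dots> \<le> norm (\<rho> c) * norm (t h)" by (rule norm_bop_apply)
    also have "\<dots> \<le> norm c * norm h" by (simp add: nt[OF h] mult_right_mono star_hom_contractive[OF \<rho>h])
    finally show "norm (bop_apply S h) \<le> norm c * norm h" .
  qed simp
qed

lemma closed_star_subalgebra_closure:
  fixes S :: "'c::cstar_algebra set"
  assumes "csubspace S" "\<And>a b. a \<in> S \<Longrightarrow> b \<in> S \<Longrightarrow> a * b \<in> S" "\<And>a. a \<in> S \<Longrightarrow> star a \<in> S"
  shows "closed_star_subalgebra (closure S)"
  unfolding closed_star_subalgebra_def
proof (intro conjI ballI)
  fix a assume a: "a \<in> closure S"
  obtain u where u: "\<And>n. u n \<in> S" "u \<longlonglongrightarrow> a" using closure_seqE[OF a] by blast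
  show "star a \<in> closure S"
    by (rule closure_seqI[OF _ bounded_linear.tendsto[OF bounded_linear_star u(2)]]) (rule assms(3)[OF u(1)])
  fix b assume b: "b \<in> closure S"
  obtain v where v: "\<And>n. v n \<in> S" "v \<longlonglongrightarrow> b" using closure_seqE[OF b] by blast
  show "a * b \<in> closure S"
    by (rule closure_seqI[OF _ tendsto_mult[OF u(2) v(2)]]) (rule assms(2)[OF u(1) v(1)])
qed (simp_all add: csubspace_closure assms(1))

text \<open>The closure of the joint relation is the graph sought. The closure of its domain is a
  closed star-subalgebra containing the generators, hence everything, and algebraic identities pass
  to limits.\<close>

theorem integrated_form_exists:
  fixes jA :: "'a::cstar_algebra \<Rightarrow> 'c::cstar_algebra" and jX :: "'x::complex_vector \<Rightarrow> 'c"
    and \<pi>A :: "'a \<Rightarrow> 'h::chilbert_space bop" and \<pi>X :: "'x \<Rightarrow> 'h bop"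
  assumes bim: "hilbert_bimodule lact ract ipL ipR" and cp: "crossed_product lact ract ipL ipR jA jX"
    and cov: "covariant_rep lact ract ipL ipR \<pi>A \<pi>X"
  obtains \<rho> where "integrated_form jA jX \<pi>A \<pi>X \<rho>"
proof -
  have covj: "covariant_rep lact ract ipL ipR jA jX"
    and gen: "\<And>S. closed_star_subalgebra S \<Longrightarrow> range jA \<union> range jX \<subseteq> S \<Longrightarrow> S = UNIV"
    using cp unfolding crossed_product_def by blast+
  define G where "G = joint_algebra jA jX \<pi>A \<pi>X"
  note homs = covariant_repD(1)[OF covj] covariant_repD(1)[OF cov]
  have Gadd: "(x, y) \<in> G \<Longrightarrow> (x', y') \<in> G \<Longrightarrow> (x + x', y + y') \<in> G" for x y x' y'
    unfolding G_def by (rule joint_add)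
  have Gscale: "(x, y) \<in> G \<Longrightarrow> (z *\<^sub>C x, z *\<^sub>C y) \<in> G" for x y z
    unfolding G_def by (rule joint_scale)
  have Gmult: "(x, y) \<in> G \<Longrightarrow> (x', y') \<in> G \<Longrightarrow> (x * x', y * y') \<in> G" for x y x' y'
    unfolding G_def by (rule joint_mult)
  have Gstar: "(x, y) \<in> G \<Longrightarrow> (star x, star y) \<in> G" for x y
    unfolding G_def by (rule joint_star[OF _ homs])
  have Gnorm: "(x, y) \<in> G \<Longrightarrow> norm y \<le> 1 * norm x" for x y
    unfolding G_def using joint_algebra_norm_le[OF bim cp cov] by simp
  obtain f where f: "\<And>x. x \<in> closure (fst ` G) \<Longrightarrow> (x, f x) \<in> closure G"
    "\<And>x y. (x, y) \<in> closure G \<Longrightarrow> f x = y"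
    "\<And>x y. (x, y) \<in> closure G \<Longrightarrow> norm y \<le> 1 * norm x"
    "\<And>x y. x \<in> closure (fst ` G) \<Longrightarrow> y \<in> closure (fst ` G) \<Longrightarrow> f (x + y) = f x + f y"
    "\<And>c x. x \<in> closure (fst ` G) \<Longrightarrow> f (c *\<^sub>C x) = c *\<^sub>C f x"
    using bounded_relation_extension[OF Gadd Gscale Gnorm] by blast
  have "closed_star_subalgebra (closure (fst ` G))"
  proof (rule closed_star_subalgebra_closure)
    have mem: "x \<in> fst ` G \<longleftrightarrow> (\<exists>y. (x, y) \<in> G)" for x by force
    have "(0 *\<^sub>C jA 0, 0 *\<^sub>C \<pi>A 0) \<in> G" unfolding G_def by (intro joint_scale joint_A)
    then have "0 \<in> fst ` G" unfolding mem by auto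
    then show "csubspace (fst ` G)"
      by (rule csubspaceI) (unfold mem, blast intro: Gadd, blast intro: Gscale)
    show "a * b \<in> fst ` G" if "a \<in> fst ` G" "b \<in> fst ` G" for a b
      using that unfolding mem by (blast intro: Gmult)
    show "star a \<in> fst ` G" if "a \<in> fst ` G" for a
      using that unfolding mem by (blast intro: Gstar)
  qed
  moreover have "range jA \<union> range jX \<subseteq> closure (fst ` G)"
  proof -
    have "jA a \<in> closure (fst ` G)" for a
      by (rule closure_memI, rule image_eqI[of _ _ "(jA a, \<pi>A a)"]) (simp_all add: G_def joint_A)
    moreover have "jX x \<in> closure (fst ` G)" for x
      by (rule closure_memI, rule image_eqI[of _ _ "(jX x, \<pi>X x)"]) (simp_all add: G_def joint_X)
    ultimately show ?thesis by blast
  qed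
  ultimately have U: "closure (fst ` G) = UNIV" by (rule gen)
  have seq: "\<exists>u v. (\<forall>n. (u n, v n) \<in> G) \<and> u \<longlonglongrightarrow> x \<and> v \<longlonglongrightarrow> f x" for x
  proof -
    have "(x, f x) \<in> closure G" by (rule f(1)) (simp add: U)
    then obtain w where w: "\<And>n. w n \<in> G" "w \<longlonglongrightarrow> (x, f x)" using closure_seqE[of "(x, f x)" G] by blast
    then show ?thesis
      using tendsto_fst[OF w(2)] tendsto_snd[OF w(2)]
      by (intro exI[of _ "\<lambda>n. fst (w n)"] exI[of _ "\<lambda>n. snd (w n)"]) simp
  qed
  have seqI: "f x = y" if "\<And>n. (u n, v n) \<in> G" "u \<longlonglongrightarrow> x" "v \<longlonglongrightarrow> y" for u v x y
    by (intro f(2) closure_seqI[of "\<lambda>n. (u n, v n)"] that tendsto_Pair)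
  have inG: "f x = y" if "(x, y) \<in> G" for x y by (intro f(2) closure_memI that)
  have "star_hom f"
  proof (rule star_homI)
    show "f (x + y) = f x + f y" "f (z *\<^sub>C x) = z *\<^sub>C f x" for x y z by (simp_all add: f(4,5) U)
    fix x y
    obtain u v where u: "\<forall>n. (u n, v n) \<in> G" "u \<longlonglongrightarrow> x" "v \<longlonglongrightarrow> f x" using seq[of x] by blast
    obtain u' v' where u': "\<forall>n. (u' n, v' n) \<in> G" "u' \<longlonglongrightarrow> y" "v' \<longlonglongrightarrow> f y" using seq[of y] by blast
    show "f (x * y) = f x * f y"
      by (rule seqI[OF _ tendsto_mult[OF u(2) u'(2)] tendsto_mult[OF u(3) u'(3)]]) (simp add: Gmult u(1) u'(1))
    show "f (star x) = star (f x)"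
      by (rule seqI[OF _ bounded_linear.tendsto[OF bounded_linear_star u(2)] bounded_linear.tendsto[OF bounded_linear_star u(3)]])
        (simp add: Gstar u(1))
  qed
  moreover have "f (jA a) = \<pi>A a" "f (jX x) = \<pi>X x" for a x
    by (intro inG; unfold G_def; rule joint_A joint_X)+
  ultimately have "integrated_form jA jX \<pi>A \<pi>X f" by (simp add: integrated_form_def)
  then show ?thesis by (rule that)
qed

section \<open>The grading\<close>

text \<open>Algebraic spans without closure, as Fejer sums only meet polynomials. Degree 1 is
  \<open>range w\<close> outright, so that \<open>w x\<close> belongs to it without having to be
  factorized as a combination of products \<open>w y * v a\<close>.\<close>

primrec component :: "('a \<Rightarrow> 'b::cstar_algebra) \<Rightarrow> ('x \<Rightarrow> 'b) \<Rightarrow> nat \<Rightarrow> 'b set" where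
  "component v w 0 = range v"
| "component v w (Suc n) = (if n = 0 then range w else cspan {w x * c | x c. c \<in> component v w n})"

definition graded :: "('a \<Rightarrow> 'b::cstar_algebra) \<Rightarrow> ('x \<Rightarrow> 'b) \<Rightarrow> int \<Rightarrow> 'b set"
  where "graded v w k = (if 0 \<le> k then component v w (nat k) else star ` component v w (nat (- k)))"

lemma clinear_mult_left: "clinear (\<lambda>z. b * z :: 'b::cstar_algebra)"
  by (rule clinearI) (simp_all add: distrib_left mult_scaleC_right)

lemma clinear_mult_right: "clinear (\<lambda>z. z * b :: 'b::cstar_algebra)"
  by (rule clinearI) (simp_all add: distrib_right mult_scaleC_left)

lemma cspan_into:
  assumes f: "clinear f" and N: "csubspace N" and S: "\<And>y. y \<in> S \<Longrightarrow> f y \<in> N" and y: "y \<in> cspan S"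
  shows "f y \<in> N"
  using y
proof (induction rule: complex_vector.span_induct_alt)
  case base
  show ?case using csubspaceD(1)[OF N] by (simp add: clinear_zero[OF f])
next
  case (step c x y)
  then show ?case using csubspaceD(2)[OF N csubspaceD(3)[OF N S[OF step(1)], of c] step(2)]
    by (simp add: clinear_add[OF f] clinear_scaleC[OF f])
qed

context
  fixes v :: "'a::cstar_algebra \<Rightarrow> 'b::cstar_algebra" and w :: "'x::complex_vector \<Rightarrow> 'b" and lact ract ipL ipR
  assumes cov: "covariant_rep lact ract ipL ipR v w"
begin

lemma csubspace_component: "csubspace (component v w n)"
proof (cases n)
  case 0
  then show ?thesis using csubspace_clinear_image[OF star_hom_clinear[OF covariant_repD(1)[OF cov]], of UNIV] by simp
next
  case (Suc m)
  then show ?thesis using csubspace_clinear_image[OF covariant_repD(2)[OF cov], of UNIV] by simp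
qed

lemma component_left_X:
  assumes c: "c \<in> component v w n" shows "w x * c \<in> component v w (Suc n)"
proof (cases "n = 0")
  case True
  then obtain a where "c = v a" using c by auto
  then have "w x * c = w (ract x a)" by (simp add: covariant_repD(4)[OF cov])
  then show ?thesis using True by simp
next
  case False
  then have eq: "component v w (Suc n) = cspan {w x * c | x c. c \<in> component v w n}" by simp
  show ?thesis unfolding eq by (rule complex_vector.span_base) (use c in blast)
qed

lemma component_left_A: "c \<in> component v w n \<Longrightarrow> v a * c \<in> component v w n"
proof (cases n)
  case 0
  assume "c \<in> component v w n"
  then show ?thesis using 0 by (auto simp flip: star_hom_mult[OF covariant_repD(1)[OF cov]])
next
  case (Suc m)
  assume c: "c \<in> component v w n"
  show ?thesis
  proof (cases m)
    case 0
    then show ?thesis using c Suc by (auto simp flip: covariant_repD(3)[OF cov])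
  next
    case (Suc l)
    have "c \<in> cspan {w x * c | x c. c \<in> component v w m}" using c \<open>n = Suc m\<close> Suc by simp
    then show ?thesis
    proof (rule cspan_into[OF clinear_mult_left csubspace_component, rotated])
      fix y assume "y \<in> {w x * c | x c. c \<in> component v w m}"
      then obtain x d where y: "y = w x * d" "d \<in> component v w m" by blast
      have "v a * y = w (lact a x) * d" by (simp add: y(1) covariant_repD(3)[OF cov] mult.assoc)
      then show "v a * y \<in> component v w n" using component_left_X[OF y(2)] \<open>n = Suc m\<close> by metis
    qed
  qed
qed

text \<open>A factor \<open>b\<close> of degree \<open>k\<close> is tested only against the two
  kinds of generators; longer products on the left follow by induction. The instances are
  \<open>b = v a\<close> and \<open>b = w x\<close>.\<close>

lemma component_right:
  assumes "\<And>a. v a * b \<in> component v w k" and "\<And>x. w x * b \<in> component v w (Suc k)"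
  shows "c \<in> component v w n \<Longrightarrow> c * b \<in> component v w (n + k)"
proof (induction n arbitrary: c)
  case 0
  then show ?case using assms(1) by auto
next
  case (Suc m)
  show ?case
  proof (cases m)
    case 0
    then show ?thesis using Suc.prems assms(2) by auto
  next
    case (Suc l)
    have "c \<in> cspan {w x * c | x c. c \<in> component v w m}" using Suc.prems Suc by simp
    then show ?thesis
    proof (rule cspan_into[OF clinear_mult_right csubspace_component, rotated])
      fix y assume "y \<in> {w x * c | x c. c \<in> component v w m}"
      then obtain x d where y: "y = w x * d" "d \<in> component v w m" by blast
      then show "y * b \<in> component v w (Suc m + k)"
        using component_left_X[OF Suc.IH[OF y(2)], of x] by (simp add: mult.assoc)
    qed
  qed
qed

lemma component_right_A: "c \<in> component v w n \<Longrightarrow> c * v a \<in> component v w n"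
  using component_right[of "v a" 0 c n]
  by (simp flip: star_hom_mult[OF covariant_repD(1)[OF cov]] covariant_repD(4)[OF cov])

lemma component_right_X: "c \<in> component v w n \<Longrightarrow> c * w x \<in> component v w (Suc n)"
proof -
  assume c: "c \<in> component v w n"
  have "c * w x \<in> component v w (n + 1)"
  proof (rule component_right[OF _ _ c])
    show "v a * w x \<in> component v w 1" for a by (simp flip: covariant_repD(3)[OF cov])
    show "w y * w x \<in> component v w (Suc 1)" for y by (rule component_left_X) simp
  qed
  then show ?thesis by simp
qed

text \<open>The adjoint cancels the leading factor, since
  \<open>star (w x) * w z = v (ipR x z)\<close>. Cancelling the last factor in the next lemma uses
  \<open>ipL\<close> instead.\<close>

lemma component_left_X_star: "c \<in> component v w (Suc n) \<Longrightarrow> star (w x) * c \<in> component v w n"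
proof (cases n)
  case 0
  assume "c \<in> component v w (Suc n)"
  then show ?thesis using 0 by (auto simp flip: covariant_repD(5)[OF cov])
next
  case (Suc m)
  assume "c \<in> component v w (Suc n)"
  then have "c \<in> cspan {w x * c | x c. c \<in> component v w n}" using Suc by simp
  then show ?thesis
  proof (rule cspan_into[OF clinear_mult_left csubspace_component, rotated])
    fix y assume "y \<in> {w x * c | x c. c \<in> component v w n}"
    then obtain z d where y: "y = w z * d" "d \<in> component v w n" by blast
    have "star (w x) * y = v (ipR x z) * d" by (simp add: y(1) covariant_repD(5)[OF cov] mult.assoc)
    then show "star (w x) * y \<in> component v w n" using component_left_A[OF y(2)] by simp
  qed
qed

lemma component_right_X_star: "c \<in> component v w (Suc n) \<Longrightarrow> c * star (w x) \<in> component v w n"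
proof (induction n arbitrary: c)
  case 0
  then show ?case by (auto simp flip: covariant_repD(6)[OF cov])
next
  case (Suc m)
  then have "c \<in> cspan {w x * c | x c. c \<in> component v w (Suc m)}" by simp
  then show ?case
  proof (rule cspan_into[OF clinear_mult_right csubspace_component, rotated])
    fix y assume "y \<in> {w x * c | x c. c \<in> component v w (Suc m)}"
    then obtain z d where y: "y = w z * d" "d \<in> component v w (Suc m)" by blast
    then show "y * star (w x) \<in> component v w (Suc m)"
      using component_left_X[OF Suc.IH[OF y(2)], of z] by (simp add: mult.assoc)
  qed
qed

section \<open>From natural to integer degrees\<close>

lemma star_component_0: "star ` component v w 0 = component v w 0"
proof -
  have s: "star (v a) = v (star a)" for a by (simp add: star_hom_star[OF covariant_repD(1)[OF cov]])
  show ?thesis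
  proof
    show "star ` component v w 0 \<subseteq> component v w 0" by (auto simp: s)
    show "component v w 0 \<subseteq> star ` component v w 0"
    proof
      fix c assume "c \<in> component v w 0"
      then obtain a where "c = star (v (star a))" by (auto simp: s star_star)
      then show "c \<in> star ` component v w 0" by simp
    qed
  qed
qed

lemma graded_int: "graded v w (int n) = component v w n"
  by (simp add: graded_def)

lemma graded_minus_int: "graded v w (- int n) = star ` component v w n"
  by (cases "n = 0") (use star_component_0 in \<open>auto simp: graded_def\<close>)

lemma star_image_star: "star ` star ` (S :: 'b set) = S"
  by (simp add: image_image star_star)

lemma star_graded: "c \<in> graded v w k \<Longrightarrow> star c \<in> graded v w (- k)"
proof (cases k rule: int_cases2)
  case (nonneg n)
  assume "c \<in> graded v w k"
  then show ?thesis by (simp add: nonneg graded_int graded_minus_int)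
next
  case (nonpos n)
  assume "c \<in> graded v w k"
  then have "star c \<in> star ` star ` component v w n" by (simp add: nonpos graded_minus_int)
  then show ?thesis by (simp add: nonpos star_image_star graded_int)
qed

lemma csubspace_graded: "csubspace (graded v w k)"
proof (cases k rule: int_cases2)
  case (nonneg n)
  then show ?thesis by (simp add: graded_int csubspace_component)
next
  case (nonpos n)
  note C = csubspaceD[OF csubspace_component[of n]]
  have "csubspace (star ` component v w n)"
  proof (rule csubspaceI)
    show "0 \<in> star ` component v w n" using C(1) by (rule image_eqI[rotated]) simp
    fix x y c assume "x \<in> star ` component v w n"
    then obtain a where a: "a \<in> component v w n" "x = star a" by blast
    show "c *\<^sub>C x \<in> star ` component v w n"
      by (rule image_eqI[OF _ C(3)[OF a(1), of "cnj c"]]) (simp add: a(2) star_scaleC)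
    assume "y \<in> star ` component v w n"
    then obtain b where b: "b \<in> component v w n" "y = star b" by blast
    show "x + y \<in> star ` component v w n"
      by (rule image_eqI[OF _ C(2)[OF a(1) b(1)]]) (simp add: a(2) b(2) star_add)
  qed
  then show ?thesis by (simp add: nonpos graded_minus_int)
qed

lemma graded_left_A: "d \<in> graded v w k \<Longrightarrow> v a * d \<in> graded v w k"
proof (cases k rule: int_cases2)
  case (nonneg n)
  assume "d \<in> graded v w k"
  then show ?thesis by (simp add: nonneg graded_int component_left_A)
next
  case (nonpos n)
  assume "d \<in> graded v w k"
  then obtain c where c: "c \<in> component v w n" "d = star c" by (auto simp: nonpos graded_minus_int)
  have "v a * d = star (c * v (star a))"
    by (simp add: c(2) star_mult star_star star_hom_star[OF covariant_repD(1)[OF cov]])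
  then show ?thesis using component_right_A[OF c(1)] by (simp add: nonpos graded_minus_int)
qed

lemma graded_left_X: "d \<in> graded v w k \<Longrightarrow> w x * d \<in> graded v w (k + 1)"
proof (cases "0 \<le> k")
  case True
  then obtain n where k: "k = int n" using zero_le_imp_eq_int by blast
  then have k1: "k + 1 = int (Suc n)" by simp
  assume "d \<in> graded v w k"
  then show ?thesis unfolding k1 graded_int unfolding k graded_int by (rule component_left_X)
next
  case False
  then have k: "k = - int (Suc n)" if "n = nat (- k) - 1" for n using that by simp
  define n where "n = nat (- k) - 1"
  note k = k[OF n_def]
  then have k1: "k + 1 = - int n" by simp
  assume "d \<in> graded v w k"
  then obtain c where c: "c \<in> component v w (Suc n)" "d = star c" unfolding k graded_minus_int by blast
  have "w x * d = star (c * star (w x))" by (simp add: c(2) star_mult star_star)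
  then show ?thesis unfolding k1 graded_minus_int using component_right_X_star[OF c(1)] by blast
qed

lemma graded_left_X_star: "d \<in> graded v w k \<Longrightarrow> star (w x) * d \<in> graded v w (k - 1)"
proof (cases "0 < k")
  case True
  then have k: "k = int (Suc n)" if "n = nat k - 1" for n using that by simp
  define n where "n = nat k - 1"
  note k = k[OF n_def]
  then have k1: "k - 1 = int n" by simp
  assume "d \<in> graded v w k"
  then show ?thesis unfolding k1 graded_int unfolding k graded_int by (rule component_left_X_star)
next
  case False
  then have k: "k = - int n" if "n = nat (- k)" for n using that by simp
  define n where "n = nat (- k)"
  note k = k[OF n_def]
  then have k1: "k - 1 = - int (Suc n)" by simp
  assume "d \<in> graded v w k"
  then obtain c where c: "c \<in> component v w n" "d = star c" unfolding k graded_minus_int by blast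
  have "star (w x) * d = star (c * w x)" by (simp add: c(2) star_mult)
  then show ?thesis unfolding k1 graded_minus_int using component_right_X[OF c(1)] by blast
qed

lemma component_mult_graded: "c \<in> component v w n \<Longrightarrow> d \<in> graded v w k \<Longrightarrow> c * d \<in> graded v w (int n + k)"
proof (induction n arbitrary: c)
  case 0
  then show ?case by (auto intro: graded_left_A)
next
  case (Suc m)
  show ?case
  proof (cases "m = 0")
    case True
    then obtain x where "c = w x" using Suc.prems(1) by auto
    then show ?thesis using graded_left_X[OF Suc.prems(2), of x] True by (simp add: add.commute)
  next
    case False
    then have "c \<in> cspan {w x * c | x c. c \<in> component v w m}" using Suc.prems by simp
    then show ?thesis
    proof (rule cspan_into[OF clinear_mult_right csubspace_graded, rotated])
      fix y assume "y \<in> {w x * c | x c. c \<in> component v w m}"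
      then obtain x e where y: "y = w x * e" "e \<in> component v w m" by blast
      then show "y * d \<in> graded v w (int (Suc m) + k)"
        using graded_left_X[OF Suc.IH[OF y(2) Suc.prems(2)], of x] by (simp add: mult.assoc algebra_simps)
    qed
  qed
qed

lemma star_component_mult_graded:
  "c \<in> component v w n \<Longrightarrow> d \<in> graded v w k \<Longrightarrow> star c * d \<in> graded v w (k - int n)"
proof (induction n arbitrary: c d k)
  case 0
  then show ?case by (auto simp: star_hom_star[OF covariant_repD(1)[OF cov], symmetric] intro: graded_left_A)
next
  case (Suc m)
  show ?case
  proof (cases "m = 0")
    case True
    then obtain x where "c = w x" using Suc.prems(1) by auto
    then show ?thesis using graded_left_X_star[OF Suc.prems(2), of x] True by simp
  next
    case False
    then have "c \<in> cspan {w x * c | x c. c \<in> component v w m}" using Suc.prems by simp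
    \<comment> \<open>The map sending \<open>c\<close> to \<open>star c * d\<close> is conjugate
      linear, whereas the span argument needs linearity. So the adjoint \<open>star d * c\<close>,
      linear in \<open>c\<close>, is treated and the result is reflected back.\<close>
    then have "star d * c \<in> graded v w (- (k - int (Suc m)))"
    proof (rule cspan_into[OF clinear_mult_left csubspace_graded, rotated])
      fix y assume "y \<in> {w x * c | x c. c \<in> component v w m}"
      then obtain x e where y: "y = w x * e" "e \<in> component v w m" by blast
      have "star e * (star (w x) * d) \<in> graded v w ((k - 1) - int m)"
        by (rule Suc.IH[OF y(2) graded_left_X_star[OF Suc.prems(2)]])
      then have "star (star e * (star (w x) * d)) \<in> graded v w (- ((k - 1) - int m))" by (rule star_graded)
      moreover have "- ((k - 1) - int m) = - (k - int (Suc m))" by simp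
      ultimately show "star d * y \<in> graded v w (- (k - int (Suc m)))"
        by (simp only: y(1) star_mult star_star mult.assoc)
    qed
    then have "star (star d * c) \<in> graded v w (- (- (k - int (Suc m))))" by (rule star_graded)
    then show ?thesis by (simp add: star_mult star_star)
  qed
qed

lemma graded_mult:
  assumes "c \<in> graded v w l" "d \<in> graded v w k" shows "c * d \<in> graded v w (l + k)"
proof (cases l rule: int_cases2)
  case (nonneg n)
  then show ?thesis using component_mult_graded[of c n d k] assms by (simp add: graded_int)
next
  case (nonpos n)
  then obtain e where "e \<in> component v w n" "c = star e" using assms(1) by (auto simp: graded_minus_int)
  then show ?thesis using star_component_mult_graded[of e n d k] assms(2) by (simp add: nonpos)
qed

end

lemma component_hom:
  assumes "star_hom \<phi>" "c \<in> component v w n"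
  shows "\<phi> c \<in> component (\<lambda>a. \<phi> (v a)) (\<lambda>x. \<phi> (w x)) n"
  using assms(2)
proof (induction n arbitrary: c)
  case 0
  then show ?case by auto
next
  case (Suc m)
  show ?case
  proof (cases "m = 0")
    case True
    then show ?thesis using Suc.prems by auto
  next
    case False
    then have "c \<in> cspan {w x * c | x c. c \<in> component v w m}" using Suc.prems by simp
    then have "\<phi> c \<in> cspan {\<phi> (w x) * c | x c. c \<in> component (\<lambda>a. \<phi> (v a)) (\<lambda>x. \<phi> (w x)) m}"
    proof (rule cspan_into[OF star_hom_clinear[OF assms(1)] complex_vector.subspace_span, rotated])
      fix y assume "y \<in> {w x * c | x c. c \<in> component v w m}"
      then obtain x e where y: "y = w x * e" "e \<in> component v w m" by blast
      then show "\<phi> y \<in> cspan {\<phi> (w x) * c | x c. c \<in> component (\<lambda>a. \<phi> (v a)) (\<lambda>x. \<phi> (w x)) m}"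
        using Suc.IH[OF y(2)] by (intro complex_vector.span_base) (auto simp: star_hom_mult[OF assms(1)])
    qed
    then show ?thesis using False by simp
  qed
qed

lemma graded_hom:
  assumes "star_hom \<phi>" "c \<in> graded v w k"
  shows "\<phi> c \<in> graded (\<lambda>a. \<phi> (v a)) (\<lambda>x. \<phi> (w x)) k"
proof (cases "0 \<le> k")
  case True
  then show ?thesis using assms(2) component_hom[OF assms(1)] by (simp add: graded_def)
next
  case False
  then obtain e where e: "e \<in> component v w (nat (- k))" "c = star e" using assms(2) by (auto simp: graded_def)
  have "\<phi> c = star (\<phi> e)" by (simp add: e(2) star_hom_star[OF assms(1)])
  then show ?thesis using component_hom[OF assms(1) e(1)] False by (simp add: graded_def)
qed

lemma component_apply:
  assumes "c \<in> component v w (Suc n)" "h \<in> M" "csubspace M" "closed M"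
  shows "bop_apply c h \<in> (xspan w ^^ Suc n) M"
  using assms(1)
proof (induction n arbitrary: c)
  case 0
  then show ?case using in_xspan[OF assms(2)] by auto
next
  case (Suc n)
  then have c: "c \<in> cspan {w x * c | x c. c \<in> component v w (Suc n)}" by simp
  have cl: "clinear (\<lambda>c. bop_apply c h)"
    by (rule clinearI) (simp_all add: bop_apply_linear_left bop_apply_scaleC_left)
  have "bop_apply c h \<in> xspan w ((xspan w ^^ Suc n) M)"
  proof (rule cspan_into[OF cl xspan_subspace _ c])
    fix y assume "y \<in> {w x * c | x c. c \<in> component v w (Suc n)}"
    then obtain x e where y: "y = w x * e" "e \<in> component v w (Suc n)" by blast
    then show "bop_apply y h \<in> xspan w ((xspan w ^^ Suc n) M)"
      using in_xspan[OF Suc.IH[OF y(2)]] by (simp only: bop_apply_times)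
  qed
  then show ?case by simp
qed

section \<open>The conditional expectation\<close>

text \<open>Off-diagonal terms vanish between vectors of an irreducible subspace whose class is not fixed by
  any of the first \<open>n\<close> powers. Since a point fixed by a \<open>k\<close>-th power is fixed by the \<open>n!\<close>-th one for
  \<open>k \<le> n\<close>, topological freeness for the single exponent \<open>n!\<close> provides such subspaces.\<close>

theorem expectation_norm_le:
  fixes \<pi>A :: "'a::cstar_algebra \<Rightarrow> 'h::chilbert_space bop" and \<pi>X :: "'x::complex_vector \<Rightarrow> 'h bop"
  assumes cov: "covariant_rep lact ract ipL ipR \<pi>A \<pi>X" and inj: "inj \<pi>A"
    and free: "topologically_free spectrum_topology (dual_partial_homeo lact ipR)"
    and b: "\<And>k. b k \<in> graded \<pi>A \<pi>X k" and b0: "b 0 = \<pi>A a"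
  shows "norm a \<le> norm (\<Sum>k\<in>{- int n..int n}. b k)"
proof (rule ccontr)
  define T where "T = (\<Sum>k\<in>{- int n..int n}. b k)"
  assume "\<not> ?thesis"
  then have \<delta>: "norm T < norm a" by (simp add: T_def)
  obtain \<sigma> :: "'a \<Rightarrow> 'a ell2 bop" where \<sigma>: "irreducible_rep \<sigma>" "norm T < norm (\<sigma> a)"
    "(spec_class \<sigma>, spec_class \<sigma>) \<notin> dual_partial_homeo lact ipR ^^ fact n"
    by (rule spectrum_point_outside[OF free norm_ge_zero \<delta> fact_gt_zero]) (rule that)
  have nfix: "(spec_class \<sigma>, spec_class \<sigma>) \<notin> dual_partial_homeo lact ipR ^^ k" if k: "0 < k" "k \<le> n" for k
  proof
    assume *: "(spec_class \<sigma>, spec_class \<sigma>) \<in> dual_partial_homeo lact ipR ^^ k"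
    have "k dvd fact n" using k by (intro dvd_fact) auto
    then obtain m where "fact n = k * m" by (auto elim: dvdE)
    then show False using relpow_fixed_mult[OF *, of m] \<sigma>(3) by simp
  qed
  note \<sigma>' = irreducible_rep_irr[OF \<sigma>(1)]
  obtain \<tau> :: "'h bop \<Rightarrow> 'h bop ell2 bop" and M where \<tau>: "star_hom \<tau>"
    and irr: "irr (\<lambda>a. \<tau> (\<pi>A a)) M" and eq: "uequiv \<sigma> (rep_space \<sigma>) (\<lambda>a. \<tau> (\<pi>A a)) M"
    by (rule irreducible_rep_extension[OF covariant_repD(1)[OF cov] inj \<sigma>(1)]) (rule that)
  have cov': "covariant_rep lact ract ipL ipR (\<lambda>a. \<tau> (\<pi>A a)) (\<lambda>x. \<tau> (\<pi>X x))"
    by (rule covariant_rep_compose[OF cov \<tau>])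
  note M = invariantD[OF irr_invariant[OF irr]]
  have eq': "uequiv (\<lambda>a. \<tau> (\<pi>A a)) M \<sigma> (rep_space \<sigma>)"
    by (rule uequiv_sym[OF invariant_rep_space irr_invariant[OF irr] eq])
  have pos: "cinner h (bop_apply (\<tau> c) y) = 0"
    if c: "c \<in> component \<pi>A \<pi>X k" and k: "0 < k" "k \<le> n" and h: "h \<in> M" and y: "y \<in> M" for c k h y
  proof -
    obtain m where m: "k = Suc m" using k(1) gr0_implies_Suc by blast
    have "bop_apply (\<tau> c) y \<in> (xspan (\<lambda>x. \<tau> (\<pi>X x)) ^^ k) M"
      unfolding m by (rule component_apply[OF component_hom[OF \<tau> c[unfolded m]] y M(1,2)])
    then show ?thesis by (rule rieffel_orthogonal[OF cov' irr \<sigma>(1) eq' nfix[OF k] h])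
  qed
  have off: "cinner h (bop_apply (\<tau> (b k)) y) = 0"
    if k: "k \<in> {- int n..int n}" "k \<noteq> 0" and h: "h \<in> M" and y: "y \<in> M" for k h y
  proof (cases "0 < k")
    case True
    then have "b k \<in> component \<pi>A \<pi>X (nat k)" using b[of k] by (simp add: graded_def)
    then show ?thesis by (rule pos) (use True k h y in auto)
  next
    case False
    then obtain e where e: "e \<in> component \<pi>A \<pi>X (nat (- k))" "b k = star e"
      using b[of k] k(2) by (auto simp: graded_def)
    have "cinner y (bop_apply (\<tau> e) h) = 0" by (rule pos[OF e(1)]) (use False k h y in auto)
    then have "cinner (bop_apply (\<tau> e) h) y = 0" by (subst cinner_commute) simp
    then show ?thesis by (simp add: e(2) star_hom_star[OF \<tau>] cinner_star_right)
  qed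
  have diag: "cinner h (bop_apply (\<tau> T) y) = cinner h (bop_apply (\<tau> (\<pi>A a)) y)" if h: "h \<in> M" and y: "y \<in> M" for h y
  proof -
    have T: "T = \<pi>A a + (\<Sum>k\<in>{- int n..int n} - {0}. b k)"
      unfolding T_def b0[symmetric] by (rule sum.remove) simp_all
    have "cinner h (bop_apply (\<tau> (\<Sum>k\<in>K. b k)) y) = 0" if "finite K" "K \<subseteq> {- int n..int n} - {0}" for K
      using that
    proof (induction rule: finite_induct)
      case empty
      then show ?case by (simp add: star_hom_zero[OF \<tau>] bop_apply_linear_left)
    next
      case (insert k K)
      then show ?case using off[OF _ _ h y, of k]
        by (simp add: star_hom_add[OF \<tau>] bop_apply_linear_left cinner_add_right)
    qed
    then have "cinner h (bop_apply (\<tau> (\<Sum>k\<in>{- int n..int n} - {0}. b k)) y) = 0" by simp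
    then show ?thesis unfolding T star_hom_add[OF \<tau>] bop_apply_linear_left cinner_add_right by simp
  qed
  have "norm (\<sigma> a) \<le> norm T"
  proof (rule uequiv_norm_bound[OF \<sigma>'(1) eq norm_ge_zero])
    fix y assume y: "y \<in> M"
    \<comment> \<open>The diagonal identity is tested against \<open>?h\<close>, which lies in
      \<open>M\<close> by invariance; this bounds the operator of \<open>a\<close> on
      \<open>M\<close> by the full sum \<open>T\<close>.\<close>
    let ?h = "bop_apply (\<tau> (\<pi>A a)) y"
    have "(norm ?h)\<^sup>2 = Re (cinner ?h (bop_apply (\<tau> T) y))"
      by (simp add: norm_power2_cinner diag[OF M(3)[OF y] y])
    also have "\<dots> \<le> norm ?h * norm (bop_apply (\<tau> T) y)" by (rule Re_cinner_le)
    finally have "norm ?h \<le> norm (bop_apply (\<tau> T) y)"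
      by (cases "norm ?h = 0") (simp_all add: power2_eq_square)
    also have "\<dots> \<le> norm (\<tau> T) * norm y" by (rule norm_bop_apply)
    also have "\<dots> \<le> norm T * norm y" by (intro mult_right_mono star_hom_contractive[OF \<tau>]) simp
    finally show "norm ?h \<le> norm T * norm y" .
  qed
  then show False using \<sigma>(2) by simp
qed

section \<open>Trigonometric polynomials in the crossed product\<close>

text \<open>A polynomial is carried as its family of coefficients, since at this stage the sum is
  not known to determine them.\<close>

definition trig_poly :: "('a \<Rightarrow> 'c::cstar_algebra) \<Rightarrow> ('x \<Rightarrow> 'c) \<Rightarrow> nat \<Rightarrow> (int \<Rightarrow> 'c) \<Rightarrow> bool"
  where "trig_poly v w n q \<longleftrightarrow> (\<forall>k. q k \<in> graded v w k) \<and> (\<forall>k. k \<notin> {- int n..int n} \<longrightarrow> q k = 0)"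

lemma trig_poly_sum:
  assumes "trig_poly v w n q" "{- int n..int n} \<subseteq> B" "finite B"
  shows "sum q B = sum q {- int n..int n}"
  by (rule sum.mono_neutral_right) (use assms in \<open>auto simp: trig_poly_def\<close>)

text \<open>A homomorphism into an arbitrary C*-algebra is reduced to one into operators by
  composing with an irreducible representation that attains the norm of
  \<open>\<phi> a\<close>.\<close>

lemma star_hom_norm_le:
  fixes \<phi> :: "'a::cstar_algebra \<Rightarrow> 'c::cstar_algebra"
  assumes \<phi>: "star_hom \<phi>"
  shows "norm (\<phi> a) \<le> norm a"
proof (cases "\<phi> a = 0")
  case False
  obtain \<tau> :: "'c \<Rightarrow> 'c unitization ell2 bop" where \<tau>: "irreducible_rep \<tau>" "norm (\<tau> (\<phi> a)) = norm (\<phi> a)"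
    by (rule irreducible_rep_norming[OF False]) (rule that)
  have "star_hom (\<lambda>a. \<tau> (\<phi> a))" by (rule star_hom_compose[OF \<phi> irreducible_rep_irr(1)[OF \<tau>(1)]])
  from star_hom_contractive[OF this, of a] show ?thesis by (simp add: \<tau>(2))
qed simp

text \<open>The span of all homogeneous elements is a star-algebra containing the generators, so its
  closure is the whole crossed product.\<close>

lemma trig_poly_dense:
  fixes jA :: "'a::cstar_algebra \<Rightarrow> 'c::cstar_algebra" and jX :: "'x::complex_vector \<Rightarrow> 'c"
  assumes cp: "crossed_product lact ract ipL ipR jA jX" and e: "0 < e"
  obtains n q where "trig_poly jA jX n q" "norm (c - sum q {- int n..int n}) < e"
proof -
  have cov: "covariant_rep lact ract ipL ipR jA jX"
    and gen: "\<And>S. closed_star_subalgebra S \<Longrightarrow> range jA \<union> range jX \<subseteq> S \<Longrightarrow> S = UNIV"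
    using cp unfolding crossed_product_def by blast+
  define S where "S = cspan (\<Union>k. graded jA jX k)"
  have S: "csubspace S" by (simp add: S_def)
  have gS: "x \<in> S" if "x \<in> graded jA jX k" for x k
    unfolding S_def by (rule complex_vector.span_base) (use that in blast)
  have mult: "a * b \<in> S" if a: "a \<in> S" and b: "b \<in> S" for a b
  proof (rule cspan_into[OF clinear_mult_right S _ a[unfolded S_def]])
    fix x assume x: "x \<in> (\<Union>k. graded jA jX k)"
    show "x * b \<in> S"
    proof (rule cspan_into[OF clinear_mult_left S _ b[unfolded S_def]])
      fix y assume "y \<in> (\<Union>k. graded jA jX k)"
      then obtain k l where "x \<in> graded jA jX k" "y \<in> graded jA jX l" using x by blast
      then show "x * y \<in> S" by (rule gS[OF graded_mult[OF cov]])
    qed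
  qed
  have star: "star a \<in> S" if "a \<in> S" for a
    using that unfolding S_def
  proof (induction rule: complex_vector.span_induct_alt)
    case base
    show ?case by (simp add: complex_vector.span_zero)
  next
    case (step c x y)
    then obtain k where "x \<in> graded jA jX k" by blast
    then have "star x \<in> S" by (rule gS[OF star_graded[OF cov]])
    then show ?case using csubspaceD(2)[OF S csubspaceD(3)[OF S], of "star x" "star y" "cnj c"] step(2)
      by (simp add: star_add star_scaleC S_def)
  qed
  have "closure S = UNIV"
  proof (rule gen[OF closed_star_subalgebra_closure[OF S mult star]])
    have "jA a \<in> closure S" for a by (rule closure_memI, rule gS[of _ 0]) (simp add: graded_def)
    moreover have "jX x \<in> closure S" for x by (rule closure_memI, rule gS[of _ 1]) (simp add: graded_def)
    ultimately show "range jA \<union> range jX \<subseteq> closure S" by blast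
  qed
  then obtain x where x: "x \<in> S" "dist x c < e" using e closure_approachable[of c S] by blast
  have "\<exists>n q. trig_poly jA jX n q \<and> x = sum q {- int n..int n}"
    using x(1) unfolding S_def
  proof (induction rule: complex_vector.span_induct_alt)
    case base
    have "trig_poly jA jX 0 (\<lambda>k. 0)" by (simp add: trig_poly_def csubspaceD(1)[OF csubspace_graded[OF cov]])
    then show ?case by (intro exI[of _ 0] exI[of _ "\<lambda>k. 0"]) simp
  next
    case (step z x y)
    then obtain l where l: "x \<in> graded jA jX l" by blast
    obtain n q where q: "trig_poly jA jX n q" "y = sum q {- int n..int n}" using step(2) by blast
    define m where "m = max n (nat \<bar>l\<bar>)"
    define r where "r k = q k + (if k = l then z *\<^sub>C x else 0)" for k
    have lm: "l \<in> {- int m..int m}" by (auto simp: m_def)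
    have "trig_poly jA jX m r"
      unfolding trig_poly_def
    proof (intro conjI allI impI)
      fix k
      have "q k \<in> graded jA jX k" using q(1) by (simp add: trig_poly_def)
      moreover have "(if k = l then z *\<^sub>C x else 0) \<in> graded jA jX k"
        using csubspaceD(1,3)[OF csubspace_graded[OF cov]] l by simp
      ultimately show "r k \<in> graded jA jX k" unfolding r_def by (rule csubspaceD(2)[OF csubspace_graded[OF cov]])
      assume k: "k \<notin> {- int m..int m}"
      then have "k \<noteq> l" using lm by blast
      moreover have "q k = 0" using q(1) k by (auto simp: trig_poly_def m_def)
      ultimately show "r k = 0" by (simp add: r_def)
    qed
    moreover have "z *\<^sub>C x + y = sum r {- int m..int m}"
    proof -
      have "sum r {- int m..int m} = sum q {- int m..int m} + (\<Sum>k\<in>{- int m..int m}. if k = l then z *\<^sub>C x else 0)"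
        unfolding r_def by (rule sum.distrib)
      also have "sum q {- int m..int m} = y"
        unfolding q(2) by (rule trig_poly_sum[OF q(1)]) (auto simp: m_def)
      also have "(\<Sum>k\<in>{- int m..int m}. if k = l then z *\<^sub>C x else 0) = z *\<^sub>C x"
        using lm by (simp add: sum.delta)
      finally show ?thesis by (simp add: add.commute)
    qed
    ultimately show ?case by blast
  qed
  then obtain n q where q: "trig_poly jA jX n q" "x = sum q {- int n..int n}" by blast
  have "norm (c - sum q {- int n..int n}) < e" using x(2) q(2) by (simp add: dist_norm norm_minus_commute)
  then show ?thesis using q(1) that by blast
qed

lemma component_gauge:
  assumes \<rho>: "star_hom \<rho>" and \<tau>: "star_hom \<tau>" and A: "\<And>a. \<rho> (v a) = \<tau> (v a)" and X: "\<And>x. \<rho> (w x) = z *\<^sub>C \<tau> (w x)"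
    and c: "c \<in> component v w n"
  shows "\<rho> c = z ^ n *\<^sub>C \<tau> c"
  using c
proof (induction n arbitrary: c)
  case 0
  then show ?case by (auto simp: A scaleC_one)
next
  case (Suc m)
  show ?case
  proof (cases "m = 0")
    case True
    then show ?thesis using Suc.prems by (auto simp: X)
  next
    case False
    \<comment> \<open>On products of generators the claim says that the difference lies in the
      subspace \<open>{0}\<close>; phrased in this way it extends to spans by
      \<open>cspan_into\<close>.\<close>
    have lin: "clinear (\<lambda>c. \<rho> c - z ^ Suc m *\<^sub>C \<tau> c)"
      by (rule clinearI) (simp_all add: star_hom_add[OF \<rho>] star_hom_add[OF \<tau>] star_hom_scaleC[OF \<rho>] star_hom_scaleC[OF \<tau>]
        scaleC_add_right scaleC_diff_right scaleC_scaleC mult.commute algebra_simps)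
    have "c \<in> cspan {w x * c | x c. c \<in> component v w m}" using Suc.prems False by simp
    then have "\<rho> c - z ^ Suc m *\<^sub>C \<tau> c \<in> {0}"
    proof (rule cspan_into[OF lin, rotated 2])
      show "csubspace {0 :: 'b}" by (rule csubspaceI) simp_all
      fix y assume "y \<in> {w x * c | x c. c \<in> component v w m}"
      then obtain x e where y: "y = w x * e" "e \<in> component v w m" by blast
      show "\<rho> y - z ^ Suc m *\<^sub>C \<tau> y \<in> {0}"
        using Suc.IH[OF y(2)] by (simp add: y(1) star_hom_mult[OF \<rho>] star_hom_mult[OF \<tau>] X mult_scaleC_left mult_scaleC_right scaleC_scaleC)
    qed
    then show ?thesis by simp
  qed
qed

text \<open>The gauge action is implemented by twisting a faithful representation of the crossed product.\<close>

lemma gauge_norm_le: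
  fixes jA :: "'a::cstar_algebra \<Rightarrow> 'c::cstar_algebra" and jX :: "'x::complex_vector \<Rightarrow> 'c"
  assumes bim: "hilbert_bimodule lact ract ipL ipR" and cp: "crossed_product lact ract ipL ipR jA jX"
    and q: "trig_poly jA jX n q" and z: "cmod z = 1"
  shows "norm (\<Sum>k\<in>{- int n..int n}. z powi k *\<^sub>C q k) \<le> norm (sum q {- int n..int n})"
proof -
  define s where "s = (\<Sum>k\<in>{- int n..int n}. z powi k *\<^sub>C q k)"
  have covj: "covariant_rep lact ract ipL ipR jA jX" using cp by (simp add: crossed_product_def)
  note c = covariant_repD[OF covj]
  have zz: "cnj z * z = 1" using z by (metis complex_norm_square mult.commute of_real_1 power_one)
  then have iz: "inverse z = cnj z" by (metis inverse_unique mult.commute)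
  show ?thesis
  proof (cases "s = 0")
    case True
    then show ?thesis by (simp add: s_def)
  next
    case False
    \<comment> \<open>One representation preserving the norm of the single element \<open>s\<close>
      serves here as the faithful one.\<close>
    obtain \<tau> :: "'c \<Rightarrow> 'c unitization ell2 bop" where irr: "irreducible_rep \<tau>" and ns: "norm (\<tau> s) = norm s"
      by (rule irreducible_rep_norming[OF False]) (rule that)
    have \<tau>: "star_hom \<tau>" by (rule irreducible_rep_irr(1)[OF irr])
    have "covariant_rep lact ract ipL ipR (\<lambda>a. \<tau> (jA a)) (\<lambda>x. z *\<^sub>C \<tau> (jX x))"
      unfolding covariant_rep_def
    proof (intro conjI allI)
      show "star_hom (\<lambda>a. \<tau> (jA a))" by (rule star_hom_compose[OF c(1) \<tau>])
      show "clinear (\<lambda>x. z *\<^sub>C \<tau> (jX x))"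
        by (rule clinearI) (simp_all add: clinear_add[OF c(2)] clinear_scaleC[OF c(2)] star_hom_add[OF \<tau>] star_hom_scaleC[OF \<tau>]
          scaleC_add_right scaleC_scaleC mult.commute)
    qed (simp_all add: c(3-6) star_hom_mult[OF \<tau>] star_hom_star[OF \<tau>] mult_scaleC_left mult_scaleC_right star_scaleC
        scaleC_scaleC zz scaleC_one mult.commute[of z "cnj z"])
    then obtain \<rho> where int: "integrated_form jA jX (\<lambda>a. \<tau> (jA a)) (\<lambda>x. z *\<^sub>C \<tau> (jX x)) \<rho>"
      by (rule integrated_form_exists[OF bim cp]) (rule that)
    then have \<rho>: "star_hom \<rho>" and \<rho>A: "\<And>a. \<rho> (jA a) = \<tau> (jA a)" and \<rho>X: "\<And>x. \<rho> (jX x) = z *\<^sub>C \<tau> (jX x)"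
      by (simp_all add: integrated_form_def)
    have g: "\<rho> (q k) = z powi k *\<^sub>C \<tau> (q k)" for k
    proof (cases "0 \<le> k")
      case True
      then have "q k \<in> component jA jX (nat k)" using q by (auto simp: trig_poly_def graded_def split: if_splits)
      from component_gauge[OF \<rho> \<tau> \<rho>A \<rho>X this] show ?thesis using True by (simp add: power_int_def)
    next
      case False
      then obtain e where e: "e \<in> component jA jX (nat (- k))" "q k = star e"
        using q unfolding trig_poly_def graded_def by (metis image_iff)
      have "\<rho> (q k) = star (z ^ nat (- k) *\<^sub>C \<tau> e)"
        by (simp add: e(2) star_hom_star[OF \<rho>] component_gauge[OF \<rho> \<tau> \<rho>A \<rho>X e(1)])
      also have "\<dots> = cnj z ^ nat (- k) *\<^sub>C \<tau> (q k)" by (simp add: star_scaleC e(2) star_hom_star[OF \<tau>])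
      also have "cnj z ^ nat (- k) = z powi k" using False by (simp add: power_int_def iz)
      finally show ?thesis .
    qed
    have sum_hom: "\<phi> (sum f K) = (\<Sum>k\<in>K. \<phi> (f k))" if "star_hom \<phi>" for \<phi> :: "'c \<Rightarrow> 'c unitization ell2 bop" and f and K :: "int set"
      by (induction K rule: infinite_finite_induct) (simp_all add: star_hom_zero[OF that] star_hom_add[OF that])
    have "\<tau> s = \<rho> (sum q {- int n..int n})"
      unfolding s_def sum_hom[OF \<tau>] sum_hom[OF \<rho>] by (simp add: g star_hom_scaleC[OF \<tau>])
    then have "norm s \<le> norm (sum q {- int n..int n})"
      using star_hom_contractive[OF \<rho>] by (metis ns)
    then show ?thesis by (simp add: s_def)
  qed
qed

section \<open>Fejer means\<close>

text \<open>A geometric sum; for \<open>\<bar>m\<bar> < int M\<close> the ratio is 1 only if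
  \<open>m = 0\<close>, as no other multiple of \<open>M\<close> is in reach.\<close>

lemma root_of_unity_sum:
  fixes m :: int and M :: nat
  assumes M: "\<bar>m\<bar> < int M"
  shows "(\<Sum>j<M. cis (2 * pi * real j / real M) powi m) = (if m = 0 then of_nat M else 0)"
proof (cases "m = 0")
  case False
  have M0: "0 < M" using M by linarith
  define u where "u = cis (of_int m * (2 * pi / real M))"
  have "cis (2 * pi * real j / real M) powi m = u ^ j" for j
    by (simp only: u_def cis_power_int Complex.DeMoivre) (simp add: mult_ac)
  then have "(\<Sum>j<M. cis (2 * pi * real j / real M) powi m) = (\<Sum>j<M. u ^ j)" by simp
  also have "u \<noteq> 1"
  proof
    assume "u = 1"
    then have "cos (of_int m * (2 * pi / real M)) = 1" by (simp add: u_def complex_eq_iff)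
    then obtain k :: int where "of_int m * (2 * pi / real M) = of_int k * 2 * pi" using cos_one_2pi_int by blast
    then have "real_of_int m = real_of_int k * real M" using M0 by (simp add: field_simps)
    then have mk: "m = k * int M" by (metis of_int_eq_iff of_int_mult of_int_of_nat_eq)
    then have "k \<noteq> 0" using False by auto
    then have "int M * 1 \<le> int M * \<bar>k\<bar>" by (intro mult_left_mono) auto
    then show False using M mk by (simp add: abs_mult mult.commute)
  qed
  then have "(\<Sum>j<M. u ^ j) = (u ^ M - 1) / (u - 1)" by (rule geometric_sum)
  also have "u ^ M = cis (2 * pi * of_int m)" using M0 by (simp add: u_def Complex.DeMoivre mult_ac)
  also have "\<dots> = 1" by (rule cis_multiple_2pi) simp
  finally show ?thesis using False by simp
qed simp

text \<open>\<open>N\<close> times the usual Fejer mean: \<open>q k\<close> occurs for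
  \<open>N - \<bar>k\<bar>\<close> pairs of indices when \<open>\<bar>k\<bar> < N\<close>. Leaving
  out the division keeps the double sum in product form.\<close>

definition fejer_sum :: "nat \<Rightarrow> (int \<Rightarrow> 'c::real_vector) \<Rightarrow> 'c"
  where "fejer_sum N q = (\<Sum>l<N. \<Sum>l'<N. q (int l' - int l))"

text \<open>With the weights \<open>\<bar>\<Sum>l<N. z\<^sup>l\<bar>\<^sup>2\<close> at sufficiently many roots of unity \<open>z\<close>, the Fejer sum is a positive
  combination of gauge transforms.\<close>

lemma fejer_sum_norm_le:
  fixes jA :: "'a::cstar_algebra \<Rightarrow> 'c::cstar_algebra" and jX :: "'x::complex_vector \<Rightarrow> 'c"
  assumes bim: "hilbert_bimodule lact ract ipL ipR" and cp: "crossed_product lact ract ipL ipR jA jX"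
    and q: "trig_poly jA jX n q"
  shows "norm (fejer_sum N q) \<le> real N * norm (sum q {- int n..int n})"
proof -
  \<comment> \<open>Enough roots of unity for every exponent that occurs:
    \<open>int l - int l' + k\<close> with \<open>l, l' < N\<close> and
    \<open>\<bar>k\<bar> \<le> n\<close> has absolute value below \<open>M\<close>.\<close>
  define M where "M = N + n + 1"
  define z where "z j = cis (2 * pi * real j / real M)" for j
  have z0: "z j \<noteq> 0" and nz: "cmod (z j) = 1" for j by (simp_all add: z_def)
  define W where "W j = (cmod (\<Sum>l<N. z j ^ l))\<^sup>2" for j
  have Wc: "complex_of_real (W j) = (\<Sum>l<N. \<Sum>l'<N. z j powi (int l - int l'))" for j
  proof -
    have cz: "cnj (z j) = inverse (z j)" by (simp add: z_def cis_cnj)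
    have "complex_of_real (W j) = (\<Sum>l<N. z j ^ l) * cnj (\<Sum>l<N. z j ^ l)"
      unfolding W_def by (rule complex_norm_square)
    also have "\<dots> = (\<Sum>l<N. \<Sum>l'<N. z j ^ l * inverse (z j) ^ l')"
      by (simp add: sum_product cz)
    also have "\<dots> = (\<Sum>l<N. \<Sum>l'<N. z j powi (int l - int l'))"
      by (simp add: power_int_diff z0 power_inverse divide_inverse)
    finally show ?thesis .
  qed
  have roots: "(\<Sum>j<M. z j powi m) = (if m = 0 then of_nat M else 0)" if "\<bar>m\<bar> < int M" for m
    unfolding z_def using that by (rule root_of_unity_sum)
  have "complex_of_real (\<Sum>j<M. W j) = (\<Sum>j<M. \<Sum>l<N. \<Sum>l'<N. z j powi (int l - int l'))" by (simp add: Wc)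
  also have "\<dots> = (\<Sum>l<N. \<Sum>l'<N. \<Sum>j<M. z j powi (int l - int l'))"
    by (subst sum.swap, rule sum.cong[OF refl], rule sum.swap)
  also have "\<dots> = (\<Sum>l<N. \<Sum>l'<N. if l' = l then of_nat M else 0)"
    by (intro sum.cong refl) (subst roots, auto simp: M_def)
  also have "\<dots> = complex_of_real (real M * real N)" by simp
  finally have Wsum: "(\<Sum>j<M. W j) = real M * real N" by (simp only: of_real_eq_iff)
  let ?I = "{- int n..int n}"
  have "(\<Sum>j<M. complex_of_real (W j) *\<^sub>C (\<Sum>k\<in>?I. z j powi k *\<^sub>C q k))
    = (\<Sum>j<M. \<Sum>l<N. \<Sum>l'<N. \<Sum>k\<in>?I. z j powi (int l - int l' + k) *\<^sub>C q k)"
    unfolding Wc complex_vector.scale_sum_left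
    by (simp add: complex_vector.scale_sum_right power_int_add z0)
  also have "\<dots> = (\<Sum>l<N. \<Sum>l'<N. \<Sum>k\<in>?I. \<Sum>j<M. z j powi (int l - int l' + k) *\<^sub>C q k)"
    by (subst sum.swap, rule sum.cong[OF refl], subst sum.swap, rule sum.cong[OF refl], rule sum.swap)
  also have "\<dots> = (\<Sum>l<N. \<Sum>l'<N. of_nat M *\<^sub>C q (int l' - int l))"
  proof (intro sum.cong refl)
    fix l l' assume l: "l \<in> {..<N}" "l' \<in> {..<N}"
    have "(\<Sum>k\<in>?I. \<Sum>j<M. z j powi (int l - int l' + k) *\<^sub>C q k)
      = (\<Sum>k\<in>?I. if k = int l' - int l then of_nat M *\<^sub>C q k else 0)"
    proof (rule sum.cong[OF refl])
      fix k assume k: "k \<in> ?I"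
      have "(\<Sum>j<M. z j powi (int l - int l' + k) *\<^sub>C q k) = (\<Sum>j<M. z j powi (int l - int l' + k)) *\<^sub>C q k"
        by (rule complex_vector.scale_sum_left[symmetric])
      also have "(\<Sum>j<M. z j powi (int l - int l' + k)) = (if int l - int l' + k = 0 then of_nat M else 0)"
        by (rule roots) (use k l in \<open>auto simp: M_def\<close>)
      finally show "(\<Sum>j<M. z j powi (int l - int l' + k) *\<^sub>C q k) = (if k = int l' - int l then of_nat M *\<^sub>C q k else 0)"
        by auto
    qed
    also have "\<dots> = of_nat M *\<^sub>C q (int l' - int l)"
      using q by (auto simp: sum.delta' trig_poly_def)
    finally show "(\<Sum>k\<in>?I. \<Sum>j<M. z j powi (int l - int l' + k) *\<^sub>C q k) = of_nat M *\<^sub>C q (int l' - int l)" .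
  qed
  also have "\<dots> = of_nat M *\<^sub>C fejer_sum N q"
    unfolding fejer_sum_def complex_vector.scale_sum_right ..
  finally have eq: "(\<Sum>j<M. complex_of_real (W j) *\<^sub>C (\<Sum>k\<in>?I. z j powi k *\<^sub>C q k)) = of_nat M *\<^sub>C fejer_sum N q" .
  have "real M * norm (fejer_sum N q) = norm (of_nat M *\<^sub>C fejer_sum N q)" by (simp add: norm_scaleC)
  also have "\<dots> \<le> (\<Sum>j<M. norm (complex_of_real (W j) *\<^sub>C (\<Sum>k\<in>?I. z j powi k *\<^sub>C q k)))"
    unfolding eq[symmetric] by (rule norm_sum)
  also have "\<dots> \<le> (\<Sum>j<M. W j * norm (sum q ?I))"
  proof (rule sum_mono)
    fix j
    show "norm (complex_of_real (W j) *\<^sub>C (\<Sum>k\<in>?I. z j powi k *\<^sub>C q k)) \<le> W j * norm (sum q ?I)"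
    proof -
      have W0: "0 \<le> W j" by (simp add: W_def)
      show ?thesis
        using mult_left_mono[OF gauge_norm_le[OF bim cp q nz[of j]] W0] W0 by (simp add: norm_scaleC)
    qed
  qed
  also have "\<dots> = real M * (real N * norm (sum q ?I))" by (simp add: Wsum flip: sum_distrib_right)
  finally show ?thesis by (simp add: M_def)
qed

text \<open>The inner sum of the Fejer sum runs over a window of length \<open>N\<close> starting at
  \<open>- l\<close>. It misses part of the support only if \<open>l\<close> is within
  \<open>n\<close> of an end of the range: at most \<open>2 * n\<close> indices, each with error at
  most \<open>2 * S\<close>.\<close>

lemma fejer_sum_approx:
  fixes q :: "int \<Rightarrow> 'c::cstar_algebra"
  assumes q: "trig_poly v w n q"
  shows "norm (real N *\<^sub>R sum q {- int n..int n} - fejer_sum N q) \<le> 4 * real n * (\<Sum>k\<in>{- int n..int n}. norm (q k))"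
proof -
  let ?I = "{- int n..int n}"
  define S where "S = (\<Sum>k\<in>?I. norm (q k))"
  have S0: "0 \<le> S" by (simp add: S_def sum_nonneg)
  define r where "r l = (\<Sum>l'<N. q (int l' - int l))" for l
  have r: "r l = sum q {- int l..<int N - int l}" for l
    unfolding r_def
    by (rule sum.reindex_bij_witness[where j = "\<lambda>l'. int l' - int l" and i = "\<lambda>k. nat (k + int l)"]) auto
  have bound: "norm (sum q B) \<le> S" if B: "finite B" for B
  proof -
    have "norm (sum q B) \<le> (\<Sum>k\<in>B. norm (q k))" by (rule norm_sum)
    also have "\<dots> = (\<Sum>k\<in>B \<inter> ?I. norm (q k))"
      by (rule sum.mono_neutral_right) (use B q in \<open>auto simp: trig_poly_def\<close>)
    also have "\<dots> \<le> S" unfolding S_def by (rule sum_mono2) auto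
    finally show ?thesis .
  qed
  define B where "B = {l. l < N \<and> (l < n \<or> N \<le> l + n)}"
  have diff: "norm (sum q ?I - r l) \<le> (if l \<in> B then 2 * S else 0)" if "l < N" for l
  proof (cases "l \<in> B")
    case True
    have "norm (sum q ?I - r l) \<le> norm (sum q ?I) + norm (r l)" by (rule norm_triangle_ineq4)
    also have "\<dots> \<le> S + S" unfolding r by (intro add_mono bound) auto
    finally show ?thesis using True by simp
  next
    case False
    then have "r l = sum q ?I" unfolding r using that by (intro trig_poly_sum[OF q]) (auto simp: B_def)
    then show ?thesis using False by simp
  qed
  have "real N *\<^sub>R sum q ?I - fejer_sum N q = (\<Sum>l<N. sum q ?I - r l)"
    by (simp add: sum_subtractf sum_constant_scaleR fejer_sum_def r_def)
  then have "norm (real N *\<^sub>R sum q ?I - fejer_sum N q) \<le> (\<Sum>l<N. norm (sum q ?I - r l))" by (simp add: norm_sum)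
  also have "\<dots> \<le> (\<Sum>l<N. if l \<in> B then 2 * S else 0)" by (rule sum_mono) (use diff in auto)
  also have "\<dots> = (\<Sum>l\<in>{..<N} \<inter> B. 2 * S)" by (rule sum.inter_restrict[symmetric]) simp
  also have "{..<N} \<inter> B = B" by (auto simp: B_def)
  also have "(\<Sum>l\<in>B. 2 * S) = real (card B) * (2 * S)" by simp
  also have "\<dots> \<le> real (2 * n) * (2 * S)"
  proof (intro mult_right_mono)
    have "B \<subseteq> {..<n} \<union> {N - n..<N}" by (auto simp: B_def)
    then have "card B \<le> card ({..<n} \<union> {N - n..<N})" by (intro card_mono) auto
    also have "\<dots> \<le> n + n" by (rule order_trans[OF card_Un_le]) simp
    finally show "real (card B) \<le> real (2 * n)" by simp
  qed (use S0 in simp)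
  finally show ?thesis by (simp add: S_def)
qed

text \<open>Multiplying by \<open>star (q k)\<close> shifts the coefficient \<open>q k\<close> into
  degree 0, where it becomes \<open>star (q k) * q k\<close>. The expectation estimate then reads
  \<open>(norm (q k))\<^sup>2 \<le> norm (q k) * norm (\<rho> ?p)\<close>.\<close>

lemma coefficient_norm_le:
  fixes jA :: "'a::cstar_algebra \<Rightarrow> 'c::cstar_algebra" and jX :: "'x::complex_vector \<Rightarrow> 'c"
    and \<pi>A :: "'a \<Rightarrow> 'h::chilbert_space bop" and \<pi>X :: "'x \<Rightarrow> 'h bop"
  assumes covj: "covariant_rep lact ract ipL ipR jA jX"
    and free: "topologically_free spectrum_topology (dual_partial_homeo lact ipR)"
    and cov: "covariant_rep lact ract ipL ipR \<pi>A \<pi>X" and inj: "inj \<pi>A"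
    and int: "integrated_form jA jX \<pi>A \<pi>X \<rho>" and q: "trig_poly jA jX n q"
  shows "norm (q k) \<le> norm (\<rho> (sum q {- int n..int n}))"
proof -
  let ?p = "sum q {- int n..int n}"
  have \<rho>: "star_hom \<rho>" and \<rho>A: "\<And>a. \<rho> (jA a) = \<pi>A a" and \<rho>X: "\<And>x. \<rho> (jX x) = \<pi>X x"
    using int by (simp_all add: integrated_form_def)
  have qg: "q j \<in> graded jA jX j" for j using q by (simp add: trig_poly_def)
  have g: "star (q k) * q (j + k) \<in> graded jA jX j" for j
    using graded_mult[OF covj star_graded[OF covj qg[of k]] qg[of "j + k"]] by simp
  obtain a where a: "star (q k) * q k = jA a" using g[of 0] by (auto simp: graded_def)
  define b where "b j = \<rho> (star (q k) * q (j + k))" for j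
  have "b j \<in> graded (\<lambda>a. \<rho> (jA a)) (\<lambda>x. \<rho> (jX x)) j" for j unfolding b_def by (rule graded_hom[OF \<rho> g])
  then have bg: "b j \<in> graded \<pi>A \<pi>X j" for j by (simp add: \<rho>A \<rho>X)
  have b0: "b 0 = \<pi>A a" by (simp add: b_def a \<rho>A)
  \<comment> \<open>Large enough for the window shifted by \<open>k\<close> to contain the whole
    support of \<open>q\<close>.\<close>
  define m where "m = n + nat \<bar>k\<bar>"
  have "norm a \<le> norm (\<Sum>j\<in>{- int m..int m}. b j)" by (rule expectation_norm_le[where b = b, OF cov inj free bg b0])
  also have "(\<Sum>j\<in>{- int m..int m}. b j) = \<rho> (star (q k)) * \<rho> ?p"
  proof -
    have sum_hom: "\<rho> (sum f K) = (\<Sum>k\<in>K. \<rho> (f k))" for f and K :: "int set"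
      by (induction K rule: infinite_finite_induct) (simp_all add: star_hom_zero[OF \<rho>] star_hom_add[OF \<rho>])
    have "(\<Sum>j\<in>{- int m..int m}. b j) = \<rho> (star (q k) * (\<Sum>j\<in>{- int m..int m}. q (j + k)))"
      by (simp add: b_def sum_hom sum_distrib_left)
    also have "(\<Sum>j\<in>{- int m..int m}. q (j + k)) = sum q {k - int m..k + int m}"
      by (rule sum.reindex_bij_witness[where j = "\<lambda>j. j + k" and i = "\<lambda>j. j - k"]) auto
    also have "\<dots> = ?p" by (rule trig_poly_sum[OF q]) (auto simp: m_def)
    finally show ?thesis by (simp add: star_hom_mult[OF \<rho>])
  qed
  also have "norm (\<rho> (star (q k)) * \<rho> ?p) \<le> norm (\<rho> (star (q k))) * norm (\<rho> ?p)" by (rule norm_mult_ineq)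
  also have "\<dots> \<le> norm (q k) * norm (\<rho> ?p)"
    using star_hom_contractive[OF \<rho>, of "star (q k)"] by (intro mult_right_mono) (simp_all add: norm_star)
  finally have "norm a \<le> norm (q k) * norm (\<rho> ?p)" .
  moreover have "(norm (q k))\<^sup>2 \<le> norm a"
    using star_hom_norm_le[OF covariant_repD(1)[OF covj], of a] by (simp add: a cstar_identity flip: a)
  ultimately have "norm (q k) * norm (q k) \<le> norm (q k) * norm (\<rho> ?p)" by (simp add: power2_eq_square)
  then show ?thesis by (cases "norm (q k) = 0") auto
qed

theorem theorem2p2:
  fixes lact :: "'a::cstar_algebra \<Rightarrow> 'x::complex_vector \<Rightarrow> 'x"
    and ract :: "'x \<Rightarrow> 'a \<Rightarrow> 'x"
    and ipL ipR :: "'x \<Rightarrow> 'x \<Rightarrow> 'a"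
    and jA :: "'a \<Rightarrow> 'c::cstar_algebra"
    and jX :: "'x \<Rightarrow> 'c"
    and \<pi>A :: "'a \<Rightarrow> 'h::chilbert_space bop"
    and \<pi>X :: "'x \<Rightarrow> 'h bop"
  assumes "hilbert_bimodule lact ract ipL ipR"
    and "crossed_product lact ract ipL ipR jA jX"
    and "topologically_free spectrum_topology (dual_partial_homeo lact ipR)"
    and "covariant_rep lact ract ipL ipR \<pi>A \<pi>X"
    and "inj \<pi>A"
  shows "\<exists>\<rho>. integrated_form jA jX \<pi>A \<pi>X \<rho> \<and> inj \<rho>"
proof -
  note bim = assms(1) and cp = assms(2) and free = assms(3) and cov = assms(4) and inj = assms(5)
  have covj: "covariant_rep lact ract ipL ipR jA jX" using cp by (simp add: crossed_product_def)
  obtain \<rho> where int: "integrated_form jA jX \<pi>A \<pi>X \<rho>"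
    by (rule integrated_form_exists[OF bim cp cov]) (rule that)
  have \<rho>: "star_hom \<rho>" using int by (simp add: integrated_form_def)
  have ker: "c = 0" if c: "\<rho> c = 0" for c
  proof -
    have "norm c \<le> 0 + 5 * e" if e: "0 < e" for e :: real
    proof -
      obtain n q where q: "trig_poly jA jX n q" "norm (c - sum q {- int n..int n}) < e"
        by (rule trig_poly_dense[OF cp e]) (rule that)
      define p where "p = sum q {- int n..int n}"
      define S where "S = (\<Sum>k\<in>{- int n..int n}. norm (q k))"
      obtain N0 :: nat where N0: "4 * real n * S / e < real N0" using reals_Archimedean2 by blast
      \<comment> \<open>Depends on \<open>p\<close> alone: the Fejer error \<open>4 * n * S\<close>
        becomes at most \<open>e * N\<close>. The successor keeps \<open>N\<close> positive and
        gives \<open>\<eta> \<le> e\<close>.\<close>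
      define N where "N = Suc N0"
      have N: "0 < real N" "4 * real n * S \<le> e * real N"
        using N0 e by (simp_all add: N_def pos_divide_less_eq algebra_simps)
      define \<eta> where "\<eta> = e / real N"
      have \<eta>: "0 < \<eta>" "\<eta> \<le> e" using e N(1) by (simp_all add: \<eta>_def N_def field_simps)
      obtain m r where r: "trig_poly jA jX m r" "norm (c - sum r {- int m..int m}) < \<eta>"
        by (rule trig_poly_dense[OF cp \<eta>(1)]) (rule that)
      \<comment> \<open>Because \<open>\<rho>\<close> kills \<open>c\<close>, it is small on
        \<open>p'\<close>: every coefficient of \<open>r\<close> has norm at most
        \<open>\<eta> = e / N\<close>, whatever the degree \<open>m\<close>.\<close>
      define p' where "p' = sum r {- int m..int m}"
      have "\<rho> p' = \<rho> (p' - c)" by (simp add: star_hom_diff[OF \<rho>] c)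
      then have "norm (\<rho> p') \<le> norm (p' - c)" using star_hom_contractive[OF \<rho>, of "p' - c"] by simp
      then have \<rho>p': "norm (\<rho> p') \<le> \<eta>" using r(2) by (simp add: p'_def norm_minus_commute)
      define K where "K = max n m"
      define d where "d k = q k - r k" for k
      have d: "trig_poly jA jX K d"
        using q(1) r(1) csubspaceD(4)[OF csubspace_graded[OF covj]] by (auto simp: trig_poly_def d_def K_def)
      have "sum q {- int K..int K} = p" unfolding p_def by (rule trig_poly_sum[OF q(1)]) (auto simp: K_def)
      moreover have "sum r {- int K..int K} = p'" unfolding p'_def by (rule trig_poly_sum[OF r(1)]) (auto simp: K_def)
      ultimately have dsum: "sum d {- int K..int K} = p - p'" by (simp add: d_def sum_subtractf)
      have "norm (p - p') \<le> norm (p - c) + norm (c - p')" using norm_triangle_ineq[of "p - c" "c - p'"] by simp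
      then have pp': "norm (p - p') \<le> 2 * e" using q(2) r(2) \<eta>(2) by (simp add: p_def p'_def norm_minus_commute)
      have F1: "norm (real N *\<^sub>R p - fejer_sum N q) \<le> e * real N"
        using fejer_sum_approx[OF q(1), of N] N(2) by (simp add: p_def S_def)
      have F2: "norm (fejer_sum N d) \<le> real N * (2 * e)"
        using fejer_sum_norm_le[OF bim cp d, of N] mult_left_mono[OF pp', of "real N"] by (simp add: dsum)
      have F3: "norm (fejer_sum N r) \<le> real N * e"
      proof -
        have "norm (r k) \<le> \<eta>" for k
          using coefficient_norm_le[OF covj free cov inj int r(1), of k] \<rho>p' by (simp add: p'_def)
        then have "norm (fejer_sum N r) \<le> (\<Sum>l<N. \<Sum>l'<N. \<eta>)"
          unfolding fejer_sum_def by (intro sum_norm_le) auto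
        also have "\<dots> = real N * e" using N(1) by (simp add: \<eta>_def)
        finally show ?thesis .
      qed
      \<comment> \<open>The errors \<open>F1\<close>, \<open>F2\<close>, \<open>F3\<close> are
        \<open>N * e\<close> times 1, 2 and 1, which gives \<open>norm p \<le> 4 * e\<close>; the
        distance from \<open>c\<close> to \<open>p\<close> adds the fifth \<open>e\<close>.\<close>
      have "fejer_sum N q = fejer_sum N d + fejer_sum N r"
        by (simp add: fejer_sum_def d_def flip: sum.distrib)
      then have "real N *\<^sub>R p = (real N *\<^sub>R p - fejer_sum N q) + (fejer_sum N d + fejer_sum N r)" by simp
      then have "norm (real N *\<^sub>R p) \<le> norm (real N *\<^sub>R p - fejer_sum N q) + norm (fejer_sum N d + fejer_sum N r)"
        by (metis norm_triangle_ineq)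
      also have "\<dots> \<le> e * real N + (real N * (2 * e) + real N * e)"
        by (intro add_mono F1 order_trans[OF norm_triangle_ineq] F2 F3)
      finally have "real N * norm p \<le> real N * (4 * e)" by (simp add: algebra_simps)
      then have "norm p \<le> 4 * e" using N(1) by simp
      moreover have "norm c \<le> norm (c - p) + norm p" using norm_triangle_ineq[of "c - p" p] by simp
      ultimately show ?thesis using q(2) by (simp add: p_def)
    qed
    then have "norm c \<le> 0 + e" if "0 < e" for e :: real using that by (metis divide_pos_pos nonzero_mult_div_cancel_left times_divide_eq_right zero_less_numeral zero_neq_numeral)
    then have "norm c \<le> 0" by (rule field_le_epsilon)
    then show ?thesis by simp
  qed
  have "inj \<rho>"
  proof (rule injI)
    fix c d assume "\<rho> c = \<rho> d"
    then have "\<rho> (c - d) = 0" by (simp add: star_hom_diff[OF \<rho>])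
    then have "c - d = 0" by (rule ker)
    then show "c = d" by simp
  qed
  then show ?thesis using int by blast
qed

end
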